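(* Let $n\ge 2$. Let $\mathcal{D}$ be the diagrammatic (Elias--Williamson) category of type $B_n$ Soergel bimodules, let $\mathscr{B}_n$ be the type $B_n$ zigzag algebra, let $\mathcal{U}_j$ ($1\le j\le n$) be the $(\mathscr{B}_n,\mathscr{B}_n)$-bimodules and $\mathcal{B}$ the monoidal category generated by them, all as defined in the context. There is an essentially surjective monoidal functor $G_0:\mathcal{D}\to\mathcal{B}$ which sends: (i) the empty sequence $\emptyset$ in $S$ to $\mathscr{B}_n$, the monoidal identity in $\mathcal{B}$; (ii) $s_j\in S$ to $\mathcal{U}_j$; and (iii) a sequence $s_{i_1}s_{i_2}\cdots s_{i_k}$ in $S$ of length $k\ge 2$ to $G_0(s_{i_1}s_{i_2}\cdots s_{i_{k-1}})\otimes_{\mathscr{B}_n}G_0(s_{i_k})$.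
   Context: **Zigzag algebra.** Let $n\ge 2$. $Q_n$ is the quiver with vertices $1,\dots,n$, arrows $(j|j+1):j\to j+1$ and $(j+1|j):j+1\to j$ for $1\le j\le n-1$, and a loop $(ie_j)$ at each vertex $j\ge 2$. Paths are read from left to right; $e_j$ is the constant path at $j$. The path algebra $\mathbb{R}Q_n$ is graded by path length, except that the loops $(ie_j)$ have degree $0$. The type $B_n$ zigzag algebra $\mathscr{B}_n$ is the quotient of $\mathbb{R}Q_n$ by: $(j|j-1)(j-1|j)=(j|j+1)(j+1|j)$ and $(j-1|j)(j|j+1)=0=(j+1|j)(j|j-1)$ for $2\le j\le n-1$; $(ie_j)(ie_j)=-e_j$ for $j\ge 2$; $(ie_{j-1})(j-1|j)=(j-1|j)(ie_j)$ and $(ie_j)(j|j-1)=(j|j-1)(ie_{j-1})$ for $j\ge 3$; $(1|2)(ie_2)(2|1)=0$; $(ie_2)X_2=X_2(ie_2)$. Here $X_1:=(1|2)(2|1)$ and $X_j:=(j|j-1)(j-1|j)$ for $j\ge 2$. It is a $\mathbb{Z}$-graded algebra. The symbol $(1)$ is the grading shift down by $1$. **Bimodules.** $\mathbb{K}_1:=\mathbb{R}$, $\mathbb{K}_j:=\mathbb{C}$ for $j\ge 2$. $P_j^B:=\mathscr{B}_ne_j$ is a $(\mathscr{B}_n,\mathbb{K}_j)$-bimodule and ${}_jP^B:=e_j\mathscr{B}_n$ a $(\mathbb{K}_j,\mathscr{B}_n)$-bimodule, where for $j\ge 2$ the imaginary unit acts as multiplication by $(ie_j)$ (on the right of $P^B_j$,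 on the left of ${}_jP^B$). $\mathcal{U}_j:=P_j^B\otimes_{\mathbb{K}_j}{}_jP^B(1)$, a $\mathbb{Z}$-graded $(\mathscr{B}_n,\mathscr{B}_n)$-bimodule. $\mathcal{B}$ is the monoidal category, under $-\otimes_{\mathscr{B}_n}-$, generated by the $\mathcal{U}_j$, with unit $\mathscr{B}_n$: its objects are finite tensor products of the $\mathcal{U}_j$, and its morphisms are $(\mathscr{B}_n,\mathscr{B}_n)$-bimodule maps, graded by degree (homogeneous maps of every degree are allowed). **Coxeter data.** $W$ is the type $B_n$ Coxeter group with $S=\{s_1,\dots,s_n\}$, $m_{s_1s_2}=4$, $m_{s_js_{j+1}}=3$ for $j\ge2$, $m_{s_js_k}=2$ for $|j-k|>1$. $\mathfrak h=\bigoplus_i\mathbb{R}\alpha_{s_i}^\vee$ with roots $\alpha_{s_i}\in\mathfrak h^*$ given by $a_{s_i,s_j}:=\langle\alpha_{s_i}^\vee,\alpha_{s_j}\rangle$: $a_{s_i,s_i}=2$; $a_{s_i,s_j}=-1$ if $i,j\ge2$, $|i-j|=1$; $a_{s_1,s_2}=-1$; $a_{s_2,s_1}=-2$; $0$ otherwise. $R=\mathrm{Sym}(\mathfrak h^* )$ with $\deg\mathfrak h^*=2$; $W$ acts on $R$ with $s(f)=f-\langle\alpha_s^\vee,f\rangle\alpha_s$ for $f\in\mathfrak h^*$; $\partial_s(f)=(f-s(f))/\alpha_s$. **The category $\mathcal{D}$.** The $\mathbb{R}$-linear monoidal category whose objects are finite sequences of letters in $S$ (monoidal product: concatenation; unit: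 $\emptyset$). $\mathrm{Hom}_{\mathcal D}(\underline w,\underline v)$ is the $\mathbb{R}$-span of Soergel graphs with bottom boundary $\underline w$ and top boundary $\underline v$, modulo relations. A Soergel graph is a planar graph in a strip, up to isotopy preserving the boundary, with edges coloured by $S$, regions decorated by homogeneous $f\in R$, and vertices of three kinds: univalent (dots, degree $+1$); trivalent with three edges of one colour (degree $-1$); $2m_{st}$-valent with edges alternating between colours $s\neq t$ (degree $0$). The degree of a graph is the sum of vertex degrees and decoration degrees. Composition is vertical stacking, tensor product is horizontal juxtaposition. Relations (all rotations included): 1. Barbell: an $s$-edge with dots at both ends equals the decoration $\alpha_s$. 2. Polynomial forcing: $f$ immediately left of an $s$-strand equals ($s$-strand with $s(f)$ immediately right of it) plus (broken $s$-strand, i.e. two dots, with $\partial_sf$ in the gap). 3. One colour: a circle of colour $s$ with empty interior attached to one $s$-edge (needle) is $0$; the two ways of joining four $s$-edges by two trivalent vertices (H-shape and I-shape) are equal; an $s$-strand with a side branch ending in a dot equals the $s$-strand. 4. Two-colour associativity, for $m=m_{st}\in\{2,3,4\}$: a $2m$-valent vertex with a trivalent vertex attached to one leg equals the graph in which the opposite leg is first split by a trivalent vertex into two edges, each entering its own $2m$-valent vertex, these two vertices being joined to each other by $m-1$ edges of alternating colours (same boundary on both sides). 5. Dot-crossing. - $m_{st}=2$: an $s$-$t$ crossing with one end of the $s$-strand dotted equals the uninterrupted $t$-strand next to the other end of the $s$-strand, which is dotted before reaching the $t$-strand. - $m_{st}=3$: consider the $6$-valent vertex whose legs are, cyclically,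 left $t$, top-left $s$, top-right $t$, right $s$, bottom-right $t$, bottom-left $s$, with the right $s$-leg dotted. It equals the sum with coefficients $1$ of two graphs: (A) left $t$-leg dotted, top-left and bottom-left $s$ joined by a strand, top-right and bottom-right $t$ joined by a strand; (B) top-left and bottom-left $s$ both dotted, and the left, top-right and bottom-right $t$-legs joined at a trivalent vertex. - $m_{st}=4$: consider the $8$-valent vertex with left leg $s$, top legs (left to right) $t,s,t$, bottom legs (left to right) $t,s,t$, and right leg $s$ dotted. It equals the graph consisting of a vertical $t$-strand joining the rightmost top and bottom $t$-legs, joined by a trivalent vertex to the right $t$-leg of a box $JW_3$ with left leg $s$, top legs $t,s$, bottom legs $t,s$, right leg $t$. With $d=a_{s,t}a_{t,s}-1=1$, $JW_3$ is the sum of: coefficient $1$: left $s$ dotted, right $t$ dotted, top and bottom $t$ joined, top and bottom $s$ joined; coefficient $-a_{s,t}/d$: the three $s$-legs dotted, the three $t$-legs joined at a trivalent vertex; coefficient $-a_{t,s}/d$: the three $t$-legs dotted, the three $s$-legs joined at a trivalent vertex; coefficient $1/d$: top $t$ joined to right $t$, left $s$ joined to bottom $s$, top $s$ and bottom $t$ dotted; coefficient $1/d$: bottom $t$ joined to right $t$, left $s$ joined to top $s$, bottom $s$ and top $t$ dotted. (This holds for both orderings of $\{s,t\}=\{s_1,s_2\}$.) 6. Three-colour (Zamolodzhikov). If $u$ commutes with both $s$ and $t$, a $u$-strand can be slid across the $2m_{st}$-valent vertex ($m_{st}=2,3,4$), crossing the other strands through $4$-valent vertices. For each parabolic subsystem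 of type $A_3$ or $B_3$: the two graphs obtained by following the two sequences of braid moves below (each braid move gives a $2m$-valent vertex, each commutation "$\sim$" gives $4$-valent vertices) are equal. Type $A_3$ (colours $1,2,3$ in a chain): $123121\to123212\to132312\sim312132\to321232\to321323$ and $123121\sim121321\to212321\to213231\sim231213\to232123\to323123\sim321323$. Type $B_3$ ($m_{12}=4,m_{23}=3,m_{13}=2$): $121232123\to212132123\sim212312123\to212321213\to213231213\sim231213231\to231212321\to232121321\to323121321\sim321323121\to321232121$ and $121232123\to121323123\sim123121323\to123121232\to123212132\to132312132\sim312132312\to312123212\to321213212\sim321231212\to321232121$. *)

theory Defs
  imports Complex_Main "HOL-Library.FuncSet" "HOL-Library.Poly_Mapping" "HOL-Algebra.QuotRing"
begin

section \<open>Real-linear monoidal categories and monoidal functors\<close>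

text \<open>
  \<open>HomDeg C d a b\<close> is the set of homogeneous morphisms of degree \<open>d\<close>. Composition is written in the
  usual order; \<open>\<boxtimes>\<close> and \<open>\<star>\<close> are the tensor product of objects and of morphisms. In both categories
  below the tensor product of homogeneous morphisms carries no Koszul sign.
\<close>

record ('o, 'm) moncat =
  Obj :: "'o set"
  Hom :: "'o \<Rightarrow> 'o \<Rightarrow> 'm set"
  HomDeg :: "int \<Rightarrow> 'o \<Rightarrow> 'o \<Rightarrow> 'm set"
  Id :: "'o \<Rightarrow> 'm"
  Comp :: "'m \<Rightarrow> 'm \<Rightarrow> 'm" (infixr "\<cdot>\<index>" 75)
  Zero :: "'o \<Rightarrow> 'o \<Rightarrow> 'm"
  Add :: "'m \<Rightarrow> 'm \<Rightarrow> 'm"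
  Scale :: "real \<Rightarrow> 'm \<Rightarrow> 'm"
  Unit :: "'o"
  TenO :: "'o \<Rightarrow> 'o \<Rightarrow> 'o" (infixl "\<boxtimes>\<index>" 80)
  TenM :: "'m \<Rightarrow> 'm \<Rightarrow> 'm" (infixl "\<star>\<index>" 80)
  Assoc :: "'o \<Rightarrow> 'o \<Rightarrow> 'o \<Rightarrow> 'm"
  Lunit :: "'o \<Rightarrow> 'm"
  Runit :: "'o \<Rightarrow> 'm"

definition is_iso :: "('o, 'm) moncat \<Rightarrow> 'o \<Rightarrow> 'o \<Rightarrow> 'm \<Rightarrow> bool" where
  "is_iso C a b f \<longleftrightarrow> f \<in> Hom C a b \<and>
     (\<exists>g \<in> Hom C b a. g \<cdot>\<^bsub>C\<^esub> f = Id C a \<and> f \<cdot>\<^bsub>C\<^esub> g = Id C b)"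

locale linear_monoidal_category =
  fixes C :: "('o, 'm) moncat" (structure)
  assumes Id_in: "a \<in> Obj C \<Longrightarrow> Id C a \<in> Hom C a a"
    and Comp_in: "\<lbrakk>a \<in> Obj C; b \<in> Obj C; c \<in> Obj C; f \<in> Hom C a b; g \<in> Hom C b c\<rbrakk>
      \<Longrightarrow> g \<cdot> f \<in> Hom C a c"
    and Comp_Id: "\<lbrakk>a \<in> Obj C; b \<in> Obj C; f \<in> Hom C a b\<rbrakk> \<Longrightarrow> f \<cdot> Id C a = f"
    and Id_Comp: "\<lbrakk>a \<in> Obj C; b \<in> Obj C; f \<in> Hom C a b\<rbrakk> \<Longrightarrow> Id C b \<cdot> f = f"
    and Comp_assoc: "\<lbrakk>a \<in> Obj C; b \<in> Obj C; c \<in> Obj C; d \<in> Obj C;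
        f \<in> Hom C a b; g \<in> Hom C b c; h \<in> Hom C c d\<rbrakk> \<Longrightarrow> (h \<cdot> g) \<cdot> f = h \<cdot> (g \<cdot> f)"
    \<comment> \<open>Hom spaces are real vector spaces and composition is bilinear\<close>
    and Zero_in: "\<lbrakk>a \<in> Obj C; b \<in> Obj C\<rbrakk> \<Longrightarrow> Zero C a b \<in> Hom C a b"
    and Add_in: "\<lbrakk>a \<in> Obj C; b \<in> Obj C; f \<in> Hom C a b; g \<in> Hom C a b\<rbrakk> \<Longrightarrow> Add C f g \<in> Hom C a b"
    and Scale_in: "\<lbrakk>a \<in> Obj C; b \<in> Obj C; f \<in> Hom C a b\<rbrakk> \<Longrightarrow> Scale C r f \<in> Hom C a b"
    and Add_assoc: "\<lbrakk>a \<in> Obj C; b \<in> Obj C; f \<in> Hom C a b; g \<in> Hom C a b; h \<in> Hom C a b\<rbrakk>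
      \<Longrightarrow> Add C (Add C f g) h = Add C f (Add C g h)"
    and Add_comm: "\<lbrakk>a \<in> Obj C; b \<in> Obj C; f \<in> Hom C a b; g \<in> Hom C a b\<rbrakk> \<Longrightarrow> Add C f g = Add C g f"
    and Add_Zero: "\<lbrakk>a \<in> Obj C; b \<in> Obj C; f \<in> Hom C a b\<rbrakk> \<Longrightarrow> Add C f (Zero C a b) = f"
    and Scale_zero: "\<lbrakk>a \<in> Obj C; b \<in> Obj C; f \<in> Hom C a b\<rbrakk> \<Longrightarrow> Scale C 0 f = Zero C a b"
    and Scale_one: "\<lbrakk>a \<in> Obj C; b \<in> Obj C; f \<in> Hom C a b\<rbrakk> \<Longrightarrow> Scale C 1 f = f"
    and Scale_Scale: "\<lbrakk>a \<in> Obj C; b \<in> Obj C; f \<in> Hom C a b\<rbrakk>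
      \<Longrightarrow> Scale C r (Scale C s f) = Scale C (r * s) f"
    and Scale_add: "\<lbrakk>a \<in> Obj C; b \<in> Obj C; f \<in> Hom C a b\<rbrakk>
      \<Longrightarrow> Scale C (r + s) f = Add C (Scale C r f) (Scale C s f)"
    and Scale_Add: "\<lbrakk>a \<in> Obj C; b \<in> Obj C; f \<in> Hom C a b; g \<in> Hom C a b\<rbrakk>
      \<Longrightarrow> Scale C r (Add C f g) = Add C (Scale C r f) (Scale C r g)"
    and Comp_Add_right: "\<lbrakk>a \<in> Obj C; b \<in> Obj C; c \<in> Obj C; f \<in> Hom C a b; f' \<in> Hom C a b; g \<in> Hom C b c\<rbrakk>
      \<Longrightarrow> g \<cdot> Add C f f' = Add C (g \<cdot> f) (g \<cdot> f')"
    and Comp_Add_left: "\<lbrakk>a \<in> Obj C; b \<in> Obj C; c \<in> Obj C; f \<in> Hom C a b; g \<in> Hom C b c; g' \<in> Hom C b c\<rbrakk>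
      \<Longrightarrow> Add C g g' \<cdot> f = Add C (g \<cdot> f) (g' \<cdot> f)"
    and Comp_Scale_right: "\<lbrakk>a \<in> Obj C; b \<in> Obj C; c \<in> Obj C; f \<in> Hom C a b; g \<in> Hom C b c\<rbrakk>
      \<Longrightarrow> g \<cdot> Scale C r f = Scale C r (g \<cdot> f)"
    and Comp_Scale_left: "\<lbrakk>a \<in> Obj C; b \<in> Obj C; c \<in> Obj C; f \<in> Hom C a b; g \<in> Hom C b c\<rbrakk>
      \<Longrightarrow> Scale C r g \<cdot> f = Scale C r (g \<cdot> f)"
    \<comment> \<open>the tensor product is a bilinear bifunctor\<close>
    and Unit_in: "Unit C \<in> Obj C"
    and TenO_in: "\<lbrakk>a \<in> Obj C; b \<in> Obj C\<rbrakk> \<Longrightarrow> a \<boxtimes> b \<in> Obj C"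
    and TenM_in: "\<lbrakk>a \<in> Obj C; a' \<in> Obj C; b \<in> Obj C; b' \<in> Obj C; f \<in> Hom C a a'; g \<in> Hom C b b'\<rbrakk>
      \<Longrightarrow> f \<star> g \<in> Hom C (a \<boxtimes> b) (a' \<boxtimes> b')"
    and TenM_Id: "\<lbrakk>a \<in> Obj C; b \<in> Obj C\<rbrakk> \<Longrightarrow> Id C a \<star> Id C b = Id C (a \<boxtimes> b)"
    and TenM_Comp: "\<lbrakk>a \<in> Obj C; a' \<in> Obj C; a'' \<in> Obj C; b \<in> Obj C; b' \<in> Obj C; b'' \<in> Obj C;
        f \<in> Hom C a a'; f' \<in> Hom C a' a''; g \<in> Hom C b b'; g' \<in> Hom C b' b''\<rbrakk>
      \<Longrightarrow> (f' \<star> g') \<cdot> (f \<star> g) = (f' \<cdot> f) \<star> (g' \<cdot> g)"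
    and TenM_Add_left: "\<lbrakk>a \<in> Obj C; a' \<in> Obj C; b \<in> Obj C; b' \<in> Obj C;
        f \<in> Hom C a a'; f' \<in> Hom C a a'; g \<in> Hom C b b'\<rbrakk> \<Longrightarrow> Add C f f' \<star> g = Add C (f \<star> g) (f' \<star> g)"
    and TenM_Add_right: "\<lbrakk>a \<in> Obj C; a' \<in> Obj C; b \<in> Obj C; b' \<in> Obj C;
        f \<in> Hom C a a'; g \<in> Hom C b b'; g' \<in> Hom C b b'\<rbrakk> \<Longrightarrow> f \<star> Add C g g' = Add C (f \<star> g) (f \<star> g')"
    and TenM_Scale_left: "\<lbrakk>a \<in> Obj C; a' \<in> Obj C; b \<in> Obj C; b' \<in> Obj C;
        f \<in> Hom C a a'; g \<in> Hom C b b'\<rbrakk> \<Longrightarrow> Scale C r f \<star> g = Scale C r (f \<star> g)"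
    and TenM_Scale_right: "\<lbrakk>a \<in> Obj C; a' \<in> Obj C; b \<in> Obj C; b' \<in> Obj C;
        f \<in> Hom C a a'; g \<in> Hom C b b'\<rbrakk> \<Longrightarrow> f \<star> Scale C r g = Scale C r (f \<star> g)"
    \<comment> \<open>associativity and unit constraints\<close>
    and Assoc_iso: "\<lbrakk>a \<in> Obj C; b \<in> Obj C; c \<in> Obj C\<rbrakk>
      \<Longrightarrow> is_iso C ((a \<boxtimes> b) \<boxtimes> c) (a \<boxtimes> (b \<boxtimes> c)) (Assoc C a b c)"
    and Lunit_iso: "a \<in> Obj C \<Longrightarrow> is_iso C (Unit C \<boxtimes> a) a (Lunit C a)"
    and Runit_iso: "a \<in> Obj C \<Longrightarrow> is_iso C (a \<boxtimes> Unit C) a (Runit C a)"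
    and Assoc_natural: "\<lbrakk>a \<in> Obj C; a' \<in> Obj C; b \<in> Obj C; b' \<in> Obj C; c \<in> Obj C; c' \<in> Obj C;
        f \<in> Hom C a a'; g \<in> Hom C b b'; h \<in> Hom C c c'\<rbrakk>
      \<Longrightarrow> Assoc C a' b' c' \<cdot> ((f \<star> g) \<star> h) = (f \<star> (g \<star> h)) \<cdot> Assoc C a b c"
    and Lunit_natural: "\<lbrakk>a \<in> Obj C; b \<in> Obj C; f \<in> Hom C a b\<rbrakk>
      \<Longrightarrow> Lunit C b \<cdot> (Id C (Unit C) \<star> f) = f \<cdot> Lunit C a"
    and Runit_natural: "\<lbrakk>a \<in> Obj C; b \<in> Obj C; f \<in> Hom C a b\<rbrakk>
      \<Longrightarrow> Runit C b \<cdot> (f \<star> Id C (Unit C)) = f \<cdot> Runit C a"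
    and pentagon: "\<lbrakk>a \<in> Obj C; b \<in> Obj C; c \<in> Obj C; d \<in> Obj C\<rbrakk>
      \<Longrightarrow> Assoc C a b (c \<boxtimes> d) \<cdot> Assoc C (a \<boxtimes> b) c d
        = (Id C a \<star> Assoc C b c d) \<cdot> Assoc C a (b \<boxtimes> c) d \<cdot> (Assoc C a b c \<star> Id C d)"
    and triangle: "\<lbrakk>a \<in> Obj C; b \<in> Obj C\<rbrakk>
      \<Longrightarrow> (Id C a \<star> Lunit C b) \<cdot> Assoc C a (Unit C) b = Runit C a \<star> Id C b"

text \<open>
  A (strong) monoidal functor \<open>(Fo, Fm)\<close> with structure isomorphisms \<open>mu\<close>, \<open>eps\<close>, linear on
  Hom spaces and preserving degrees.
\<close>

locale linear_monoidal_functor =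
  C: linear_monoidal_category C + D: linear_monoidal_category D
  for C :: "('o, 'm) moncat" and D :: "('p, 'k) moncat" +
  fixes Fo :: "'o \<Rightarrow> 'p" and Fm :: "'m \<Rightarrow> 'k" and mu :: "'o \<Rightarrow> 'o \<Rightarrow> 'k" and eps :: 'k
  assumes Fo_in: "a \<in> Obj C \<Longrightarrow> Fo a \<in> Obj D"
    and Fm_in: "\<lbrakk>a \<in> Obj C; b \<in> Obj C; f \<in> Hom C a b\<rbrakk> \<Longrightarrow> Fm f \<in> Hom D (Fo a) (Fo b)"
    and Fm_Id: "a \<in> Obj C \<Longrightarrow> Fm (Id C a) = Id D (Fo a)"
    and Fm_Comp: "\<lbrakk>a \<in> Obj C; b \<in> Obj C; c \<in> Obj C; f \<in> Hom C a b; g \<in> Hom C b c\<rbrakk>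
      \<Longrightarrow> Fm (g \<cdot>\<^bsub>C\<^esub> f) = Fm g \<cdot>\<^bsub>D\<^esub> Fm f"
    and Fm_Add: "\<lbrakk>a \<in> Obj C; b \<in> Obj C; f \<in> Hom C a b; g \<in> Hom C a b\<rbrakk>
      \<Longrightarrow> Fm (Add C f g) = Add D (Fm f) (Fm g)"
    and Fm_Scale: "\<lbrakk>a \<in> Obj C; b \<in> Obj C; f \<in> Hom C a b\<rbrakk> \<Longrightarrow> Fm (Scale C r f) = Scale D r (Fm f)"
    and Fm_degree: "\<lbrakk>a \<in> Obj C; b \<in> Obj C; f \<in> HomDeg C d a b\<rbrakk> \<Longrightarrow> Fm f \<in> HomDeg D d (Fo a) (Fo b)"
    and mu_iso: "\<lbrakk>a \<in> Obj C; b \<in> Obj C\<rbrakk>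
      \<Longrightarrow> is_iso D (Fo a \<boxtimes>\<^bsub>D\<^esub> Fo b) (Fo (a \<boxtimes>\<^bsub>C\<^esub> b)) (mu a b)"
    and mu_degree: "\<lbrakk>a \<in> Obj C; b \<in> Obj C\<rbrakk>
      \<Longrightarrow> mu a b \<in> HomDeg D 0 (Fo a \<boxtimes>\<^bsub>D\<^esub> Fo b) (Fo (a \<boxtimes>\<^bsub>C\<^esub> b))"
    and mu_natural: "\<lbrakk>a \<in> Obj C; a' \<in> Obj C; b \<in> Obj C; b' \<in> Obj C; f \<in> Hom C a a'; g \<in> Hom C b b'\<rbrakk>
      \<Longrightarrow> mu a' b' \<cdot>\<^bsub>D\<^esub> (Fm f \<star>\<^bsub>D\<^esub> Fm g) = Fm (f \<star>\<^bsub>C\<^esub> g) \<cdot>\<^bsub>D\<^esub> mu a b"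
    and eps_iso: "is_iso D (Unit D) (Fo (Unit C)) eps"
    and eps_degree: "eps \<in> HomDeg D 0 (Unit D) (Fo (Unit C))"
    and mu_assoc: "\<lbrakk>a \<in> Obj C; b \<in> Obj C; c \<in> Obj C\<rbrakk>
      \<Longrightarrow> Fm (Assoc C a b c) \<cdot>\<^bsub>D\<^esub> mu (a \<boxtimes>\<^bsub>C\<^esub> b) c \<cdot>\<^bsub>D\<^esub> (mu a b \<star>\<^bsub>D\<^esub> Id D (Fo c))
        = mu a (b \<boxtimes>\<^bsub>C\<^esub> c) \<cdot>\<^bsub>D\<^esub> (Id D (Fo a) \<star>\<^bsub>D\<^esub> mu b c) \<cdot>\<^bsub>D\<^esub> Assoc D (Fo a) (Fo b) (Fo c)"
    and mu_Lunit: "a \<in> Obj C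
      \<Longrightarrow> Fm (Lunit C a) \<cdot>\<^bsub>D\<^esub> mu (Unit C) a \<cdot>\<^bsub>D\<^esub> (eps \<star>\<^bsub>D\<^esub> Id D (Fo a)) = Lunit D (Fo a)"
    and mu_Runit: "a \<in> Obj C
      \<Longrightarrow> Fm (Runit C a) \<cdot>\<^bsub>D\<^esub> mu a (Unit C) \<cdot>\<^bsub>D\<^esub> (Id D (Fo a) \<star>\<^bsub>D\<^esub> eps) = Runit D (Fo a)"

definition essentially_surjective :: "('o, 'm) moncat \<Rightarrow> ('p, 'k) moncat \<Rightarrow> ('o \<Rightarrow> 'p) \<Rightarrow> bool" where
  "essentially_surjective C D Fo \<longleftrightarrow> (\<forall>b \<in> Obj D. \<exists>a \<in> Obj C. \<exists>f. is_iso D (Fo a) b f)"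


section \<open>The type B zigzag algebra\<close>

text \<open>\<open>Step i j\<close> is the arrow \<open>(i|j)\<close> and \<open>Loop j\<close> the loop \<open>(ie\<^sub>j)\<close>.\<close>

datatype arrow = Step nat nat | Loop nat

fun src :: "arrow \<Rightarrow> nat" where
  "src (Step i j) = i" | "src (Loop j) = j"

fun tgt :: "arrow \<Rightarrow> nat" where
  "tgt (Step i j) = j" | "tgt (Loop j) = j"

definition arrows :: "nat \<Rightarrow> arrow set" where
  "arrows n = {Step j (j + 1) | j. 1 \<le> j \<and> j < n} \<union> {Step (j + 1) j | j. 1 \<le> j \<and> j < n}
     \<union> {Loop j | j. 2 \<le> j \<and> j \<le> n}"

text \<open>A path is its initial vertex together with its arrows, read from left to right.\<close>

type_synonym qpath = "nat \<times> arrow list"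

fun composable :: "nat \<Rightarrow> arrow list \<Rightarrow> bool" where
  "composable v [] \<longleftrightarrow> True"
| "composable v (a # as) \<longleftrightarrow> src a = v \<and> composable (tgt a) as"

definition paths :: "nat \<Rightarrow> qpath set" where
  "paths n = {(v, as). v \<in> {1..n} \<and> set as \<subseteq> arrows n \<and> composable v as}"

definition path_end :: "qpath \<Rightarrow> nat" where
  "path_end x = (if snd x = [] then fst x else tgt (last (snd x)))"

definition path_degree :: "qpath \<Rightarrow> int" where
  "path_degree x = int (length (filter (\<lambda>a. \<not> (\<exists>j. a = Loop j)) (snd x)))"

definition path_mult :: "(qpath \<Rightarrow>\<^sub>0 real) \<Rightarrow> (qpath \<Rightarrow>\<^sub>0 real) \<Rightarrow> (qpath \<Rightarrow>\<^sub>0 real)" (infixl "**" 70) where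
  "p ** q = (\<Sum>x \<in> Poly_Mapping.keys p. \<Sum>y \<in> Poly_Mapping.keys q. if path_end x = fst y
     then Poly_Mapping.single (fst x, snd x @ snd y) (Poly_Mapping.lookup p x * Poly_Mapping.lookup q y) else 0)"

definition pe :: "nat \<Rightarrow> qpath \<Rightarrow>\<^sub>0 real" where
  "pe j = Poly_Mapping.single (j, []) 1"

definition pie :: "nat \<Rightarrow> qpath \<Rightarrow>\<^sub>0 real" where
  "pie j = Poly_Mapping.single (j, [Loop j]) 1"

definition pstep :: "nat \<Rightarrow> nat \<Rightarrow> qpath \<Rightarrow>\<^sub>0 real" where
  "pstep i j = Poly_Mapping.single (i, [Step i j]) 1"

definition pX :: "nat \<Rightarrow> qpath \<Rightarrow>\<^sub>0 real" where
  "pX j = (if j = 1 then pstep 1 2 ** pstep 2 1 else pstep j (j - 1) ** pstep (j - 1) j)"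

definition path_algebra :: "nat \<Rightarrow> (qpath \<Rightarrow>\<^sub>0 real) ring" where
  "path_algebra n = \<lparr>carrier = {p. Poly_Mapping.keys p \<subseteq> paths n}, mult = (**), one = (\<Sum>j = 1..n. pe j),
     zero = 0, add = (+)\<rparr>"

definition zigzag_relations :: "nat \<Rightarrow> (qpath \<Rightarrow>\<^sub>0 real) set" where
  "zigzag_relations n =
     {pstep j (j - 1) ** pstep (j - 1) j - pstep j (j + 1) ** pstep (j + 1) j | j. 2 \<le> j \<and> j < n}
   \<union> {pstep (j - 1) j ** pstep j (j + 1) | j. 2 \<le> j \<and> j < n}
   \<union> {pstep (j + 1) j ** pstep j (j - 1) | j. 2 \<le> j \<and> j < n}
   \<union> {pie j ** pie j + pe j | j. 2 \<le> j \<and> j \<le> n}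
   \<union> {pie (j - 1) ** pstep (j - 1) j - pstep (j - 1) j ** pie j | j. 3 \<le> j \<and> j \<le> n}
   \<union> {pie j ** pstep j (j - 1) - pstep j (j - 1) ** pie (j - 1) | j. 3 \<le> j \<and> j \<le> n}
   \<union> {pstep 1 2 ** pie 2 ** pstep 2 1, pie 2 ** pX 2 - pX 2 ** pie 2}"

type_synonym zz = "(qpath \<Rightarrow>\<^sub>0 real) set"

definition zigzag_ideal :: "nat \<Rightarrow> (qpath \<Rightarrow>\<^sub>0 real) set" where
  "zigzag_ideal n = genideal (path_algebra n) (zigzag_relations n)"

definition zigzag :: "nat \<Rightarrow> zz ring" where
  "zigzag n = path_algebra n Quot zigzag_ideal n"

definition zz_class :: "nat \<Rightarrow> (qpath \<Rightarrow>\<^sub>0 real) \<Rightarrow> zz" where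
  "zz_class n p = zigzag_ideal n +>\<^bsub>path_algebra n\<^esub> p"

definition zz_scalar :: "nat \<Rightarrow> real \<Rightarrow> zz" where
  "zz_scalar n r = zz_class n (\<Sum>j = 1..n. Poly_Mapping.single (j, []) r)"

definition zz_degree :: "nat \<Rightarrow> int \<Rightarrow> zz set" where
  "zz_degree n d = zz_class n ` {p \<in> carrier (path_algebra n). \<forall>x \<in> Poly_Mapping.keys p. path_degree x = d}"


section \<open>Graded bimodules\<close>

text \<open>
  Iterated tensor products have to live in one type. The elements of a tensor product are classes of
  formal sums of pure tensors; such a class is stored as \<open>Ten\<close> of a chosen representative of it,
  a list of pairs standing for the sum of the corresponding pure tensors.
\<close>

datatype elt = Alg (the_alg: zz) | Ten (the_ten: "(elt \<times> elt) list")

record ('a, 'b) bimod =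
  bcar :: "elt set"
  badd :: "elt \<Rightarrow> elt \<Rightarrow> elt"
  bzero :: "elt"
  lact :: "'a \<Rightarrow> elt \<Rightarrow> elt"
  ract :: "elt \<Rightarrow> 'b \<Rightarrow> elt"
  bdeg :: "int \<Rightarrow> elt set"

text \<open>
  Equality of formal sums of pure tensors in the tensor product over the scalars \<open>A\<close>. Additive
  inverses, and \<open>x \<otimes> 0 = 0\<close>, are consequences: \<open>(x, y) + (-x, y) = (0, y) = 0\<close>.
\<close>

inductive tensor_eq :: "'c set \<Rightarrow> ('a, 'c) bimod \<Rightarrow> ('c, 'b) bimod \<Rightarrow>
    (elt \<times> elt) list \<Rightarrow> (elt \<times> elt) list \<Rightarrow> bool"
  for A :: "'c set" and M :: "('a, 'c) bimod" and N :: "('c, 'b) bimod" where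
  refl: "set xs \<subseteq> bcar M \<times> bcar N \<Longrightarrow> tensor_eq A M N xs xs"
| sym: "tensor_eq A M N xs ys \<Longrightarrow> tensor_eq A M N ys xs"
| trans: "tensor_eq A M N xs ys \<Longrightarrow> tensor_eq A M N ys zs \<Longrightarrow> tensor_eq A M N xs zs"
| append: "tensor_eq A M N xs xs' \<Longrightarrow> tensor_eq A M N ys ys' \<Longrightarrow> tensor_eq A M N (xs @ ys) (xs' @ ys')"
| commute: "set xs \<subseteq> bcar M \<times> bcar N \<Longrightarrow> set ys \<subseteq> bcar M \<times> bcar N \<Longrightarrow> tensor_eq A M N (xs @ ys) (ys @ xs)"
| add_left: "x \<in> bcar M \<Longrightarrow> x' \<in> bcar M \<Longrightarrow> y \<in> bcar N \<Longrightarrow>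
    tensor_eq A M N [(badd M x x', y)] [(x, y), (x', y)]"
| add_right: "x \<in> bcar M \<Longrightarrow> y \<in> bcar N \<Longrightarrow> y' \<in> bcar N \<Longrightarrow>
    tensor_eq A M N [(x, badd N y y')] [(x, y), (x, y')]"
| zero_left: "y \<in> bcar N \<Longrightarrow> tensor_eq A M N [(bzero M, y)] []"
| balanced: "x \<in> bcar M \<Longrightarrow> a \<in> A \<Longrightarrow> y \<in> bcar N \<Longrightarrow>
    tensor_eq A M N [(ract M x a, y)] [(x, lact N a y)]"

definition tensor_class :: "'c set \<Rightarrow> ('a, 'c) bimod \<Rightarrow> ('c, 'b) bimod \<Rightarrow> (elt \<times> elt) list \<Rightarrow> elt" where
  "tensor_class A M N xs = Ten (SOME ys. tensor_eq A M N xs ys)"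

definition tensor :: "'c set \<Rightarrow> ('a, 'c) bimod \<Rightarrow> ('c, 'b) bimod \<Rightarrow> ('a, 'b) bimod" where
  "tensor A M N = \<lparr>
     bcar = tensor_class A M N ` {xs. set xs \<subseteq> bcar M \<times> bcar N},
     badd = (\<lambda>u v. tensor_class A M N (the_ten u @ the_ten v)),
     bzero = tensor_class A M N [],
     lact = (\<lambda>a u. tensor_class A M N (map (\<lambda>(x, y). (lact M a x, y)) (the_ten u))),
     ract = (\<lambda>u b. tensor_class A M N (map (\<lambda>(x, y). (x, ract N y b)) (the_ten u))),
     bdeg = (\<lambda>d. tensor_class A M N `
       {xs. set xs \<subseteq> bcar M \<times> bcar N \<and> (\<forall>(x, y) \<in> set xs. \<exists>k. x \<in> bdeg M k \<and> y \<in> bdeg N (d - k))})\<rparr>"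

text \<open>Grading shift down by one, i.e. \<open>M(1)\<^sub>d = M\<^sub>d\<^sub>+\<^sub>1\<close>.\<close>

definition shift1 :: "('a, 'b) bimod \<Rightarrow> ('a, 'b) bimod" where
  "shift1 M = M\<lparr>bdeg := (\<lambda>d. bdeg M (d + 1))\<rparr>"

text \<open>
  A sub-bimodule \<open>S\<close> of the zigzag algebra, where left and right scalars act by multiplication with
  their images in the algebra under \<open>f\<close> and \<open>g\<close>.
\<close>

definition zz_bimod :: "nat \<Rightarrow> zz set \<Rightarrow> ('a \<Rightarrow> zz) \<Rightarrow> ('b \<Rightarrow> zz) \<Rightarrow> ('a, 'b) bimod" where
  "zz_bimod n S f g = \<lparr>
     bcar = Alg ` S,
     badd = (\<lambda>x y. Alg (the_alg x \<oplus>\<^bsub>zigzag n\<^esub> the_alg y)),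
     bzero = Alg \<zero>\<^bsub>zigzag n\<^esub>,
     lact = (\<lambda>a x. Alg (f a \<otimes>\<^bsub>zigzag n\<^esub> the_alg x)),
     ract = (\<lambda>x b. Alg (the_alg x \<otimes>\<^bsub>zigzag n\<^esub> g b)),
     bdeg = (\<lambda>d. Alg ` (S \<inter> zz_degree n d))\<rparr>"

type_synonym zbimod = "(zz, zz) bimod"

definition zz_regular :: "nat \<Rightarrow> zbimod" where
  "zz_regular n = zz_bimod n (carrier (zigzag n)) id id"

text \<open>
  The field \<open>\<bbbK>\<^sub>j\<close>, as a subfield of the complex numbers, and its image in \<open>e\<^sub>j \<B> e\<^sub>j\<close>. For \<open>j = 1\<close> all
  scalars are real, so the non-existent loop at vertex 1 only occurs with coefficient 0.
\<close>

definition KK :: "nat \<Rightarrow> complex set" where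
  "KK j = (if j = 1 then \<real> else UNIV)"

definition KK_embed :: "nat \<Rightarrow> nat \<Rightarrow> complex \<Rightarrow> zz" where
  "KK_embed n j c = zz_class n
     (Poly_Mapping.single (j, []) (Re c) + Poly_Mapping.single (j, [Loop j]) (Im c))"

definition P_left :: "nat \<Rightarrow> nat \<Rightarrow> (zz, complex) bimod" where
  "P_left n j = zz_bimod n {b \<otimes>\<^bsub>zigzag n\<^esub> zz_class n (pe j) | b. b \<in> carrier (zigzag n)} id (KK_embed n j)"

definition P_right :: "nat \<Rightarrow> nat \<Rightarrow> (complex, zz) bimod" where
  "P_right n j = zz_bimod n {zz_class n (pe j) \<otimes>\<^bsub>zigzag n\<^esub> b | b. b \<in> carrier (zigzag n)} (KK_embed n j) id"

definition U_bimod :: "nat \<Rightarrow> nat \<Rightarrow> zbimod" where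
  "U_bimod n j = shift1 (tensor (KK j) (P_left n j) (P_right n j))"

definition zz_tensor :: "nat \<Rightarrow> zbimod \<Rightarrow> zbimod \<Rightarrow> zbimod" where
  "zz_tensor n = tensor (carrier (zigzag n))"


section \<open>The monoidal category of zigzag bimodules\<close>

inductive_set zz_objects :: "nat \<Rightarrow> zbimod set" for n where
  unit: "zz_regular n \<in> zz_objects n"
| gen: "j \<in> {1..n} \<Longrightarrow> U_bimod n j \<in> zz_objects n"
| tensor: "M \<in> zz_objects n \<Longrightarrow> N \<in> zz_objects n \<Longrightarrow> zz_tensor n M N \<in> zz_objects n"

text \<open>Underlying functions are extensional, so that equality of morphisms is equality on the source.\<close>

record bimap =
  bsrc :: zbimod
  btgt :: zbimod
  bfun :: "elt \<Rightarrow> elt"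

definition mk_bimap :: "zbimod \<Rightarrow> zbimod \<Rightarrow> (elt \<Rightarrow> elt) \<Rightarrow> bimap" where
  "mk_bimap M N f = \<lparr>bsrc = M, btgt = N, bfun = restrict f (bcar M)\<rparr>"

definition bimaps :: "nat \<Rightarrow> zbimod \<Rightarrow> zbimod \<Rightarrow> bimap set" where
  "bimaps n M N = {mk_bimap M N f | f. f \<in> bcar M \<rightarrow> bcar N
     \<and> (\<forall>x \<in> bcar M. \<forall>y \<in> bcar M. f (badd M x y) = badd N (f x) (f y))
     \<and> (\<forall>x \<in> bcar M. \<forall>a \<in> carrier (zigzag n). f (lact M a x) = lact N a (f x) \<and> f (ract M x a) = ract N (f x) a)}"

text \<open>
  In \<open>Assoc\<close>, \<open>t\<close> is a sum of \<open>u \<otimes> z\<close> where \<open>u\<close> is in turn a sum of \<open>x \<otimes> y\<close>.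
\<close>

definition zz_category :: "nat \<Rightarrow> (zbimod, bimap) moncat" where
  "zz_category n = \<lparr>
     Obj = zz_objects n,
     Hom = bimaps n,
     HomDeg = (\<lambda>d M N. {f \<in> bimaps n M N. \<forall>k. bfun f ` bdeg M k \<subseteq> bdeg N (k + d)}),
     Id = (\<lambda>M. mk_bimap M M (\<lambda>x. x)),
     Comp = (\<lambda>g f. mk_bimap (bsrc f) (btgt g) (\<lambda>x. bfun g (bfun f x))),
     Zero = (\<lambda>M N. mk_bimap M N (\<lambda>x. bzero N)),
     Add = (\<lambda>f g. mk_bimap (bsrc f) (btgt f) (\<lambda>x. badd (btgt f) (bfun f x) (bfun g x))),
     Scale = (\<lambda>r f. mk_bimap (bsrc f) (btgt f) (\<lambda>x. lact (btgt f) (zz_scalar n r) (bfun f x))),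
     Unit = zz_regular n,
     TenO = zz_tensor n,
     TenM = (\<lambda>f g. mk_bimap (zz_tensor n (bsrc f) (bsrc g)) (zz_tensor n (btgt f) (btgt g))
       (\<lambda>t. tensor_class (carrier (zigzag n)) (btgt f) (btgt g) (map (map_prod (bfun f) (bfun g)) (the_ten t)))),
     Assoc = (\<lambda>M N L. mk_bimap (zz_tensor n (zz_tensor n M N) L) (zz_tensor n M (zz_tensor n N L))
       (\<lambda>t. tensor_class (carrier (zigzag n)) M (zz_tensor n N L)
         (concat (map (\<lambda>(u, z). map (\<lambda>(x, y). (x, tensor_class (carrier (zigzag n)) N L [(y, z)])) (the_ten u))
           (the_ten t))))),
     Lunit = (\<lambda>M. mk_bimap (zz_tensor n (zz_regular n) M) M
       (\<lambda>t. foldr (\<lambda>(b, x). badd M (lact M (the_alg b) x)) (the_ten t) (bzero M))),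
     Runit = (\<lambda>M. mk_bimap (zz_tensor n M (zz_regular n)) M
       (\<lambda>t. foldr (\<lambda>(x, b). badd M (ract M x (the_alg b))) (the_ten t) (bzero M)))\<rparr>"


section \<open>Coxeter data of type B\<close>

definition coxm :: "nat \<Rightarrow> nat \<Rightarrow> nat" where
  "coxm i j = (if i = j then 1 else if i = 1 \<and> j = 2 \<or> i = 2 \<and> j = 1 then 4 else if j = i + 1 \<or> i = j + 1 then 3 else 2)"

definition cartan :: "nat \<Rightarrow> nat \<Rightarrow> real" where
  "cartan i j = (if i = j then 2 else if i = 2 \<and> j = 1 then -2
     else if j = i + 1 \<or> i = j + 1 then -1 else 0)"

text \<open>
  \<open>R = Sym(\<hh>\<^sup>*)\<close> is the polynomial ring in the basis \<open>\<omega>\<^sub>1, \<dots>, \<omega>\<^sub>n\<close> of \<open>\<hh>\<^sup>*\<close> dual to the basis of simple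
  coroots, so that \<open>\<alpha>\<^sub>t = \<Sum>\<^sub>i \<langle>\<alpha>\<^sub>i\<^sup>\<or>, \<alpha>\<^sub>t\<rangle> \<omega>\<^sub>i\<close>. Monomials are exponent vectors.
\<close>

type_synonym rpoly = "(nat \<Rightarrow>\<^sub>0 nat) \<Rightarrow>\<^sub>0 real"

definition R_ring :: "nat \<Rightarrow> rpoly set" where
  "R_ring n = {p. \<forall>m \<in> Poly_Mapping.keys p. Poly_Mapping.keys m \<subseteq> {1..n}}"

definition R_homogeneous :: "int \<Rightarrow> rpoly \<Rightarrow> bool" where
  "R_homogeneous d p \<longleftrightarrow> (\<forall>m \<in> Poly_Mapping.keys p. 2 * int (\<Sum>i \<in> Poly_Mapping.keys m. Poly_Mapping.lookup m i) = d)"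

definition R_const :: "real \<Rightarrow> rpoly" where
  "R_const c = Poly_Mapping.single 0 c"

definition omega :: "nat \<Rightarrow> rpoly" where
  "omega i = Poly_Mapping.single (Poly_Mapping.single i 1) 1"

definition alpha :: "nat \<Rightarrow> nat \<Rightarrow> rpoly" where
  "alpha n t = (\<Sum>i = 1..n. R_const (cartan i t) * omega i)"

definition R_subst :: "(nat \<Rightarrow> rpoly) \<Rightarrow> rpoly \<Rightarrow> rpoly" where
  "R_subst f p = (\<Sum>m \<in> Poly_Mapping.keys p. R_const (Poly_Mapping.lookup p m) * (\<Prod>i \<in> Poly_Mapping.keys m. f i ^ Poly_Mapping.lookup m i))"

definition reflect :: "nat \<Rightarrow> nat \<Rightarrow> rpoly \<Rightarrow> rpoly" where
  "reflect n s = R_subst (\<lambda>i. if i = s then omega i - alpha n s else omega i)"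

definition demazure :: "nat \<Rightarrow> nat \<Rightarrow> rpoly \<Rightarrow> rpoly" where
  "demazure n s f = (THE g. g \<in> R_ring n \<and> alpha n s * g = f - reflect n s f)"


section \<open>The diagrammatic category\<close>

text \<open>
  Planar diagrams up to isotopy are encoded in the usual way, as the morphisms of a strict pivotal
  category: a diagram is cut into horizontal slices, each containing one elementary piece, and isotopy
  becomes the interchange law, the zigzag relations for cups and caps, and invariance of all vertices
  under rotation. Diagrams are read from bottom (source) to top (target), and
  \<open>DComp g f\<close> stacks \<open>g\<close> on top of \<open>f\<close>. \<open>Vert s t\<close> is the \<open>2m\<^sub>s\<^sub>t\<close>-valent vertex with bottom boundary
  \<open>s t s \<dots>\<close> and top boundary \<open>t s t \<dots>\<close>.
\<close>

datatype dmor =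
    DId "nat list"
  | Box rpoly
  | StartDot nat
  | EndDot nat
  | Merge nat
  | Split nat
  | Cup nat
  | Cap nat
  | Vert nat nat
  | DComp dmor dmor
  | DTen dmor dmor
  | DZero "nat list" "nat list"
  | DAdd dmor dmor
  | DScale real dmor

fun alt :: "nat \<Rightarrow> nat \<Rightarrow> nat \<Rightarrow> nat list" where
  "alt 0 s t = []"
| "alt (Suc k) s t = s # alt k t s"

inductive diagram :: "nat \<Rightarrow> nat list \<Rightarrow> nat list \<Rightarrow> dmor \<Rightarrow> bool" for n where
  "set w \<subseteq> {1..n} \<Longrightarrow> diagram n w w (DId w)"
| "f \<in> R_ring n \<Longrightarrow> diagram n [] [] (Box f)"
| "s \<in> {1..n} \<Longrightarrow> diagram n [] [s] (StartDot s)"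
| "s \<in> {1..n} \<Longrightarrow> diagram n [s] [] (EndDot s)"
| "s \<in> {1..n} \<Longrightarrow> diagram n [s, s] [s] (Merge s)"
| "s \<in> {1..n} \<Longrightarrow> diagram n [s] [s, s] (Split s)"
| "s \<in> {1..n} \<Longrightarrow> diagram n [] [s, s] (Cup s)"
| "s \<in> {1..n} \<Longrightarrow> diagram n [s, s] [] (Cap s)"
| "s \<in> {1..n} \<Longrightarrow> t \<in> {1..n} \<Longrightarrow> s \<noteq> t \<Longrightarrow>
     diagram n (alt (coxm s t) s t) (alt (coxm s t) t s) (Vert s t)"
| "diagram n u v f \<Longrightarrow> diagram n v w g \<Longrightarrow> diagram n u w (DComp g f)"
| "diagram n u v f \<Longrightarrow> diagram n u' v' g \<Longrightarrow> diagram n (u @ u') (v @ v') (DTen f g)"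
| "set u \<subseteq> {1..n} \<Longrightarrow> set v \<subseteq> {1..n} \<Longrightarrow> diagram n u v (DZero u v)"
| "diagram n u v f \<Longrightarrow> diagram n u v g \<Longrightarrow> diagram n u v (DAdd f g)"
| "diagram n u v f \<Longrightarrow> diagram n u v (DScale r f)"

inductive dhomogeneous :: "int \<Rightarrow> dmor \<Rightarrow> bool" where
  "dhomogeneous 0 (DId w)"
| "R_homogeneous d f \<Longrightarrow> dhomogeneous d (Box f)"
| "dhomogeneous 1 (StartDot s)"
| "dhomogeneous 1 (EndDot s)"
| "dhomogeneous (-1) (Merge s)"
| "dhomogeneous (-1) (Split s)"
| "dhomogeneous 0 (Cup s)"
| "dhomogeneous 0 (Cap s)"
| "dhomogeneous 0 (Vert s t)"
| "dhomogeneous d f \<Longrightarrow> dhomogeneous e g \<Longrightarrow> dhomogeneous (d + e) (DComp g f)"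
| "dhomogeneous d f \<Longrightarrow> dhomogeneous e g \<Longrightarrow> dhomogeneous (d + e) (DTen f g)"
| "dhomogeneous d (DZero u v)"
| "dhomogeneous d f \<Longrightarrow> dhomogeneous d g \<Longrightarrow> dhomogeneous d (DAdd f g)"
| "dhomogeneous d f \<Longrightarrow> dhomogeneous d (DScale r f)"

text \<open>
  The relations below are stated without boundary conditions; \<open>dequiv\<close> only uses their instances in
  which both sides are diagrams with the same boundary.
\<close>

inductive linear_relation :: "dmor \<Rightarrow> dmor \<Rightarrow> bool" where
  "linear_relation (DComp f (DId w)) f"
| "linear_relation (DComp (DId w) f) f"
| "linear_relation (DComp (DComp h g) f) (DComp h (DComp g f))"
| "linear_relation (DTen f (DId [])) f"
| "linear_relation (DTen (DId []) f) f"
| "linear_relation (DTen (DTen f g) h) (DTen f (DTen g h))"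
| "linear_relation (DTen (DId v) (DId w)) (DId (v @ w))"
| "linear_relation (DComp (DTen f' g') (DTen f g)) (DTen (DComp f' f) (DComp g' g))"
| "linear_relation (DAdd (DAdd f g) h) (DAdd f (DAdd g h))"
| "linear_relation (DAdd f g) (DAdd g f)"
| "linear_relation (DAdd f (DZero v w)) f"
| "linear_relation (DScale 0 f) (DZero v w)"
| "linear_relation (DScale 1 f) f"
| "linear_relation (DScale r (DScale s f)) (DScale (r * s) f)"
| "linear_relation (DScale (r + s) f) (DAdd (DScale r f) (DScale s f))"
| "linear_relation (DScale r (DAdd f g)) (DAdd (DScale r f) (DScale r g))"
| "linear_relation (DComp g (DAdd f f')) (DAdd (DComp g f) (DComp g f'))"
| "linear_relation (DComp (DAdd g g') f) (DAdd (DComp g f) (DComp g' f))"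
| "linear_relation (DComp g (DScale r f)) (DScale r (DComp g f))"
| "linear_relation (DComp (DScale r g) f) (DScale r (DComp g f))"
| "linear_relation (DTen f (DAdd g g')) (DAdd (DTen f g) (DTen f g'))"
| "linear_relation (DTen (DAdd f f') g) (DAdd (DTen f g) (DTen f' g))"
| "linear_relation (DTen f (DScale r g)) (DScale r (DTen f g))"
| "linear_relation (DTen (DScale r f) g) (DScale r (DTen f g))"

inductive isotopy_relation :: "dmor \<Rightarrow> dmor \<Rightarrow> bool" where
  "isotopy_relation (DComp (DTen (DId [s]) (Cap s)) (DTen (Cup s) (DId [s]))) (DId [s])"
| "isotopy_relation (DComp (DTen (Cap s) (DId [s])) (DTen (DId [s]) (Cup s))) (DId [s])"
| "isotopy_relation (EndDot s) (DComp (Cap s) (DTen (StartDot s) (DId [s])))"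
| "isotopy_relation (EndDot s) (DComp (Cap s) (DTen (DId [s]) (StartDot s)))"
| "isotopy_relation (Split s) (DComp (DTen (DId [s]) (Merge s)) (DTen (Cup s) (DId [s])))"
| "isotopy_relation (Split s) (DComp (DTen (Merge s) (DId [s])) (DTen (DId [s]) (Cup s)))"
| \<comment> \<open>rotating a vertex by one leg: the leftmost bottom leg is bent up, the rightmost top leg bent down\<close>
  "ts = alt (coxm s t) t s \<Longrightarrow> isotopy_relation (Vert t s)
     (DComp (DTen (DId (s # butlast ts)) (Cap (last ts)))
       (DComp (DTen (DId [s]) (DTen (Vert s t) (DId [last ts])))
         (DTen (Cup s) (DId ts))))"

text \<open>
  \<open>JW s t\<close> is the box \<open>JW\<^sub>3\<close> with its left leg bent to the bottom and its right leg bent to the top: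
  bottom boundary \<open>s t s\<close> (left leg, then bottom legs) and top boundary \<open>t s t\<close> (top legs, then right leg).
\<close>

definition JW :: "nat \<Rightarrow> nat \<Rightarrow> dmor" where
  "JW s t = (let d = cartan s t * cartan t s - 1 in
     DAdd (DTen (EndDot s) (DTen (DId [t, s]) (StartDot t)))
    (DAdd (DScale (- cartan s t / d)
       (DComp (DTen (DId [t]) (DTen (StartDot s) (DId [t])))
         (DComp (Split t) (DTen (EndDot s) (DTen (DId [t]) (EndDot s))))))
    (DAdd (DScale (- cartan t s / d)
       (DTen (StartDot t)
         (DTen (DComp (Merge s) (DTen (DId [s]) (DTen (EndDot t) (DId [s])))) (StartDot t))))
    (DAdd (DScale (1 / d)
       (DComp (DComp (DTen (DId [t]) (DTen (StartDot s) (DId [t]))) (Cup t))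
         (DComp (Cap s) (DTen (DId [s]) (DTen (EndDot t) (DId [s]))))))
      (DScale (1 / d)
       (DTen (StartDot t) (DTen (DId [s, t]) (EndDot s))))))))"

text \<open>\<open>slide u w\<close> crosses a \<open>u\<close>-strand from the left of \<open>w\<close> to its right.\<close>

fun slide :: "nat \<Rightarrow> nat list \<Rightarrow> dmor" where
  "slide u [] = DId [u]"
| "slide u (x # xs) = DComp (DTen (DId [x]) (slide u xs)) (DTen (Vert u x) (DId xs))"

text \<open>
  The graph following a sequence of braid moves, given by the words it passes through. A single braid
  move takes place at the first letter where the two words differ.
\<close>

definition braid_move :: "nat list \<Rightarrow> nat list \<Rightarrow> dmor" where
  "braid_move w w' = (let p = length (takeWhile (\<lambda>(x, y). x = y) (zip w w')); s = w ! p; t = w ! Suc p in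
     DTen (DId (take p w)) (DTen (Vert s t) (DId (drop (p + coxm s t) w))))"

fun braid_path :: "nat list list \<Rightarrow> dmor" where
  "braid_path [] = DId []"
| "braid_path [w] = DId w"
| "braid_path (w # w' # ws) = DComp (braid_path (w' # ws)) (braid_move w w')"

text \<open>
  Words in the colours 1, 2, 3, to be renamed to the colours of a parabolic subsystem. Simultaneous
  commutations are carried out one after the other.
\<close>

definition A3_path :: "nat list list" where
  "A3_path = [[1,2,3,1,2,1], [1,2,3,2,1,2], [1,3,2,3,1,2], [3,1,2,3,1,2], [3,1,2,1,3,2],
     [3,2,1,2,3,2], [3,2,1,3,2,3]]"

definition A3_path' :: "nat list list" where
  "A3_path' = [[1,2,3,1,2,1], [1,2,1,3,2,1], [2,1,2,3,2,1], [2,1,3,2,3,1], [2,3,1,2,3,1], [2,3,1,2,1,3],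
     [2,3,2,1,2,3], [3,2,3,1,2,3], [3,2,1,3,2,3]]"

definition B3_path :: "nat list list" where
  "B3_path = [[1,2,1,2,3,2,1,2,3], [2,1,2,1,3,2,1,2,3], [2,1,2,3,1,2,1,2,3], [2,1,2,3,2,1,2,1,3],
     [2,1,3,2,3,1,2,1,3], [2,3,1,2,3,1,2,1,3], [2,3,1,2,1,3,2,1,3], [2,3,1,2,1,3,2,3,1],
     [2,3,1,2,1,2,3,2,1], [2,3,2,1,2,1,3,2,1], [3,2,3,1,2,1,3,2,1], [3,2,1,3,2,1,3,2,1],
     [3,2,1,3,2,3,1,2,1], [3,2,1,2,3,2,1,2,1]]"

definition B3_path' :: "nat list list" where
  "B3_path' = [[1,2,1,2,3,2,1,2,3], [1,2,1,3,2,3,1,2,3], [1,2,3,1,2,3,1,2,3], [1,2,3,1,2,1,3,2,3],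
     [1,2,3,1,2,1,2,3,2], [1,2,3,2,1,2,1,3,2], [1,3,2,3,1,2,1,3,2], [3,1,2,3,1,2,1,3,2],
     [3,1,2,1,3,2,1,3,2], [3,1,2,1,3,2,3,1,2], [3,1,2,1,2,3,2,1,2], [3,2,1,2,1,3,2,1,2],
     [3,2,1,2,3,1,2,1,2], [3,2,1,2,3,2,1,2,1]]"

definition recolour :: "nat \<Rightarrow> nat \<Rightarrow> nat \<Rightarrow> nat list list \<Rightarrow> nat list list" where
  "recolour a b c = map (map (\<lambda>i. if i = 1 then a else if i = 2 then b else c))"

text \<open>
  Each relation is given in one rotation; the others follow by isotopy. The first four rules say that
  decorations in a common region are added and multiplied.
\<close>

inductive local_relation :: "nat \<Rightarrow> dmor \<Rightarrow> dmor \<Rightarrow> bool" for n where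
  box_one: "local_relation n (Box 1) (DId [])"
| box_mult: "local_relation n (Box (f * g)) (DTen (Box f) (Box g))"
| box_add: "local_relation n (Box (f + g)) (DAdd (Box f) (Box g))"
| box_scale: "local_relation n (Box (R_const r * f)) (DScale r (Box f))"
| barbell: "local_relation n (DComp (EndDot s) (StartDot s)) (Box (alpha n s))"
| forcing: "local_relation n (DTen (Box f) (DId [s]))
    (DAdd (DTen (DId [s]) (Box (reflect n s f)))
      (DComp (StartDot s) (DComp (Box (demazure n s f)) (EndDot s))))"
| needle: "local_relation n (DComp (Cap s) (Split s)) (DZero [s] [])"
| H_eq_I: "local_relation n (DComp (DTen (DId [s]) (Merge s)) (DTen (Split s) (DId [s])))
    (DComp (Split s) (Merge s))"
| unit: "local_relation n (DComp (Merge s) (DTen (StartDot s) (DId [s]))) (DId [s])"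
| two_colour_assoc: "s \<noteq> t \<Longrightarrow> m = coxm s t \<Longrightarrow> x = last (alt m t s) \<Longrightarrow>
    local_relation n (DComp (Vert s t) (DTen (Merge s) (DId (alt (m - 1) t s))))
      (DComp (DTen (DId (alt (m - 1) t s)) (Merge x))
        (DComp (DTen (Vert s t) (DId [x])) (DTen (DId [s]) (Vert s t))))"
| dot_crossing_2: "coxm s t = 2 \<Longrightarrow>
    local_relation n (DComp (DTen (DId [t]) (EndDot s)) (Vert s t)) (DTen (EndDot s) (DId [t]))"
| dot_crossing_3: "coxm s t = 3 \<Longrightarrow>
    local_relation n (DComp (DTen (DId [s, t]) (EndDot s)) (Vert t s))
      (DAdd (DTen (EndDot t) (DId [s, t]))
        (DTen (StartDot s) (DComp (Merge t) (DTen (DId [t]) (DTen (EndDot s) (DId [t]))))))"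
| dot_crossing_4: "coxm s t = 4 \<Longrightarrow>
    local_relation n (DComp (DTen (DId [t, s, t]) (EndDot s)) (Vert s t))
      (DComp (DTen (DId [t, s]) (Merge t)) (DTen (JW s t) (DId [t])))"
| three_colour_slide: "s \<noteq> t \<Longrightarrow> m = coxm s t \<Longrightarrow> coxm u s = 2 \<Longrightarrow> coxm u t = 2 \<Longrightarrow>
    local_relation n (DComp (slide u (alt m t s)) (DTen (DId [u]) (Vert s t)))
      (DComp (DTen (Vert s t) (DId [u])) (slide u (alt m s t)))"
| three_colour_A3: "coxm a b = 3 \<Longrightarrow> coxm b c = 3 \<Longrightarrow> coxm a c = 2 \<Longrightarrow>
    local_relation n (braid_path (recolour a b c A3_path)) (braid_path (recolour a b c A3_path'))"
| three_colour_B3: "coxm a b = 4 \<Longrightarrow> coxm b c = 3 \<Longrightarrow> coxm a c = 2 \<Longrightarrow>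
    local_relation n (braid_path (recolour a b c B3_path)) (braid_path (recolour a b c B3_path'))"

inductive dequiv :: "nat \<Rightarrow> nat list \<Rightarrow> nat list \<Rightarrow> dmor \<Rightarrow> dmor \<Rightarrow> bool" for n where
  base: "diagram n w v f \<Longrightarrow> diagram n w v g \<Longrightarrow>
    linear_relation f g \<or> isotopy_relation f g \<or> local_relation n f g \<Longrightarrow> dequiv n w v f g"
| refl: "diagram n w v f \<Longrightarrow> dequiv n w v f f"
| sym: "dequiv n w v f g \<Longrightarrow> dequiv n w v g f"
| trans: "dequiv n w v f g \<Longrightarrow> dequiv n w v g h \<Longrightarrow> dequiv n w v f h"
| comp: "dequiv n u v f f' \<Longrightarrow> dequiv n v w g g' \<Longrightarrow> dequiv n u w (DComp g f) (DComp g' f')"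
| ten: "dequiv n u v f f' \<Longrightarrow> dequiv n u' v' g g' \<Longrightarrow> dequiv n (u @ u') (v @ v') (DTen f g) (DTen f' g')"
| add: "dequiv n u v f f' \<Longrightarrow> dequiv n u v g g' \<Longrightarrow> dequiv n u v (DAdd f g) (DAdd f' g')"
| scale: "dequiv n u v f f' \<Longrightarrow> dequiv n u v (DScale r f) (DScale r f')"

definition dclass :: "nat \<Rightarrow> dmor \<Rightarrow> dmor set" where
  "dclass n f = {g. \<exists>w v. dequiv n w v f g}"

definition soergel_category :: "nat \<Rightarrow> (nat list, dmor set) moncat" where
  "soergel_category n = \<lparr>
     Obj = {w. set w \<subseteq> {1..n}},
     Hom = (\<lambda>w v. dclass n ` {f. diagram n w v f}),
     HomDeg = (\<lambda>d w v. dclass n ` {f. diagram n w v f \<and> dhomogeneous d f}),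
     Id = (\<lambda>w. dclass n (DId w)),
     Comp = (\<lambda>G F. \<Union>g \<in> G. \<Union>f \<in> F. dclass n (DComp g f)),
     Zero = (\<lambda>w v. dclass n (DZero w v)),
     Add = (\<lambda>F G. \<Union>f \<in> F. \<Union>g \<in> G. dclass n (DAdd f g)),
     Scale = (\<lambda>r F. \<Union>f \<in> F. dclass n (DScale r f)),
     Unit = [],
     TenO = (@),
     TenM = (\<lambda>F G. \<Union>f \<in> F. \<Union>g \<in> G. dclass n (DTen f g)),
     Assoc = (\<lambda>u v w. dclass n (DId (u @ v @ w))),
     Lunit = (\<lambda>w. dclass n (DId w)),
     Runit = (\<lambda>w. dclass n (DId w))\<rparr>"

end

theory Submission
  imports Defs "HOL-Computational_Algebra.Polynomial"
begin

text \<open>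
  Let \<open>u\<^sub>j = e\<^sub>j \<otimes> e\<^sub>j\<close> generate \<open>U\<^sub>j\<close>, let \<open>\<kappa>\<^sub>j = (-1)\<^sup>j\<close>, and let \<open>\<theta>\<^sub>j : e\<^sub>j B e\<^sub>j \<rightarrow> K\<^sub>j\<close> read off the coefficient of
  \<open>X\<^sub>j\<close>. The functor sends the end dot to \<open>u\<^sub>j \<mapsto> e\<^sub>j\<close>, the splitting vertex to \<open>u\<^sub>j \<mapsto> u\<^sub>j \<otimes> u\<^sub>j\<close>, the merging vertex
  to \<open>u\<^sub>j \<otimes> y u\<^sub>j \<mapsto> \<kappa>\<^sub>j \<theta>\<^sub>j(y) u\<^sub>j\<close>, and the start dot to the central element
  \<open>\<kappa>\<^sub>j (X\<^sub>j u\<^sub>j + u\<^sub>j X\<^sub>j + \<Sum>\<^sub>k (k|j) u\<^sub>j (j|k))\<close>, where for \<open>j = 1\<close> the neighbour \<open>k = 2\<close> contributes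
  \<open>(2|1) u\<^sub>1 (1|2) - (ie\<^sub>2) (2|1) u\<^sub>1 (1|2) (ie\<^sub>2)\<close> instead. A polynomial with constant term \<open>c\<close> and linear
  coefficients \<open>f\<^sub>j\<close> at \<open>\<omega>\<^sub>j\<close> acts as \<open>c + \<Sum>\<^sub>j \<kappa>\<^sub>j f\<^sub>j X\<^sub>j\<close>. All \<open>2m\<close>-valent vertices go to \<open>0\<close>, so relations with
  such a vertex on both sides are trivial, and a dot-crossing relation says that the side without it goes
  to \<open>0\<close>: for \<open>m = 2\<close> because \<open>e\<^sub>s B e\<^sub>t = 0\<close>, for \<open>m = 3\<close> because \<open>\<kappa>\<^sub>s \<kappa>\<^sub>t = -1\<close>, for \<open>m = 4\<close> because the five summands
  of \<open>JW\<^sub>3\<close> cancel.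
\<close>

text \<open>The images of dots and trivalent vertices are the structure maps of a Frobenius algebra
  object. They come from the form \<open>\<theta>_s(x y)\<close> on \<open>e_s B\<close> and
  \<open>B e_s\<close>, and the start dot is the copairing, a sum over dual bases. For
  \<open>s = 1\<close> the ground field is real, whereas \<open>e_2 B e_1\<close> has the real basis
  \<open>(2|1)\<close>, \<open>(ie_2)(2|1)\<close>, with dual basis \<open>(1|2)\<close>,
  \<open>-(1|2)(ie_2)\<close>. This explains the two summands at vertex 1, and counting both
  produces the Cartan entry \<open>-2\<close>. The barbell of a copairing counts each neighbour
  positively, while off-diagonal Cartan entries are negative; an alternating sign repairs this,
  because adjacent vertices have opposite parity. Two obstacles shape the proof. The quotient
  algebra comes without a basis: the trace is therefore defined on paths and shown to vanish on the
  ideal, and for the corners \<open>e_s B e_t\<close> only small spanning sets are established.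
  Bimodule maps live on iterated tensor products: two of them are compared on products such as
  \<open>u_s y u_t\<close>, with \<open>y\<close> in such a spanning set, which turns each relation
  into a finite computation.\<close>

hide_const (open) Multiset.mult
abbreviation "keys \<equiv> Poly_Mapping.keys"
abbreviation "lookup \<equiv> Poly_Mapping.lookup"
abbreviation "single \<equiv> Poly_Mapping.single"

section \<open>The path algebra and the zigzag algebra\<close>

lemma poly_mapping_sum_singles:
 "p = (\<Sum>x\<in>keys p. single x (lookup p x))"
proof (rule poly_mapping_eqI)
 fix k
 have "lookup (\<Sum>x\<in>keys p. single x (lookup p x)) k
   = (\<Sum>x\<in>keys p. lookup p x when x = k)"
  by (simp add: lookup_sum lookup_single)
 also have "\<dots> = (\<Sum>x\<in>keys p. if x = k then lookup p k else 0)"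
  by (rule sum.cong) (auto simp: when_def)
 also have "\<dots> = lookup p k"
  by (simp add: sum.delta in_keys_iff)
 finally show "lookup p k
   = lookup (\<Sum>x\<in>keys p. single x (lookup p x)) k" by simp
qed

text \<open>The defining sum runs over the exact supports, which shrink when terms cancel. Summing
  over larger finite sets changes nothing and lets \<open>p\<close>, \<open>p'\<close> and
  \<open>p + p'\<close> be expanded over one common index set.\<close>

lemma path_mult_superset:
 assumes "finite A" "finite B" "keys p \<subseteq> A" "keys q \<subseteq> B"
 shows "p ** q = (\<Sum>x\<in>A. \<Sum>y\<in>B. if path_end x = fst y
   then single (fst x, snd x @ snd y) (lookup p x * lookup q y) else 0)"
  (is "_ = (\<Sum>x\<in>A. \<Sum>y\<in>B. ?g x y)")
proof -
 have "(\<Sum>x\<in>A. \<Sum>y\<in>B. ?g x y) = (\<Sum>x\<in>A. \<Sum>y\<in>keys q. ?g x y)"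
  using assms by (intro sum.cong HOL.refl sum.mono_neutral_right) (auto simp: in_keys_iff)
 also have "\<dots> = (\<Sum>x\<in>keys p. \<Sum>y\<in>keys q. ?g x y)"
  using assms by (intro sum.mono_neutral_right) (auto simp: in_keys_iff intro!: sum.neutral)
 finally show ?thesis unfolding path_mult_def by simp
qed

lemma path_mult_add_left: "(p + p') ** q = p ** q + p' ** q"
proof -
 let ?A = "keys p \<union> keys p'"
 have "keys (p + p') \<subseteq> ?A" by (rule keys_add)
 then show ?thesis
  by (subst (1 2 3) path_mult_superset[of ?A "keys q"])
   (auto simp: sum.distrib[symmetric] lookup_add distrib_right single_add intro!: sum.cong)
qed

lemma path_mult_add_right: "p ** (q + q') = p ** q + p ** q'"
proof -
 let ?A = "keys q \<union> keys q'"
 have "keys (q + q') \<subseteq> ?A" by (rule keys_add)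
 then show ?thesis
  by (subst (1 2 3) path_mult_superset[of "keys p" ?A])
   (auto simp: sum.distrib[symmetric] lookup_add distrib_left single_add intro!: sum.cong)
qed

lemma path_mult_zero [simp]: "0 ** q = 0" "p ** 0 = 0"
 by (simp_all add: path_mult_def)

lemma path_mult_sum_left: "(\<Sum>i\<in>I. f i) ** q = (\<Sum>i\<in>I. f i ** q)"
 by (induction I rule: infinite_finite_induct) (simp_all add: path_mult_add_left)

lemma path_mult_sum_right: "q ** (\<Sum>i\<in>I. f i) = (\<Sum>i\<in>I. q ** f i)"
 by (induction I rule: infinite_finite_induct) (simp_all add: path_mult_add_right)

lemma path_mult_uminus: "(- p) ** q = - (p ** q)" "p ** (- q) = - (p ** q)"
 using path_mult_add_left[of p "- p" q] path_mult_add_right[of p q "- q"]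
 by (simp_all add: eq_neg_iff_add_eq_0 add.commute)

lemma path_mult_single:
 "single x a ** single y b
  = (if path_end x = fst y then single (fst x, snd x @ snd y) (a * b) else 0)"
 by (subst path_mult_superset[of "{x}" "{y}"]) auto

lemma path_end_append:
 "path_end x = fst y ==> path_end (v, snd x @ snd y) = (if snd x = [] \<and> snd y = [] then v else path_end y)"
 by (auto simp: path_end_def)

text \<open>Biadditive maps are determined by pairs of monomials. Cancellation in the target forces
  the value 0 at 0, and this generality lets the lemma serve both for products of paths and for
  complex traces.\<close>

lemma path_bilinear_eq:
 fixes f g :: "('a \<Rightarrow>\<^sub>0 real) => ('b \<Rightarrow>\<^sub>0 real) => 'c::cancel_comm_monoid_add"
 assumes "\<And>p p' q. f (p + p') q = f p q + f p' q" "\<And>p q q'. f p (q + q') = f p q + f p q'"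
  "\<And>p p' q. g (p + p') q = g p q + g p' q" "\<And>p q q'. g p (q + q') = g p q + g p q'"
  "\<And>x a y b. x \<in> keys p ==> y \<in> keys q
   ==> f (single x a) (single y b) = g (single x a) (single y b)"
 shows "f p q = g p q"
proof -
 have expand: "h p q = (\<Sum>x\<in>keys p. \<Sum>y\<in>keys q.
   h (single x (lookup p x)) (single y (lookup q y)))"
  if h: "\<And>p p' q. h (p + p') q = h p q + h p' q" "\<And>p q q'. h p (q + q') = h p q + h p q'"
  for h :: "('a \<Rightarrow>\<^sub>0 real) => ('b \<Rightarrow>\<^sub>0 real) => 'c"
 proof -
  have z: "h 0 q = 0" "h p 0 = 0" for p q
   using h(1)[of 0 0 q] h(2)[of p 0 0] by simp_all
  have left: "h (\<Sum>x\<in>A. k x) q = (\<Sum>x\<in>A. h (k x) q)" for k q and A :: "'a set"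
   by (induction A rule: infinite_finite_induct) (simp_all add: z h)
  have right: "h q (\<Sum>x\<in>A. k x) = (\<Sum>x\<in>A. h q (k x))" for k q and A :: "'b set"
   by (induction A rule: infinite_finite_induct) (simp_all add: z h)
  have "h p q = h (\<Sum>x\<in>keys p. single x (lookup p x))
    (\<Sum>y\<in>keys q. single y (lookup q y))"
   by (simp flip: poly_mapping_sum_singles)
  then show ?thesis by (simp add: left right sum.swap[of _ "keys p"])
 qed
 show ?thesis
  unfolding expand[of f, OF assms(1,2)] expand[of g, OF assms(3,4)]
  by (intro sum.cong HOL.refl assms(5))
qed

lemma path_mult_assoc: "(p ** q) ** r = p ** (q ** r)"
proof -
 have 1: "(single x a ** single y b) ** single z c
   = single x a ** (single y b ** single z c)" for x y z a b c
  by (auto simp: path_mult_single path_end_append path_end_def mult.assoc split: if_splits)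
 have 2: "(single x a ** q) ** r = single x a ** (q ** r)" for x a
  by (rule path_bilinear_eq[where f = "\<lambda>q r. (single x a ** q) ** r"
     and g = "\<lambda>q r. single x a ** (q ** r)"])
   (simp_all add: path_mult_add_left path_mult_add_right 1)
 show ?thesis
  by (subst (1 2) poly_mapping_sum_singles[of p]) (simp only: path_mult_sum_left 2)
qed

section \<open>The path algebra as a ring\<close>

lemma carrier_path_algebra [simp]: "p \<in> carrier (path_algebra n) \<longleftrightarrow> keys p \<subseteq> paths n"
 by (simp add: path_algebra_def)

lemma path_algebra_ops [simp]:
 "mult (path_algebra n) = (**)" "one (path_algebra n) = (\<Sum>j = 1..n. pe j)"
 "zero (path_algebra n) = 0" "add (path_algebra n) = (+)"
 by (simp_all add: path_algebra_def)

lemma composable_append: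
 "composable v (as @ bs) \<longleftrightarrow> composable v as \<and> composable (path_end (v, as)) bs"
 by (induction as arbitrary: v) (auto simp: path_end_def)

lemma path_append_closed:
 assumes "x \<in> paths n" "y \<in> paths n" "path_end x = fst y"
 shows "(fst x, snd x @ snd y) \<in> paths n"
 using assms by (auto simp: paths_def composable_append)

lemma path_mult_closed:
 assumes "keys p \<subseteq> paths n" "keys q \<subseteq> paths n"
 shows "keys (p ** q) \<subseteq> paths n"
proof -
 have "keys (if path_end x = fst y
   then single (fst x, snd x @ snd y) (lookup p x * lookup q y) else 0) \<subseteq> paths n"
  if "x \<in> keys p" "y \<in> keys q" for x y
  using that assms by (auto intro!: path_append_closed)
 then show ?thesis unfolding path_mult_def
  by (intro order.trans[OF keys_sum] UN_least)
qed

lemma tgt_arrow: "a \<in> arrows n ==> tgt a \<in> {1..n}"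
 by (auto simp: arrows_def)

lemma path_ends: "x \<in> paths n ==> fst x \<in> {1..n} \<and> path_end x \<in> {1..n}"
 by (auto simp: paths_def path_end_def dest!: subsetD[OF _ last_in_set] tgt_arrow)

lemma pe_mult_single: "pe j ** single y b = (if j = fst y then single y b else 0)"
 by (simp add: pe_def path_mult_single path_end_def)

lemma single_mult_pe: "single y b ** pe j = (if j = path_end y then single y b else 0)"
 by (auto simp: pe_def path_mult_single)

lemma path_one_mult:
 assumes "keys p \<subseteq> paths n"
 shows "(\<Sum>j = 1..n. pe j) ** p = p" "p ** (\<Sum>j = 1..n. pe j) = p"
proof -
 have "(\<Sum>j = 1..n. pe j) ** single x a = single x a"
  "single x a ** (\<Sum>j = 1..n. pe j) = single x a"
  if "x \<in> keys p" for x a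
  using path_ends[of x n] that assms
  by (auto simp: path_mult_sum_left path_mult_sum_right pe_mult_single single_mult_pe sum.delta)
 then have "(\<Sum>j = 1..n. pe j) ** (\<Sum>x\<in>keys p. single x (lookup p x))
    = (\<Sum>x\<in>keys p. single x (lookup p x))"
   "(\<Sum>x\<in>keys p. single x (lookup p x)) ** (\<Sum>j = 1..n. pe j)
    = (\<Sum>x\<in>keys p. single x (lookup p x))"
  by (simp_all only: path_mult_sum_right[of "sum pe {1..n}"] path_mult_sum_left[of _ "keys p"] cong: sum.cong)
 then show "(\<Sum>j = 1..n. pe j) ** p = p" "p ** (\<Sum>j = 1..n. pe j) = p"
  by (simp_all only: poly_mapping_sum_singles[symmetric])
qed

lemma one_path_algebra_closed: "keys (\<Sum>j = 1..n. pe j) \<subseteq> paths n"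
 by (intro order.trans[OF keys_sum] UN_least) (auto simp: pe_def paths_def)

lemma ring_path_algebra: "ring (path_algebra n)"
proof (rule ringI)
 show "abelian_group (path_algebra n)"
 proof (rule abelian_groupI)
  fix x assume "x \<in> carrier (path_algebra n)"
  then show "\<exists>y\<in>carrier (path_algebra n). y \<oplus>\<^bsub>path_algebra n\<^esub> x = \<zero>\<^bsub>path_algebra n\<^esub>"
   by (intro bexI[of _ "- x"]) (auto simp: in_keys_iff)
 next
  fix x y assume "x \<in> carrier (path_algebra n)" "y \<in> carrier (path_algebra n)"
  then show "x \<oplus>\<^bsub>path_algebra n\<^esub> y \<in> carrier (path_algebra n)"
   using keys_add[of x y] by auto
 qed (simp_all add: algebra_simps)
 show "monoid (path_algebra n)"
  by (rule monoidI) (simp_all add: path_mult_assoc path_one_mult path_mult_closed one_path_algebra_closed del: One_nat_def)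
qed (simp_all add: path_mult_add_left path_mult_add_right)

locale type_B =
 fixes n :: nat
 assumes n_ge_2: "2 \<le> n"
begin

abbreviation Z where "Z \<equiv> zigzag n"
abbreviation ZT where "ZT \<equiv> zz_tensor n"
abbreviation zz_mult (infixl "\<bullet>" 70) where "a \<bullet> b \<equiv> a \<otimes>\<^bsub>Z\<^esub> b"
abbreviation cls where "cls \<equiv> zz_class n"
abbreviation pcl :: "nat => arrow list => zz" where
 "pcl v as \<equiv> zz_class n (single (v, as) 1)"

text \<open>The ideal generated by a set is under control only for subsets of the carrier, so each
  relation has to be a combination of paths of the quiver on \<open>1..n\<close>.\<close>

lemma zigzag_relations_closed: "zigzag_relations n \<subseteq> carrier (path_algebra n)"
proof -
 have up: "(j, [Step j (j + 1)]) \<in> paths n" "(j + 1, [Step (j + 1) j]) \<in> paths n" if "1 \<le> j" "j < n" for j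
  using that by (auto simp: paths_def arrows_def)
 have lp: "(j, [Loop j]) \<in> paths n" if "2 \<le> j" "j \<le> n" for j
  using that by (auto simp: paths_def arrows_def)
 have st: "keys (pstep j (j + 1)) \<subseteq> paths n" "keys (pstep (j + 1) j) \<subseteq> paths n"
  if "1 \<le> j" "j < n" for j using up[OF that] by (auto simp: pstep_def)
 have st': "keys (pstep j (j - 1)) \<subseteq> paths n" "keys (pstep (j - 1) j) \<subseteq> paths n"
  if "2 \<le> j" "j \<le> n" for j using st[of "j - 1"] that by auto
 have ie: "keys (pie j) \<subseteq> paths n" if "2 \<le> j" "j \<le> n" for j
  using lp[OF that] by (auto simp: pie_def)
 have pe: "keys (pe j) \<subseteq> paths n" if "1 \<le> j" "j \<le> n" for j
  using that by (auto simp: pe_def paths_def)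
 have add: "keys (p + q) \<subseteq> paths n"
  if "keys p \<subseteq> paths n" "keys q \<subseteq> paths n" for p q :: "qpath \<Rightarrow>\<^sub>0 real"
  using keys_add[of p q] that by blast
 have diff: "keys (p - q) \<subseteq> paths n"
  if "keys p \<subseteq> paths n" "keys q \<subseteq> paths n" for p q :: "qpath \<Rightarrow>\<^sub>0 real"
  using keys_diff[of p q] that by blast
 \<comment> \<open>An opaque name for \<open>keys p \<subseteq> paths n\<close>: the closure facts
   can act as introduction rules without \<open>auto\<close> taking the inclusions apart.\<close>
 define ok where "ok p \<longleftrightarrow> keys p \<subseteq> paths n" for p :: "qpath \<Rightarrow>\<^sub>0 real"
 note ok = path_mult_closed[where n = n, folded ok_def] add[folded ok_def] diff[folded ok_def]
  st[folded ok_def] st'[folded ok_def] ie[folded ok_def] pe[folded ok_def]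
 have ok12: "ok (pstep 1 2)" "ok (pstep 2 1)"
  using ok(4,5)[of 1] n_ge_2 by (simp_all add: numeral_2_eq_2)
 have X: "ok (pX 2)"
  unfolding pX_def using ok12 by (simp add: ok)
 have "\<forall>r\<in>zigzag_relations n. ok r"
  using n_ge_2 unfolding zigzag_relations_def by (auto simp del: One_nat_def intro!: ok ok12 X)
 then show ?thesis by (auto simp: ok_def)
qed

sublocale P: ring "path_algebra n"
 by (rule ring_path_algebra)

lemma keys_uminus [simp]: "keys (- p) = keys (p :: 'x \<Rightarrow>\<^sub>0 real)"
 by (auto simp: in_keys_iff)

lemma path_algebra_minus: "keys p \<subseteq> paths n ==> \<ominus>\<^bsub>path_algebra n\<^esub> p = - p"
 by (rule P.minus_equality) simp_all

lemma keys_add_subset: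
 "keys p \<subseteq> A ==> keys q \<subseteq> A ==> keys (p + q) \<subseteq> A"
 using keys_add[of p q] by blast

lemma ideal_zigzag: "ideal (zigzag_ideal n) (path_algebra n)"
 unfolding zigzag_ideal_def by (rule P.genideal_ideal[OF zigzag_relations_closed])

sublocale I: ideal "zigzag_ideal n" "path_algebra n"
 by (rule ideal_zigzag)

sublocale Z: ring "zigzag n"
 unfolding zigzag_def by (rule I.quotient_is_ring)

section \<open>Classes in the quotient algebra\<close>

lemma cls_hom: "cls \<in> ring_hom (path_algebra n) Z"
 unfolding zigzag_def using I.rcos_ring_hom by (simp add: zz_class_def[abs_def])

lemma cls_closed [simp, intro]: "keys p \<subseteq> paths n ==> cls p \<in> carrier Z"
 using ring_hom_closed[OF cls_hom] by simp

lemma cls_add: "keys p \<subseteq> paths n ==> keys q \<subseteq> paths n ==> cls (p + q) = cls p \<oplus>\<^bsub>Z\<^esub> cls q"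
 using ring_hom_add[OF cls_hom] by simp

lemma cls_mult: "keys p \<subseteq> paths n ==> keys q \<subseteq> paths n ==> cls (p ** q) = cls p \<bullet> cls q"
 using ring_hom_mult[OF cls_hom] by simp

lemma cls_one: "cls (\<Sum>j = 1..n. pe j) = \<one>\<^bsub>Z\<^esub>"
 using ring_hom_one[OF cls_hom] by simp

lemma cls_zero: "cls 0 = \<zero>\<^bsub>Z\<^esub>"
 using ring_hom_zero[OF cls_hom P.ring_axioms Z.ring_axioms] by simp

lemma carrier_zigzagE:
 assumes "b \<in> carrier Z"
 obtains p where "keys p \<subseteq> paths n" "b = cls p"
proof -
 have "b \<in> a_rcosets\<^bsub>path_algebra n\<^esub> zigzag_ideal n"
  using assms by (simp add: zigzag_def FactRing_def)
 then obtain p where "p \<in> carrier (path_algebra n)" "b = cls p"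
  unfolding A_RCOSETS_def' zz_class_def by blast
 then show ?thesis using that by simp
qed

lemma cls_eqI: assumes "keys p \<subseteq> paths n" "keys q \<subseteq> paths n"
 "p - q \<in> zigzag_ideal n"
 shows "cls p = cls q"
proof -
 have "p \<ominus>\<^bsub>path_algebra n\<^esub> q = p - q"
  using path_algebra_minus[OF assms(2)] by (simp add: a_minus_def)
 then show ?thesis
  using P.quotient_eq_iff_same_a_r_cos[OF ideal_zigzag, of p q] assms by (simp add: zz_class_def)
qed

lemma cls_eq_imp: assumes "keys p \<subseteq> paths n" "keys q \<subseteq> paths n"
 "cls p = cls q"
 shows "p - q \<in> zigzag_ideal n"
proof -
 have "p \<ominus>\<^bsub>path_algebra n\<^esub> q = p - q"
  using path_algebra_minus[OF assms(2)] by (simp add: a_minus_def)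
 then show ?thesis
  using P.quotient_eq_iff_same_a_r_cos[OF ideal_zigzag, of p q] assms by (simp add: zz_class_def)
qed

lemma relation_in_ideal: "r \<in> zigzag_relations n ==> r \<in> zigzag_ideal n"
 unfolding zigzag_ideal_def using P.genideal_self[OF zigzag_relations_closed] by blast

lemma pcl_mult:
 assumes "(v, as) \<in> paths n" "(w, bs) \<in> paths n"
 shows "pcl v as \<bullet> pcl w bs = (if path_end (v, as) = w then pcl v (as @ bs) else \<zero>\<^bsub>Z\<^esub>)"
proof -
 have "keys (single (v, as) (1::real)) \<subseteq> paths n"
  "keys (single (w, bs) (1::real)) \<subseteq> paths n"
  using assms by simp_all
 from cls_mult[OF this, symmetric] show ?thesis
  by (simp add: path_mult_single cls_zero)
qed

lemma in_paths [simp]: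
 "(v, []) \<in> paths n \<longleftrightarrow> 1 \<le> v \<and> v \<le> n"
 "(v, a # as) \<in> paths n \<longleftrightarrow> a \<in> arrows n \<and> src a = v \<and> (tgt a, as) \<in> paths n"
 using tgt_arrow[of a n] by (auto simp: paths_def arrows_def)

lemma in_arrows [simp]:
 "Loop j \<in> arrows n \<longleftrightarrow> 2 \<le> j \<and> j \<le> n"
 "Step i j \<in> arrows n \<longleftrightarrow> (j = i + 1 \<or> i = j + 1) \<and> 1 \<le> i \<and> i \<le> n \<and> 1 \<le> j \<and> j \<le> n"
 by (auto simp: arrows_def)

subsection \<open>The trace\<close>

definition loops :: "arrow list => nat" where
 "loops as = length (filter (\<lambda>a. \<exists>j. a = Loop j) as)"

text \<open>The coefficient of \<open>X_s\<close> that a path represents: a closed path of degree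
  two equals a power of \<open>(ie_s)\<close> times \<open>X_s\<close>, one factor
  \<open>\<i>\<close> for each loop. At vertex 1 the real part is taken, because the field there is
  real and a path \<open>(1|2)(ie_2)(2|1)\<close> has to vanish.\<close>

definition trace_weight :: "nat => qpath => complex" where
 "trace_weight s x = (if fst x = s \<and> path_end x = s \<and> path_degree x = 2
   then (if s = 1 then complex_of_real (Re (\<i> ^ loops (snd x))) else \<i> ^ loops (snd x)) else 0)"

lemma trace_weight_cong:
 "fst x = fst y ==> path_end x = path_end y ==> path_degree x = path_degree y ==> loops (snd x) = loops (snd y)
  ==> trace_weight s x = trace_weight s y"
 by (simp add: trace_weight_def)

text \<open>Two loops contribute \<open>\<i> ^ 2 = -1\<close>, also after passing to real parts.
  This matches the relation \<open>(ie_j)(ie_j) = -e_j\<close>.\<close>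

lemma trace_weight_two_loops:
 "fst x = fst y ==> path_end x = path_end y ==> path_degree x = path_degree y ==> loops (snd x) = loops (snd y) + 2
  ==> trace_weight s x = - trace_weight s y"
 by (simp add: trace_weight_def)

definition path_trace :: "nat => (qpath \<Rightarrow>\<^sub>0 real) => complex" where
 "path_trace s p = (\<Sum>x\<in>keys p. complex_of_real (lookup p x) * trace_weight s x)"

lemma path_trace_add: "path_trace s (p + q) = path_trace s p + path_trace s q"
proof -
 let ?A = "keys p \<union> keys q"
 have *: "path_trace s r = (\<Sum>x\<in>?A. complex_of_real (lookup r x) * trace_weight s x)"
  if "keys r \<subseteq> ?A" for r
  unfolding path_trace_def using that by (intro sum.mono_neutral_left) (auto simp: in_keys_iff)
 show ?thesis
  by (simp add: * keys_add sum.distrib[symmetric] lookup_add distrib_right)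
qed

lemma path_trace_zero [simp]: "path_trace s 0 = 0"
 by (simp add: path_trace_def)

lemma path_trace_single [simp]: "path_trace s (single x a) = complex_of_real a * trace_weight s x"
 by (cases "a = 0") (simp_all add: path_trace_def)

lemma path_trace_diff: "path_trace s (p - q) = path_trace s p - path_trace s q"
 using path_trace_add[of s "p - q" q] by simp

text \<open>The expression is biadditive in the outer factors, so monomials suffice.\<close>

lemma path_trace_bilinear_zero:
 assumes "\<And>x y a b. x \<in> paths n ==> y \<in> paths n
  ==> path_trace s (single x a ** (r ** single y b)) = 0"
  and "keys u \<subseteq> paths n" "keys v \<subseteq> paths n"
 shows "path_trace s (u ** (r ** v)) = 0"
 by (rule path_bilinear_eq[where f = "\<lambda>u v. path_trace s (u ** (r ** v))" and g = "\<lambda>_ _. 0"])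
  (use assms(2,3) in \<open>simp_all add: path_mult_add_left path_mult_add_right path_trace_add assms(1) subset_eq\<close>)

text \<open>The largest two-sided ideal inside the kernel of the trace. Since it is an ideal by its
  form, well-definedness of the trace on the quotient reduces to an inspection of the generating
  relations.\<close>

definition trace_null :: "nat => (qpath \<Rightarrow>\<^sub>0 real) set" where
 "trace_null s = {r. keys r \<subseteq> paths n \<and> (\<forall>u v. keys u \<subseteq> paths n \<longrightarrow>
   keys v \<subseteq> paths n \<longrightarrow> path_trace s (u ** (r ** v)) = 0)}"

lemma ideal_trace_null: "ideal (trace_null s) (path_algebra n)"
proof (rule idealI[OF ring_path_algebra])
 show "subgroup (trace_null s) (add_monoid (path_algebra n))"
 proof (rule P.add.subgroupI)
  have "0 \<in> trace_null s" by (simp add: trace_null_def)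
  then show "trace_null s \<noteq> {}" by blast
  show "trace_null s \<subseteq> carrier (path_algebra n)" by (auto simp: trace_null_def)
 next
  fix a assume a: "a \<in> trace_null s"
  have "path_trace s (- p) = - path_trace s p" for p
   using path_trace_diff[of s 0 p] by simp
  then have "- a \<in> trace_null s"
   using a by (simp add: trace_null_def path_mult_uminus)
  moreover have "\<ominus>\<^bsub>path_algebra n\<^esub> a = - a"
   using a by (intro path_algebra_minus) (simp add: trace_null_def)
  ultimately show "\<ominus>\<^bsub>path_algebra n\<^esub> a \<in> trace_null s" by simp
 next
  fix a b assume ab: "a \<in> trace_null s" "b \<in> trace_null s"
  then have "keys (a + b) \<subseteq> paths n"
   using keys_add[of a b] unfolding trace_null_def by blast
  then show "a \<oplus>\<^bsub>path_algebra n\<^esub> b \<in> trace_null s"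
   using ab by (simp add: trace_null_def path_mult_add_left path_mult_add_right path_trace_add)
 qed
next
 fix a x assume "a \<in> trace_null s" "x \<in> carrier (path_algebra n)"
 then have a: "keys a \<subseteq> paths n" "keys x \<subseteq> paths n"
  and null: "\<And>u v. keys u \<subseteq> paths n ==> keys v \<subseteq> paths n ==> path_trace s (u ** (a ** v)) = 0"
  by (simp_all add: trace_null_def)
 have "path_trace s (u ** (x ** a ** v)) = 0" "path_trace s (u ** (a ** x ** v)) = 0"
  if "keys u \<subseteq> paths n" "keys v \<subseteq> paths n" for u v
  using null[of "u ** x" v] null[of u "x ** v"] that a by (simp_all add: path_mult_assoc path_mult_closed)
 then show "x \<otimes>\<^bsub>path_algebra n\<^esub> a \<in> trace_null s" "a \<otimes>\<^bsub>path_algebra n\<^esub> x \<in> trace_null s"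
  using a by (simp_all add: trace_null_def path_mult_closed)
qed

lemma path_degree_append: "path_degree (v, as @ bs) = path_degree (v, as) + path_degree (w, bs)"
 by (simp add: path_degree_def)

lemma loops_append: "loops (as @ bs) = loops as + loops bs"
 by (simp add: loops_def)

lemma path_degree_nonneg: "0 \<le> path_degree x"
 by (simp add: path_degree_def)

text \<open>Such a path consists of loops only.\<close>

lemma path_degree_zero:
 assumes "x \<in> paths n" "path_degree x = 0"
 shows "path_end x = fst x"
proof -
 have "path_end (v, as) = v" if "(v, as) \<in> paths n" "path_degree (v, as) = 0" for v as
  using that
 proof (induction as arbitrary: v)
  case (Cons a as)
  then show ?case by (cases a; cases as) (auto simp: path_degree_def path_end_def split: if_splits)
 qed (simp add: path_end_def)
 then show ?thesis using assms by (cases x) auto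
qed

text \<open>Vertex 1 carries no loop. Hence nothing of degree zero but scalars can be attached to
  the path \<open>(1|2)(ie_2)(2|1)\<close>, whose trace must vanish in every product.\<close>

lemma path_degree_zero_at_1:
 assumes "(1, as) \<in> paths n" "path_degree (1, as) = 0"
 shows "as = []"
 using assms by (cases as; cases "hd as") (auto simp: path_degree_def split: if_splits)

lemma trace_null_single:
 assumes z: "z \<in> paths n"
  and "\<And>x y. x \<in> paths n ==> y \<in> paths n ==> path_end x = fst z ==> path_end z = fst y
   ==> trace_weight s (fst x, snd x @ snd z @ snd y) = 0"
 shows "single z 1 \<in> trace_null s"
proof -
 have "path_trace s (single x a ** (single z 1 ** single y b)) = 0"
  if "x \<in> paths n" "y \<in> paths n" for x y a b
  using assms(2)[OF that] by (simp add: path_mult_single)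
 then show ?thesis
  using z by (simp add: trace_null_def path_trace_bilinear_zero)
qed

lemma trace_null_binomial:
 assumes z: "z \<in> paths n" "z' \<in> paths n" "fst z = fst z'" "path_end z = path_end z'"
  and "\<And>x y. x \<in> paths n ==> y \<in> paths n ==> path_end x = fst z ==> path_end z = fst y
   ==> trace_weight s (fst x, snd x @ snd z @ snd y) + c * trace_weight s (fst x, snd x @ snd z' @ snd y) = 0"
 shows "single z 1 + single z' c \<in> trace_null s"
proof -
 have "keys (single z 1 + single z' c) \<subseteq> paths n"
  using keys_add[of "single z 1" "single z' c"] z by (auto split: if_splits)
 moreover have "path_trace s (single x a ** ((single z 1 + single z' c) ** single y b)) = 0"
  if "x \<in> paths n" "y \<in> paths n" for x y a b
 proof (cases "path_end x = fst z \<and> path_end z = fst y")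
  case True
  then have "path_trace s (single x a ** ((single z 1 + single z' c) ** single y b))
   = a * b * (trace_weight s (fst x, snd x @ snd z @ snd y) + c * trace_weight s (fst x, snd x @ snd z' @ snd y))"
   using z by (simp add: path_mult_single path_mult_add_left path_mult_add_right path_trace_add distrib_left)
  also have "\<dots> = 0" using assms(5)[OF that] True by simp
  finally show ?thesis .
 next
  case False
  then show ?thesis using z(3,4)
   by (simp add: path_mult_single path_mult_add_left path_mult_add_right)
 qed
 ultimately show ?thesis by (simp add: trace_null_def path_trace_bilinear_zero)
qed

text \<open>The weight sees a path only through its end points, its degree and its number of loops.
  Attaching the same paths on both sides keeps these data equal.\<close>

lemma trace_null_binomial_diff:
 assumes "z \<in> paths n" "z' \<in> paths n" "fst z = fst z'" "path_end z = path_end z'"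
  "path_degree z = path_degree z'" "loops (snd z) = loops (snd z')"
 shows "single z 1 - single z' 1 \<in> trace_null s"
proof -
 have "single z 1 + single z' (-1) \<in> trace_null s"
 proof (rule trace_null_binomial[OF assms(1-4)])
  fix x y :: qpath assume "path_end x = fst z" "path_end z = fst y"
  then have "path_end (fst x, snd x @ snd z @ snd y) = path_end (fst x, snd x @ snd z' @ snd y)"
   using assms(3,4) path_end_append[of x "(fst z, snd z @ snd y)" "fst x"] path_end_append[of z y "fst z"]
    path_end_append[of x "(fst z, snd z' @ snd y)" "fst x"] path_end_append[of z' y "fst z"]
   by (auto simp: path_end_def split: if_splits)
  then have "trace_weight s (fst x, snd x @ snd z @ snd y) = trace_weight s (fst x, snd x @ snd z' @ snd y)"
   by (intro trace_weight_cong) (use assms(5,6) in \<open>simp_all add: path_degree_def loops_append\<close>)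
  then show "trace_weight s (fst x, snd x @ snd z @ snd y) + complex_of_real (-1) * trace_weight s (fst x, snd x @ snd z' @ snd y) = 0"
   by simp
 qed
 then show ?thesis by (simp add: single_uminus)
qed

text \<open>Every relation is a monomial or a binomial in paths, the shape to which the preceding
  criteria apply.\<close>

lemma relation_forms:
 assumes "r \<in> zigzag_relations n"
 obtains (X) j where "2 \<le> j" "j < n" "r = single (j, [Step j (j - 1), Step (j - 1) j]) 1
   - single (j, [Step j (j + 1), Step (j + 1) j]) 1"
 | (up) j where "2 \<le> j" "j < n" "r = single (j - 1, [Step (j - 1) j, Step j (j + 1)]) 1"
 | (down) j where "2 \<le> j" "j < n" "r = single (j + 1, [Step (j + 1) j, Step j (j - 1)]) 1"
 | (loop) j where "2 \<le> j" "j \<le> n" "r = single (j, [Loop j, Loop j]) 1 + single (j, []) 1"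
 | (loop_up) j where "3 \<le> j" "j \<le> n" "r = single (j - 1, [Loop (j - 1), Step (j - 1) j]) 1
   - single (j - 1, [Step (j - 1) j, Loop j]) 1"
 | (loop_down) j where "3 \<le> j" "j \<le> n" "r = single (j, [Loop j, Step j (j - 1)]) 1
   - single (j, [Step j (j - 1), Loop (j - 1)]) 1"
 | (loop_1) "r = single (1, [Step 1 2, Loop 2, Step 2 1]) 1"
 | (loop_X) "r = single (2, [Loop 2, Step 2 1, Step 1 2]) 1 - single (2, [Step 2 1, Step 1 2, Loop 2]) 1"
proof -
 note defs = pstep_def pie_def pe_def pX_def path_mult_single path_end_def
 show ?thesis
  using assms unfolding zigzag_relations_def
  apply (elim UnE CollectE exE conjE insertE emptyE)
  subgoal for j by (rule X[of j]) (simp_all add: defs)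
  subgoal for j by (rule up[of j]) (simp_all add: defs)
  subgoal for j by (rule down[of j]) (simp_all add: defs)
  subgoal for j by (rule loop[of j]) (simp_all add: defs)
  subgoal for j by (rule loop_up[of j]) (simp_all add: defs)
  subgoal for j by (rule loop_down[of j]) (simp_all add: defs)
  subgoal by (rule loop_1) (simp add: defs)
  subgoal by (rule loop_X) (simp add: defs)
  done
qed

text \<open>The path already exhausts the degree two that the trace detects. Whatever is attached
  has degree zero and does not move the end points, so the extended path is still not
  closed.\<close>

lemma trace_null_monomial:
 assumes "z \<in> paths n" "path_degree z = 2" "fst z \<noteq> path_end z"
 shows "single z 1 \<in> trace_null s"
proof (rule trace_null_single[OF assms(1)])
 fix x y assume xy: "x \<in> paths n" "y \<in> paths n" "path_end x = fst z" "path_end z = fst y"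
 show "trace_weight s (fst x, snd x @ snd z @ snd y) = 0"
 proof (rule ccontr)
  assume "trace_weight s (fst x, snd x @ snd z @ snd y) \<noteq> 0"
  then have w: "fst x = s" "path_end (fst x, snd x @ snd z @ snd y) = s"
    "path_degree (fst x, snd x @ snd z @ snd y) = 2"
   by (auto simp: trace_weight_def split: if_splits)
  have "path_degree x + path_degree z + path_degree y = 2"
   using w(3) by (simp add: path_degree_def)
  then have "path_degree x = 0" "path_degree y = 0"
   using assms(2) path_degree_nonneg[of x] path_degree_nonneg[of y] by linarith+
  then have "path_end x = fst x" "path_end y = fst y"
   using path_degree_zero xy by auto
  moreover have "snd z \<noteq> []" using assms(2) by (auto simp: path_degree_def)
  then have "path_end (fst x, snd x @ snd z @ snd y) = path_end y"
   using xy(4) by (auto simp: path_end_def)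
  ultimately show False using w xy assms(3) by simp
 qed
qed

lemma zigzag_relations_trace_null: "zigzag_relations n \<subseteq> trace_null s"
proof
 fix r assume "r \<in> zigzag_relations n"
 then show "r \<in> trace_null s"
 proof (cases rule: relation_forms)
  case (loop j)
  have "trace_weight s (fst x, snd x @ snd (j, [Loop j, Loop j]) @ snd y)
    + complex_of_real 1 * trace_weight s (fst x, snd x @ snd (j, [] :: arrow list) @ snd y) = 0"
   if "path_end x = fst (j, [Loop j, Loop j])" "path_end (j, [Loop j, Loop j]) = fst y" for x y :: qpath
  proof -
   have e: "path_end (fst x, snd x @ Loop j # Loop j # snd y) = path_end (fst x, snd x @ snd y)"
    using that by (auto simp: path_end_def)
   have "trace_weight s (fst x, snd x @ Loop j # Loop j # snd y) = - trace_weight s (fst x, snd x @ snd y)"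
    by (rule trace_weight_two_loops[OF _ e]) (simp_all add: path_degree_def loops_def)
   then show ?thesis by simp
  qed
  then show ?thesis unfolding loop(3)
   using loop(1,2) by (intro trace_null_binomial) (simp_all add: path_end_def)
 next
  case loop_1
  show ?thesis unfolding loop_1
  proof (rule trace_null_single)
   show "(1, [Step 1 2, Loop 2, Step 2 1]) \<in> paths n" using n_ge_2 by simp
   fix x y assume xy: "x \<in> paths n" "y \<in> paths n" "path_end x = fst (1, [Step 1 2, Loop 2, Step 2 1])"
    "path_end (1, [Step 1 2, Loop 2, Step 2 1]) = fst y"
   show "trace_weight s (fst x, snd x @ snd (1, [Step 1 2, Loop 2, Step 2 1]) @ snd y) = 0"
   proof (rule ccontr)
    \<comment> \<open>A nonzero weight leaves degree zero for \<open>x\<close> and \<open>y\<close>,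
      which are then constant at vertex 1; only the path itself remains.\<close>
    assume *: "\<not> ?thesis"
    then have "path_degree x + path_degree y = 0"
     by (auto simp: trace_weight_def path_degree_def split: if_splits)
    then have 0: "path_degree x = 0" "path_degree y = 0"
     using path_degree_nonneg[of x] path_degree_nonneg[of y] by linarith+
    then have 1: "fst x = 1" "fst y = 1"
     using path_degree_zero xy by (auto simp: path_end_def)
    then have "snd x = []" "snd y = []"
     using path_degree_zero_at_1[of "snd x"] path_degree_zero_at_1[of "snd y"] 0 xy by (metis prod.collapse)+
    \<comment> \<open>One loop gives \<open>\<i>\<close>, whose real part is 0.\<close>
    moreover have "trace_weight s (1, [Step 1 2, Loop 2, Step 2 1]) = 0"
     by (auto simp: trace_weight_def loops_def)
    ultimately show False using * 1 by simp
   qed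
  qed
 \<comment> \<open>The other relations are paths of degree two with distinct ends, or differences of
   two paths with equally many loops.\<close>
 qed (use n_ge_2 in \<open>auto intro!: trace_null_binomial_diff trace_null_monomial
   simp: path_end_def path_degree_def loops_def\<close>)
qed

text \<open>An arbitrary representative is chosen; the value does not depend on it, as the trace
  vanishes on the ideal.\<close>

definition trace :: "nat => zz => complex" where
 "trace s b = path_trace s (SOME p. keys p \<subseteq> paths n \<and> b = cls p)"

text \<open>Minimality puts the zigzag ideal inside \<open>trace_null s\<close>. With the unit as
  both multipliers, the defining condition there becomes the trace of \<open>r\<close>
  itself.\<close>

lemma path_trace_ideal: "r \<in> zigzag_ideal n ==> path_trace s r = 0"
proof -
 assume r: "r \<in> zigzag_ideal n"
 have "r \<in> trace_null s"
  using P.genideal_minimal[OF ideal_trace_null zigzag_relations_trace_null] r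
  by (auto simp: zigzag_ideal_def)
 then have k: "keys r \<subseteq> paths n"
  and "path_trace s ((\<Sum>j = 1..n. pe j) ** (r ** (\<Sum>j = 1..n. pe j))) = 0"
  using one_path_algebra_closed[of n] by (simp_all add: trace_null_def)
 then show ?thesis by (simp only: path_one_mult[OF k])
qed

lemma trace_cls: assumes "keys p \<subseteq> paths n" shows "trace s (cls p) = path_trace s p"
proof -
 let ?q = "SOME q. keys q \<subseteq> paths n \<and> cls p = cls q"
 have q: "keys ?q \<subseteq> paths n \<and> cls p = cls ?q"
  by (rule someI[of _ p]) (simp add: assms)
 then have "?q - p \<in> zigzag_ideal n" using cls_eq_imp[of ?q p] assms by simp
 then show ?thesis unfolding trace_def using path_trace_ideal[of "?q - p" s] by (simp add: path_trace_diff)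
qed

lemma trace_add: "b \<in> carrier Z ==> c \<in> carrier Z ==> trace s (b \<oplus>\<^bsub>Z\<^esub> c) = trace s b + trace s c"
proof -
 assume "b \<in> carrier Z" "c \<in> carrier Z"
 then obtain p q where pq: "keys p \<subseteq> paths n" "keys q \<subseteq> paths n" "b = cls p" "c = cls q"
  by (elim carrier_zigzagE)
 then have "keys (p + q) \<subseteq> paths n" using keys_add[of p q] by blast
 with pq show ?thesis by (simp flip: cls_add add: trace_cls path_trace_add)
qed

lemma trace_zero [simp]: "trace s \<zero>\<^bsub>Z\<^esub> = 0"
 by (simp add: trace_cls flip: cls_zero)

lemma zz_induct [consumes 1, case_names add single]:
 assumes "b \<in> carrier Z"
  and "\<And>b c. b \<in> carrier Z ==> c \<in> carrier Z ==> P b ==> P c ==> P (b \<oplus>\<^bsub>Z\<^esub> c)"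
  and "\<And>x a. x \<in> paths n ==> P (cls (single x a))"
 shows "P b"
proof -
 obtain p where p: "keys p \<subseteq> paths n" "b = cls p" using carrier_zigzagE[OF assms(1)] .
 \<comment> \<open>The zero class is obtained as a monomial with coefficient 0.\<close>
 have "(1, []) \<in> paths n" using n_ge_2 by simp
 then have "P (cls (single (1, []) 0))" by (rule assms(3))
 then have z: "P (cls 0)" by simp
 have "keys (\<Sum>x\<in>A. single x (lookup p x)) \<subseteq> paths n
   \<and> P (cls (\<Sum>x\<in>A. single x (lookup p x)))" if "finite A" "A \<subseteq> paths n" for A
  using that
 proof (induction A rule: finite_induct)
  case (insert x A)
  let ?s = "\<Sum>x\<in>A. single x (lookup p x)"
  have 1: "keys (single x (lookup p x)) \<subseteq> paths n" "keys ?s \<subseteq> paths n"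
   using insert by auto
  then have "P (cls (single x (lookup p x) + ?s))"
   using insert assms(3)[of x] by (simp add: cls_add assms(2))
  then show ?case using insert 1 keys_add[of "single x (lookup p x)" ?s]
   by (simp add: subset_trans[OF _ Un_least])
 qed (simp add: z)
 from this[of "keys p"] p show ?thesis by (simp flip: poly_mapping_sum_singles)
qed

subsection \<open>Scalars and grading\<close>

abbreviation scal :: "real => qpath \<Rightarrow>\<^sub>0 real" where
 "scal r \<equiv> (\<Sum>j = 1..n. single (j, []) r)"

lemma keys_scal: "keys (scal r) \<subseteq> paths n"
 by (intro order.trans[OF keys_sum] UN_least) (auto simp: paths_def)

lemma scal_mult: assumes "x \<in> paths n"
 shows "scal r ** single x a = single x (r * a)"
  "single x a ** scal r = single x (a * r)"
proof -
 have "1 \<le> fst x" "fst x \<le> n" "1 \<le> path_end x" "path_end x \<le> n"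
  using path_ends[OF assms] by auto
 then show "scal r ** single x a = single x (r * a)"
  "single x a ** scal r = single x (a * r)"
  by (simp_all add: path_mult_sum_left path_mult_sum_right path_mult_single path_end_def[of "(_, [])"] sum.delta
   del: One_nat_def)
qed

lemma zz_scalar_closed [simp]: "zz_scalar n r \<in> carrier Z"
 unfolding zz_scalar_def using keys_scal by simp

lemma zz_scalar_single: assumes "x \<in> paths n"
 shows "zz_scalar n r \<bullet> cls (single x a) = cls (single x (r * a))"
  "cls (single x a) \<bullet> zz_scalar n r = cls (single x (r * a))"
 unfolding zz_scalar_def
 using assms keys_scal by (simp_all add: cls_mult[symmetric] scal_mult mult.commute del: One_nat_def)

lemma zz_scalar_central: "b \<in> carrier Z ==> zz_scalar n r \<bullet> b = b \<bullet> zz_scalar n r"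
 by (induction rule: zz_induct) (simp_all add: Z.r_distr Z.l_distr zz_scalar_single)

lemma zz_scalar_add: "zz_scalar n (r + s) = zz_scalar n r \<oplus>\<^bsub>Z\<^esub> zz_scalar n s"
 unfolding zz_scalar_def using keys_scal by (simp add: cls_add[symmetric] single_add sum.distrib)

lemma zz_scalar_one: "zz_scalar n 1 = \<one>\<^bsub>Z\<^esub>"
 unfolding zz_scalar_def using cls_one by (simp add: pe_def)

lemma zz_scalar_zero: "zz_scalar n 0 = \<zero>\<^bsub>Z\<^esub>"
 unfolding zz_scalar_def by (simp add: cls_zero)

lemma zz_scalar_mult: "zz_scalar n (r * s) = zz_scalar n r \<bullet> zz_scalar n s"
proof -
 have "scal r ** scal s = scal (r * s)"
  unfolding path_mult_sum_right by (intro sum.cong HOL.refl scal_mult) simp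
 then show ?thesis unfolding zz_scalar_def using keys_scal by (simp add: cls_mult[symmetric])
qed

lemma zz_degree_closed: "b \<in> zz_degree n d ==> b \<in> carrier Z"
 by (auto simp: zz_degree_def)

lemma zz_degreeI:
 "keys p \<subseteq> paths n ==> (\<And>x. x \<in> keys p ==> path_degree x = d) ==> cls p \<in> zz_degree n d"
 by (auto simp: zz_degree_def)

lemma zz_degreeE:
 assumes "b \<in> zz_degree n d"
 obtains p where "keys p \<subseteq> paths n" "\<And>x. x \<in> keys p ==> path_degree x = d" "b = cls p"
 using assms by (auto simp: zz_degree_def)

lemma zz_degree_add: assumes "b \<in> zz_degree n d" "c \<in> zz_degree n d"
 shows "b \<oplus>\<^bsub>Z\<^esub> c \<in> zz_degree n d"
proof -
 obtain p q where pq: "keys p \<subseteq> paths n" "\<And>x. x \<in> keys p ==> path_degree x = d" "b = cls p"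
  "keys q \<subseteq> paths n" "\<And>x. x \<in> keys q ==> path_degree x = d" "c = cls q"
  using zz_degreeE[OF assms(1)] zz_degreeE[OF assms(2)] by metis
 have "cls (p + q) \<in> zz_degree n d"
  by (rule zz_degreeI) (use keys_add[of p q] pq in blast)+
 then show ?thesis using pq by (simp add: cls_add)
qed

lemma zz_degree_zero: "\<zero>\<^bsub>Z\<^esub> \<in> zz_degree n d"
 using zz_degreeI[of 0 d] by (simp add: cls_zero)

lemma zz_degree_mult: assumes "b \<in> zz_degree n d" "c \<in> zz_degree n e"
 shows "b \<bullet> c \<in> zz_degree n (d + e)"
proof -
 obtain p q where pq: "keys p \<subseteq> paths n" "\<And>x. x \<in> keys p ==> path_degree x = d" "b = cls p"
  "keys q \<subseteq> paths n" "\<And>x. x \<in> keys q ==> path_degree x = e" "c = cls q"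
  using zz_degreeE[OF assms(1)] zz_degreeE[OF assms(2)] by metis
 have "path_degree (fst x, snd x @ snd y) = d + e"
  if "x \<in> keys p" "y \<in> keys q" for x y
  using that pq(2)[of x] pq(5)[of y] path_degree_append[of "fst x" "snd x" "snd y" "fst y"] by simp
 then have "keys (p ** q) \<subseteq> {x. path_degree x = d + e}"
  unfolding path_mult_def by (intro order.trans[OF keys_sum] UN_least) simp
 then have "cls (p ** q) \<in> zz_degree n (d + e)"
  by (intro zz_degreeI path_mult_closed pq) blast
 then show ?thesis using pq by (simp add: cls_mult)
qed

lemma zz_degree_scalar: "zz_scalar n r \<in> zz_degree n 0"
 unfolding zz_scalar_def
proof (rule zz_degreeI[OF keys_scal])
 fix x assume "x \<in> keys (scal r)"
 then have "x \<in> (\<Union>j\<in>{1..n}. keys (single (j, [] :: arrow list) r))"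
  by (rule subsetD[OF keys_sum])
 then obtain j where "x \<in> keys (single (j, [] :: arrow list) r)" by blast
 then show "path_degree x = 0" by (simp add: path_degree_def split: if_splits)
qed

lemma zz_degree_one: "\<one>\<^bsub>Z\<^esub> \<in> zz_degree n 0"
 using zz_degree_scalar[of 1] by (simp add: zz_scalar_one)

lemma zz_degree_pcl: "(v, as) \<in> paths n ==> path_degree (v, as) = d ==> pcl v as \<in> zz_degree n d"
 by (rule zz_degreeI) auto

lemma trace_degree: assumes "b \<in> zz_degree n d" "d \<noteq> 2" shows "trace s b = 0"
proof -
 obtain p where p: "keys p \<subseteq> paths n" "\<And>x. x \<in> keys p ==> path_degree x = d" "b = cls p"
  using zz_degreeE[OF assms(1)] by metis
 have "path_trace s p = 0"
  unfolding path_trace_def by (rule sum.neutral) (use p(2) assms(2) in \<open>simp add: trace_weight_def\<close>)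
 with p show ?thesis by (simp add: trace_cls)
qed

subsection \<open>The fields attached to the vertices\<close>

abbreviation kem :: "nat => complex => zz" where "kem \<equiv> KK_embed n"

lemma KK_real: "c \<in> KK j ==> j = 1 ==> Im c = 0"
 by (auto simp: KK_def complex_is_Real_iff)

lemma KK_closed:
 "0 \<in> KK j" "1 \<in> KK j" "c \<in> KK j ==> d \<in> KK j ==> c + d \<in> KK j" "c \<in> KK j ==> d \<in> KK j ==> c * d \<in> KK j"
 "complex_of_real r \<in> KK j"
 by (auto simp: KK_def)

abbreviation pkem :: "nat => complex => qpath \<Rightarrow>\<^sub>0 real" where
 "pkem j c \<equiv> single (j, []) (Re c) + single (j, [Loop j]) (Im c)"

lemma keys_pkem: assumes "j \<in> {1..n}" "c \<in> KK j" shows "keys (pkem j c) \<subseteq> paths n"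
proof -
 have "keys (single (j, [Loop j]) (Im c)) \<subseteq> paths n"
  using assms KK_real[of c j] by (cases "j = 1") auto
 then show ?thesis using assms(1) by (intro keys_add_subset) simp_all
qed

lemma kem_closed [simp]: "j \<in> {1..n} ==> c \<in> KK j ==> kem j c \<in> carrier Z"
 unfolding KK_embed_def using keys_pkem by simp

lemma kem_zero: "kem j 0 = \<zero>\<^bsub>Z\<^esub>"
 by (simp add: KK_embed_def cls_zero)

lemma kem_one: "kem j 1 = pcl j []"
 by (simp add: KK_embed_def)

lemma kem_add: assumes "j \<in> {1..n}" "c \<in> KK j" "d \<in> KK j" shows "kem j (c + d) = kem j c \<oplus>\<^bsub>Z\<^esub> kem j d"
 using assms unfolding KK_embed_def
 by (simp add: cls_add[symmetric] keys_pkem single_add algebra_simps)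

lemma loop_square: "2 \<le> j ==> j \<le> n ==> cls (single (j, [Loop j, Loop j]) a) = cls (single (j, []) (- a))"
proof -
 assume j: "2 \<le> j" "j \<le> n"
 have "pie j ** pie j + pe j \<in> zigzag_relations n"
  using j unfolding zigzag_relations_def by blast
 then have "scal a ** (pie j ** pie j + pe j) \<in> zigzag_ideal n"
  using I.I_l_closed[OF relation_in_ideal] keys_scal by simp
 moreover have "scal a ** (pie j ** pie j + pe j) = single (j, [Loop j, Loop j]) a - single (j, []) (- a)"
  using j by (simp add: pie_def pe_def path_mult_single path_end_def path_mult_add_right scal_mult single_uminus del: One_nat_def)
 ultimately show ?thesis using j by (intro cls_eqI) auto
qed

text \<open>The product of the representatives has one term with two loops. The relation
  \<open>(ie_j)(ie_j) = -e_j\<close> turns it into the real contribution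
  \<open>- (Im c * Im d)\<close>, which is the multiplication rule of complex numbers. At vertex 1
  the imaginary parts are 0.\<close>

lemma kem_mult: assumes "j \<in> {1..n}" "c \<in> KK j" "d \<in> KK j" shows "kem j (c * d) = kem j c \<bullet> kem j d"
proof (cases "j = 1")
 case True
 then show ?thesis using assms KK_real[of c j] KK_real[of d j] unfolding KK_embed_def
  by (simp add: cls_mult[symmetric] path_mult_single path_end_def del: One_nat_def)
next
 case False
 then have j: "2 \<le> j" "j \<le> n" using assms by auto
 let ?L = "\<lambda>a. single (j, [Loop j, Loop j]) (a::real)"
 let ?r = "single (j, []) (Re c * Re d) + single (j, [Loop j]) (Im (c * d)) :: qpath \<Rightarrow>\<^sub>0 real"
 have r: "keys ?r \<subseteq> paths n"
  using j by (intro keys_add_subset) simp_all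
 have "pkem j c ** pkem j d = ?r + ?L (Im c * Im d)"
  by (simp add: path_mult_add_left path_mult_add_right path_mult_single path_end_def single_add[symmetric] add_ac)
 then have "kem j c \<bullet> kem j d = cls (?r + ?L (Im c * Im d))"
  using assms unfolding KK_embed_def by (simp add: cls_mult[symmetric] keys_pkem)
 also have "\<dots> = cls ?r \<oplus>\<^bsub>Z\<^esub> cls (?L (Im c * Im d))"
  using j by (intro cls_add r) auto
 also have "\<dots> = cls ?r \<oplus>\<^bsub>Z\<^esub> cls (single (j, []) (- (Im c * Im d)))"
  using j by (simp only: loop_square)
 also have "\<dots> = cls (?r + single (j, []) (- (Im c * Im d)))"
  using j by (intro cls_add[symmetric] r) auto
 also have "\<dots> = kem j (c * d)"
  unfolding KK_embed_def by (rule arg_cong[where f = cls]) (simp add: single_add[symmetric] single_diff single_uminus algebra_simps)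
 finally show ?thesis ..
qed

lemma kem_degree: "j \<in> {1..n} ==> c \<in> KK j ==> kem j c \<in> zz_degree n 0"
 unfolding KK_embed_def
 using keys_add[of "single (j, []) (Re c)" "single (j, [Loop j]) (Im c)"]
 by (intro zz_degreeI keys_pkem) (auto simp: path_degree_def split: if_splits)

lemma trace_in_KK: assumes "b \<in> carrier Z" shows "trace j b \<in> KK j"
 using assms
proof (induction rule: zz_induct)
 case (single x a)
 then show ?case by (simp add: trace_cls trace_weight_def KK_def)
qed (simp add: trace_add KK_closed)

text \<open>A loop at either end multiplies the weight by \<open>\<i>\<close>. This linearity over
  the field of the vertex is what makes the contraction of \<open>U_j \<otimes> U_j\<close> well
  defined on tensor products over that field.\<close>

lemma trace_kem:
 assumes "b \<in> carrier Z" "j \<in> {1..n}" "c \<in> KK j"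
 shows "trace j (kem j c \<bullet> b) = c * trace j b" "trace j (b \<bullet> kem j c) = trace j b * c"
proof -
 have "trace j (kem j c \<bullet> b) = c * trace j b \<and> trace j (b \<bullet> kem j c) = trace j b * c"
  using assms(1)
 proof (induction rule: zz_induct)
  case (add b d)
  then show ?case using assms(2,3) by (simp add: Z.r_distr Z.l_distr trace_add distrib_left distrib_right)
 next
  case (single x a)
  have k: "keys (single x a) \<subseteq> paths n" using single by simp
  have c: "complex_of_real (Re c) + \<i> * complex_of_real (Im c) = c" by (simp add: complex_eq_iff)
  have l: "path_trace j (pkem j c ** single x a) = c * (a * trace_weight j x)"
  proof (cases "fst x = j")
   case True
   have e: "path_end (j, snd x) = path_end x" "path_end (j, Loop j # snd x) = path_end x"
    using True by (auto simp: path_end_def)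
   show ?thesis
   proof (cases "j = 1")
    case j1: True
    then have "Im c = 0" using assms(3) KK_real by blast
    then show ?thesis using True c j1 e
     by (simp add: path_mult_single path_mult_add_left path_end_def[of "(_, [])"] trace_weight_def path_degree_def complex_eq_iff)
   next
    case False
    then have "path_trace j (pkem j c ** single x a) = (complex_of_real (Re c) + \<i> * complex_of_real (Im c)) * (a * trace_weight j x)"
     using True e
     by (simp add: path_mult_single path_mult_add_left path_trace_add path_end_def[of "(_, [])"] path_end_def[of "(_, [_])"]
       trace_weight_def path_degree_def loops_def algebra_simps)
    then show ?thesis using c by simp
   qed
  next
   case False
   then show ?thesis by (simp add: path_mult_single path_mult_add_left path_end_def[of "(_, [])"] path_end_def[of "(_, [_])"] trace_weight_def)
  qed
  have r: "path_trace j (single x a ** pkem j c) = a * trace_weight j x * c"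
  proof (cases "path_end x = j")
   case True
   have e: "path_end (fst x, snd x @ [Loop j]) = path_end x"
    using True by (auto simp: path_end_def)
   show ?thesis
   proof (cases "j = 1")
    case j1: True
    then have "Im c = 0" using assms(3) KK_real by blast
    then show ?thesis using True c j1
     by (simp add: path_mult_single path_mult_add_right trace_weight_def complex_eq_iff)
   next
    case False
    then have "path_trace j (single x a ** pkem j c) = (a * trace_weight j x) * (complex_of_real (Re c) + \<i> * complex_of_real (Im c))"
     using True e
     by (simp add: path_mult_single path_mult_add_right path_trace_add
       trace_weight_def path_degree_def loops_def algebra_simps)
    then show ?thesis using c by simp
   qed
  next
   case False
   then show ?thesis by (simp add: path_mult_single path_mult_add_right trace_weight_def)
  qed
  show ?case unfolding KK_embed_def using k assms(2,3) l r
   by (simp add: cls_mult[symmetric] keys_pkem trace_cls path_mult_closed)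
 qed
 then show "trace j (kem j c \<bullet> b) = c * trace j b" "trace j (b \<bullet> kem j c) = trace j b * c"
  by simp_all
qed

end

section \<open>Graded bimodules and tensor products\<close>

text \<open>The two rings are independent, as the same axioms have to cover bimodules over the
  zigzag algebra on both sides and those with a field \<open>KK j\<close> on one side.\<close>

locale graded_bimodule =
 fixes A :: "'a ring" and dA :: "int => 'a set" and B :: "'b ring" and dB :: "int => 'b set"
  and M :: "('a, 'b) bimod"
 assumes add_closed: "x \<in> bcar M ==> y \<in> bcar M ==> badd M x y \<in> bcar M"
  and zero_closed: "bzero M \<in> bcar M"
  and add_assoc: "x \<in> bcar M ==> y \<in> bcar M ==> z \<in> bcar M ==> badd M (badd M x y) z = badd M x (badd M y z)"
  and add_comm: "x \<in> bcar M ==> y \<in> bcar M ==> badd M x y = badd M y x"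
  and add_zero: "x \<in> bcar M ==> badd M x (bzero M) = x"
  and lact_closed: "a \<in> carrier A ==> x \<in> bcar M ==> lact M a x \<in> bcar M"
  and ract_closed: "b \<in> carrier B ==> x \<in> bcar M ==> ract M x b \<in> bcar M"
  and lact_add: "a \<in> carrier A ==> x \<in> bcar M ==> y \<in> bcar M ==> lact M a (badd M x y) = badd M (lact M a x) (lact M a y)"
  and ract_add: "b \<in> carrier B ==> x \<in> bcar M ==> y \<in> bcar M ==> ract M (badd M x y) b = badd M (ract M x b) (ract M y b)"
  and lact_zero: "a \<in> carrier A ==> lact M a (bzero M) = bzero M"
  and ract_zero: "b \<in> carrier B ==> ract M (bzero M) b = bzero M"
  and add_lact: "a \<in> carrier A ==> a' \<in> carrier A ==> x \<in> bcar M ==> lact M (a \<oplus>\<^bsub>A\<^esub> a') x = badd M (lact M a x) (lact M a' x)"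
  and add_ract: "b \<in> carrier B ==> b' \<in> carrier B ==> x \<in> bcar M ==> ract M x (b \<oplus>\<^bsub>B\<^esub> b') = badd M (ract M x b) (ract M x b')"
  and zero_lact: "x \<in> bcar M ==> lact M \<zero>\<^bsub>A\<^esub> x = bzero M"
  and zero_ract: "x \<in> bcar M ==> ract M x \<zero>\<^bsub>B\<^esub> = bzero M"
  and mult_lact: "a \<in> carrier A ==> a' \<in> carrier A ==> x \<in> bcar M ==> lact M (a \<otimes>\<^bsub>A\<^esub> a') x = lact M a (lact M a' x)"
  and mult_ract: "b \<in> carrier B ==> b' \<in> carrier B ==> x \<in> bcar M ==> ract M x (b \<otimes>\<^bsub>B\<^esub> b') = ract M (ract M x b) b'"
  and one_lact: "x \<in> bcar M ==> lact M \<one>\<^bsub>A\<^esub> x = x"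
  and one_ract: "x \<in> bcar M ==> ract M x \<one>\<^bsub>B\<^esub> = x"
  and lact_ract: "a \<in> carrier A ==> b \<in> carrier B ==> x \<in> bcar M ==> ract M (lact M a x) b = lact M a (ract M x b)"
  and deg_closed: "x \<in> bdeg M d ==> x \<in> bcar M"
  and deg_zero: "bzero M \<in> bdeg M d"
  and deg_add: "x \<in> bdeg M d ==> y \<in> bdeg M d ==> badd M x y \<in> bdeg M d"
  and deg_lact: "a \<in> dA i ==> a \<in> carrier A ==> x \<in> bdeg M d ==> lact M a x \<in> bdeg M (i + d)"
  and deg_ract: "b \<in> dB i ==> b \<in> carrier B ==> x \<in> bdeg M d ==> ract M x b \<in> bdeg M (d + i)"
begin

lemma zero_add: "x \<in> bcar M ==> badd M (bzero M) x = x"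
 using add_comm[OF zero_closed] add_zero by simp

lemma add_left_comm:
 "x \<in> bcar M ==> y \<in> bcar M ==> z \<in> bcar M ==> badd M x (badd M y z) = badd M y (badd M x z)"
 by (metis add_assoc add_comm)

lemma add_interchange:
 "x \<in> bcar M ==> y \<in> bcar M ==> z \<in> bcar M ==> w \<in> bcar M
  ==> badd M (badd M x y) (badd M z w) = badd M (badd M x z) (badd M y w)"
 by (simp add: add_assoc add_closed add_left_comm)

lemmas laws = add_closed zero_closed add_zero zero_add lact_closed ract_closed lact_add ract_add
 lact_zero ract_zero add_lact add_ract zero_lact zero_ract mult_lact mult_ract one_lact one_ract lact_ract

end

definition balanced :: "'c set => ('a, 'c) bimod => ('c, 'b) bimod => ('d, 'e) bimod => (elt => elt => elt) => bool" where
 "balanced A M N L f \<longleftrightarrow>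
   (\<forall>x\<in>bcar M. \<forall>y\<in>bcar N. f x y \<in> bcar L)
  \<and> (\<forall>x\<in>bcar M. \<forall>x'\<in>bcar M. \<forall>y\<in>bcar N. f (badd M x x') y = badd L (f x y) (f x' y))
  \<and> (\<forall>x\<in>bcar M. \<forall>y\<in>bcar N. \<forall>y'\<in>bcar N. f x (badd N y y') = badd L (f x y) (f x y'))
  \<and> (\<forall>y\<in>bcar N. f (bzero M) y = bzero L)
  \<and> (\<forall>x\<in>bcar M. \<forall>a\<in>A. \<forall>y\<in>bcar N. f (ract M x a) y = f x (lact N a y))"

lemma balancedI:
 assumes "\<And>x y. x \<in> bcar M ==> y \<in> bcar N ==> f x y \<in> bcar L"
  "\<And>x x' y. x \<in> bcar M ==> x' \<in> bcar M ==> y \<in> bcar N ==> f (badd M x x') y = badd L (f x y) (f x' y)"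
  "\<And>x y y'. x \<in> bcar M ==> y \<in> bcar N ==> y' \<in> bcar N ==> f x (badd N y y') = badd L (f x y) (f x y')"
  "\<And>y. y \<in> bcar N ==> f (bzero M) y = bzero L"
  "\<And>x a y. x \<in> bcar M ==> a \<in> A ==> y \<in> bcar N ==> f (ract M x a) y = f x (lact N a y)"
 shows "balanced A M N L f"
 unfolding balanced_def using assms by blast

text \<open>The map induced by a balanced \<open>f\<close>, computed from the list stored in the
  element. Independence of that list is \<open>tsum_te\<close>.\<close>

definition tlift :: "('a, 'b) bimod => (elt => elt => elt) => elt => elt" where
 "tlift L f t = foldr (\<lambda>(x, y). badd L (f x y)) (the_ten t) (bzero L)"

section \<open>The tensor product of two bimodules\<close>

locale tensor_pair =
 M: graded_bimodule A dA K dK M + N: graded_bimodule K dK B dB N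
 for A :: "'a ring" and dA and K :: "'c ring" and dK and B :: "'b ring" and dB and M and N +
 assumes K_zero: "\<zero>\<^bsub>K\<^esub> \<in> carrier K"
begin

abbreviation "te \<equiv> tensor_eq (carrier K) M N"
abbreviation "cl \<equiv> tensor_class (carrier K) M N"
abbreviation "T \<equiv> tensor (carrier K) M N"
abbreviation "valid xs \<equiv> set xs \<subseteq> bcar M \<times> bcar N"
abbreviation pure :: "elt => elt => elt" where "pure x y \<equiv> cl [(x, y)]"

lemma te_valid: "te xs ys ==> valid xs \<and> valid ys"
 by (induction rule: tensor_eq.induct) (auto simp: M.laws N.laws)

text \<open>The stored list need not be the one from which the class was formed, but the choice
  always returns an equivalent one.\<close>

lemma te_the_ten: assumes "valid xs" shows "te xs (the_ten (cl xs))"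
proof -
 have "te xs (SOME ys. te xs ys)"
  by (rule someI[of _ xs]) (rule tensor_eq.refl[OF assms])
 then show ?thesis by (simp add: tensor_class_def)
qed

lemma valid_the_ten: "valid xs ==> valid (the_ten (cl xs))"
 using te_the_ten te_valid by blast

text \<open>By symmetry and transitivity, equivalent lists have the same equivalent lists, and
  choosing from one and the same set gives one and the same representative.\<close>

lemma cl_eqI: assumes "te xs ys" shows "cl xs = cl ys"
proof -
 have "te xs zs \<longleftrightarrow> te ys zs" for zs
  using assms by (meson tensor_eq.sym tensor_eq.trans)
 then show ?thesis by (simp add: tensor_class_def)
qed

lemma bcar_T: "bcar T = cl ` {xs. valid xs}"
 by (simp add: tensor_def)

lemma cl_in: "valid xs ==> cl xs \<in> bcar T"
 by (simp add: bcar_T)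

lemma bzero_T: "bzero T = cl []"
 by (simp add: tensor_def)

lemma badd_cl: assumes "valid xs" "valid ys" shows "badd T (cl xs) (cl ys) = cl (xs @ ys)"
proof -
 have "te (xs @ ys) (the_ten (cl xs) @ the_ten (cl ys))"
  using assms by (intro tensor_eq.append te_the_ten)
 then show ?thesis by (simp add: tensor_def cl_eqI)
qed

lemma valid_map_lact: "a \<in> carrier A ==> valid xs ==> valid (map (\<lambda>(x, y). (lact M a x, y)) xs)"
 by (induction xs) (auto simp: M.laws)

lemma valid_map_ract: "b \<in> carrier B ==> valid xs ==> valid (map (\<lambda>(x, y). (x, ract N y b)) xs)"
 by (induction xs) (auto simp: N.laws)

lemma te_lact: assumes "a \<in> carrier A" "te xs ys"
 shows "te (map (\<lambda>(x, y). (lact M a x, y)) xs) (map (\<lambda>(x, y). (lact M a x, y)) ys)"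
 using assms(2)
proof (induction rule: tensor_eq.induct)
 case (trans xs ys zs)
 then show ?case by (blast intro: tensor_eq.trans)
next
 case (balanced x k y)
 then show ?case using assms(1) tensor_eq.balanced[of "lact M a x" M k "carrier K" y N]
  by (simp add: M.lact_closed flip: M.lact_ract)
next
 case (add_left x x' y)
 then show ?case using assms(1) by (simp add: M.laws tensor_eq.add_left)
next
 case (refl xs)
 then show ?case using assms(1) by (intro tensor_eq.refl valid_map_lact)
next
 case (commute xs ys)
 then show ?case using assms(1) unfolding map_append by (intro tensor_eq.commute valid_map_lact)
qed (use assms(1) in \<open>auto simp: M.laws intro!: tensor_eq.append
  tensor_eq.add_right tensor_eq.zero_left intro: tensor_eq.sym\<close>)

lemma te_ract: assumes "b \<in> carrier B" "te xs ys"
 shows "te (map (\<lambda>(x, y). (x, ract N y b)) xs) (map (\<lambda>(x, y). (x, ract N y b)) ys)"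
 using assms(2)
proof (induction rule: tensor_eq.induct)
 case (trans xs ys zs)
 then show ?case by (blast intro: tensor_eq.trans)
next
 case (balanced x k y)
 then show ?case using assms(1) tensor_eq.balanced[of x M k "carrier K" "ract N y b" N]
  by (simp add: N.laws)
next
 case (add_right x y y')
 then show ?case using assms(1) by (simp add: N.laws tensor_eq.add_right)
next
 case (refl xs)
 then show ?case using assms(1) by (intro tensor_eq.refl valid_map_ract)
next
 case (commute xs ys)
 then show ?case using assms(1) unfolding map_append by (intro tensor_eq.commute valid_map_ract)
qed (use assms(1) in \<open>auto simp: N.laws intro!: tensor_eq.append
  tensor_eq.add_left tensor_eq.zero_left intro: tensor_eq.sym\<close>)

lemma lact_cl: "a \<in> carrier A ==> valid xs ==> lact T a (cl xs) = cl (map (\<lambda>(x, y). (lact M a x, y)) xs)"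
 by (simp add: tensor_def cl_eqI[OF te_lact[OF _ te_the_ten]])

lemma ract_cl: "b \<in> carrier B ==> valid xs ==> ract T (cl xs) b = cl (map (\<lambda>(x, y). (x, ract N y b)) xs)"
 by (simp add: tensor_def cl_eqI[OF te_ract[OF _ te_the_ten]])

lemma pure_closed: "x \<in> bcar M ==> y \<in> bcar N ==> pure x y \<in> bcar T"
 by (simp add: cl_in)

lemma pure_add_left: "x \<in> bcar M ==> x' \<in> bcar M ==> y \<in> bcar N ==> pure (badd M x x') y = badd T (pure x y) (pure x' y)"
 by (simp add: badd_cl cl_eqI[OF tensor_eq.add_left])

lemma pure_add_right: "x \<in> bcar M ==> y \<in> bcar N ==> y' \<in> bcar N ==> pure x (badd N y y') = badd T (pure x y) (pure x y')"
 by (simp add: badd_cl cl_eqI[OF tensor_eq.add_right])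

lemma pure_zero_left: "y \<in> bcar N ==> pure (bzero M) y = bzero T"
 by (simp add: bzero_T cl_eqI[OF tensor_eq.zero_left])

lemma pure_balanced: "x \<in> bcar M ==> k \<in> carrier K ==> y \<in> bcar N ==> pure (ract M x k) y = pure x (lact N k y)"
 by (rule cl_eqI[OF tensor_eq.balanced])

text \<open>The zero on the right is the zero scalar applied to itself; moved across the tensor
  sign, this scalar annihilates the left factor.\<close>

lemma pure_zero_right: "x \<in> bcar M ==> pure x (bzero N) = bzero T"
 using pure_balanced[of x "\<zero>\<^bsub>K\<^esub>" "bzero N"] K_zero
 by (simp add: M.laws N.laws pure_zero_left)

lemma lact_pure: "a \<in> carrier A ==> x \<in> bcar M ==> y \<in> bcar N ==> lact T a (pure x y) = pure (lact M a x) y"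
 by (simp add: lact_cl)

lemma ract_pure: "b \<in> carrier B ==> x \<in> bcar M ==> y \<in> bcar N ==> ract T (pure x y) b = pure x (ract N y b)"
 by (simp add: ract_cl)

lemma add_closed_T: "s \<in> bcar T ==> t \<in> bcar T ==> badd T s t \<in> bcar T"
 by (auto simp: bcar_T badd_cl)

lemma tensor_induct [consumes 1, case_names zero pure add]:
 assumes "t \<in> bcar T"
  and "P (bzero T)"
  and "\<And>x y. x \<in> bcar M ==> y \<in> bcar N ==> P (pure x y)"
  and "\<And>s t. s \<in> bcar T ==> t \<in> bcar T ==> P s ==> P t ==> P (badd T s t)"
 shows "P t"
proof -
 obtain xs where xs: "valid xs" "t = cl xs" using assms(1) by (auto simp: bcar_T)
 have "P (cl xs)" using xs(1)
 proof (induction xs)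
  case (Cons p xs)
  then have "cl (p # xs) = badd T (pure (fst p) (snd p)) (cl xs)" by (subst badd_cl) auto
  moreover have "P (badd T (pure (fst p) (snd p)) (cl xs))"
   using Cons by (intro assms(3,4) cl_in) auto
  ultimately show ?case by simp
 qed (use assms(2) bzero_T in simp)
 then show ?thesis using xs by simp
qed

lemma bdeg_T: "bdeg T d = cl ` {xs. valid xs \<and> (\<forall>(x, y)\<in>set xs. \<exists>k. x \<in> bdeg M k \<and> y \<in> bdeg N (d - k))}"
 by (simp add: tensor_def)

lemma tensor_deg_induct [consumes 1, case_names zero pure add]:
 assumes "t \<in> bdeg T d"
  and "P (bzero T)"
  and "\<And>x y k. x \<in> bdeg M k ==> y \<in> bdeg N (d - k) ==> P (pure x y)"
  and "\<And>s t. s \<in> bcar T ==> t \<in> bcar T ==> P s ==> P t ==> P (badd T s t)"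
 shows "P t"
proof -
 obtain xs where xs: "valid xs" "\<forall>(x, y)\<in>set xs. \<exists>k. x \<in> bdeg M k \<and> y \<in> bdeg N (d - k)" "t = cl xs"
  using assms(1) by (auto simp: bdeg_T)
 have "P (cl xs)" using xs(1,2)
 proof (induction xs)
  case (Cons p xs)
  then have "cl (p # xs) = badd T (pure (fst p) (snd p)) (cl xs)" by (subst badd_cl) auto
  moreover have "P (badd T (pure (fst p) (snd p)) (cl xs))"
   using Cons by (intro assms(4) cl_in) (auto intro: assms(3))
  ultimately show ?case by simp
 qed (use assms(2) bzero_T in simp)
 then show ?thesis using xs by simp
qed

lemma pure_deg: "x \<in> bdeg M k ==> y \<in> bdeg N l ==> pure x y \<in> bdeg T (k + l)"
 unfolding bdeg_T by (rule imageI) (auto simp: M.deg_closed N.deg_closed intro!: exI[of _ k])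

lemma deg_add_T: "s \<in> bdeg T d ==> t \<in> bdeg T d ==> badd T s t \<in> bdeg T d"
 unfolding bdeg_T by (auto simp: badd_cl intro!: image_eqI[of _ cl])

lemma deg_zero_T: "bzero T \<in> bdeg T d"
 unfolding bdeg_T bzero_T by auto

lemma assoc_T: "s \<in> bcar T ==> t \<in> bcar T ==> u \<in> bcar T ==> badd T (badd T s t) u = badd T s (badd T t u)"
 by (auto simp: bcar_T badd_cl)

lemma comm_T: "s \<in> bcar T ==> t \<in> bcar T ==> badd T s t = badd T t s"
 by (auto simp: bcar_T badd_cl intro!: cl_eqI tensor_eq.commute)

lemma zero_T: "s \<in> bcar T ==> badd T s (bzero T) = s" "bzero T \<in> bcar T"
 by (auto simp: bcar_T badd_cl bzero_T)

lemma lact_add_T: "a \<in> carrier A ==> s \<in> bcar T ==> t \<in> bcar T ==> lact T a (badd T s t) = badd T (lact T a s) (lact T a t)"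
 unfolding bcar_T
 by (elim imageE CollectE) (simp only: badd_cl lact_cl valid_map_lact set_append Un_subset_iff map_append simp_thms)

lemma ract_add_T: "b \<in> carrier B ==> s \<in> bcar T ==> t \<in> bcar T ==> ract T (badd T s t) b = badd T (ract T s b) (ract T t b)"
 unfolding bcar_T
 by (elim imageE CollectE) (simp only: badd_cl ract_cl valid_map_ract set_append Un_subset_iff map_append simp_thms)

lemma lact_zero_T: "a \<in> carrier A ==> lact T a (bzero T) = bzero T" "b \<in> carrier B ==> ract T (bzero T) b = bzero T"
 unfolding bzero_T by (simp_all add: lact_cl ract_cl)

lemma act_closed_T: "a \<in> carrier A ==> s \<in> bcar T ==> lact T a s \<in> bcar T"
 "b \<in> carrier B ==> s \<in> bcar T ==> ract T s b \<in> bcar T"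
 unfolding bcar_T by (auto simp: lact_cl ract_cl valid_map_lact valid_map_ract intro!: imageI) (auto simp: M.laws N.laws intro!: imageI)

lemma interchange_T: assumes "x \<in> bcar T" "y \<in> bcar T" "z \<in> bcar T" "w \<in> bcar T"
 shows "badd T (badd T x y) (badd T z w) = badd T (badd T x z) (badd T y w)"
proof -
 have "badd T y (badd T z w) = badd T z (badd T y w)"
  using assms assoc_T comm_T by metis
 then show ?thesis using assms by (simp add: assoc_T add_closed_T)
qed

lemma graded_bimodule_tensor:
 assumes "ring A" "ring B"
 shows "graded_bimodule A dA B dB T"
proof
 interpret A: ring A by fact
 interpret B: ring B by fact
 note L = zero_T lact_zero_T lact_pure ract_pure M.laws N.laws pure_add_left pure_add_right
  pure_zero_left pure_zero_right lact_add_T ract_add_T act_closed_T add_closed_T pure_closed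
 fix a a' b b' x y d i
 show "x \<in> bcar T ==> a \<in> carrier A ==> a' \<in> carrier A ==> lact T (a \<oplus>\<^bsub>A\<^esub> a') x = badd T (lact T a x) (lact T a' x)"
  by (induction rule: tensor_induct) (simp_all add: L interchange_T)
 show "x \<in> bcar T ==> b \<in> carrier B ==> b' \<in> carrier B ==> ract T x (b \<oplus>\<^bsub>B\<^esub> b') = badd T (ract T x b) (ract T x b')"
  by (induction rule: tensor_induct) (simp_all add: L interchange_T)
 show "x \<in> bcar T ==> lact T \<zero>\<^bsub>A\<^esub> x = bzero T"
  by (induction rule: tensor_induct) (simp_all add: L)
 show "x \<in> bcar T ==> ract T x \<zero>\<^bsub>B\<^esub> = bzero T"
  by (induction rule: tensor_induct) (simp_all add: L)
 show "x \<in> bcar T ==> a \<in> carrier A ==> a' \<in> carrier A ==> lact T (a \<otimes>\<^bsub>A\<^esub> a') x = lact T a (lact T a' x)"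
  by (induction rule: tensor_induct) (simp_all add: L)
 show "x \<in> bcar T ==> b \<in> carrier B ==> b' \<in> carrier B ==> ract T x (b \<otimes>\<^bsub>B\<^esub> b') = ract T (ract T x b) b'"
  by (induction rule: tensor_induct) (simp_all add: L)
 show "x \<in> bcar T ==> lact T \<one>\<^bsub>A\<^esub> x = x"
  by (induction rule: tensor_induct) (simp_all add: L)
 show "x \<in> bcar T ==> ract T x \<one>\<^bsub>B\<^esub> = x"
  by (induction rule: tensor_induct) (simp_all add: L)
 show "x \<in> bcar T ==> a \<in> carrier A ==> b \<in> carrier B ==> ract T (lact T a x) b = lact T a (ract T x b)"
  by (induction rule: tensor_induct) (simp_all add: L)
 show in_T: "x \<in> bdeg T d ==> x \<in> bcar T"
  by (auto simp: bdeg_T bcar_T)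
 show "x \<in> bdeg T d ==> a \<in> dA i ==> a \<in> carrier A ==> lact T a x \<in> bdeg T (i + d)"
 proof (induction rule: tensor_deg_induct)
  case (pure x y k)
  then have "pure (lact M a x) y \<in> bdeg T ((i + k) + (d - k))"
   by (intro pure_deg M.deg_lact)
  with pure show ?case by (simp add: lact_pure M.deg_closed N.deg_closed)
 qed (simp_all add: L deg_zero_T deg_add_T)
 show "x \<in> bdeg T d ==> b \<in> dB i ==> b \<in> carrier B ==> ract T x b \<in> bdeg T (d + i)"
 proof (induction rule: tensor_deg_induct)
  case (pure x y k)
  then have "pure x (ract N y b) \<in> bdeg T (k + ((d - k) + i))"
   by (intro pure_deg N.deg_ract)
  with pure show ?case by (simp add: ract_pure M.deg_closed N.deg_closed)
 qed (simp_all add: L deg_zero_T deg_add_T)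
 show "x \<in> bcar T ==> y \<in> bcar T ==> badd T x y = badd T y x" by (rule comm_T)
 show "x \<in> bcar T ==> y \<in> bcar T ==> z \<in> bcar T ==> badd T (badd T x y) z = badd T x (badd T y z)" for z by (rule assoc_T)
qed (simp_all add: add_closed_T zero_T lact_zero_T act_closed_T lact_add_T ract_add_T deg_zero_T deg_add_T)

end

section \<open>The universal property of the tensor product\<close>

locale tensor_lift = tensor_pair A dA K dK B dB M N + L: graded_bimodule C dC D dD L
 for A :: "'a ring" and dA and K :: "'c ring" and dK and B :: "'b ring" and dB and M and N
  and C :: "'d ring" and dC and D :: "'e ring" and dD and L +
 fixes f :: "elt => elt => elt"
 assumes bal: "balanced (carrier K) M N L f"
begin

lemma f_laws:
 "x \<in> bcar M ==> y \<in> bcar N ==> f x y \<in> bcar L"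
 "x \<in> bcar M ==> x' \<in> bcar M ==> y \<in> bcar N ==> f (badd M x x') y = badd L (f x y) (f x' y)"
 "x \<in> bcar M ==> y \<in> bcar N ==> y' \<in> bcar N ==> f x (badd N y y') = badd L (f x y) (f x y')"
 "y \<in> bcar N ==> f (bzero M) y = bzero L"
 "x \<in> bcar M ==> a \<in> carrier K ==> y \<in> bcar N ==> f (ract M x a) y = f x (lact N a y)"
 using bal unfolding balanced_def by blast+

abbreviation "tsum xs \<equiv> foldr (\<lambda>(x, y). badd L (f x y)) xs (bzero L)"

lemma tsum_closed: "valid xs ==> tsum xs \<in> bcar L"
 by (induction xs) (auto simp: L.laws f_laws)

lemma tsum_append: "valid xs ==> valid ys ==> tsum (xs @ ys) = badd L (tsum xs) (tsum ys)"
 by (induction xs) (auto simp: L.laws f_laws tsum_closed L.add_assoc)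

text \<open>Each rule generating \<open>tensor_eq\<close> is either one of the conditions in
  \<open>balanced\<close> or a law of addition in the target.\<close>

lemma tsum_te: "te xs ys ==> tsum xs = tsum ys"
proof (induction rule: tensor_eq.induct)
 case (append xs xs' ys ys')
 then show ?case using te_valid by (metis tsum_append)
next
 case (commute xs ys)
 then show ?case using L.add_comm[OF tsum_closed tsum_closed] tsum_append by metis
qed (auto simp: f_laws L.laws L.add_assoc)

lemma tlift_cl: "valid xs ==> tlift L f (cl xs) = tsum xs"
 unfolding tlift_def using tsum_te[OF te_the_ten] by simp

lemma tlift_pure: "x \<in> bcar M ==> y \<in> bcar N ==> tlift L f (pure x y) = f x y"
 by (simp add: tlift_cl f_laws L.laws)

lemma tlift_closed: "t \<in> bcar T ==> tlift L f t \<in> bcar L"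
 by (auto simp: bcar_T tlift_cl tsum_closed)

lemma tlift_add: "s \<in> bcar T ==> t \<in> bcar T ==> tlift L f (badd T s t) = badd L (tlift L f s) (tlift L f t)"
 unfolding bcar_T
 by (elim imageE CollectE) (simp only: badd_cl tlift_cl set_append Un_subset_iff simp_thms tsum_append)

lemma tlift_zero: "tlift L f (bzero T) = bzero L"
 by (simp add: bzero_T tlift_cl)

lemma tlift_lact:
 assumes "t \<in> bcar T" "a \<in> carrier A" "c \<in> carrier C"
  and "\<And>x y. x \<in> bcar M ==> y \<in> bcar N ==> f (lact M a x) y = lact L c (f x y)"
 shows "tlift L f (lact T a t) = lact L c (tlift L f t)"
 using assms(1)
 by (induction rule: tensor_induct)
  (simp_all add: assms lact_zero_T tlift_zero L.laws lact_pure tlift_pure M.laws lact_add_T tlift_add act_closed_T tlift_closed)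

lemma tlift_ract:
 assumes "t \<in> bcar T" "b \<in> carrier B" "d \<in> carrier D"
  and "\<And>x y. x \<in> bcar M ==> y \<in> bcar N ==> f x (ract N y b) = ract L (f x y) d"
 shows "tlift L f (ract T t b) = ract L (tlift L f t) d"
 using assms(1)
 by (induction rule: tensor_induct)
  (simp_all add: assms lact_zero_T tlift_zero L.laws ract_pure tlift_pure N.laws ract_add_T tlift_add act_closed_T tlift_closed)

end

section \<open>The category of zigzag bimodules\<close>

definition K_ring :: "nat => complex ring" where
 "K_ring j = \<lparr>carrier = KK j, mult = (*), one = 1, zero = 0, add = (+)\<rparr>"

definition K_deg :: "nat => int => complex set" where
 "K_deg j d = (if d = 0 then KK j else {})"

lemma K_ring_simps [simp]:
 "carrier (K_ring j) = KK j" "mult (K_ring j) = (*)" "one (K_ring j) = 1" "zero (K_ring j) = 0" "add (K_ring j) = (+)"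
 by (simp_all add: K_ring_def)

lemma graded_bimodule_shift1:
 assumes "graded_bimodule A dA B dB M" shows "graded_bimodule A dA B dB (shift1 M)"
proof -
 interpret graded_bimodule A dA B dB M by fact
 show ?thesis
  by unfold_locales
   (auto simp: shift1_def laws add_assoc deg_closed deg_zero deg_add add.assoc intro: add_comm
    intro!: deg_lact[of _ _ _ "_ + 1"] dest: deg_lact deg_ract simp: add.commute add.left_commute)
qed

context type_B
begin

text \<open>That real scalars act equally from both sides does not follow from the bimodule axioms.
  It lets a scalar be extracted from either factor of a tensor product of maps.\<close>

definition zzb :: "zbimod => bool" where
 "zzb M \<longleftrightarrow> graded_bimodule Z (zz_degree n) Z (zz_degree n) M
   \<and> (\<forall>x\<in>bcar M. \<forall>r. lact M (zz_scalar n r) x = ract M x (zz_scalar n r))"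

section \<open>Bimodules inside the zigzag algebra and their tensor products\<close>

lemma zz_bimod_simps:
 "bcar (zz_bimod n S f g) = Alg ` S" "badd (zz_bimod n S f g) (Alg a) (Alg b) = Alg (a \<oplus>\<^bsub>Z\<^esub> b)"
 "bzero (zz_bimod n S f g) = Alg \<zero>\<^bsub>Z\<^esub>" "lact (zz_bimod n S f g) c (Alg a) = Alg (f c \<bullet> a)"
 "ract (zz_bimod n S f g) (Alg a) d = Alg (a \<bullet> g d)" "bdeg (zz_bimod n S f g) i = Alg ` (S \<inter> zz_degree n i)"
 by (simp_all add: zz_bimod_def)

lemma graded_bimodule_zz_bimod:
 assumes S: "S \<subseteq> carrier Z" "\<zero>\<^bsub>Z\<^esub> \<in> S" "\<And>x y. x \<in> S ==> y \<in> S ==> x \<oplus>\<^bsub>Z\<^esub> y \<in> S"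
  and f: "\<And>a. a \<in> carrier A ==> f a \<in> carrier Z" "\<And>a x. a \<in> carrier A ==> x \<in> S ==> f a \<bullet> x \<in> S"
   "\<And>a b. a \<in> carrier A ==> b \<in> carrier A ==> f (a \<oplus>\<^bsub>A\<^esub> b) = f a \<oplus>\<^bsub>Z\<^esub> f b"
   "\<And>a b. a \<in> carrier A ==> b \<in> carrier A ==> f (a \<otimes>\<^bsub>A\<^esub> b) = f a \<bullet> f b"
   "f \<zero>\<^bsub>A\<^esub> = \<zero>\<^bsub>Z\<^esub>" "\<And>x. x \<in> S ==> f \<one>\<^bsub>A\<^esub> \<bullet> x = x"
   "\<And>a d. a \<in> dA d ==> a \<in> carrier A ==> f a \<in> zz_degree n d"
  and g: "\<And>a. a \<in> carrier B ==> g a \<in> carrier Z" "\<And>a x. a \<in> carrier B ==> x \<in> S ==> x \<bullet> g a \<in> S"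
   "\<And>a b. a \<in> carrier B ==> b \<in> carrier B ==> g (a \<oplus>\<^bsub>B\<^esub> b) = g a \<oplus>\<^bsub>Z\<^esub> g b"
   "\<And>a b. a \<in> carrier B ==> b \<in> carrier B ==> g (a \<otimes>\<^bsub>B\<^esub> b) = g a \<bullet> g b"
   "g \<zero>\<^bsub>B\<^esub> = \<zero>\<^bsub>Z\<^esub>" "\<And>x. x \<in> S ==> x \<bullet> g \<one>\<^bsub>B\<^esub> = x"
   "\<And>a d. a \<in> dB d ==> a \<in> carrier B ==> g a \<in> zz_degree n d"
 shows "graded_bimodule A dA B dB (zz_bimod n S f g)"
proof -
 have SZ: "x \<in> S ==> x \<in> carrier Z" for x using S by blast
 note simps = zz_bimod_simps S(2,3) f(1-6) g(1-6) SZ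
 show ?thesis
 proof (unfold_locales, goal_cases)
  case (4 x y)
  then show ?case by (auto simp: simps intro!: Z.a_comm)
 next
  case (24 a i x d)
  then show ?case by (auto simp: simps intro!: imageI zz_degree_mult f(7))
 next
  case (25 b i x d)
  then show ?case by (auto simp: simps intro!: imageI zz_degree_mult g(7))
 qed (auto simp: simps Z.m_assoc Z.a_assoc Z.l_distr Z.r_distr intro: zz_degree_zero zz_degree_add)
qed

lemma zzb_regular: "zzb (zz_regular n)"
 unfolding zzb_def zz_regular_def
proof
 show "graded_bimodule Z (zz_degree n) Z (zz_degree n) (zz_bimod n (carrier Z) id id)"
  by (rule graded_bimodule_zz_bimod) auto
qed (auto simp: zz_bimod_simps zz_scalar_central)

lemma pcl_nil_closed [simp]: "j \<in> {1..n} ==> pcl j [] \<in> carrier Z"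
 by (rule cls_closed) auto

lemma pcl_nil_idem: "j \<in> {1..n} ==> pcl j [] \<bullet> pcl j [] = pcl j []"
 by (subst pcl_mult) (auto simp: path_end_def)

lemma kem_pcl: "j \<in> {1..n} ==> c \<in> KK j ==> kem j c \<bullet> pcl j [] = kem j c"
 "j \<in> {1..n} ==> c \<in> KK j ==> pcl j [] \<bullet> kem j c = kem j c"
 using kem_mult[of j c 1] kem_mult[of j 1 c] by (simp_all add: KK_closed kem_one)

lemma kem_real: assumes "j \<in> {1..n}" shows "kem j (complex_of_real r) = zz_scalar n r \<bullet> pcl j []"
 using zz_scalar_single(1)[of "(j, [])" r 1] assms by (simp add: KK_embed_def)

abbreviation "PL j \<equiv> {b \<bullet> pcl j [] | b. b \<in> carrier Z}"
abbreviation "PR j \<equiv> {pcl j [] \<bullet> b | b. b \<in> carrier Z}"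

lemma PL_iff: assumes "j \<in> {1..n}" shows "x \<in> PL j \<longleftrightarrow> x \<in> carrier Z \<and> x \<bullet> pcl j [] = x"
 using assms by (auto simp: Z.m_assoc pcl_nil_idem)

lemma PR_iff: assumes "j \<in> {1..n}" shows "x \<in> PR j \<longleftrightarrow> x \<in> carrier Z \<and> pcl j [] \<bullet> x = x"
 using assms by (auto simp: Z.m_assoc[symmetric] pcl_nil_idem)

lemma graded_bimodule_P_left: assumes j: "j \<in> {1..n}"
 shows "graded_bimodule Z (zz_degree n) (K_ring j) (K_deg j) (P_left n j)"
 unfolding P_left_def pe_def
proof (rule graded_bimodule_zz_bimod)
 fix x y a show "x \<in> PL j ==> y \<in> PL j ==> x \<oplus>\<^bsub>Z\<^esub> y \<in> PL j"
  unfolding PL_iff[OF j] using j by (auto simp: Z.l_distr)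
 show "x \<in> PL j ==> a \<in> carrier Z ==> id a \<bullet> x \<in> PL j" for a
  unfolding PL_iff[OF j] using j by (auto simp: Z.m_assoc)
 show "a \<in> carrier (K_ring j) ==> x \<in> PL j ==> x \<bullet> kem j a \<in> PL j"
  unfolding PL_iff[OF j] using j by (auto simp: Z.m_assoc kem_pcl)
 show "x \<in> PL j ==> x \<bullet> kem j \<one>\<^bsub>K_ring j\<^esub> = x"
  unfolding PL_iff[OF j] by (simp add: kem_one)
 show "x \<in> PL j ==> id \<one>\<^bsub>Z\<^esub> \<bullet> x = x"
  unfolding PL_iff[OF j] by simp
 show "PL j \<subseteq> carrier Z" "\<zero>\<^bsub>Z\<^esub> \<in> PL j"
  using PL_iff[OF j] j by auto
qed (use j in \<open>auto simp: kem_add kem_mult kem_zero kem_degree K_deg_def split: if_splits\<close>)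

lemma graded_bimodule_P_right: assumes j: "j \<in> {1..n}"
 shows "graded_bimodule (K_ring j) (K_deg j) Z (zz_degree n) (P_right n j)"
 unfolding P_right_def pe_def
proof (rule graded_bimodule_zz_bimod)
 fix x y a show "x \<in> PR j ==> y \<in> PR j ==> x \<oplus>\<^bsub>Z\<^esub> y \<in> PR j"
  unfolding PR_iff[OF j] using j by (auto simp: Z.r_distr)
 show "x \<in> PR j ==> a \<in> carrier Z ==> x \<bullet> id a \<in> PR j" for a
  unfolding PR_iff[OF j] using j by (auto simp: Z.m_assoc[symmetric])
 show "a \<in> carrier (K_ring j) ==> x \<in> PR j ==> kem j a \<bullet> x \<in> PR j"
  unfolding PR_iff[OF j] using j by (auto simp: Z.m_assoc[symmetric] kem_pcl)
 show "x \<in> PR j ==> kem j \<one>\<^bsub>K_ring j\<^esub> \<bullet> x = x"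
  unfolding PR_iff[OF j] by (simp add: kem_one)
 show "x \<in> PR j ==> x \<bullet> id \<one>\<^bsub>Z\<^esub> = x"
  unfolding PR_iff[OF j] by simp
 show "PR j \<subseteq> carrier Z" "\<zero>\<^bsub>Z\<^esub> \<in> PR j"
  using PR_iff[OF j] j by auto
qed (use j in \<open>auto simp: kem_add kem_mult kem_zero kem_degree K_deg_def split: if_splits\<close>)

lemma tensor_pair_P: assumes "j \<in> {1..n}"
 shows "tensor_pair Z (zz_degree n) (K_ring j) (K_deg j) Z (zz_degree n) (P_left n j) (P_right n j)"
 using graded_bimodule_P_left[OF assms] graded_bimodule_P_right[OF assms]
 by (simp add: tensor_pair_def tensor_pair_axioms_def KK_closed)

lemma shift1_simps [simp]:
 "bcar (shift1 M) = bcar M" "badd (shift1 M) = badd M" "bzero (shift1 M) = bzero M"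
 "lact (shift1 M) = lact M" "ract (shift1 M) = ract M" "bdeg (shift1 M) d = bdeg M (d + 1)"
 by (simp_all add: shift1_def)

lemma zzb_U: assumes j: "j \<in> {1..n}" shows "zzb (U_bimod n j)"
proof -
 interpret T: tensor_pair Z "zz_degree n" "K_ring j" "K_deg j" Z "zz_degree n" "P_left n j" "P_right n j"
  by (rule tensor_pair_P[OF j])
 have gb: "graded_bimodule Z (zz_degree n) Z (zz_degree n) T.T"
  by (rule T.graded_bimodule_tensor) (rule Z.ring_axioms)+
 have "lact T.T (zz_scalar n r) x = ract T.T x (zz_scalar n r)" if "x \<in> bcar T.T" for x r
  using that
 proof (induction rule: T.tensor_induct)
  case (pure x y)
  obtain a b where ab: "x = Alg a" "y = Alg b" "a \<in> PL j" "b \<in> PR j"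
   using pure by (auto simp: P_left_def P_right_def pe_def zz_bimod_simps)
  have 1: "lact (P_left n j) (zz_scalar n r) x = ract (P_left n j) x (complex_of_real r)"
   using ab(3) j unfolding PL_iff[OF j] ab
   by (simp add: P_left_def zz_bimod_simps kem_real zz_scalar_central Z.m_assoc flip: Z.m_assoc[of a "pcl j []"])
  have 2: "lact (P_right n j) (complex_of_real r) y = ract (P_right n j) y (zz_scalar n r)"
   using ab(4) j unfolding PR_iff[OF j] ab
   by (simp add: P_right_def zz_bimod_simps kem_real Z.m_assoc) (simp add: zz_scalar_central)
  \<comment> \<open>Through its image in the field of the vertex, a real scalar crosses the inner
    tensor sign.\<close>
  have "lact T.T (zz_scalar n r) (T.pure x y) = T.pure (ract (P_left n j) x (complex_of_real r)) y"
   using pure by (simp add: T.lact_pure 1 del: K_ring_simps)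
  also have "\<dots> = T.pure x (lact (P_right n j) (complex_of_real r) y)"
   using pure by (intro T.pure_balanced) (simp_all add: KK_closed)
  also have "\<dots> = ract T.T (T.pure x y) (zz_scalar n r)"
   using pure by (simp add: T.ract_pure 2 del: K_ring_simps)
  finally show ?case .
 next
  case (add s t)
  then show ?case by (simp add: T.lact_add_T T.ract_add_T del: K_ring_simps)
 qed (simp add: T.lact_zero_T del: K_ring_simps)
 then show ?thesis using graded_bimodule_shift1[OF gb] by (simp add: zzb_def U_bimod_def)
qed

lemma tensor_pair_zz: "zzb M ==> zzb N
  ==> tensor_pair Z (zz_degree n) Z (zz_degree n) Z (zz_degree n) M N"
 by (simp add: tensor_pair_def tensor_pair_axioms_def zzb_def)

lemma zzb_tensor: assumes "zzb M" "zzb N" shows "zzb (ZT M N)"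
proof -
 interpret T: tensor_pair Z "zz_degree n" Z "zz_degree n" Z "zz_degree n" M N
  by (rule tensor_pair_zz[OF assms])
 have gb: "graded_bimodule Z (zz_degree n) Z (zz_degree n) T.T"
  by (rule T.graded_bimodule_tensor) (rule Z.ring_axioms)+
 have "lact T.T (zz_scalar n r) x = ract T.T x (zz_scalar n r)" if "x \<in> bcar T.T" for x r
  using that
 proof (induction rule: T.tensor_induct)
  case (pure x y)
  then show ?case using assms T.pure_balanced[of x "zz_scalar n r" y] by (simp add: T.lact_pure T.ract_pure zzb_def)
 qed (simp_all add: T.lact_zero_T T.lact_add_T T.ract_add_T)
 then show ?thesis using gb by (simp add: zzb_def zz_tensor_def)
qed

lemma zz_objects_zzb: "M \<in> zz_objects n ==> zzb M"
 by (induction rule: zz_objects.induct) (simp_all add: zzb_regular zzb_U zzb_tensor)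

section \<open>Bimodule maps\<close>

abbreviation pu :: "zbimod => zbimod => elt => elt => elt" where
 "pu M N x y \<equiv> tensor_class (carrier Z) M N [(x, y)]"

lemma bimapsI:
 assumes "\<And>x. x \<in> bcar M ==> f x \<in> bcar N"
  and "\<And>x y. x \<in> bcar M ==> y \<in> bcar M ==> f (badd M x y) = badd N (f x) (f y)"
  and "\<And>x a. x \<in> bcar M ==> a \<in> carrier Z ==> f (lact M a x) = lact N a (f x)"
  and "\<And>x a. x \<in> bcar M ==> a \<in> carrier Z ==> f (ract M x a) = ract N (f x) a"
 shows "mk_bimap M N f \<in> bimaps n M N"
 unfolding bimaps_def using assms by blast

lemma mk_bimap_simps [simp]: "bsrc (mk_bimap M N f) = M" "btgt (mk_bimap M N f) = N"
 "x \<in> bcar M ==> bfun (mk_bimap M N f) x = f x"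
 by (simp_all add: mk_bimap_def)

lemma mk_bimap_cong: "(\<And>x. x \<in> bcar M ==> f x = g x) ==> mk_bimap M N f = mk_bimap M N g"
 by (auto simp: mk_bimap_def fun_eq_iff)

lemma bimapsD:
 assumes f: "f \<in> bimaps n M N" and M: "zzb M" and N: "zzb N"
 shows "bsrc f = M" "btgt f = N" "x \<in> bcar M ==> bfun f x \<in> bcar N"
  "x \<in> bcar M ==> y \<in> bcar M ==> bfun f (badd M x y) = badd N (bfun f x) (bfun f y)"
  "x \<in> bcar M ==> a \<in> carrier Z ==> bfun f (lact M a x) = lact N a (bfun f x)"
  "x \<in> bcar M ==> a \<in> carrier Z ==> bfun f (ract M x a) = ract N (bfun f x) a"
  "bfun f (bzero M) = bzero N"
proof -
 interpret M: graded_bimodule Z "zz_degree n" Z "zz_degree n" M using M by (simp add: zzb_def)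
 interpret N: graded_bimodule Z "zz_degree n" Z "zz_degree n" N using N by (simp add: zzb_def)
 obtain h where h: "f = mk_bimap M N h" "h \<in> bcar M \<rightarrow> bcar N"
   "\<forall>x \<in> bcar M. \<forall>y \<in> bcar M. h (badd M x y) = badd N (h x) (h y)"
   "\<forall>x \<in> bcar M. \<forall>a \<in> carrier Z. h (lact M a x) = lact N a (h x) \<and> h (ract M x a) = ract N (h x) a"
  using f unfolding bimaps_def by blast
 show "bsrc f = M" "btgt f = N" and c: "x \<in> bcar M ==> bfun f x \<in> bcar N" for x
  using h by auto
 show "x \<in> bcar M ==> y \<in> bcar M ==> bfun f (badd M x y) = badd N (bfun f x) (bfun f y)"
  and l: "x \<in> bcar M ==> a \<in> carrier Z ==> bfun f (lact M a x) = lact N a (bfun f x)"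
  and "x \<in> bcar M ==> a \<in> carrier Z ==> bfun f (ract M x a) = ract N (bfun f x) a" for x y a
  using h by (simp_all add: M.laws)
 show "bfun f (bzero M) = bzero N"
  using l[of "bzero M" "\<zero>\<^bsub>Z\<^esub>"] c[of "bzero M"] by (simp add: M.laws N.laws)
qed

lemma bimap_eqI:
 assumes "f \<in> bimaps n M N" "g \<in> bimaps n M N" "\<And>x. x \<in> bcar M ==> bfun f x = bfun g x"
 shows "f = g"
proof -
 obtain h k where "f = mk_bimap M N h" "g = mk_bimap M N k"
  using assms(1,2) unfolding bimaps_def by blast
 with assms(3) show ?thesis by (auto intro: mk_bimap_cong)
qed

lemma bimap_tensor_eqI:
 assumes "zzb M" "zzb N" "zzb L" "f \<in> bimaps n (ZT M N) L" "g \<in> bimaps n (ZT M N) L"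
  "\<And>x y. x \<in> bcar M ==> y \<in> bcar N ==> bfun f (pu M N x y) = bfun g (pu M N x y)"
 shows "f = g"
proof (rule bimap_eqI[OF assms(4,5)])
 interpret T: tensor_pair Z "zz_degree n" Z "zz_degree n" Z "zz_degree n" M N
  by (rule tensor_pair_zz[OF assms(1,2)])
 note F = bimapsD[OF assms(4) zzb_tensor[OF assms(1,2)] assms(3)]
 note G = bimapsD[OF assms(5) zzb_tensor[OF assms(1,2)] assms(3)]
 fix x assume "x \<in> bcar (ZT M N)"
 then show "bfun f x = bfun g x"
  using F(4,7) G(4,7) unfolding zz_tensor_def
  by (induction rule: T.tensor_induct) (simp_all add: assms(6))
qed

lemma zz_category_simps [simp]:
 "Obj (zz_category n) = zz_objects n" "Hom (zz_category n) = bimaps n"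
 "Id (zz_category n) M = mk_bimap M M (\<lambda>x. x)"
 "Comp (zz_category n) g f = mk_bimap (bsrc f) (btgt g) (\<lambda>x. bfun g (bfun f x))"
 "Zero (zz_category n) M N = mk_bimap M N (\<lambda>x. bzero N)"
 "Add (zz_category n) f g = mk_bimap (bsrc f) (btgt f) (\<lambda>x. badd (btgt f) (bfun f x) (bfun g x))"
 "Scale (zz_category n) r f = mk_bimap (bsrc f) (btgt f) (\<lambda>x. lact (btgt f) (zz_scalar n r) (bfun f x))"
 "Unit (zz_category n) = zz_regular n" "TenO (zz_category n) = ZT"
 "HomDeg (zz_category n) d M N = {f \<in> bimaps n M N. \<forall>k. bfun f ` bdeg M k \<subseteq> bdeg N (k + d)}"
 by (simp_all add: zz_category_def)

abbreviation ZC where "ZC \<equiv> zz_category n"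

lemma zzb_graded: "zzb M ==> graded_bimodule Z (zz_degree n) Z (zz_degree n) M"
 by (simp add: zzb_def)

lemma pu_laws:
 assumes "zzb M" "zzb N"
 shows "x \<in> bcar M ==> y \<in> bcar N ==> pu M N x y \<in> bcar (ZT M N)"
  "x \<in> bcar M ==> x' \<in> bcar M ==> y \<in> bcar N ==> pu M N (badd M x x') y = badd (ZT M N) (pu M N x y) (pu M N x' y)"
  "x \<in> bcar M ==> y \<in> bcar N ==> y' \<in> bcar N ==> pu M N x (badd N y y') = badd (ZT M N) (pu M N x y) (pu M N x y')"
  "y \<in> bcar N ==> pu M N (bzero M) y = bzero (ZT M N)"
  "x \<in> bcar M ==> pu M N x (bzero N) = bzero (ZT M N)"
  "x \<in> bcar M ==> a \<in> carrier Z ==> y \<in> bcar N ==> pu M N (ract M x a) y = pu M N x (lact N a y)"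
  "a \<in> carrier Z ==> x \<in> bcar M ==> y \<in> bcar N ==> lact (ZT M N) a (pu M N x y) = pu M N (lact M a x) y"
  "a \<in> carrier Z ==> x \<in> bcar M ==> y \<in> bcar N ==> ract (ZT M N) (pu M N x y) a = pu M N x (ract N y a)"
  "x \<in> bdeg M k ==> y \<in> bdeg N l ==> pu M N x y \<in> bdeg (ZT M N) (k + l)"
proof -
 interpret T: tensor_pair Z "zz_degree n" Z "zz_degree n" Z "zz_degree n" M N
  by (rule tensor_pair_zz[OF assms])
 show "x \<in> bcar M ==> y \<in> bcar N ==> pu M N x y \<in> bcar (ZT M N)"
  "x \<in> bcar M ==> x' \<in> bcar M ==> y \<in> bcar N ==> pu M N (badd M x x') y = badd (ZT M N) (pu M N x y) (pu M N x' y)"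
  "x \<in> bcar M ==> y \<in> bcar N ==> y' \<in> bcar N ==> pu M N x (badd N y y') = badd (ZT M N) (pu M N x y) (pu M N x y')"
  "y \<in> bcar N ==> pu M N (bzero M) y = bzero (ZT M N)"
  "x \<in> bcar M ==> pu M N x (bzero N) = bzero (ZT M N)"
  "x \<in> bcar M ==> a \<in> carrier Z ==> y \<in> bcar N ==> pu M N (ract M x a) y = pu M N x (lact N a y)"
  "a \<in> carrier Z ==> x \<in> bcar M ==> y \<in> bcar N ==> lact (ZT M N) a (pu M N x y) = pu M N (lact M a x) y"
  "a \<in> carrier Z ==> x \<in> bcar M ==> y \<in> bcar N ==> ract (ZT M N) (pu M N x y) a = pu M N x (ract N y a)"
  "x \<in> bdeg M k ==> y \<in> bdeg N l ==> pu M N x y \<in> bdeg (ZT M N) (k + l)"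
  unfolding zz_tensor_def
  by (rule T.pure_closed T.pure_add_left T.pure_add_right T.pure_zero_left T.pure_zero_right T.pure_balanced
    T.lact_pure T.ract_pure T.pure_deg; assumption)+
qed

lemma zz_laws:
 assumes "zzb M"
 shows "x \<in> bcar M ==> y \<in> bcar M ==> badd M x y \<in> bcar M" "bzero M \<in> bcar M"
  "x \<in> bcar M ==> badd M x (bzero M) = x" "x \<in> bcar M ==> badd M (bzero M) x = x"
  "a \<in> carrier Z ==> x \<in> bcar M ==> lact M a x \<in> bcar M" "a \<in> carrier Z ==> x \<in> bcar M ==> ract M x a \<in> bcar M"
  "a \<in> carrier Z ==> x \<in> bcar M ==> y \<in> bcar M ==> lact M a (badd M x y) = badd M (lact M a x) (lact M a y)"
  "a \<in> carrier Z ==> x \<in> bcar M ==> y \<in> bcar M ==> ract M (badd M x y) a = badd M (ract M x a) (ract M y a)"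
  "a \<in> carrier Z ==> lact M a (bzero M) = bzero M" "a \<in> carrier Z ==> ract M (bzero M) a = bzero M"
  "a \<in> carrier Z ==> b \<in> carrier Z ==> x \<in> bcar M ==> lact M (a \<oplus>\<^bsub>Z\<^esub> b) x = badd M (lact M a x) (lact M b x)"
  "a \<in> carrier Z ==> b \<in> carrier Z ==> x \<in> bcar M ==> ract M x (a \<oplus>\<^bsub>Z\<^esub> b) = badd M (ract M x a) (ract M x b)"
  "x \<in> bcar M ==> lact M \<zero>\<^bsub>Z\<^esub> x = bzero M" "x \<in> bcar M ==> ract M x \<zero>\<^bsub>Z\<^esub> = bzero M"
  "a \<in> carrier Z ==> b \<in> carrier Z ==> x \<in> bcar M ==> lact M (a \<bullet> b) x = lact M a (lact M b x)"
  "a \<in> carrier Z ==> b \<in> carrier Z ==> x \<in> bcar M ==> ract M x (a \<bullet> b) = ract M (ract M x a) b"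
  "x \<in> bcar M ==> lact M \<one>\<^bsub>Z\<^esub> x = x" "x \<in> bcar M ==> ract M x \<one>\<^bsub>Z\<^esub> = x"
  "a \<in> carrier Z ==> b \<in> carrier Z ==> x \<in> bcar M ==> ract M (lact M a x) b = lact M a (ract M x b)"
  "x \<in> bcar M ==> ract M x (zz_scalar n r) = lact M (zz_scalar n r) x"
proof -
 interpret M: graded_bimodule Z "zz_degree n" Z "zz_degree n" M by (rule zzb_graded[OF assms])
 show "x \<in> bcar M ==> ract M x (zz_scalar n r) = lact M (zz_scalar n r) x"
  using assms by (simp add: zzb_def)
qed (simp_all add: graded_bimodule.laws[OF zzb_graded[OF assms]])

lemma zz_add_laws:
 assumes "zzb M"
 shows "x \<in> bcar M ==> y \<in> bcar M ==> z \<in> bcar M ==> badd M (badd M x y) z = badd M x (badd M y z)"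
  "x \<in> bcar M ==> y \<in> bcar M ==> badd M x y = badd M y x"
  "x \<in> bcar M ==> y \<in> bcar M ==> z \<in> bcar M ==> badd M x (badd M y z) = badd M y (badd M x z)"
  "x \<in> bcar M ==> y \<in> bcar M ==> z \<in> bcar M ==> w \<in> bcar M
   ==> badd M (badd M x y) (badd M z w) = badd M (badd M x z) (badd M y w)"
 by (rule graded_bimodule.add_assoc[OF zzb_graded[OF assms]] graded_bimodule.add_comm[OF zzb_graded[OF assms]]
  graded_bimodule.add_left_comm[OF zzb_graded[OF assms]] graded_bimodule.add_interchange[OF zzb_graded[OF assms]]; assumption)+

lemma tlift_bimap:
 assumes M: "zzb M" and N: "zzb N" and L: "zzb L"
  and bal: "balanced (carrier Z) M N L f"
  and l: "\<And>x y a. x \<in> bcar M ==> y \<in> bcar N ==> a \<in> carrier Z ==> f (lact M a x) y = lact L a (f x y)"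
  and r: "\<And>x y a. x \<in> bcar M ==> y \<in> bcar N ==> a \<in> carrier Z ==> f x (ract N y a) = ract L (f x y) a"
 shows "mk_bimap (ZT M N) L (tlift L f) \<in> bimaps n (ZT M N) L"
  "\<And>x y. x \<in> bcar M ==> y \<in> bcar N ==> tlift L f (pu M N x y) = f x y"
proof -
 interpret T: tensor_lift Z "zz_degree n" Z "zz_degree n" Z "zz_degree n" M N Z "zz_degree n" Z "zz_degree n" L f
  using tensor_pair_zz[OF M N] zzb_graded[OF L] bal by (simp add: tensor_lift_def tensor_lift_axioms_def)
 show "mk_bimap (ZT M N) L (tlift L f) \<in> bimaps n (ZT M N) L"
  unfolding zz_tensor_def
  by (rule bimapsI) (simp_all add: T.tlift_closed T.tlift_add T.tlift_lact T.tlift_ract l r)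
 show "\<And>x y. x \<in> bcar M ==> y \<in> bcar N ==> tlift L f (pu M N x y) = f x y"
  by (rule T.tlift_pure)
qed

lemma tensor_zz_induct [consumes 3, case_names zero pure add]:
 assumes "zzb M" "zzb N" "t \<in> bcar (ZT M N)"
  and "P (bzero (ZT M N))"
  and "\<And>x y. x \<in> bcar M ==> y \<in> bcar N ==> P (pu M N x y)"
  and "\<And>s t. s \<in> bcar (ZT M N) ==> t \<in> bcar (ZT M N) ==> P s ==> P t ==> P (badd (ZT M N) s t)"
 shows "P t"
 using tensor_pair.tensor_induct[OF tensor_pair_zz[OF assms(1,2)], of t P] assms(3-6) by (simp add: zz_tensor_def)

lemma tensor_zz_deg_induct [consumes 3, case_names zero pure add]:
 assumes "zzb M" "zzb N" "t \<in> bdeg (ZT M N) d"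
  and "P (bzero (ZT M N))"
  and "\<And>x y k. x \<in> bdeg M k ==> y \<in> bdeg N (d - k) ==> P (pu M N x y)"
  and "\<And>s t. s \<in> bcar (ZT M N) ==> t \<in> bcar (ZT M N) ==> P s ==> P t ==> P (badd (ZT M N) s t)"
 shows "P t"
 using tensor_pair.tensor_deg_induct[OF tensor_pair_zz[OF assms(1,2)], of t d P] assms(3-6) by (simp add: zz_tensor_def)

text \<open>On representing lists, \<open>TenM\<close> and \<open>Assoc\<close> are defined by concatenations of lists of pure tensors;
 such a concatenation represents the corresponding sum.\<close>

lemma tensor_class_concat:
 assumes "zzb M" "zzb N" "\<And>x y. (x, y) \<in> set xs ==> set (h x y) \<subseteq> bcar M \<times> bcar N"
 shows "tensor_class (carrier Z) M N (concat (map (\<lambda>(x, y). h x y) xs))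
  = foldr (\<lambda>(x, y). badd (ZT M N) (tensor_class (carrier Z) M N (h x y))) xs (bzero (ZT M N))"
  (is "?c (concat _) = _")
proof -
 interpret T: tensor_pair Z "zz_degree n" Z "zz_degree n" Z "zz_degree n" M N
  by (rule tensor_pair_zz[OF assms(1,2)])
 show ?thesis using assms(3)
 proof (induction xs)
  case Nil
  then show ?case by (simp add: T.bzero_T zz_tensor_def)
 next
  case (Cons p xs)
  have v: "set (h (fst p) (snd p)) \<subseteq> bcar M \<times> bcar N"
   "set (concat (map (\<lambda>(x, y). h x y) xs)) \<subseteq> bcar M \<times> bcar N"
   using Cons.prems[of "fst p" "snd p"] Cons.prems by (simp, force)
  show ?case using Cons.IH Cons.prems T.badd_cl[OF v] by (cases p) (simp add: zz_tensor_def)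
 qed
qed

section \<open>Tensor products of maps, associator and unit constraints\<close>

lemma TenM_eq:
 assumes "zzb M" "zzb N" "zzb M'" "zzb N'" "f \<in> bimaps n M M'" "g \<in> bimaps n N N'"
 shows "TenM ZC f g = mk_bimap (ZT M N) (ZT M' N')
  (tlift (ZT M' N') (\<lambda>x y. pu M' N' (bfun f x) (bfun g y)))"
proof -
 interpret T: tensor_pair Z "zz_degree n" Z "zz_degree n" Z "zz_degree n" M N
  by (rule tensor_pair_zz[OF assms(1,2)])
 note F = bimapsD[OF assms(5,1,3)] and G = bimapsD[OF assms(6,2,4)]
 have "tensor_class (carrier Z) M' N' (map (map_prod (bfun f) (bfun g)) (the_ten t))
   = tlift (ZT M' N') (\<lambda>x y. pu M' N' (bfun f x) (bfun g y)) t" if t: "t \<in> bcar (ZT M N)" for t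
 proof -
  have "t \<in> bcar T.T" using t by (simp add: zz_tensor_def)
  then obtain xs where xs: "T.valid xs" "t = T.cl xs"
   unfolding T.bcar_T by blast
  then have v: "T.valid (the_ten t)" using T.valid_the_ten by simp
  have "map (map_prod (bfun f) (bfun g)) ys = concat (map (\<lambda>(x, y). [(bfun f x, bfun g y)]) ys)" for ys
   by (induction ys) auto
  then show ?thesis
   unfolding tlift_def using v F(3) G(3)
   by (subst tensor_class_concat[OF assms(3,4), symmetric]) (auto simp: subset_iff)
 qed
 then show ?thesis using F(1,2) G(1,2) by (auto simp: zz_category_def intro!: mk_bimap_cong)
qed

lemma TenM_bimap:
 assumes "zzb M" "zzb N" "zzb M'" "zzb N'" "f \<in> bimaps n M M'" "g \<in> bimaps n N N'"
 shows "TenM ZC f g \<in> bimaps n (ZT M N) (ZT M' N')"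
  "x \<in> bcar M ==> y \<in> bcar N ==> bfun (TenM ZC f g) (pu M N x y) = pu M' N' (bfun f x) (bfun g y)"
proof -
 note F = bimapsD[OF assms(5,1,3)] and G = bimapsD[OF assms(6,2,4)]
 have "balanced (carrier Z) M N (ZT M' N') (\<lambda>x y. pu M' N' (bfun f x) (bfun g y))"
  by (rule balancedI) (simp_all add: F G pu_laws[OF assms(3,4)])
 note * = tlift_bimap[OF assms(1,2) zzb_tensor[OF assms(3,4)] this]
 show "TenM ZC f g \<in> bimaps n (ZT M N) (ZT M' N')"
  unfolding TenM_eq[OF assms] by (rule *(1)) (simp_all add: F G pu_laws[OF assms(3,4)])
 show "x \<in> bcar M ==> y \<in> bcar N ==> bfun (TenM ZC f g) (pu M N x y) = pu M' N' (bfun f x) (bfun g y)"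
  unfolding TenM_eq[OF assms] by (simp add: pu_laws[OF assms(1,2)] *(2) F G pu_laws[OF assms(3,4)])
qed

text \<open>The associator arises from two successive lifts: for fixed \<open>z\<close> a map on
  \<open>M \<otimes> N\<close>, which is then balanced as a function of both \<open>u\<close> and
  \<open>z\<close>.\<close>

definition assoc_fun :: "zbimod => zbimod => zbimod => elt => elt => elt" where
 "assoc_fun M N L u z = tlift (ZT M (ZT N L)) (\<lambda>x y. pu M (ZT N L) x (pu N L y z)) u"

definition assoc_inv_fun :: "zbimod => zbimod => zbimod => elt => elt => elt" where
 "assoc_inv_fun M N L x u = tlift (ZT (ZT M N) L) (\<lambda>y z. pu (ZT M N) L (pu M N x y) z) u"

lemma assoc_fun_laws:
 assumes "zzb M" "zzb N" "zzb L"
 defines "T \<equiv> ZT M (ZT N L)"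
 shows "z \<in> bcar L ==> x \<in> bcar M ==> y \<in> bcar N ==> assoc_fun M N L (pu M N x y) z = pu M (ZT N L) x (pu N L y z)"
  "balanced (carrier Z) (ZT M N) L T (assoc_fun M N L)"
  "u \<in> bcar (ZT M N) ==> z \<in> bcar L ==> a \<in> carrier Z ==>
   assoc_fun M N L (lact (ZT M N) a u) z = lact T a (assoc_fun M N L u z)"
  "u \<in> bcar (ZT M N) ==> z \<in> bcar L ==> a \<in> carrier Z ==>
   assoc_fun M N L u (ract L z a) = ract T (assoc_fun M N L u z) a"
proof -
 note NL = zzb_tensor[OF assms(2,3)] and MN = zzb_tensor[OF assms(1,2)]
 note TT = zzb_tensor[OF assms(1) NL]
 note laws = pu_laws[OF assms(1) NL] pu_laws[OF assms(2,3)] pu_laws[OF assms(1,2)]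
  zz_laws[OF assms(1)] zz_laws[OF assms(2)] zz_laws[OF assms(3)] zz_laws[OF NL] zz_laws[OF MN] zz_laws[OF TT]
 have bal: "balanced (carrier Z) M N T (\<lambda>x y. pu M (ZT N L) x (pu N L y z))" if "z \<in> bcar L" for z
  unfolding T_def using that by (intro balancedI) (simp_all add: laws)
 have TL: "tensor_lift Z (zz_degree n) Z (zz_degree n) Z (zz_degree n) M N Z (zz_degree n) Z (zz_degree n) T
   (\<lambda>x y. pu M (ZT N L) x (pu N L y z))" if "z \<in> bcar L" for z
  using bal[OF that] tensor_pair_zz[OF assms(1,2)] zzb_graded[OF TT]
  by (simp add: tensor_lift_def tensor_lift_axioms_def T_def)
 note tl = tensor_lift.tlift_pure[OF TL, folded T_def] tensor_lift.tlift_add[OF TL, folded T_def zz_tensor_def]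
  tensor_lift.tlift_closed[OF TL, folded zz_tensor_def] tensor_lift.tlift_zero[OF TL, folded zz_tensor_def]
 have pure: "assoc_fun M N L (pu M N x y) z = pu M (ZT N L) x (pu N L y z)"
  if "z \<in> bcar L" "x \<in> bcar M" "y \<in> bcar N" for x y z
  using tl(1)[OF that] unfolding assoc_fun_def T_def .
 have add: "assoc_fun M N L (badd (ZT M N) s t) z = badd T (assoc_fun M N L s z) (assoc_fun M N L t z)"
  if "s \<in> bcar (ZT M N)" "t \<in> bcar (ZT M N)" "z \<in> bcar L" for s t z
  using tl(2)[OF that(3,1,2)] unfolding assoc_fun_def T_def .
 have closed: "assoc_fun M N L s z \<in> bcar T" if "s \<in> bcar (ZT M N)" "z \<in> bcar L" for s z
  using tl(3)[OF that(2,1)] unfolding assoc_fun_def T_def .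
 have zero: "assoc_fun M N L (bzero (ZT M N)) z = bzero T" if "z \<in> bcar L" for z
  using tl(4)[OF that] unfolding assoc_fun_def T_def .
 note af = pure add closed zero
 have radd: "assoc_fun M N L u (badd L z z') = badd T (assoc_fun M N L u z) (assoc_fun M N L u z')"
  if "u \<in> bcar (ZT M N)" "z \<in> bcar L" "z' \<in> bcar L" for u z z'
  using assms(1,2) that(1)
  by (induction rule: tensor_zz_induct)
   (simp_all add: af laws that zz_add_laws(4)[OF TT] T_def closed[unfolded T_def])
 have lact: "assoc_fun M N L (lact (ZT M N) a u) z = lact T a (assoc_fun M N L u z)"
  if "u \<in> bcar (ZT M N)" "z \<in> bcar L" "a \<in> carrier Z" for u z a
  using assms(1,2) that(1)
  by (induction rule: tensor_zz_induct)
   (simp_all add: af laws that T_def closed[unfolded T_def])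
 have ract: "assoc_fun M N L u (ract L z a) = ract T (assoc_fun M N L u z) a"
  if "u \<in> bcar (ZT M N)" "z \<in> bcar L" "a \<in> carrier Z" for u z a
  using assms(1,2) that(1)
  by (induction rule: tensor_zz_induct)
   (simp_all add: af laws that T_def closed[unfolded T_def])
 have mid: "assoc_fun M N L (ract (ZT M N) u a) z = assoc_fun M N L u (lact L a z)"
  if "u \<in> bcar (ZT M N)" "z \<in> bcar L" "a \<in> carrier Z" for u z a
  using assms(1,2) that(1)
  by (induction rule: tensor_zz_induct) (simp_all add: af laws that T_def closed[unfolded T_def])
 show "balanced (carrier Z) (ZT M N) L T (assoc_fun M N L)"
  by (rule balancedI) (simp_all add: af radd mid)
 show "z \<in> bcar L ==> x \<in> bcar M ==> y \<in> bcar N ==> assoc_fun M N L (pu M N x y) z = pu M (ZT N L) x (pu N L y z)"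
  by (rule pure)
 show "u \<in> bcar (ZT M N) ==> z \<in> bcar L ==> a \<in> carrier Z ==>
   assoc_fun M N L (lact (ZT M N) a u) z = lact T a (assoc_fun M N L u z)"
  "u \<in> bcar (ZT M N) ==> z \<in> bcar L ==> a \<in> carrier Z ==>
   assoc_fun M N L u (ract L z a) = ract T (assoc_fun M N L u z) a"
  by (rule lact ract; assumption)+
qed

lemma assoc_inv_fun_laws:
 assumes "zzb M" "zzb N" "zzb L"
 defines "T \<equiv> ZT (ZT M N) L"
 shows "z \<in> bcar L ==> x \<in> bcar M ==> y \<in> bcar N ==> assoc_inv_fun M N L x (pu N L y z) = pu (ZT M N) L (pu M N x y) z"
  "balanced (carrier Z) M (ZT N L) T (assoc_inv_fun M N L)"
  "u \<in> bcar (ZT N L) ==> x \<in> bcar M ==> a \<in> carrier Z ==>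
   assoc_inv_fun M N L (lact M a x) u = lact T a (assoc_inv_fun M N L x u)"
  "u \<in> bcar (ZT N L) ==> x \<in> bcar M ==> a \<in> carrier Z ==>
   assoc_inv_fun M N L x (ract (ZT N L) u a) = ract T (assoc_inv_fun M N L x u) a"
proof -
 note NL = zzb_tensor[OF assms(2,3)] and MN = zzb_tensor[OF assms(1,2)]
 note TT = zzb_tensor[OF MN assms(3)]
 note laws = pu_laws[OF MN assms(3)] pu_laws[OF assms(2,3)] pu_laws[OF assms(1,2)]
  zz_laws[OF assms(1)] zz_laws[OF assms(2)] zz_laws[OF assms(3)] zz_laws[OF NL] zz_laws[OF MN] zz_laws[OF TT]
 have bal: "balanced (carrier Z) N L T (\<lambda>y z. pu (ZT M N) L (pu M N x y) z)" if "x \<in> bcar M" for x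
 proof (unfold T_def, rule balancedI)
  fix y a z assume yz: "y \<in> bcar N" "a \<in> carrier Z" "z \<in> bcar L"
  \<comment> \<open>The scalar leaves \<open>y\<close> as a right action on
    \<open>M \<otimes> N\<close> and from there crosses over to \<open>z\<close>.\<close>
  have "pu (ZT M N) L (pu M N x (ract N y a)) z = pu (ZT M N) L (ract (ZT M N) (pu M N x y) a) z"
   using yz that by (simp add: pu_laws[OF assms(1,2)])
  also have "\<dots> = pu (ZT M N) L (pu M N x y) (lact L a z)"
   using yz that by (intro pu_laws[OF MN assms(3)]) (simp_all add: laws)
  finally show "pu (ZT M N) L (pu M N x (ract N y a)) z = pu (ZT M N) L (pu M N x y) (lact L a z)" .
 qed (use that in \<open>simp_all add: laws\<close>)
 have TL: "tensor_lift Z (zz_degree n) Z (zz_degree n) Z (zz_degree n) N L Z (zz_degree n) Z (zz_degree n) T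
   (\<lambda>y z. pu (ZT M N) L (pu M N x y) z)" if "x \<in> bcar M" for x
  using bal[OF that] tensor_pair_zz[OF assms(2,3)] zzb_graded[OF TT]
  by (simp add: tensor_lift_def tensor_lift_axioms_def T_def)
 note tl = tensor_lift.tlift_pure[OF TL, folded T_def] tensor_lift.tlift_add[OF TL, folded T_def zz_tensor_def]
  tensor_lift.tlift_closed[OF TL, folded zz_tensor_def] tensor_lift.tlift_zero[OF TL, folded zz_tensor_def]
 have pure: "assoc_inv_fun M N L x (pu N L y z) = pu (ZT M N) L (pu M N x y) z"
  if "x \<in> bcar M" "y \<in> bcar N" "z \<in> bcar L" for x y z
  using tl(1)[OF that] unfolding assoc_inv_fun_def T_def .
 have add: "assoc_inv_fun M N L x (badd (ZT N L) s t) = badd T (assoc_inv_fun M N L x s) (assoc_inv_fun M N L x t)"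
  if "s \<in> bcar (ZT N L)" "t \<in> bcar (ZT N L)" "x \<in> bcar M" for s t x
  using tl(2)[OF that(3,1,2)] unfolding assoc_inv_fun_def T_def .
 have closed: "assoc_inv_fun M N L x s \<in> bcar T" if "s \<in> bcar (ZT N L)" "x \<in> bcar M" for s x
  using tl(3)[OF that(2,1)] unfolding assoc_inv_fun_def T_def .
 have zero: "assoc_inv_fun M N L x (bzero (ZT N L)) = bzero T" if "x \<in> bcar M" for x
  using tl(4)[OF that] unfolding assoc_inv_fun_def T_def .
 note af = pure add closed zero
 have ladd: "assoc_inv_fun M N L (badd M x x') u = badd T (assoc_inv_fun M N L x u) (assoc_inv_fun M N L x' u)"
  if "u \<in> bcar (ZT N L)" "x \<in> bcar M" "x' \<in> bcar M" for u x x'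
  using assms(2,3) that(1)
  by (induction rule: tensor_zz_induct)
   (simp_all add: af laws that zz_add_laws(4)[OF TT] T_def closed[unfolded T_def])
 have lzero: "assoc_inv_fun M N L (bzero M) u = bzero T"
  if "u \<in> bcar (ZT N L)" for u
  using assms(2,3) that(1)
  by (induction rule: tensor_zz_induct)
   (simp_all add: af laws that T_def closed[unfolded T_def])
 have lact: "assoc_inv_fun M N L (lact M a x) u = lact T a (assoc_inv_fun M N L x u)"
  if "u \<in> bcar (ZT N L)" "x \<in> bcar M" "a \<in> carrier Z" for u x a
  using assms(2,3) that(1)
  by (induction rule: tensor_zz_induct)
   (simp_all add: af laws that T_def closed[unfolded T_def])
 have ract: "assoc_inv_fun M N L x (ract (ZT N L) u a) = ract T (assoc_inv_fun M N L x u) a"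
  if "u \<in> bcar (ZT N L)" "x \<in> bcar M" "a \<in> carrier Z" for u x a
  using assms(2,3) that(1)
  by (induction rule: tensor_zz_induct)
   (simp_all add: af laws that T_def closed[unfolded T_def])
 have mid: "assoc_inv_fun M N L (ract M x a) u = assoc_inv_fun M N L x (lact (ZT N L) a u)"
  if "u \<in> bcar (ZT N L)" "x \<in> bcar M" "a \<in> carrier Z" for u x a
  using assms(2,3) that(1)
  by (induction rule: tensor_zz_induct) (simp_all add: af laws that T_def closed[unfolded T_def])
 show "balanced (carrier Z) M (ZT N L) T (assoc_inv_fun M N L)"
  by (rule balancedI) (simp_all add: af ladd mid lzero)
 show "z \<in> bcar L ==> x \<in> bcar M ==> y \<in> bcar N ==> assoc_inv_fun M N L x (pu N L y z) = pu (ZT M N) L (pu M N x y) z"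
  by (rule pure)
 show "u \<in> bcar (ZT N L) ==> x \<in> bcar M ==> a \<in> carrier Z ==>
   assoc_inv_fun M N L (lact M a x) u = lact T a (assoc_inv_fun M N L x u)"
  "u \<in> bcar (ZT N L) ==> x \<in> bcar M ==> a \<in> carrier Z ==>
   assoc_inv_fun M N L x (ract (ZT N L) u a) = ract T (assoc_inv_fun M N L x u) a"
  by (rule lact ract; assumption)+
qed

lemma Assoc_eq:
 assumes "zzb M" "zzb N" "zzb L"
 shows "Assoc ZC M N L = mk_bimap (ZT (ZT M N) L) (ZT M (ZT N L))
  (tlift (ZT M (ZT N L)) (assoc_fun M N L))"
proof -
 note NL = zzb_tensor[OF assms(2,3)] and MN = zzb_tensor[OF assms(1,2)]
 interpret T: tensor_pair Z "zz_degree n" Z "zz_degree n" Z "zz_degree n" "ZT M N" L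
  by (rule tensor_pair_zz[OF MN assms(3)])
 interpret MN: tensor_pair Z "zz_degree n" Z "zz_degree n" Z "zz_degree n" M N
  by (rule tensor_pair_zz[OF assms(1,2)])
 let ?h = "\<lambda>u z. map (\<lambda>(x, y). (x, tensor_class (carrier Z) N L [(y, z)])) (the_ten u)"
 have "tensor_class (carrier Z) M (ZT N L) (concat (map (\<lambda>(u, z). ?h u z) (the_ten t)))
   = tlift (ZT M (ZT N L)) (assoc_fun M N L) t"
  if t: "t \<in> bcar (ZT (ZT M N) L)" for t
 proof -
  have "t \<in> bcar T.T" using t by (simp add: zz_tensor_def)
  then obtain xs where xs: "T.valid xs" "t = T.cl xs"
   unfolding T.bcar_T by blast
  then have v: "T.valid (the_ten t)" using T.valid_the_ten by simp
  have *: "set (?h u z) \<subseteq> bcar M \<times> bcar (ZT N L)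
    \<and> tensor_class (carrier Z) M (ZT N L) (?h u z) = assoc_fun M N L u z"
   if uz: "(u, z) \<in> set (the_ten t)" for u z
  proof -
   have "u \<in> bcar (ZT M N)" and z: "z \<in> bcar L" using uz v by auto
   then obtain ys where ys: "MN.valid ys" "u = MN.cl ys"
    by (auto simp: zz_tensor_def MN.bcar_T)
   then have v: "MN.valid (the_ten u)" using MN.valid_the_ten by simp
   have "map (\<lambda>(x, y). (x, pu N L y z)) zs = concat (map (\<lambda>(x, y). [(x, pu N L y z)]) zs)" for zs :: "(elt \<times> elt) list"
    by (induction zs) auto
   then have "?h u z = concat (map (\<lambda>(x, y). [(x, pu N L y z)]) (the_ten u))" .
   moreover have "tensor_class (carrier Z) M (ZT N L) (concat (map (\<lambda>(x, y). [(x, pu N L y z)]) (the_ten u)))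
     = assoc_fun M N L u z"
    unfolding assoc_fun_def tlift_def using v z
    by (intro tensor_class_concat[OF assms(1) NL]) (auto intro: pu_laws(1)[OF assms(2,3)])
   ultimately show ?thesis using v z by (auto intro: pu_laws(1)[OF assms(2,3)])
  qed
  then have "tensor_class (carrier Z) M (ZT N L) (concat (map (\<lambda>(u, z). ?h u z) (the_ten t)))
   = foldr (\<lambda>(u, z). badd (ZT M (ZT N L)) (tensor_class (carrier Z) M (ZT N L) (?h u z)))
     (the_ten t) (bzero (ZT M (ZT N L)))"
   by (intro tensor_class_concat[OF assms(1) NL]) auto
  also have "\<dots> = tlift (ZT M (ZT N L)) (assoc_fun M N L) t"
   unfolding tlift_def using * by (intro foldr_cong) auto
  finally show ?thesis .
 qed
 then show ?thesis by (auto simp: zz_category_def intro!: mk_bimap_cong)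
qed

lemma Assoc_bimap:
 assumes "zzb M" "zzb N" "zzb L"
 shows "Assoc ZC M N L \<in> bimaps n (ZT (ZT M N) L) (ZT M (ZT N L))"
  "x \<in> bcar M ==> y \<in> bcar N ==> z \<in> bcar L
   ==> bfun (Assoc ZC M N L) (pu (ZT M N) L (pu M N x y) z) = pu M (ZT N L) x (pu N L y z)"
proof -
 note NL = zzb_tensor[OF assms(2,3)] and MN = zzb_tensor[OF assms(1,2)]
 note * = tlift_bimap[OF MN assms(3) zzb_tensor[OF assms(1) NL] assoc_fun_laws(2)[OF assms]]
 show "Assoc ZC M N L \<in> bimaps n (ZT (ZT M N) L) (ZT M (ZT N L))"
  unfolding Assoc_eq[OF assms] by (rule *(1)) (simp_all add: assoc_fun_laws(3,4)[OF assms])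
 show "x \<in> bcar M ==> y \<in> bcar N ==> z \<in> bcar L
   ==> bfun (Assoc ZC M N L) (pu (ZT M N) L (pu M N x y) z) = pu M (ZT N L) x (pu N L y z)"
  unfolding Assoc_eq[OF assms] using *(2)[OF assoc_fun_laws(3,4)[OF assms]]
  by (simp add: pu_laws[OF assms(1,2)] pu_laws[OF MN assms(3)] assoc_fun_laws(1)[OF assms])
qed

definition Assoc_inv :: "zbimod => zbimod => zbimod => bimap" where
 "Assoc_inv M N L = mk_bimap (ZT M (ZT N L)) (ZT (ZT M N) L)
  (tlift (ZT (ZT M N) L) (assoc_inv_fun M N L))"

lemma Assoc_inv_bimap:
 assumes "zzb M" "zzb N" "zzb L"
 shows "Assoc_inv M N L \<in> bimaps n (ZT M (ZT N L)) (ZT (ZT M N) L)"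
  "x \<in> bcar M ==> y \<in> bcar N ==> z \<in> bcar L
   ==> bfun (Assoc_inv M N L) (pu M (ZT N L) x (pu N L y z)) = pu (ZT M N) L (pu M N x y) z"
proof -
 note NL = zzb_tensor[OF assms(2,3)] and MN = zzb_tensor[OF assms(1,2)]
 note * = tlift_bimap[OF assms(1) NL zzb_tensor[OF MN assms(3)] assoc_inv_fun_laws(2)[OF assms]]
 show "Assoc_inv M N L \<in> bimaps n (ZT M (ZT N L)) (ZT (ZT M N) L)"
  unfolding Assoc_inv_def by (rule *(1)) (simp_all add: assoc_inv_fun_laws(3,4)[OF assms])
 show "x \<in> bcar M ==> y \<in> bcar N ==> z \<in> bcar L
   ==> bfun (Assoc_inv M N L) (pu M (ZT N L) x (pu N L y z)) = pu (ZT M N) L (pu M N x y) z"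
  unfolding Assoc_inv_def using *(2)[OF assoc_inv_fun_laws(3,4)[OF assms]]
  by (simp add: pu_laws[OF assms(2,3)] pu_laws[OF assms(1) NL] assoc_inv_fun_laws(1)[OF assms])
qed

lemma bcar_regular: "bcar (zz_regular n) = Alg ` carrier Z"
 by (simp add: zz_regular_def zz_bimod_def)

lemma regular_simps:
 "lact (zz_regular n) a (Alg b) = Alg (a \<bullet> b)" "ract (zz_regular n) (Alg b) a = Alg (b \<bullet> a)"
 "badd (zz_regular n) (Alg a) (Alg b) = Alg (a \<oplus>\<^bsub>Z\<^esub> b)" "bzero (zz_regular n) = Alg \<zero>\<^bsub>Z\<^esub>"
 "bdeg (zz_regular n) d = Alg ` (carrier Z \<inter> zz_degree n d)"
 by (simp_all add: zz_regular_def zz_bimod_simps)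

lemma regular_closed: "b \<in> carrier Z ==> Alg b \<in> bcar (zz_regular n)"
 by (simp add: bcar_regular)

lemma Lunit_bimap:
 assumes "zzb M"
 shows "Lunit ZC M \<in> bimaps n (ZT (zz_regular n) M) M"
  "b \<in> carrier Z ==> x \<in> bcar M ==> bfun (Lunit ZC M) (pu (zz_regular n) M (Alg b) x) = lact M b x"
proof -
 have eq: "Lunit ZC M = mk_bimap (ZT (zz_regular n) M) M (tlift M (\<lambda>b x. lact M (the_alg b) x))"
  by (simp add: zz_category_def tlift_def[abs_def])
 have "balanced (carrier Z) (zz_regular n) M M (\<lambda>b x. lact M (the_alg b) x)"
  by (rule balancedI) (auto simp: bcar_regular regular_simps zz_laws[OF assms])
 then have *: "mk_bimap (ZT (zz_regular n) M) M (tlift M (\<lambda>b x. lact M (the_alg b) x)) \<in> bimaps n (ZT (zz_regular n) M) M"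
  "\<And>b x. b \<in> bcar (zz_regular n) ==> x \<in> bcar M ==> tlift M (\<lambda>b x. lact M (the_alg b) x) (pu (zz_regular n) M b x) = lact M (the_alg b) x"
  by (rule tlift_bimap[OF zzb_regular assms assms]; auto simp: bcar_regular regular_simps zz_laws[OF assms])+
 show "Lunit ZC M \<in> bimaps n (ZT (zz_regular n) M) M"
  unfolding eq by (rule *(1))
 show "b \<in> carrier Z ==> x \<in> bcar M ==> bfun (Lunit ZC M) (pu (zz_regular n) M (Alg b) x) = lact M b x"
  unfolding eq by (subst mk_bimap_simps)
   (auto simp: bcar_regular regular_simps zz_laws[OF assms] pu_laws[OF zzb_regular assms] *(2))
qed

lemma Runit_bimap:
 assumes "zzb M"
 shows "Runit ZC M \<in> bimaps n (ZT M (zz_regular n)) M"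
  "b \<in> carrier Z ==> x \<in> bcar M ==> bfun (Runit ZC M) (pu M (zz_regular n) x (Alg b)) = ract M x b"
proof -
 have eq: "Runit ZC M = mk_bimap (ZT M (zz_regular n)) M (tlift M (\<lambda>x b. ract M x (the_alg b)))"
  by (simp add: zz_category_def tlift_def[abs_def])
 have "balanced (carrier Z) M (zz_regular n) M (\<lambda>x b. ract M x (the_alg b))"
  by (rule balancedI) (auto simp: bcar_regular regular_simps zz_laws[OF assms])
 then have *: "mk_bimap (ZT M (zz_regular n)) M (tlift M (\<lambda>x b. ract M x (the_alg b))) \<in> bimaps n (ZT M (zz_regular n)) M"
  "\<And>x b. x \<in> bcar M ==> b \<in> bcar (zz_regular n) ==> tlift M (\<lambda>x b. ract M x (the_alg b)) (pu M (zz_regular n) x b) = ract M x (the_alg b)"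
  by (rule tlift_bimap[OF assms zzb_regular assms]; auto simp: bcar_regular regular_simps zz_laws[OF assms])+
 show "Runit ZC M \<in> bimaps n (ZT M (zz_regular n)) M"
  unfolding eq by (rule *(1))
 show "b \<in> carrier Z ==> x \<in> bcar M ==> bfun (Runit ZC M) (pu M (zz_regular n) x (Alg b)) = ract M x b"
  unfolding eq by (subst mk_bimap_simps)
   (auto simp: bcar_regular regular_simps zz_laws[OF assms] pu_laws[OF assms zzb_regular] *(2))
qed

lemma Id_bimap: "zzb M ==> Id ZC M \<in> bimaps n M M" "x \<in> bcar M ==> bfun (Id ZC M) x = x"
 by (auto intro: bimapsI)

lemma Comp_bimap:
 assumes "zzb M" "zzb N" "zzb L" "f \<in> bimaps n M N" "g \<in> bimaps n N L"
 shows "Comp ZC g f \<in> bimaps n M L" "x \<in> bcar M ==> bfun (Comp ZC g f) x = bfun g (bfun f x)"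
proof -
 note F = bimapsD[OF assms(4,1,2)] and G = bimapsD[OF assms(5,2,3)]
 show "Comp ZC g f \<in> bimaps n M L" by (simp add: F G) (rule bimapsI; simp add: F G)
 show "x \<in> bcar M ==> bfun (Comp ZC g f) x = bfun g (bfun f x)" by (simp add: F G)
qed

lemma Zero_bimap: "zzb M ==> zzb N ==> Zero ZC M N \<in> bimaps n M N" "x \<in> bcar M ==> bfun (Zero ZC M N) x = bzero N"
 by (auto intro!: bimapsI simp: zz_laws)

lemma Add_bimap:
 assumes "zzb M" "zzb N" "f \<in> bimaps n M N" "g \<in> bimaps n M N"
 shows "Add ZC f g \<in> bimaps n M N" "x \<in> bcar M ==> bfun (Add ZC f g) x = badd N (bfun f x) (bfun g x)"
proof -
 note F = bimapsD[OF assms(3,1,2)] and G = bimapsD[OF assms(4,1,2)]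
 show "Add ZC f g \<in> bimaps n M N"
  by (simp add: F G) (rule bimapsI; simp add: F G zz_laws[OF assms(2)] zz_add_laws(4)[OF assms(2)])
 show "x \<in> bcar M ==> bfun (Add ZC f g) x = badd N (bfun f x) (bfun g x)" by (simp add: F G)
qed

lemma scalar_lact_commute:
 assumes "zzb M" "a \<in> carrier Z" "x \<in> bcar M"
 shows "lact M (zz_scalar n r) (lact M a x) = lact M a (lact M (zz_scalar n r) x)"
 using assms zz_laws(15)[OF assms(1), symmetric] by (simp add: zz_scalar_central)

lemma Scale_bimap:
 assumes "zzb M" "zzb N" "f \<in> bimaps n M N"
 shows "Scale ZC r f \<in> bimaps n M N" "x \<in> bcar M ==> bfun (Scale ZC r f) x = lact N (zz_scalar n r) (bfun f x)"
proof -
 note F = bimapsD[OF assms(3,1,2)]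
 show "Scale ZC r f \<in> bimaps n M N"
  by (simp add: F) (rule bimapsI; simp add: F zz_laws[OF assms(2)] scalar_lact_commute[OF assms(2)])
 show "x \<in> bcar M ==> bfun (Scale ZC r f) x = lact N (zz_scalar n r) (bfun f x)" by (simp add: F)
qed

lemma bimap_tensor3_eqI:
 assumes "zzb M" "zzb N" "zzb L" "zzb Q"
  and f: "f \<in> bimaps n (ZT (ZT M N) L) Q" and g: "g \<in> bimaps n (ZT (ZT M N) L) Q"
  and "\<And>x y z. x \<in> bcar M ==> y \<in> bcar N ==> z \<in> bcar L
   ==> bfun f (pu (ZT M N) L (pu M N x y) z) = bfun g (pu (ZT M N) L (pu M N x y) z)"
 shows "f = g"
proof (rule bimap_tensor_eqI[OF zzb_tensor[OF assms(1,2)] assms(3,4) f g])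
 note MN = zzb_tensor[OF assms(1,2)]
 note F = bimapsD[OF f zzb_tensor[OF MN assms(3)] assms(4)] and G = bimapsD[OF g zzb_tensor[OF MN assms(3)] assms(4)]
 fix u z assume z: "z \<in> bcar L" and u: "u \<in> bcar (ZT M N)"
 show "bfun f (pu (ZT M N) L u z) = bfun g (pu (ZT M N) L u z)"
  using assms(1,2) u
  by (induction rule: tensor_zz_induct)
   (simp_all add: pu_laws[OF MN assms(3)] z F G assms(7))
qed

lemma bimap_tensor3_eqI':
 assumes "zzb M" "zzb N" "zzb L" "zzb Q"
  and f: "f \<in> bimaps n (ZT M (ZT N L)) Q" and g: "g \<in> bimaps n (ZT M (ZT N L)) Q"
  and "\<And>x y z. x \<in> bcar M ==> y \<in> bcar N ==> z \<in> bcar L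
   ==> bfun f (pu M (ZT N L) x (pu N L y z)) = bfun g (pu M (ZT N L) x (pu N L y z))"
 shows "f = g"
proof (rule bimap_tensor_eqI[OF assms(1) zzb_tensor[OF assms(2,3)] assms(4) f g])
 note NL = zzb_tensor[OF assms(2,3)]
 note F = bimapsD[OF f zzb_tensor[OF assms(1) NL] assms(4)] and G = bimapsD[OF g zzb_tensor[OF assms(1) NL] assms(4)]
 fix x u assume x: "x \<in> bcar M" and u: "u \<in> bcar (ZT N L)"
 show "bfun f (pu M (ZT N L) x u) = bfun g (pu M (ZT N L) x u)"
  using assms(2,3) u
  by (induction rule: tensor_zz_induct)
   (simp_all add: pu_laws[OF assms(1) NL] x F G assms(7))
qed

lemma bimap_tensor4_eqI:
 assumes "zzb M" "zzb N" "zzb L" "zzb K" "zzb Q"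
  and f: "f \<in> bimaps n (ZT (ZT (ZT M N) L) K) Q"
  and g: "g \<in> bimaps n (ZT (ZT (ZT M N) L) K) Q"
  and "\<And>x y z w. x \<in> bcar M ==> y \<in> bcar N ==> z \<in> bcar L ==> w \<in> bcar K
   ==> bfun f (pu (ZT (ZT M N) L) K (pu (ZT M N) L (pu M N x y) z) w)
    = bfun g (pu (ZT (ZT M N) L) K (pu (ZT M N) L (pu M N x y) z) w)"
 shows "f = g"
proof (rule bimap_tensor3_eqI[OF zzb_tensor[OF assms(1,2)] assms(3,4,5) f g])
 note MN = zzb_tensor[OF assms(1,2)]
 note MNL = zzb_tensor[OF MN assms(3)]
 note F = bimapsD[OF f zzb_tensor[OF MNL assms(4)] assms(5)] and G = bimapsD[OF g zzb_tensor[OF MNL assms(4)] assms(5)]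
 fix u z w assume z: "z \<in> bcar L" "w \<in> bcar K" and u: "u \<in> bcar (ZT M N)"
 show "bfun f (pu (ZT (ZT M N) L) K (pu (ZT M N) L u z) w)
   = bfun g (pu (ZT (ZT M N) L) K (pu (ZT M N) L u z) w)"
  using assms(1,2) u
  by (induction rule: tensor_zz_induct)
   (simp_all add: pu_laws[OF MN assms(3)] pu_laws[OF MNL assms(4)] z F G assms(8))
qed

lemma is_iso_zzI:
 assumes "zzb M" "zzb N" "f \<in> bimaps n M N" "g \<in> bimaps n N M"
  "Comp ZC g f = Id ZC M" "Comp ZC f g = Id ZC N"
 shows "is_iso ZC M N f"
 using assms unfolding is_iso_def by auto

section \<open>Coherence of the tensor product\<close>

lemma Assoc_is_iso:
 assumes "zzb M" "zzb N" "zzb L"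
 shows "is_iso ZC (ZT (ZT M N) L) (ZT M (ZT N L)) (Assoc ZC M N L)"
  "Comp ZC (Assoc_inv M N L) (Assoc ZC M N L) = Id ZC (ZT (ZT M N) L)"
  "Comp ZC (Assoc ZC M N L) (Assoc_inv M N L) = Id ZC (ZT M (ZT N L))"
proof -
 note NL = zzb_tensor[OF assms(2,3)] and MN = zzb_tensor[OF assms(1,2)]
 note l = zzb_tensor[OF MN assms(3)] and r = zzb_tensor[OF assms(1) NL]
 note laws = pu_laws(1)[OF assms(1,2)] pu_laws(1)[OF MN assms(3)] pu_laws(1)[OF assms(2,3)] pu_laws(1)[OF assms(1) NL]
 note A = Assoc_bimap[OF assms] and I = Assoc_inv_bimap[OF assms]
 show 1: "Comp ZC (Assoc_inv M N L) (Assoc ZC M N L) = Id ZC (ZT (ZT M N) L)"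
  by (rule bimap_tensor3_eqI[OF assms l Comp_bimap(1)[OF l r l A(1) I(1)] Id_bimap(1)[OF l]])
   (simp add: Comp_bimap(2)[OF l r l A(1) I(1)] Id_bimap(2) A(2) I(2) laws del: zz_category_simps)
 show 2: "Comp ZC (Assoc ZC M N L) (Assoc_inv M N L) = Id ZC (ZT M (ZT N L))"
  by (rule bimap_tensor3_eqI'[OF assms r Comp_bimap(1)[OF r l r I(1) A(1)] Id_bimap(1)[OF r]])
   (simp add: Comp_bimap(2)[OF r l r I(1) A(1)] Id_bimap(2) A(2) I(2) laws del: zz_category_simps)
 show "is_iso ZC (ZT (ZT M N) L) (ZT M (ZT N L)) (Assoc ZC M N L)"
  by (rule is_iso_zzI[OF l r A(1) I(1) 1 2])
qed

lemma Lunit_is_iso: assumes "zzb M" shows "is_iso ZC (ZT (zz_regular n) M) M (Lunit ZC M)"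
proof -
 note R = zzb_regular and T = zzb_tensor[OF zzb_regular assms]
 note laws = pu_laws[OF R assms] zz_laws[OF assms]
 let ?g = "mk_bimap M (ZT (zz_regular n) M) (\<lambda>x. pu (zz_regular n) M (Alg \<one>\<^bsub>Z\<^esub>) x)"
 \<comment> \<open>The inverse sends \<open>x\<close> to \<open>1 \<otimes> x\<close>. This rule
   gives its compatibility with the left action and recovers \<open>a \<otimes> x\<close> from
   \<open>1 \<otimes> a x\<close>.\<close>
 have move: "pu (zz_regular n) M (Alg \<one>\<^bsub>Z\<^esub>) (lact M a x) = pu (zz_regular n) M (Alg a) x"
  if "a \<in> carrier Z" "x \<in> bcar M" for a x
  using that laws(6)[of "Alg \<one>\<^bsub>Z\<^esub>" a x] by (simp add: regular_closed regular_simps)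
 have g: "?g \<in> bimaps n M (ZT (zz_regular n) M)"
  by (rule bimapsI) (simp_all add: laws regular_closed move regular_simps)
 note L = Lunit_bimap[OF assms]
 have 1: "Comp ZC ?g (Lunit ZC M) = Id ZC (ZT (zz_regular n) M)"
  by (rule bimap_tensor_eqI[OF R assms T Comp_bimap(1)[OF T assms T L(1) g] Id_bimap(1)[OF T]])
   (auto simp: Comp_bimap(2)[OF T assms T L(1) g] Id_bimap(2) L(2) laws move bcar_regular regular_simps simp del: zz_category_simps)
 have 2: "Comp ZC (Lunit ZC M) ?g = Id ZC M"
  by (rule bimap_eqI[OF Comp_bimap(1)[OF assms T assms g L(1)] Id_bimap(1)[OF assms]])
   (simp add: Comp_bimap(2)[OF assms T assms g L(1)] Id_bimap(2) L(2) laws del: zz_category_simps)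
 show ?thesis by (rule is_iso_zzI[OF T assms L(1) g 1 2])
qed

lemma Runit_is_iso: assumes "zzb M" shows "is_iso ZC (ZT M (zz_regular n)) M (Runit ZC M)"
proof -
 note R = zzb_regular and T = zzb_tensor[OF assms zzb_regular]
 note laws = pu_laws[OF assms R] zz_laws[OF assms]
 let ?g = "mk_bimap M (ZT M (zz_regular n)) (\<lambda>x. pu M (zz_regular n) x (Alg \<one>\<^bsub>Z\<^esub>))"
 have move: "pu M (zz_regular n) (ract M x a) (Alg \<one>\<^bsub>Z\<^esub>) = pu M (zz_regular n) x (Alg a)"
  if "a \<in> carrier Z" "x \<in> bcar M" for a x
  using that laws(6)[of x a "Alg \<one>\<^bsub>Z\<^esub>"] by (simp add: regular_closed regular_simps)
 have g: "?g \<in> bimaps n M (ZT M (zz_regular n))"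
  by (rule bimapsI) (simp_all add: laws regular_closed move regular_simps)
 note L = Runit_bimap[OF assms]
 have 1: "Comp ZC ?g (Runit ZC M) = Id ZC (ZT M (zz_regular n))"
  by (rule bimap_tensor_eqI[OF assms R T Comp_bimap(1)[OF T assms T L(1) g] Id_bimap(1)[OF T]])
   (auto simp: Comp_bimap(2)[OF T assms T L(1) g] Id_bimap(2) L(2) laws move bcar_regular regular_simps simp del: zz_category_simps)
 have 2: "Comp ZC (Runit ZC M) ?g = Id ZC M"
  by (rule bimap_eqI[OF Comp_bimap(1)[OF assms T assms g L(1)] Id_bimap(1)[OF assms]])
   (simp add: Comp_bimap(2)[OF assms T assms g L(1)] Id_bimap(2) L(2) laws del: zz_category_simps)
 show ?thesis by (rule is_iso_zzI[OF T assms L(1) g 1 2])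
qed

lemma mk_bimap_full_cong:
 "M = M' ==> N = N' ==> (\<And>x. x \<in> bcar M' ==> f x = g x) ==> mk_bimap M N f = mk_bimap M' N' g"
 by (auto intro: mk_bimap_cong)

text \<open>On \<open>((x \<otimes> y) \<otimes> z) \<otimes> w\<close> both sides give
  \<open>x \<otimes> (y \<otimes> (z \<otimes> w))\<close>, and such elements generate the source
  additively.\<close>

lemma pentagon_zz:
 assumes "zzb M" "zzb N" "zzb L" "zzb K"
 shows "Comp ZC (Assoc ZC M N (ZT L K)) (Assoc ZC (ZT M N) L K)
  = Comp ZC (TenM ZC (Id ZC M) (Assoc ZC N L K)) (Comp ZC (Assoc ZC M (ZT N L) K) (TenM ZC (Assoc ZC M N L) (Id ZC K)))"
proof -
 note a = assms
 note MN = zzb_tensor[OF a(1,2)] and NL = zzb_tensor[OF a(2,3)] and LK = zzb_tensor[OF a(3,4)]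
 note MN_L = zzb_tensor[OF MN a(3)] and M_NL = zzb_tensor[OF a(1) NL] and NL_K = zzb_tensor[OF NL a(4)] and N_LK = zzb_tensor[OF a(2) LK]
 note MN_L_K = zzb_tensor[OF MN_L a(4)] and MN_LK = zzb_tensor[OF MN LK] and M_N_LK = zzb_tensor[OF a(1) N_LK]
  and M_NL_K' = zzb_tensor[OF M_NL a(4)] and M_NL_K = zzb_tensor[OF a(1) NL_K]
 note A1 = Assoc_bimap[OF MN a(3,4)] and A2 = Assoc_bimap[OF a(1,2) LK]
  and A3 = TenM_bimap[OF MN_L a(4) M_NL a(4) Assoc_bimap(1)[OF a(1-3)] Id_bimap(1)[OF a(4)]]
  and A4 = Assoc_bimap[OF a(1) NL a(4)]
  and A5 = TenM_bimap[OF a(1) NL_K a(1) N_LK Id_bimap(1)[OF a(1)] Assoc_bimap(1)[OF a(2-4)]]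
 note C1 = Comp_bimap[OF MN_L_K MN_LK M_N_LK A1(1) A2(1)]
  and C2 = Comp_bimap[OF MN_L_K M_NL_K' M_NL_K A3(1) A4(1)]
 note C3 = Comp_bimap[OF MN_L_K M_NL_K M_N_LK C2(1) A5(1)]
 show ?thesis
  by (rule bimap_tensor4_eqI[OF assms M_N_LK C1(1) C3(1)])
   (simp add: C1(2) C2(2) C3(2) A1(2) A2(2) A3(2) A4(2) A5(2) Id_bimap(2) Assoc_bimap(2)[OF a(1-3)] Assoc_bimap(2)[OF a(2-4)]
    pu_laws(1)[OF a(1,2)] pu_laws(1)[OF a(2,3)] pu_laws(1)[OF a(3,4)] pu_laws(1)[OF MN a(3)] pu_laws(1)[OF a(1) NL]
    pu_laws(1)[OF NL a(4)] pu_laws(1)[OF a(2) LK] pu_laws(1)[OF MN_L a(4)] pu_laws(1)[OF MN LK] pu_laws(1)[OF M_NL a(4)] del: zz_category_simps)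
qed

lemma triangle_zz:
 assumes "zzb M" "zzb N"
 shows "Comp ZC (TenM ZC (Id ZC M) (Lunit ZC N)) (Assoc ZC M (zz_regular n) N) = TenM ZC (Runit ZC M) (Id ZC N)"
proof -
 note R = zzb_regular
 note MR = zzb_tensor[OF assms(1) R] and RN = zzb_tensor[OF R assms(2)] and MN = zzb_tensor[OF assms]
 note T1 = TenM_bimap[OF assms(1) RN assms Id_bimap(1)[OF assms(1)] Lunit_bimap(1)[OF assms(2)]]
  and T2 = TenM_bimap[OF MR assms(2) assms Runit_bimap(1)[OF assms(1)] Id_bimap(1)[OF assms(2)]]
  and A = Assoc_bimap[OF assms(1) R assms(2)]
 note C = Comp_bimap[OF zzb_tensor[OF MR assms(2)] zzb_tensor[OF assms(1) RN] MN A(1) T1(1)]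
 show ?thesis
  by (rule bimap_tensor3_eqI[OF assms(1) R assms(2) MN C(1) T2(1)])
   (auto simp: C(2) A(2) T1(2) T2(2) Id_bimap(2) Lunit_bimap(2)[OF assms(2)] Runit_bimap(2)[OF assms(1)]
    bcar_regular pu_laws[OF assms(1) R] pu_laws[OF R assms(2)] pu_laws[OF assms] pu_laws[OF MR assms(2)] regular_closed simp del: zz_category_simps)
qed

lemma TenM_Comp_zz:
 assumes "zzb a" "zzb a'" "zzb a''" "zzb b" "zzb b'" "zzb b''"
  and f: "f \<in> bimaps n a a'" "f' \<in> bimaps n a' a''" "g \<in> bimaps n b b'" "g' \<in> bimaps n b' b''"
 shows "Comp ZC (TenM ZC f' g') (TenM ZC f g) = TenM ZC (Comp ZC f' f) (Comp ZC g' g)"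
proof -
 note z = assms(1-6)
 note ff = Comp_bimap[OF z(1-3) f(1,2)] and gg = Comp_bimap[OF z(4-6) f(3,4)]
 note T1 = TenM_bimap[OF z(1,4,2,5) f(1,3)] and T2 = TenM_bimap[OF z(2,5,3,6) f(2,4)]
  and T3 = TenM_bimap[OF z(1,4,3,6) ff(1) gg(1)]
 note t = zzb_tensor[OF z(1,4)] zzb_tensor[OF z(2,5)] zzb_tensor[OF z(3,6)]
 note C = Comp_bimap[OF t T1(1) T2(1)]
 show ?thesis
  by (rule bimap_tensor_eqI[OF z(1,4) t(3) C(1) T3(1)])
   (simp add: C(2) T1(2) T2(2) T3(2) ff(2) gg(2) pu_laws(1)[OF z(1,4)] bimapsD(3)[OF f(1) z(1,2)] bimapsD(3)[OF f(3) z(4,5)] del: zz_category_simps)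
qed

lemma Assoc_natural_zz:
 assumes "zzb a" "zzb a'" "zzb b" "zzb b'" "zzb c" "zzb c'"
  and f: "f \<in> bimaps n a a'" "g \<in> bimaps n b b'" "h \<in> bimaps n c c'"
 shows "Comp ZC (Assoc ZC a' b' c') (TenM ZC (TenM ZC f g) h) = Comp ZC (TenM ZC f (TenM ZC g h)) (Assoc ZC a b c)"
proof -
 note z = assms(1-6)
 note t = zzb_tensor[OF z(1,3)] zzb_tensor[OF z(2,4)] zzb_tensor[OF z(3,5)] zzb_tensor[OF z(4,6)]
 note fg = TenM_bimap[OF z(1,3,2,4) f(1,2)] and gh = TenM_bimap[OF z(3,5,4,6) f(2,3)]
 note l = TenM_bimap[OF t(1) z(5) t(2) z(6) fg(1) f(3)] and r = TenM_bimap[OF z(1) t(3) z(2) t(4) f(1) gh(1)]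
 note A = Assoc_bimap[OF z(1,3,5)] and A' = Assoc_bimap[OF z(2,4,6)]
 note C1 = Comp_bimap[OF zzb_tensor[OF t(1) z(5)] zzb_tensor[OF t(2) z(6)] zzb_tensor[OF z(2) t(4)] l(1) A'(1)]
  and C2 = Comp_bimap[OF zzb_tensor[OF t(1) z(5)] zzb_tensor[OF z(1) t(3)] zzb_tensor[OF z(2) t(4)] A(1) r(1)]
 show ?thesis
  by (rule bimap_tensor3_eqI[OF z(1,3,5) zzb_tensor[OF z(2) t(4)] C1(1) C2(1)])
   (simp add: C1(2) C2(2) l(2) r(2) A(2) A'(2) fg(2) gh(2) pu_laws(1)[OF z(1,3)] pu_laws(1)[OF z(3,5)] pu_laws(1)[OF t(1) z(5)]
    bimapsD(3)[OF f(1) z(1,2)] bimapsD(3)[OF f(2) z(3,4)] bimapsD(3)[OF f(3) z(5,6)] del: zz_category_simps)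
qed

lemma linear_monoidal_category_zz: "linear_monoidal_category ZC"
proof
 fix a b c d a' b' c' a'' b'' f g h f' g' and r s :: real
 note zz = zz_objects_zzb
 note nosimp = zz_category_simps(3-7)
 let ?O = "Obj ZC" and ?H = "Hom ZC"
 have O: "M \<in> ?O ==> zzb M" for M by (simp add: zz_objects_zzb)
 note B = bimapsD[OF _ O O, of f a b] bimapsD[OF _ O O, of f' a b] bimapsD[OF _ O O, of g a b] bimapsD[OF _ O O, of h a b]
  bimapsD[OF _ O O, of g b c] bimapsD[OF _ O O, of g' b c] bimapsD[OF _ O O, of h c d]
 show "a \<in> ?O ==> Id ZC a \<in> ?H a a"
  using Id_bimap(1)[OF O] by simp
 show c: "a \<in> ?O ==> b \<in> ?O ==> c \<in> ?O ==> f \<in> ?H a b ==> g \<in> ?H b c ==> Comp ZC g f \<in> ?H a c" for a b c f g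
  using Comp_bimap(1)[OF O O O] by simp
 show "a \<in> ?O ==> b \<in> ?O ==> f \<in> ?H a b ==> Comp ZC f (Id ZC a) = f"
  by (rule bimap_eqI[of _ a b]) (use Comp_bimap[OF O O O, of a a b] Id_bimap(1)[OF O, of a] Id_bimap(2)[of _ a] in \<open>simp_all del: nosimp\<close>)
 show "a \<in> ?O ==> b \<in> ?O ==> f \<in> ?H a b ==> Comp ZC (Id ZC b) f = f"
  by (rule bimap_eqI[of _ a b])
   (use Comp_bimap[OF O O O, of a b b] Id_bimap(1)[OF O, of b] Id_bimap(2)[of _ b] bimapsD(3)[OF _ O O, of f a b] in \<open>simp_all del: nosimp\<close>)
 show "a \<in> ?O ==> b \<in> ?O ==> c \<in> ?O ==> d \<in> ?O ==> f \<in> ?H a b ==> g \<in> ?H b c ==> h \<in> ?H c d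
   ==> Comp ZC (Comp ZC h g) f = Comp ZC h (Comp ZC g f)"
  by (simp add: B cong: mk_bimap_full_cong)
 show "a \<in> ?O ==> b \<in> ?O ==> Zero ZC a b \<in> ?H a b"
  using Zero_bimap(1)[OF O O] by simp
 show "a \<in> ?O ==> b \<in> ?O ==> f \<in> ?H a b ==> g \<in> ?H a b ==> Add ZC f g \<in> ?H a b"
  using Add_bimap(1)[OF O O] by simp
 show "a \<in> ?O ==> b \<in> ?O ==> f \<in> ?H a b ==> Scale ZC r f \<in> ?H a b"
  using Scale_bimap(1)[OF O O] by simp
 note eq = bimap_eqI[of _ a b] bimap_eqI[of _ a c]
 note laws = zz_laws[OF O, of b] zz_laws[OF O, of c] zz_add_laws[OF O, of b] zz_add_laws[OF O, of c]
 show "a \<in> ?O ==> b \<in> ?O ==> f \<in> ?H a b ==> g \<in> ?H a b ==> h \<in> ?H a b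
   ==> Add ZC (Add ZC f g) h = Add ZC f (Add ZC g h)"
  by (simp add: B zz_add_laws(1)[OF O, of b] cong: mk_bimap_full_cong)
 show "a \<in> ?O ==> b \<in> ?O ==> f \<in> ?H a b ==> g \<in> ?H a b ==> Add ZC f g = Add ZC g f"
  by (simp add: B) (rule mk_bimap_cong, simp add: B zz_add_laws(2)[OF O, of b])
 show "a \<in> ?O ==> b \<in> ?O ==> f \<in> ?H a b ==> Add ZC f (Zero ZC a b) = f"
  by (rule eq(1)) (use Add_bimap[OF O O, of a b] Zero_bimap(1)[OF O O, of a b] Zero_bimap(2)[where M = a and N = b] zz_laws(3)[OF O, of b] B(3) in \<open>simp_all del: nosimp\<close>)
 show "a \<in> ?O ==> b \<in> ?O ==> f \<in> ?H a b ==> Scale ZC 0 f = Zero ZC a b"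
  by (rule eq(1)) (use Scale_bimap[OF O O, of a b] Zero_bimap(1)[OF O O, of a b] Zero_bimap(2)[where M = a and N = b] zz_laws(13)[OF O, of b] B(3)
    in \<open>simp_all add: zz_scalar_zero del: nosimp\<close>)
 show "a \<in> ?O ==> b \<in> ?O ==> f \<in> ?H a b ==> Scale ZC 1 f = f"
  by (rule eq(1)) (use Scale_bimap[OF O O, of a b] zz_laws(17)[OF O, of b] B(3)
    in \<open>simp_all add: zz_scalar_one del: nosimp\<close>)
 show "a \<in> ?O ==> b \<in> ?O ==> f \<in> ?H a b ==> Scale ZC r (Scale ZC s f) = Scale ZC (r * s) f"
  by (simp add: B zz_laws(15)[OF O, of b] zz_scalar_mult cong: mk_bimap_full_cong)
 show "a \<in> ?O ==> b \<in> ?O ==> f \<in> ?H a b ==> Scale ZC (r + s) f = Add ZC (Scale ZC r f) (Scale ZC s f)"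
  by (simp add: B zz_laws(11)[OF O, of b] zz_scalar_add cong: mk_bimap_full_cong)
 show "a \<in> ?O ==> b \<in> ?O ==> f \<in> ?H a b ==> g \<in> ?H a b ==> Scale ZC r (Add ZC f g) = Add ZC (Scale ZC r f) (Scale ZC r g)"
  by (simp add: B zz_laws(7)[OF O, of b] cong: mk_bimap_full_cong)
 show "a \<in> ?O ==> b \<in> ?O ==> c \<in> ?O ==> f \<in> ?H a b ==> f' \<in> ?H a b ==> g \<in> ?H b c
   ==> Comp ZC g (Add ZC f f') = Add ZC (Comp ZC g f) (Comp ZC g f')"
  by (simp add: B cong: mk_bimap_full_cong)
 show "a \<in> ?O ==> b \<in> ?O ==> c \<in> ?O ==> f \<in> ?H a b ==> g \<in> ?H b c ==> g' \<in> ?H b c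
   ==> Comp ZC (Add ZC g g') f = Add ZC (Comp ZC g f) (Comp ZC g' f)"
  by (simp add: B cong: mk_bimap_full_cong)
 show "a \<in> ?O ==> b \<in> ?O ==> c \<in> ?O ==> f \<in> ?H a b ==> g \<in> ?H b c
   ==> Comp ZC g (Scale ZC r f) = Scale ZC r (Comp ZC g f)"
  by (simp add: B cong: mk_bimap_full_cong)
 show "a \<in> ?O ==> b \<in> ?O ==> c \<in> ?O ==> f \<in> ?H a b ==> g \<in> ?H b c
   ==> Comp ZC (Scale ZC r g) f = Scale ZC r (Comp ZC g f)"
  by (simp add: B cong: mk_bimap_full_cong)
 show "Unit ZC \<in> ?O" by (simp add: zz_objects.unit)
 show "a \<in> ?O ==> b \<in> ?O ==> TenO ZC a b \<in> ?O" by (simp add: zz_objects.tensor)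
 show "a \<in> ?O ==> a' \<in> ?O ==> b \<in> ?O ==> b' \<in> ?O ==> f \<in> ?H a a' ==> g \<in> ?H b b'
   ==> TenM ZC f g \<in> ?H (TenO ZC a b) (TenO ZC a' b')"
  using TenM_bimap(1)[OF O O O O] by simp
 show "a \<in> ?O ==> b \<in> ?O ==> TenM ZC (Id ZC a) (Id ZC b) = Id ZC (TenO ZC a b)"
 proof -
  assume "a \<in> ?O" "b \<in> ?O"
  then have z: "zzb a" "zzb b" by (simp_all add: zz_objects_zzb)
  note T = TenM_bimap[OF z z Id_bimap(1)[OF z(1)] Id_bimap(1)[OF z(2)]]
  have "TenM ZC (Id ZC a) (Id ZC b) = Id ZC (ZT a b)"
   by (rule bimap_tensor_eqI[OF z zzb_tensor[OF z] T(1) Id_bimap(1)[OF zzb_tensor[OF z]]])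
    (simp add: T(2) Id_bimap(2) pu_laws(1)[OF z] del: nosimp)
  then show ?thesis by (simp del: nosimp)
 qed
 show "a \<in> ?O ==> a' \<in> ?O ==> a'' \<in> ?O ==> b \<in> ?O ==> b' \<in> ?O ==> b'' \<in> ?O ==> f \<in> ?H a a' ==> f' \<in> ?H a' a''
   ==> g \<in> ?H b b' ==> g' \<in> ?H b' b'' ==> Comp ZC (TenM ZC f' g') (TenM ZC f g) = TenM ZC (Comp ZC f' f) (Comp ZC g' g)"
  using TenM_Comp_zz[OF O O O O O O] by (simp del: nosimp)
 show "a \<in> ?O ==> a' \<in> ?O ==> b \<in> ?O ==> b' \<in> ?O ==> f \<in> ?H a a' ==> f' \<in> ?H a a' ==> g \<in> ?H b b'
   ==> TenM ZC (Add ZC f f') g = Add ZC (TenM ZC f g) (TenM ZC f' g)"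
 proof -
  assume "a \<in> ?O" "a' \<in> ?O" "b \<in> ?O" "b' \<in> ?O" "f \<in> ?H a a'" "f' \<in> ?H a a'" "g \<in> ?H b b'"
  then have z: "zzb a" "zzb b" "zzb a'" "zzb b'" "f \<in> bimaps n a a'" "f' \<in> bimaps n a a'" "g \<in> bimaps n b b'"
   by (simp_all add: zz_objects_zzb)
  note A = Add_bimap[OF z(1,3,5,6)]
  note T = TenM_bimap[OF z(1-4) A(1) z(7)] TenM_bimap[OF z(1-4,5,7)] TenM_bimap[OF z(1-4,6,7)]
  note T' = Add_bimap[OF zzb_tensor[OF z(1,2)] zzb_tensor[OF z(3,4)] T(3,5)]
  show ?thesis
   by (rule bimap_tensor_eqI[OF z(1,2) zzb_tensor[OF z(3,4)] T(1) T'(1)])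
    (simp add: T T'(2) A pu_laws[OF z(1,2)] pu_laws[OF z(3,4)] bimapsD(3)[OF z(5,1,3)] bimapsD(3)[OF z(6,1,3)] bimapsD(3)[OF z(7,2,4)] del: nosimp)
 qed
 show "a \<in> ?O ==> a' \<in> ?O ==> b \<in> ?O ==> b' \<in> ?O ==> f \<in> ?H a a' ==> g \<in> ?H b b' ==> g' \<in> ?H b b'
   ==> TenM ZC f (Add ZC g g') = Add ZC (TenM ZC f g) (TenM ZC f g')"
 proof -
  assume "a \<in> ?O" "a' \<in> ?O" "b \<in> ?O" "b' \<in> ?O" "f \<in> ?H a a'" "g \<in> ?H b b'" "g' \<in> ?H b b'"
  then have z: "zzb a" "zzb b" "zzb a'" "zzb b'" "f \<in> bimaps n a a'" "g \<in> bimaps n b b'" "g' \<in> bimaps n b b'"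
   by (simp_all add: zz_objects_zzb)
  note A = Add_bimap[OF z(2,4,6,7)]
  note T = TenM_bimap[OF z(1-4,5) A(1)] TenM_bimap[OF z(1-4,5,6)] TenM_bimap[OF z(1-4,5,7)]
  note T' = Add_bimap[OF zzb_tensor[OF z(1,2)] zzb_tensor[OF z(3,4)] T(3,5)]
  show ?thesis
   by (rule bimap_tensor_eqI[OF z(1,2) zzb_tensor[OF z(3,4)] T(1) T'(1)])
    (simp add: T T'(2) A pu_laws[OF z(1,2)] pu_laws[OF z(3,4)] bimapsD(3)[OF z(5,1,3)] bimapsD(3)[OF z(6,2,4)] bimapsD(3)[OF z(7,2,4)] del: nosimp)
 qed
 show "a \<in> ?O ==> a' \<in> ?O ==> b \<in> ?O ==> b' \<in> ?O ==> f \<in> ?H a a' ==> g \<in> ?H b b'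
   ==> TenM ZC (Scale ZC r f) g = Scale ZC r (TenM ZC f g)"
  "a \<in> ?O ==> a' \<in> ?O ==> b \<in> ?O ==> b' \<in> ?O ==> f \<in> ?H a a' ==> g \<in> ?H b b'
   ==> TenM ZC f (Scale ZC r g) = Scale ZC r (TenM ZC f g)"
 proof -
  assume "a \<in> ?O" "a' \<in> ?O" "b \<in> ?O" "b' \<in> ?O" "f \<in> ?H a a'" "g \<in> ?H b b'"
  then have z: "zzb a" "zzb b" "zzb a'" "zzb b'" "f \<in> bimaps n a a'" "g \<in> bimaps n b b'"
   by (simp_all add: zz_objects_zzb)
  note A = Scale_bimap[OF z(1,3,5), where r = r] and A' = Scale_bimap[OF z(2,4,6), where r = r]
  note T = TenM_bimap[OF z(1-4) A(1) z(6)] TenM_bimap[OF z(1-6)] TenM_bimap[OF z(1-4) z(5) A'(1)]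
  note T' = Scale_bimap[OF zzb_tensor[OF z(1,2)] zzb_tensor[OF z(3,4)] T(3), where r = r]
  note c = bimapsD(3)[OF z(5,1,3)] bimapsD(3)[OF z(6,2,4)]
  \<comment> \<open>The equality of left and right real scalars carries the scalar to the first
    factor, on which the tensor product is acted.\<close>
  have mid: "pu a' b' x (lact b' (zz_scalar n r) y) = pu a' b' (lact a' (zz_scalar n r) x) y"
   if "x \<in> bcar a'" "y \<in> bcar b'" for x y
   using that pu_laws(6)[OF z(3,4), of x "zz_scalar n r" y] zz_laws(20)[OF z(3)] by simp
  show "TenM ZC (Scale ZC r f) g = Scale ZC r (TenM ZC f g)"
   by (rule bimap_tensor_eqI[OF z(1,2) zzb_tensor[OF z(3,4)] T(1) T'(1)])
    (simp add: T T'(2) A pu_laws[OF z(1,2)] pu_laws[OF z(3,4)] c del: nosimp)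
  show "TenM ZC f (Scale ZC r g) = Scale ZC r (TenM ZC f g)"
   by (rule bimap_tensor_eqI[OF z(1,2) zzb_tensor[OF z(3,4)] T(5) T'(1)])
    (simp add: T T'(2) A' pu_laws[OF z(1,2)] pu_laws(7)[OF z(3,4)] mid c del: nosimp)
 qed
 show "a \<in> ?O ==> b \<in> ?O ==> c \<in> ?O ==> is_iso ZC (TenO ZC (TenO ZC a b) c) (TenO ZC a (TenO ZC b c)) (Assoc ZC a b c)"
  using Assoc_is_iso(1)[OF O O O] by simp
 show "a \<in> ?O ==> is_iso ZC (TenO ZC (Unit ZC) a) a (Lunit ZC a)"
  using Lunit_is_iso[OF O] by simp
 show "a \<in> ?O ==> is_iso ZC (TenO ZC a (Unit ZC)) a (Runit ZC a)"
  using Runit_is_iso[OF O] by simp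
 show "a \<in> ?O ==> a' \<in> ?O ==> b \<in> ?O ==> b' \<in> ?O ==> c \<in> ?O ==> c' \<in> ?O ==> f \<in> ?H a a' ==> g \<in> ?H b b' ==> h \<in> ?H c c'
   ==> Comp ZC (Assoc ZC a' b' c') (TenM ZC (TenM ZC f g) h) = Comp ZC (TenM ZC f (TenM ZC g h)) (Assoc ZC a b c)"
  using Assoc_natural_zz[OF O O O O O O] by (simp del: nosimp)
 show "a \<in> ?O ==> b \<in> ?O ==> f \<in> ?H a b ==> Comp ZC (Lunit ZC b) (TenM ZC (Id ZC (Unit ZC)) f) = Comp ZC f (Lunit ZC a)"
  "a \<in> ?O ==> b \<in> ?O ==> f \<in> ?H a b ==> Comp ZC (Runit ZC b) (TenM ZC f (Id ZC (Unit ZC))) = Comp ZC f (Runit ZC a)"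
 proof -
  assume "a \<in> ?O" "b \<in> ?O" "f \<in> ?H a b"
  then have z: "zzb a" "zzb b" "f \<in> bimaps n a b" by (simp_all add: zz_objects_zzb)
  note R = zzb_regular
  note Ra = zzb_tensor[OF R z(1)] and Rb = zzb_tensor[OF R z(2)] and aR = zzb_tensor[OF z(1) R] and bR = zzb_tensor[OF z(2) R]
  note T = TenM_bimap[OF R z(1) R z(2) Id_bimap(1)[OF R] z(3)] and T' = TenM_bimap[OF z(1) R z(2) R z(3) Id_bimap(1)[OF R]]
  note C = Comp_bimap[OF Ra Rb z(2) T(1) Lunit_bimap(1)[OF z(2)]] Comp_bimap[OF Ra z(1,2) Lunit_bimap(1)[OF z(1)] z(3)]
  note C' = Comp_bimap[OF aR bR z(2) T'(1) Runit_bimap(1)[OF z(2)]] Comp_bimap[OF aR z(1,2) Runit_bimap(1)[OF z(1)] z(3)]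
  have "Comp ZC (Lunit ZC b) (TenM ZC (Id ZC (zz_regular n)) f) = Comp ZC f (Lunit ZC a)"
   by (rule bimap_tensor_eqI[OF R z(1,2) C(1,3)])
    (auto simp: C T Id_bimap(2) Lunit_bimap(2)[OF z(2)] Lunit_bimap(2)[OF z(1)] bimapsD[OF z(3,1,2)] bcar_regular regular_closed
     pu_laws[OF R z(1)] simp del: nosimp)
  then show "Comp ZC (Lunit ZC b) (TenM ZC (Id ZC (Unit ZC)) f) = Comp ZC f (Lunit ZC a)" by (simp del: nosimp)
  have "Comp ZC (Runit ZC b) (TenM ZC f (Id ZC (zz_regular n))) = Comp ZC f (Runit ZC a)"
   by (rule bimap_tensor_eqI[OF z(1) R z(2) C'(1,3)])
    (auto simp: C' T' Id_bimap(2) Runit_bimap(2)[OF z(2)] Runit_bimap(2)[OF z(1)] bimapsD[OF z(3,1,2)] bcar_regular regular_closed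
     pu_laws[OF z(1) R] simp del: nosimp)
  then show "Comp ZC (Runit ZC b) (TenM ZC f (Id ZC (Unit ZC))) = Comp ZC f (Runit ZC a)" by (simp del: nosimp)
 qed
 show "a \<in> ?O ==> b \<in> ?O ==> c \<in> ?O ==> d \<in> ?O
   ==> Comp ZC (Assoc ZC a b (TenO ZC c d)) (Assoc ZC (TenO ZC a b) c d)
    = Comp ZC (TenM ZC (Id ZC a) (Assoc ZC b c d)) (Comp ZC (Assoc ZC a (TenO ZC b c) d) (TenM ZC (Assoc ZC a b c) (Id ZC d)))"
  using pentagon_zz[OF O O O O] by (simp del: nosimp)
 show "a \<in> ?O ==> b \<in> ?O ==> Comp ZC (TenM ZC (Id ZC a) (Lunit ZC b)) (Assoc ZC a (Unit ZC) b) = TenM ZC (Runit ZC a) (Id ZC b)"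
  using triangle_zz[OF O O] by (simp del: nosimp)
qed

end

section \<open>The diagrammatic category is linear monoidal\<close>

text \<open>Vertex 1 has to keep its numeral form in the computations with colours.\<close>

declare One_nat_def [simp del]

text \<open>A diagram has only one boundary, and it can be read off the term. Hence the boundary
  left existential in \<open>dclass\<close> is determined by the diagram.\<close>

fun dsrc :: "dmor => nat list" and dtgt :: "dmor => nat list" where
 "dsrc (DId w) = w" | "dtgt (DId w) = w"
| "dsrc (Box f) = []" | "dtgt (Box f) = []"
| "dsrc (StartDot s) = []" | "dtgt (StartDot s) = [s]"
| "dsrc (EndDot s) = [s]" | "dtgt (EndDot s) = []"
| "dsrc (Merge s) = [s, s]" | "dtgt (Merge s) = [s]"
| "dsrc (Split s) = [s]" | "dtgt (Split s) = [s, s]"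
| "dsrc (Cup s) = []" | "dtgt (Cup s) = [s, s]"
| "dsrc (Cap s) = [s, s]" | "dtgt (Cap s) = []"
| "dsrc (Vert s t) = alt (coxm s t) s t" | "dtgt (Vert s t) = alt (coxm s t) t s"
| "dsrc (DComp g f) = dsrc f" | "dtgt (DComp g f) = dtgt g"
| "dsrc (DTen f g) = dsrc f @ dsrc g" | "dtgt (DTen f g) = dtgt f @ dtgt g"
| "dsrc (DZero u v) = u" | "dtgt (DZero u v) = v"
| "dsrc (DAdd f g) = dsrc f" | "dtgt (DAdd f g) = dtgt f"
| "dsrc (DScale r f) = dsrc f" | "dtgt (DScale r f) = dtgt f"

lemma diagram_boundary: "diagram n w v f ==> w = dsrc f \<and> v = dtgt f"
 by (induction rule: diagram.induct) auto

lemma set_alt: "set (alt k s t) \<subseteq> {s, t}"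
 by (induction k s t rule: alt.induct) auto

lemma diagram_words: "diagram n w v f ==> set w \<subseteq> {1..n} \<and> set v \<subseteq> {1..n}"
proof (induction rule: diagram.induct)
 case (9 s t)
 then show ?case using set_alt[of "coxm s t" s t] set_alt[of "coxm s t" t s] by auto
qed auto

lemma diagram_Ten: "diagram n u v f ==> diagram n u' v' g ==> w = u @ u' ==> w' = v @ v' ==> diagram n w w' (DTen f g)"
 by (simp add: diagram.intros)

lemma dequiv_diagram: "dequiv n w v f g ==> diagram n w v f \<and> diagram n w v g"
 by (induction rule: dequiv.induct) (auto intro: diagram.intros)

text \<open>Both diagrams determine the same boundary, so the existential boundaries in the two
  classes can be matched, and symmetry and transitivity apply.\<close>

lemma dequiv_dclass: assumes "dequiv n w v f g" shows "dclass n f = dclass n g"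
proof -
 have "(\<exists>w v. dequiv n w v f h) \<longleftrightarrow> (\<exists>w v. dequiv n w v g h)" for h
 proof -
  have b: "w' = w \<and> v' = v" if "dequiv n w' v' f h" for w' v'
   using dequiv_diagram[OF that] dequiv_diagram[OF assms] diagram_boundary by metis
  have c: "w' = w \<and> v' = v" if "dequiv n w' v' g h" for w' v'
   using dequiv_diagram[OF that] dequiv_diagram[OF assms] diagram_boundary by metis
  show ?thesis using b c assms dequiv.sym dequiv.trans by metis
 qed
 then show ?thesis by (simp add: dclass_def)
qed

lemma dclass_self: "diagram n w v f ==> f \<in> dclass n f"
 unfolding dclass_def using dequiv.refl by blast

lemma in_dclass: assumes "diagram n w v f" "g \<in> dclass n f" shows "dequiv n w v f g"
proof -
 obtain w' v' where d: "dequiv n w' v' f g" using assms(2) by (auto simp: dclass_def)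
 then have "w' = w" "v' = v" using dequiv_diagram[OF d] assms(1) diagram_boundary by blast+
 then show ?thesis using d by simp
qed

lemma dclass_linear: "linear_relation f g ==> diagram n w v f ==> diagram n w v g ==> dclass n f = dclass n g"
 by (rule dequiv_dclass) (rule dequiv.base; simp)

abbreviation SC where "SC n \<equiv> soergel_category n"

text \<open>Operations on classes are unions over all representatives. By congruence every
  representative contributes the same class, so the union is that class.\<close>

lemma UN_constant: "x0 \<in> A ==> (\<And>x. x \<in> A ==> f x = c) ==> (\<Union>x\<in>A. f x) = c"
 by blast

lemma soergel_simps [simp]:
 "Obj (SC n) = {w. set w \<subseteq> {1..n}}" "Hom (SC n) w v = dclass n ` {f. diagram n w v f}"
 "Id (SC n) w = dclass n (DId w)" "Zero (SC n) w v = dclass n (DZero w v)"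
 "Unit (SC n) = []" "TenO (SC n) u v = u @ v" "Assoc (SC n) u v w = dclass n (DId (u @ v @ w))"
 "Lunit (SC n) w = dclass n (DId w)" "Runit (SC n) w = dclass n (DId w)"
 "HomDeg (SC n) d w v = dclass n ` {f. diagram n w v f \<and> dhomogeneous d f}"
 by (simp_all add: soergel_category_def)

lemma Comp_dclass: assumes "diagram n u v f" "diagram n v w g"
 shows "Comp (SC n) (dclass n g) (dclass n f) = dclass n (DComp g f)"
 unfolding soergel_category_def moncat.simps
 by (intro UN_constant[OF dclass_self[OF assms(2)]] UN_constant[OF dclass_self[OF assms(1)]] dequiv_dclass[OF dequiv.comp[OF in_dclass[OF assms(1)] in_dclass[OF assms(2)]], symmetric])

lemma Add_dclass: assumes "diagram n u v f" "diagram n u v g"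
 shows "Add (SC n) (dclass n f) (dclass n g) = dclass n (DAdd f g)"
 unfolding soergel_category_def moncat.simps
 by (intro UN_constant[OF dclass_self[OF assms(2)]] UN_constant[OF dclass_self[OF assms(1)]] dequiv_dclass[OF dequiv.add[OF in_dclass[OF assms(1)] in_dclass[OF assms(2)]], symmetric])

lemma Scale_dclass: assumes "diagram n u v f"
 shows "Scale (SC n) r (dclass n f) = dclass n (DScale r f)"
 unfolding soergel_category_def moncat.simps
 by (intro UN_constant[OF dclass_self[OF assms]] dequiv_dclass[OF dequiv.scale[OF in_dclass[OF assms]], symmetric])

lemma TenM_dclass: assumes "diagram n u v f" "diagram n u' v' g"
 shows "TenM (SC n) (dclass n f) (dclass n g) = dclass n (DTen f g)"
 unfolding soergel_category_def moncat.simps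
 by (intro UN_constant[OF dclass_self[OF assms(2)]] UN_constant[OF dclass_self[OF assms(1)]] dequiv_dclass[OF dequiv.ten[OF in_dclass[OF assms(1)] in_dclass[OF assms(2)]], symmetric])

lemma Comp_DId:
 assumes "diagram n w v f"
 shows "Comp (SC n) (dclass n f) (dclass n (DId w)) = dclass n f" "Comp (SC n) (dclass n (DId v)) (dclass n f) = dclass n f"
proof -
 have i: "diagram n w w (DId w)" "diagram n v v (DId v)"
  using diagram_words[OF assms] by (auto intro: diagram.intros)
 have c: "diagram n w v (DComp f (DId w))" "diagram n w v (DComp (DId v) f)"
  using i assms by (auto intro: diagram.intros)
 show "Comp (SC n) (dclass n f) (dclass n (DId w)) = dclass n f"
  unfolding Comp_dclass[OF i(1) assms] by (rule dclass_linear[OF linear_relation.intros(1) c(1) assms])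
 show "Comp (SC n) (dclass n (DId v)) (dclass n f) = dclass n f"
  unfolding Comp_dclass[OF assms i(2)] by (rule dclass_linear[OF linear_relation.intros(2) c(2) assms])
qed

lemma TenM_DId:
 "set u \<subseteq> {1..n} ==> set v \<subseteq> {1..n} ==> TenM (SC n) (dclass n (DId u)) (dclass n (DId v)) = dclass n (DId (u @ v))"
 by (subst TenM_dclass[of n u u _ v v])
  (auto intro!: diagram.intros(1) dclass_linear[OF linear_relation.intros(7), of n "u @ v" "u @ v"] diagram_Ten simp: subset_iff)

text \<open>With the boundaries computed by \<open>dsrc\<close> and \<open>dtgt\<close>, typing a
  diagram becomes a rewriting problem instead of a search for a derivation.\<close>

definition wfd :: "nat => dmor => bool" where
 "wfd n f \<longleftrightarrow> diagram n (dsrc f) (dtgt f) f"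

lemma diagram_iff: "diagram n w v f \<longleftrightarrow> wfd n f \<and> w = dsrc f \<and> v = dtgt f"
 unfolding wfd_def using diagram_boundary by blast

lemma wfd_intros:
 "set w \<subseteq> {1..n} ==> wfd n (DId w)"
 "set u \<subseteq> {1..n} ==> set v \<subseteq> {1..n} ==> wfd n (DZero u v)"
 "wfd n f ==> wfd n g ==> dtgt f = dsrc g ==> wfd n (DComp g f)"
 "wfd n f ==> wfd n g ==> dtgt f = dtgt g ==> dsrc f = dsrc g ==> wfd n (DAdd f g)"
 "wfd n f ==> wfd n g ==> wfd n (DTen f g)" "wfd n f ==> wfd n (DScale r f)"
 using diagram.intros(1,12)[of _ n] diagram.intros(10,13)[of n "dsrc f" "dtgt f" f] diagram.intros(11)[of n "dsrc f" "dtgt f" f]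
  diagram.intros(14)[of n "dsrc f" "dtgt f" f]
 by (simp_all add: wfd_def)

lemma wfd_words: "wfd n f ==> set (dsrc f) \<subseteq> {1..n}" "wfd n f ==> set (dtgt f) \<subseteq> {1..n}"
 using diagram_words unfolding wfd_def by blast+

lemma ops_wfd:
 "wfd n f ==> wfd n g ==> dtgt f = dsrc g ==> Comp (SC n) (dclass n g) (dclass n f) = dclass n (DComp g f)"
 "wfd n f ==> wfd n g ==> dtgt f = dtgt g ==> dsrc f = dsrc g ==> Add (SC n) (dclass n f) (dclass n g) = dclass n (DAdd f g)"
 "wfd n f ==> Scale (SC n) r (dclass n f) = dclass n (DScale r f)"
 "wfd n f ==> wfd n g ==> TenM (SC n) (dclass n f) (dclass n g) = dclass n (DTen f g)"
 unfolding wfd_def by (simp_all add: Comp_dclass Add_dclass Scale_dclass TenM_dclass)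

lemma dclass_wfd:
 "linear_relation f g ==> wfd n f ==> wfd n g ==> dsrc f = dsrc g ==> dtgt f = dtgt g ==> dclass n f = dclass n g"
 unfolding wfd_def by (rule dclass_linear) simp_all

lemma DId_is_iso: "set w \<subseteq> {1..n} ==> is_iso (SC n) w w (dclass n (DId w))"
 unfolding is_iso_def using Comp_DId[of n w w "DId w"] diagram.intros(1)[of w n] by auto

lemma linear_monoidal_category_soergel: "linear_monoidal_category (SC n)"
proof
 fix a b c d a' b' c' a'' b'' :: "nat list" and F G H F' G' :: "dmor set" and r s :: real
 let ?O = "Obj (SC n)" and ?H = "Hom (SC n)"
 note di = diagram.intros(1,10-14)
 note lr = linear_relation.intros
 show "a \<in> ?O ==> Id (SC n) a \<in> ?H a a" by (auto intro: di)
 show "a \<in> ?O ==> b \<in> ?O ==> c \<in> ?O ==> F \<in> ?H a b ==> G \<in> ?H b c ==> Comp (SC n) G F \<in> ?H a c"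
  by (auto simp: Comp_dclass intro!: imageI di)
 show "a \<in> ?O ==> b \<in> ?O ==> F \<in> ?H a b ==> Comp (SC n) F (Id (SC n) a) = F"
  "a \<in> ?O ==> b \<in> ?O ==> F \<in> ?H a b ==> Comp (SC n) (Id (SC n) b) F = F"
  by (auto simp: Comp_DId)
 show "a \<in> ?O ==> b \<in> ?O ==> c \<in> ?O ==> d \<in> ?O ==> F \<in> ?H a b ==> G \<in> ?H b c ==> H \<in> ?H c d
  ==> Comp (SC n) (Comp (SC n) H G) F = Comp (SC n) H (Comp (SC n) G F)"
  by (clarsimp simp: diagram_iff ops_wfd wfd_intros wfd_words) (rule dclass_wfd[OF lr(3)]; simp add: wfd_intros wfd_words)
 show "a \<in> ?O ==> b \<in> ?O ==> Zero (SC n) a b \<in> ?H a b" by (auto intro: di)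
 show "a \<in> ?O ==> b \<in> ?O ==> F \<in> ?H a b ==> G \<in> ?H a b ==> Add (SC n) F G \<in> ?H a b"
  by (auto simp: Add_dclass intro!: imageI di)
 show "a \<in> ?O ==> b \<in> ?O ==> F \<in> ?H a b ==> Scale (SC n) r F \<in> ?H a b"
  by (auto simp: Scale_dclass intro!: imageI di)
 show "a \<in> ?O ==> b \<in> ?O ==> F \<in> ?H a b ==> G \<in> ?H a b ==> H \<in> ?H a b
  ==> Add (SC n) (Add (SC n) F G) H = Add (SC n) F (Add (SC n) G H)"
  by (clarsimp simp: diagram_iff ops_wfd wfd_intros wfd_words) (rule dclass_wfd[OF lr(9)]; simp add: wfd_intros wfd_words)
 show "a \<in> ?O ==> b \<in> ?O ==> F \<in> ?H a b ==> G \<in> ?H a b ==> Add (SC n) F G = Add (SC n) G F"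
  by (clarsimp simp: diagram_iff ops_wfd wfd_intros wfd_words) (rule dclass_wfd[OF lr(10)]; simp add: wfd_intros wfd_words)
 show "a \<in> ?O ==> b \<in> ?O ==> F \<in> ?H a b ==> Add (SC n) F (Zero (SC n) a b) = F"
  by (clarsimp simp: diagram_iff ops_wfd wfd_intros wfd_words) (rule dclass_wfd[OF lr(11)]; simp add: wfd_intros wfd_words)
 show "a \<in> ?O ==> b \<in> ?O ==> F \<in> ?H a b ==> Scale (SC n) 0 F = Zero (SC n) a b"
  by (clarsimp simp: diagram_iff ops_wfd wfd_intros wfd_words) (rule dclass_wfd[OF lr(12)]; simp add: wfd_intros wfd_words)
 show "a \<in> ?O ==> b \<in> ?O ==> F \<in> ?H a b ==> Scale (SC n) 1 F = F"
  by (clarsimp simp: diagram_iff ops_wfd wfd_intros wfd_words) (rule dclass_wfd[OF lr(13)]; simp add: wfd_intros wfd_words)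
 show "a \<in> ?O ==> b \<in> ?O ==> F \<in> ?H a b ==> Scale (SC n) r (Scale (SC n) s F) = Scale (SC n) (r * s) F"
  by (clarsimp simp: diagram_iff ops_wfd wfd_intros wfd_words) (rule dclass_wfd[OF lr(14)]; simp add: wfd_intros wfd_words)
 show "a \<in> ?O ==> b \<in> ?O ==> F \<in> ?H a b ==> Scale (SC n) (r + s) F = Add (SC n) (Scale (SC n) r F) (Scale (SC n) s F)"
  by (clarsimp simp: diagram_iff ops_wfd wfd_intros wfd_words) (rule dclass_wfd[OF lr(15)]; simp add: wfd_intros wfd_words)
 show "a \<in> ?O ==> b \<in> ?O ==> F \<in> ?H a b ==> G \<in> ?H a b
  ==> Scale (SC n) r (Add (SC n) F G) = Add (SC n) (Scale (SC n) r F) (Scale (SC n) r G)"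
  by (clarsimp simp: diagram_iff ops_wfd wfd_intros wfd_words) (rule dclass_wfd[OF lr(16)]; simp add: wfd_intros wfd_words)
 show "a \<in> ?O ==> b \<in> ?O ==> c \<in> ?O ==> F \<in> ?H a b ==> F' \<in> ?H a b ==> G \<in> ?H b c
  ==> Comp (SC n) G (Add (SC n) F F') = Add (SC n) (Comp (SC n) G F) (Comp (SC n) G F')"
  by (clarsimp simp: diagram_iff ops_wfd wfd_intros wfd_words) (rule dclass_wfd[OF lr(17)]; simp add: wfd_intros wfd_words)
 show "a \<in> ?O ==> b \<in> ?O ==> c \<in> ?O ==> F \<in> ?H a b ==> G \<in> ?H b c ==> G' \<in> ?H b c
  ==> Comp (SC n) (Add (SC n) G G') F = Add (SC n) (Comp (SC n) G F) (Comp (SC n) G' F)"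
  by (clarsimp simp: diagram_iff ops_wfd wfd_intros wfd_words) (rule dclass_wfd[OF lr(18)]; simp add: wfd_intros wfd_words)
 show "a \<in> ?O ==> b \<in> ?O ==> c \<in> ?O ==> F \<in> ?H a b ==> G \<in> ?H b c
  ==> Comp (SC n) G (Scale (SC n) r F) = Scale (SC n) r (Comp (SC n) G F)"
  by (clarsimp simp: diagram_iff ops_wfd wfd_intros wfd_words) (rule dclass_wfd[OF lr(19)]; simp add: wfd_intros wfd_words)
 show "a \<in> ?O ==> b \<in> ?O ==> c \<in> ?O ==> F \<in> ?H a b ==> G \<in> ?H b c
  ==> Comp (SC n) (Scale (SC n) r G) F = Scale (SC n) r (Comp (SC n) G F)"
  by (clarsimp simp: diagram_iff ops_wfd wfd_intros wfd_words) (rule dclass_wfd[OF lr(20)]; simp add: wfd_intros wfd_words)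
 show "Unit (SC n) \<in> ?O" by simp
 show "a \<in> ?O ==> b \<in> ?O ==> TenO (SC n) a b \<in> ?O" by simp
 show "a \<in> ?O ==> a' \<in> ?O ==> b \<in> ?O ==> b' \<in> ?O ==> F \<in> ?H a a' ==> G \<in> ?H b b'
  ==> TenM (SC n) F G \<in> ?H (TenO (SC n) a b) (TenO (SC n) a' b')"
  by (auto simp: TenM_dclass intro!: imageI di)
 show "a \<in> ?O ==> b \<in> ?O ==> TenM (SC n) (Id (SC n) a) (Id (SC n) b) = Id (SC n) (TenO (SC n) a b)"
  by (simp add: TenM_DId)
 show "a \<in> ?O ==> a' \<in> ?O ==> a'' \<in> ?O ==> b \<in> ?O ==> b' \<in> ?O ==> b'' \<in> ?O ==> F \<in> ?H a a' ==> F' \<in> ?H a' a''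
  ==> G \<in> ?H b b' ==> G' \<in> ?H b' b'' ==> Comp (SC n) (TenM (SC n) F' G') (TenM (SC n) F G) = TenM (SC n) (Comp (SC n) F' F) (Comp (SC n) G' G)"
  by (clarsimp simp: diagram_iff ops_wfd wfd_intros wfd_words) (rule dclass_wfd[OF lr(8)]; simp add: wfd_intros wfd_words)
 show "a \<in> ?O ==> a' \<in> ?O ==> b \<in> ?O ==> b' \<in> ?O ==> F \<in> ?H a a' ==> F' \<in> ?H a a' ==> G \<in> ?H b b'
  ==> TenM (SC n) (Add (SC n) F F') G = Add (SC n) (TenM (SC n) F G) (TenM (SC n) F' G)"
  by (clarsimp simp: diagram_iff ops_wfd wfd_intros wfd_words) (rule dclass_wfd[OF lr(22)]; simp add: wfd_intros wfd_words)
 show "a \<in> ?O ==> a' \<in> ?O ==> b \<in> ?O ==> b' \<in> ?O ==> F \<in> ?H a a' ==> G \<in> ?H b b' ==> G' \<in> ?H b b'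
  ==> TenM (SC n) F (Add (SC n) G G') = Add (SC n) (TenM (SC n) F G) (TenM (SC n) F G')"
  by (clarsimp simp: diagram_iff ops_wfd wfd_intros wfd_words) (rule dclass_wfd[OF lr(21)]; simp add: wfd_intros wfd_words)
 show "a \<in> ?O ==> a' \<in> ?O ==> b \<in> ?O ==> b' \<in> ?O ==> F \<in> ?H a a' ==> G \<in> ?H b b'
  ==> TenM (SC n) (Scale (SC n) r F) G = Scale (SC n) r (TenM (SC n) F G)"
  by (clarsimp simp: diagram_iff ops_wfd wfd_intros wfd_words) (rule dclass_wfd[OF lr(24)]; simp add: wfd_intros wfd_words)
 show "a \<in> ?O ==> a' \<in> ?O ==> b \<in> ?O ==> b' \<in> ?O ==> F \<in> ?H a a' ==> G \<in> ?H b b'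
  ==> TenM (SC n) F (Scale (SC n) r G) = Scale (SC n) r (TenM (SC n) F G)"
  by (clarsimp simp: diagram_iff ops_wfd wfd_intros wfd_words) (rule dclass_wfd[OF lr(23)]; simp add: wfd_intros wfd_words)
 show "a \<in> ?O ==> b \<in> ?O ==> c \<in> ?O ==> is_iso (SC n) (TenO (SC n) (TenO (SC n) a b) c) (TenO (SC n) a (TenO (SC n) b c)) (Assoc (SC n) a b c)"
  "a \<in> ?O ==> is_iso (SC n) (TenO (SC n) (Unit (SC n)) a) a (Lunit (SC n) a)"
  "a \<in> ?O ==> is_iso (SC n) (TenO (SC n) a (Unit (SC n))) a (Runit (SC n) a)"
  by (simp_all add: DId_is_iso)
 show "Comp (SC n) (Assoc (SC n) a' b' c') (TenM (SC n) (TenM (SC n) F G) H) = Comp (SC n) (TenM (SC n) F (TenM (SC n) G H)) (Assoc (SC n) a b c)"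
  if that': "a \<in> ?O" "a' \<in> ?O" "b \<in> ?O" "b' \<in> ?O" "c \<in> ?O" "c' \<in> ?O" "F \<in> ?H a a'" "G \<in> ?H b b'" "H \<in> ?H c c'"
 proof -
  obtain f g h where f: "diagram n a a' f" "diagram n b b' g" "diagram n c c' h" "F = dclass n f" "G = dclass n g" "H = dclass n h"
   using that' by auto
  have d: "diagram n (a @ b @ c) (a' @ b' @ c') (DTen (DTen f g) h)" "diagram n (a @ b @ c) (a' @ b' @ c') (DTen f (DTen g h))"
   using f by (auto intro!: diagram_Ten)
  have "TenM (SC n) (TenM (SC n) F G) H = dclass n (DTen (DTen f g) h)"
   using f by (simp add: TenM_dclass[OF f(1,2)] TenM_dclass[OF diagram.intros(11)[OF f(1,2)] f(3)])
  moreover have "TenM (SC n) F (TenM (SC n) G H) = dclass n (DTen f (DTen g h))"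
   using f by (simp add: TenM_dclass[OF f(2,3)] TenM_dclass[OF f(1) diagram.intros(11)[OF f(2,3)]])
  moreover have "dclass n (DTen (DTen f g) h) = dclass n (DTen f (DTen g h))"
   by (rule dclass_linear[OF lr(6) d])
  ultimately show ?thesis using Comp_DId[OF d(1)] Comp_DId[OF d(2)] by simp
 qed
 show "a \<in> ?O ==> b \<in> ?O ==> F \<in> ?H a b ==> Comp (SC n) (Lunit (SC n) b) (TenM (SC n) (Id (SC n) (Unit (SC n))) F) = Comp (SC n) F (Lunit (SC n) a)"
 proof -
  assume "a \<in> ?O" "b \<in> ?O" "F \<in> ?H a b"
  then obtain f where f: "diagram n a b f" "F = dclass n f" by auto
  have i: "diagram n [] [] (DId [])" by (rule diagram.intros) simp
  have d: "diagram n a b (DTen (DId []) f)" using diagram.intros(11)[OF i f(1)] by simp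
  have "TenM (SC n) (dclass n (DId [])) F = dclass n f"
   using TenM_dclass[OF i f(1)] dclass_linear[OF lr(5) d f(1)] f by simp
  then show ?thesis using f Comp_DId[OF f(1)] by simp
 qed
 show "a \<in> ?O ==> b \<in> ?O ==> F \<in> ?H a b ==> Comp (SC n) (Runit (SC n) b) (TenM (SC n) F (Id (SC n) (Unit (SC n)))) = Comp (SC n) F (Runit (SC n) a)"
 proof -
  assume "a \<in> ?O" "b \<in> ?O" "F \<in> ?H a b"
  then obtain f where f: "diagram n a b f" "F = dclass n f" by auto
  have i: "diagram n [] [] (DId [])" by (rule diagram.intros) simp
  have d: "diagram n a b (DTen f (DId []))" using diagram.intros(11)[OF f(1) i] by simp
  have "TenM (SC n) F (dclass n (DId [])) = dclass n f"
   using TenM_dclass[OF f(1) i] dclass_linear[OF lr(4) d f(1)] f by simp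
  then show ?thesis using f Comp_DId[OF f(1)] by simp
 qed
 have idid: "set w \<subseteq> {1..n} ==> Comp (SC n) (dclass n (DId w)) (dclass n (DId w)) = dclass n (DId w)" for w
  by (rule Comp_DId) (rule diagram.intros)
 show "a \<in> ?O ==> b \<in> ?O ==> c \<in> ?O ==> d \<in> ?O
   ==> Comp (SC n) (Assoc (SC n) a b (TenO (SC n) c d)) (Assoc (SC n) (TenO (SC n) a b) c d)
    = Comp (SC n) (TenM (SC n) (Id (SC n) a) (Assoc (SC n) b c d)) (Comp (SC n) (Assoc (SC n) a (TenO (SC n) b c) d) (TenM (SC n) (Assoc (SC n) a b c) (Id (SC n) d)))"
  by (simp add: TenM_DId idid)
 show "a \<in> ?O ==> b \<in> ?O ==> Comp (SC n) (TenM (SC n) (Id (SC n) a) (Lunit (SC n) b)) (Assoc (SC n) a (Unit (SC n)) b) = TenM (SC n) (Runit (SC n) a) (Id (SC n) b)"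
  by (simp add: TenM_DId idid)
qed

section \<open>The functor on objects\<close>

context linear_monoidal_category
begin

lemma is_iso_Id: "a \<in> Obj C ==> is_iso C a a (Id C a)"
 unfolding is_iso_def using Id_in[of a] Comp_Id[of a a "Id C a"] by auto

lemma is_iso_Comp:
 assumes "a \<in> Obj C" "b \<in> Obj C" "c \<in> Obj C" "is_iso C a b f" "is_iso C b c g"
 shows "is_iso C a c (g \<cdot> f)"
proof -
 obtain f' where f: "f \<in> Hom C a b" "f' \<in> Hom C b a" "f' \<cdot> f = Id C a" "f \<cdot> f' = Id C b"
  using assms(4) by (auto simp: is_iso_def)
 obtain g' where g: "g \<in> Hom C b c" "g' \<in> Hom C c b" "g' \<cdot> g = Id C b" "g \<cdot> g' = Id C c"
  using assms(5) by (auto simp: is_iso_def)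
 note O = assms(1-3)
 have "(f' \<cdot> g') \<cdot> (g \<cdot> f) = f' \<cdot> ((g' \<cdot> g) \<cdot> f)"
  using O f(1,2) g(1,2) by (simp add: Comp_assoc[of a c b a] Comp_in[of a b c] Comp_assoc[of a b c b])
 moreover have "(g \<cdot> f) \<cdot> (f' \<cdot> g') = g \<cdot> ((f \<cdot> f') \<cdot> g')"
  using O f(1,2) g(1,2) by (simp add: Comp_assoc[of c a b c] Comp_in[of c b a] Comp_assoc[of c b a b])
 ultimately show ?thesis
  unfolding is_iso_def using O f g
  by (auto intro!: Comp_in[of a b c] bexI[of _ "f' \<cdot> g'"] Comp_in[of c b a] simp: Id_Comp[of a b] Id_Comp[of c b])
qed

lemma is_iso_TenM:
 assumes "a \<in> Obj C" "a' \<in> Obj C" "b \<in> Obj C" "b' \<in> Obj C" "is_iso C a a' f" "is_iso C b b' g"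
 shows "is_iso C (a \<boxtimes> b) (a' \<boxtimes> b') (f \<star> g)"
proof -
 obtain f' where f: "f \<in> Hom C a a'" "f' \<in> Hom C a' a" "f' \<cdot> f = Id C a" "f \<cdot> f' = Id C a'"
  using assms(5) by (auto simp: is_iso_def)
 obtain g' where g: "g \<in> Hom C b b'" "g' \<in> Hom C b' b" "g' \<cdot> g = Id C b" "g \<cdot> g' = Id C b'"
  using assms(6) by (auto simp: is_iso_def)
 note O = assms(1-4)
 show ?thesis
  unfolding is_iso_def using O f g
  by (auto intro!: TenM_in bexI[of _ "f' \<star> g'"] simp: TenM_Comp[of a a' a b b' b] TenM_Comp[of a' a a' b' b b'] TenM_Id)
qed

definition iso_inverse where
 "iso_inverse a b f = (SOME g. g \<in> Hom C b a \<and> g \<cdot> f = Id C a \<and> f \<cdot> g = Id C b)"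

lemma iso_inverse:
 assumes "is_iso C a b f"
 shows "iso_inverse a b f \<in> Hom C b a" "iso_inverse a b f \<cdot> f = Id C a" "f \<cdot> iso_inverse a b f = Id C b"
  "is_iso C b a (iso_inverse a b f)"
proof -
 have "\<exists>g. g \<in> Hom C b a \<and> g \<cdot> f = Id C a \<and> f \<cdot> g = Id C b"
  using assms by (auto simp: is_iso_def)
 from someI_ex[OF this] show *: "iso_inverse a b f \<in> Hom C b a" "iso_inverse a b f \<cdot> f = Id C a" "f \<cdot> iso_inverse a b f = Id C b"
  by (simp_all add: iso_inverse_def)
 then show "is_iso C b a (iso_inverse a b f)"
  using assms by (auto simp: is_iso_def)
qed

end

context type_B
begin

sublocale ZC: linear_monoidal_category "zz_category n"
 by (rule linear_monoidal_category_zz)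

text \<open>The prescribed value on a word is a tensor product bracketed to the left, from which the
  last letter is split off; the recursion therefore runs over the reversed word. The separate
  one-letter case prevents a unit factor in front.\<close>

fun Fo_rev :: "nat list => zbimod" where
 "Fo_rev [] = zz_regular n"
| "Fo_rev [s] = U_bimod n s"
| "Fo_rev (s # t # w) = ZT (Fo_rev (t # w)) (U_bimod n s)"

definition Fo :: "nat list => zbimod" where
 "Fo w = Fo_rev (rev w)"

lemma Fo_Nil [simp]: "Fo [] = zz_regular n"
 by (simp add: Fo_def)

lemma Fo_single [simp]: "Fo [s] = U_bimod n s"
 by (simp add: Fo_def)

lemma Fo_snoc: "w \<noteq> [] ==> Fo (w @ [s]) = ZT (Fo w) (U_bimod n s)"
 by (cases w rule: rev_cases) (simp_all add: Fo_def)

lemma word_induct [case_names Nil single snoc]: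
 assumes "P []" "\<And>s. P [s]" "\<And>w s. w \<noteq> [] ==> P w ==> P (w @ [s])"
 shows "P w"
proof (induction w rule: rev_induct)
 case (snoc s w)
 then show ?case using assms(2,3) by (cases "w = []") auto
qed (rule assms(1))

definition word :: "nat list => bool" where
 "word w \<longleftrightarrow> set w \<subseteq> {1..n}"

lemma word_simps [simp]: "word []" "word (s # w) \<longleftrightarrow> s \<in> {1..n} \<and> word w" "word (u @ v) \<longleftrightarrow> word u \<and> word v"
 by (auto simp: word_def)

lemma Fo_obj: "word w ==> Fo w \<in> zz_objects n"
 by (induction w rule: word_induct) (simp_all add: Fo_snoc zz_objects.intros)

lemma Fo_zzb: "word w ==> zzb (Fo w)"
 by (rule zz_objects_zzb[OF Fo_obj])

text \<open>Moving a left-bracketed second word behind the first takes inverse associators, one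
  letter at a time. Empty words are absorbed by the unit constraints, which is why the one-letter
  case distinguishes whether \<open>w\<close> is empty.\<close>

fun mu_rev :: "nat list => nat list => bimap" where
 "mu_rev w [] = Runit ZC (Fo w)"
| "mu_rev w [s] = (if w = [] then Lunit ZC (U_bimod n s) else Id ZC (ZT (Fo w) (U_bimod n s)))"
| "mu_rev w (s # t # v) = Comp ZC (TenM ZC (mu_rev w (t # v)) (Id ZC (U_bimod n s)))
   (Assoc_inv (Fo w) (Fo (rev (t # v))) (U_bimod n s))"

definition mu :: "nat list => nat list => bimap" where
 "mu w v = mu_rev w (rev v)"

lemma mu_simps:
 "mu w [] = Runit ZC (Fo w)" "mu [] [s] = Lunit ZC (U_bimod n s)"
 "w \<noteq> [] ==> mu w [s] = Id ZC (ZT (Fo w) (U_bimod n s))"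
 "v \<noteq> [] ==> mu w (v @ [s]) = Comp ZC (TenM ZC (mu w v) (Id ZC (U_bimod n s))) (Assoc_inv (Fo w) (Fo v) (U_bimod n s))"
 by (simp_all add: mu_def, cases v rule: rev_cases, simp_all)

lemma Assoc_inv_is_iso:
 assumes "zzb M" "zzb N" "zzb L"
 shows "is_iso ZC (ZT M (ZT N L)) (ZT (ZT M N) L) (Assoc_inv M N L)"
 by (rule is_iso_zzI[OF _ _ Assoc_inv_bimap(1)[OF assms] Assoc_bimap(1)[OF assms] Assoc_is_iso(3,2)[OF assms]])
  (intro zzb_tensor assms)+

lemma mu_is_iso: "word w ==> word v ==> is_iso ZC (ZT (Fo w) (Fo v)) (Fo (w @ v)) (mu w v)"
proof (induction v rule: word_induct)
 case Nil
 then show ?case by (simp add: mu_simps Runit_is_iso Fo_zzb del: zz_category_simps)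
next
 case (single s)
 then show ?case
  using ZC.is_iso_Id[of "ZT (Fo w) (U_bimod n s)"]
  by (cases "w = []") (simp_all add: mu_simps Lunit_is_iso Fo_snoc Fo_obj zz_objects.intros zzb_U del: zz_category_simps(3-7))
next
 case (snoc v s)
 then have o: "Fo w \<in> zz_objects n" "Fo v \<in> zz_objects n" "U_bimod n s \<in> zz_objects n" "Fo (w @ v) \<in> zz_objects n"
  by (simp_all add: Fo_obj zz_objects.gen)
 note z = o[THEN zz_objects_zzb]
 have "is_iso ZC (ZT (ZT (Fo w) (Fo v)) (U_bimod n s)) (ZT (Fo (w @ v)) (U_bimod n s))
   (TenM ZC (mu w v) (Id ZC (U_bimod n s)))"
  using ZC.is_iso_TenM[of "ZT (Fo w) (Fo v)" "Fo (w @ v)" "U_bimod n s" "U_bimod n s" "mu w v" "Id ZC (U_bimod n s)"]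
   ZC.is_iso_Id[of "U_bimod n s"] o snoc
  by (simp add: zz_objects.tensor del: zz_category_simps(3-7))
 then have "is_iso ZC (ZT (Fo w) (ZT (Fo v) (U_bimod n s))) (ZT (Fo (w @ v)) (U_bimod n s))
  (Comp ZC (TenM ZC (mu w v) (Id ZC (U_bimod n s))) (Assoc_inv (Fo w) (Fo v) (U_bimod n s)))"
  using o by (intro ZC.is_iso_Comp[OF _ _ _ Assoc_inv_is_iso[OF z(1-3)]]) (simp_all add: zz_objects.tensor del: zz_category_simps(3-7))
 moreover have "Fo (w @ v @ [s]) = ZT (Fo (w @ v)) (U_bimod n s)"
  using Fo_snoc[of "w @ v" s] snoc by simp
 ultimately show ?case using snoc by (simp add: mu_simps Fo_snoc del: zz_category_simps(3-7))
qed

lemma mu_bimap: "word w ==> word v ==> mu w v \<in> bimaps n (ZT (Fo w) (Fo v)) (Fo (w @ v))"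
 using mu_is_iso[of w v] by (simp add: is_iso_def)

text \<open>The concatenation product on elements. Read through it, the coherence conditions for
  \<open>mu\<close> become associativity and unit laws.\<close>

definition op :: "nat list => nat list => elt => elt => elt" where
 "op w v x y = bfun (mu w v) (pu (Fo w) (Fo v) x y)"

lemma op_laws:
 assumes "word w" "word v"
 shows "x \<in> bcar (Fo w) ==> y \<in> bcar (Fo v) ==> op w v x y \<in> bcar (Fo (w @ v))"
  "x \<in> bcar (Fo w) ==> x' \<in> bcar (Fo w) ==> y \<in> bcar (Fo v) ==> op w v (badd (Fo w) x x') y = badd (Fo (w @ v)) (op w v x y) (op w v x' y)"
  "x \<in> bcar (Fo w) ==> y \<in> bcar (Fo v) ==> y' \<in> bcar (Fo v) ==> op w v x (badd (Fo v) y y') = badd (Fo (w @ v)) (op w v x y) (op w v x y')"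
  "y \<in> bcar (Fo v) ==> op w v (bzero (Fo w)) y = bzero (Fo (w @ v))"
  "x \<in> bcar (Fo w) ==> op w v x (bzero (Fo v)) = bzero (Fo (w @ v))"
  "x \<in> bcar (Fo w) ==> a \<in> carrier Z ==> y \<in> bcar (Fo v) ==> op w v (ract (Fo w) x a) y = op w v x (lact (Fo v) a y)"
  "a \<in> carrier Z ==> x \<in> bcar (Fo w) ==> y \<in> bcar (Fo v) ==> lact (Fo (w @ v)) a (op w v x y) = op w v (lact (Fo w) a x) y"
  "a \<in> carrier Z ==> x \<in> bcar (Fo w) ==> y \<in> bcar (Fo v) ==> ract (Fo (w @ v)) (op w v x y) a = op w v x (ract (Fo v) y a)"
proof -
 note F = Fo_zzb[OF assms(1)] Fo_zzb[OF assms(2)]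
 have wv: "word (w @ v)" using assms by simp
 note B = bimapsD[OF mu_bimap[OF assms] zzb_tensor[OF F] Fo_zzb[OF wv]]
 note l = op_def pu_laws(1-6)[OF F] B zz_laws[OF F(1)] zz_laws[OF F(2)]
 show "x \<in> bcar (Fo w) ==> y \<in> bcar (Fo v) ==> op w v x y \<in> bcar (Fo (w @ v))"
  "x \<in> bcar (Fo w) ==> x' \<in> bcar (Fo w) ==> y \<in> bcar (Fo v) ==> op w v (badd (Fo w) x x') y = badd (Fo (w @ v)) (op w v x y) (op w v x' y)"
  "x \<in> bcar (Fo w) ==> y \<in> bcar (Fo v) ==> y' \<in> bcar (Fo v) ==> op w v x (badd (Fo v) y y') = badd (Fo (w @ v)) (op w v x y) (op w v x y')"
  "y \<in> bcar (Fo v) ==> op w v (bzero (Fo w)) y = bzero (Fo (w @ v))"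
  "x \<in> bcar (Fo w) ==> op w v x (bzero (Fo v)) = bzero (Fo (w @ v))"
  "x \<in> bcar (Fo w) ==> a \<in> carrier Z ==> y \<in> bcar (Fo v) ==> op w v (ract (Fo w) x a) y = op w v x (lact (Fo v) a y)"
  by (simp_all add: l)
 show "a \<in> carrier Z ==> x \<in> bcar (Fo w) ==> y \<in> bcar (Fo v) ==> lact (Fo (w @ v)) a (op w v x y) = op w v (lact (Fo w) a x) y"
  "a \<in> carrier Z ==> x \<in> bcar (Fo w) ==> y \<in> bcar (Fo v) ==> ract (Fo (w @ v)) (op w v x y) a = op w v x (ract (Fo v) y a)"
  by (simp_all add: op_def pu_laws(7,8)[OF F, symmetric] B pu_laws(1)[OF F])
qed

lemma op_Nil_right: "word w ==> x \<in> bcar (Fo w) ==> b \<in> carrier Z ==> op w [] x (Alg b) = ract (Fo w) x b"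
 by (simp add: op_def mu_simps Runit_bimap(2) Fo_zzb del: zz_category_simps(3-7))

lemma op_single: "word w ==> w \<noteq> [] ==> s \<in> {1..n} ==> x \<in> bcar (Fo w) ==> y \<in> bcar (U_bimod n s)
  ==> op w [s] x y = pu (Fo w) (U_bimod n s) x y"
 by (simp add: op_def mu_simps pu_laws(1) Fo_zzb zzb_U)

lemma op_snoc:
 assumes "word w" "word v" "v \<noteq> []" "s \<in> {1..n}" "x \<in> bcar (Fo w)" "t \<in> bcar (Fo v)" "y \<in> bcar (U_bimod n s)"
 shows "op w (v @ [s]) x (pu (Fo v) (U_bimod n s) t y) = pu (Fo (w @ v)) (U_bimod n s) (op w v x t) y"
proof -
 have wv: "word (w @ v)" using assms by simp
 note z = Fo_zzb[OF assms(1)] Fo_zzb[OF assms(2)] zzb_U[OF assms(4)] Fo_zzb[OF wv]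
 note I = Assoc_inv_bimap[OF z(1-3)]
 note T = TenM_bimap[OF zzb_tensor[OF z(1,2)] z(3,4,3) mu_bimap[OF assms(1,2)] Id_bimap(1)[OF z(3)]]
 note C = Comp_bimap[OF zzb_tensor[OF z(1) zzb_tensor[OF z(2,3)]] zzb_tensor[OF zzb_tensor[OF z(1,2)] z(3)] zzb_tensor[OF z(4,3)] I(1) T(1)]
 show ?thesis using assms
  by (simp add: op_def mu_simps Fo_snoc C(2) I(2) T(2) Id_bimap(2) pu_laws(1)[OF z(1) zzb_tensor[OF z(2,3)]] pu_laws(1)[OF z(2,3)]
    pu_laws(1)[OF z(1,2)] del: zz_category_simps(3-7))
qed

lemma Fo_snoc_induct [consumes 4, case_names zero pure add]:
 assumes "word v" "v \<noteq> []" "s \<in> {1..n}" "t \<in> bcar (Fo (v @ [s]))"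
  and "P (bzero (Fo (v @ [s])))"
  and "\<And>x y. x \<in> bcar (Fo v) ==> y \<in> bcar (U_bimod n s) ==> P (pu (Fo v) (U_bimod n s) x y)"
  and "\<And>a b. a \<in> bcar (Fo (v @ [s])) ==> b \<in> bcar (Fo (v @ [s])) ==> P a ==> P b ==> P (badd (Fo (v @ [s])) a b)"
 shows "P t"
 using assms(4-7) unfolding Fo_snoc[OF assms(2)]
 by (rule tensor_zz_induct[OF Fo_zzb[OF assms(1)] zzb_U[OF assms(3)]])

text \<open>The recursion of \<open>mu\<close> runs along the right word, so the left unit law is
  not built in; it is propagated letter by letter from \<open>Lunit\<close>.\<close>

lemma op_Nil_left: "word w ==> x \<in> bcar (Fo w) ==> b \<in> carrier Z ==> op [] w (Alg b) x = lact (Fo w) b x"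
proof (induction w arbitrary: x rule: word_induct)
 case Nil
 then show ?case using op_Nil_right[of "[]" "Alg b"] by (auto simp: bcar_regular regular_simps)
next
 case (single s)
 then show ?case by (simp add: op_def mu_simps Lunit_bimap(2) zzb_U del: zz_category_simps(3-7))
next
 case (snoc w s)
 have w: "word w" "s \<in> {1..n}" "word (w @ [s])" using snoc by simp_all
 show ?case
  using w(1) snoc.hyps(1) w(2) snoc.prems(2)
 proof (induction rule: Fo_snoc_induct)
  case zero
  then show ?case using op_laws(5)[of "[]" "w @ [s]"] zz_laws(9)[OF Fo_zzb[OF w(3)]] w snoc.prems(3) by (simp add: regular_closed)
 next
  case (pure x y)
  then show ?case using op_snoc[of "[]" w s "Alg b" x y] w snoc pu_laws(7)[OF Fo_zzb[OF w(1)] zzb_U[OF w(2)]]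
   by (simp add: regular_closed Fo_snoc)
 next
  case (add a c)
  then show ?case using op_laws(3)[of "[]" "w @ [s]" "Alg b" a c] zz_laws(7)[OF Fo_zzb[OF w(3)], of b a c] w snoc.prems(3)
   by (simp add: regular_closed)
 qed
qed

text \<open>This contains the coherence of \<open>mu\<close> with the associators. Removing the last
  letter of \<open>w\<close> reduces it to words \<open>w\<close> of length at most one, where only
  an empty word \<open>v\<close> needs care: then \<open>y\<close> is an algebra element acting on a
  neighbour.\<close>

lemma op_assoc:
 assumes "word u" "word v" "word w" "x \<in> bcar (Fo u)" "y \<in> bcar (Fo v)" "z \<in> bcar (Fo w)"
 shows "op (u @ v) w (op u v x y) z = op u (v @ w) x (op v w y z)"
 using assms(3,6)
proof (induction w arbitrary: z rule: word_induct)
 case Nil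
 then show ?case using assms(1,2,4,5)
  by (auto simp: bcar_regular op_Nil_right op_laws zz_laws Fo_zzb)
next
 case (single s)
 have v: "v \<noteq> [] ==> ?case"
  using single assms(1,2,4,5) by (simp add: op_single op_snoc op_laws)
 have "v = [] ==> u \<noteq> [] ==> ?case"
 proof -
  assume v: "v = []" "u \<noteq> []"
  then obtain b where b: "b \<in> carrier Z" "y = Alg b" using assms(5) by (auto simp: bcar_regular)
  \<comment> \<open>The algebra element in the middle passes from the right of \<open>x\<close> to
    the left of \<open>z\<close>, as the product is balanced.\<close>
  then show ?case using v single assms(1,4) op_laws(6)[of u "[s]" x b z]
   by (simp add: op_Nil_right op_Nil_left)
 qed
 moreover have "v = [] ==> u = [] ==> ?case"
  using single assms(1,2,4,5) zz_laws(15)[OF zzb_U, of s]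
  by (auto simp: bcar_regular op_Nil_right op_Nil_left regular_simps zz_laws zzb_U)
 ultimately show ?case using v by blast
next
 case (snoc w s)
 have w: "word w" "s \<in> {1..n}" "word (w @ [s])" "word (v @ w @ [s])" "word (u @ v @ w @ [s])" "word (u @ v)" "word (v @ w)"
  using snoc assms by simp_all
 have xy: "op u v x y \<in> bcar (Fo (u @ v))" by (rule op_laws(1)[OF assms(1,2,4,5)])
 show ?case
  using w(1) snoc.hyps(1) w(2) snoc.prems(2)
 proof (induction rule: Fo_snoc_induct)
  case zero
  then show ?case using op_laws(5)[OF w(6,3) xy] op_laws(5)[OF assms(2) w(3) assms(5)] op_laws(5)[OF assms(1) w(4) assms(4)] by simp
 next
  case (pure a b)
  have "op (u @ v) (w @ [s]) (op u v x y) (pu (Fo w) (U_bimod n s) a b) = pu (Fo ((u @ v) @ w)) (U_bimod n s) (op (u @ v) w (op u v x y) a) b"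
   by (rule op_snoc[OF w(6,1) snoc.hyps(1) w(2) xy pure])
  also have "\<dots> = pu (Fo (u @ (v @ w))) (U_bimod n s) (op u (v @ w) x (op v w y a)) b"
   using snoc.IH[OF w(1) pure(1)] by simp
  also have "\<dots> = op u ((v @ w) @ [s]) x (pu (Fo (v @ w)) (U_bimod n s) (op v w y a) b)"
   using snoc.hyps(1) by (intro op_snoc[symmetric] assms(1,4) w pure op_laws(1) assms(2,5)) simp
  also have "pu (Fo (v @ w)) (U_bimod n s) (op v w y a) b = op v (w @ [s]) y (pu (Fo w) (U_bimod n s) a b)"
   by (rule op_snoc[OF assms(2) w(1) snoc.hyps(1) w(2) assms(5) pure, symmetric])
  finally show ?case by simp
 next
  case (add a b)
  then show ?case
   using op_laws(3)[OF w(6,3) xy add(1,2)] op_laws(3)[OF assms(2) w(3) assms(5) add(1,2)]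
    op_laws(3)[OF assms(1) w(4) assms(4) op_laws(1)[OF assms(2) w(3) assms(5) add(1)] op_laws(1)[OF assms(2) w(3) assms(5) add(2)]]
   by simp
 qed
qed

text \<open>Since \<open>mu w v\<close> is invertible, every element of \<open>Fo (w @ v)\<close>
  comes from \<open>Fo w \<otimes> Fo v\<close> and hence is a sum of products.\<close>

lemma op_span [consumes 3, case_names zero op add]:
 assumes "word w" "word v" "t \<in> bcar (Fo (w @ v))"
  and "P (bzero (Fo (w @ v)))"
  and "\<And>x y. x \<in> bcar (Fo w) ==> y \<in> bcar (Fo v) ==> P (op w v x y)"
  and "\<And>a b. a \<in> bcar (Fo (w @ v)) ==> b \<in> bcar (Fo (w @ v)) ==> P a ==> P b ==> P (badd (Fo (w @ v)) a b)"
 shows "P t"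
proof -
 have wv: "word (w @ v)" using assms by simp
 note z = Fo_zzb[OF assms(1)] Fo_zzb[OF assms(2)] and z' = Fo_zzb[OF wv]
 note iso = mu_is_iso[OF assms(1,2)]
 note inv = ZC.iso_inverse[OF iso]
 let ?g = "ZC.iso_inverse (ZT (Fo w) (Fo v)) (Fo (w @ v)) (mu w v)"
 have g: "?g \<in> bimaps n (Fo (w @ v)) (ZT (Fo w) (Fo v))" using inv(1) by simp
 note B = bimapsD[OF mu_bimap[OF assms(1,2)] zzb_tensor[OF z] z']
 have "t = bfun (mu w v) (bfun ?g t)"
  using arg_cong[OF inv(3), of "\<lambda>f. bfun f t"] Comp_bimap(2)[OF z' zzb_tensor[OF z] z' g mu_bimap[OF assms(1,2)] assms(3)]
   Id_bimap(2)[OF assms(3)] by (simp del: zz_category_simps(3-7))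
 moreover have "P (bfun (mu w v) u)" if u: "u \<in> bcar (ZT (Fo w) (Fo v))" for u
  using z u
 proof (induction rule: tensor_zz_induct)
  case (pure x y)
  then show ?case using assms(5) by (simp add: op_def)
 qed (simp_all add: B assms(4,6))
 ultimately show ?thesis using bimapsD(3)[OF g z' zzb_tensor[OF z] assms(3)] by metis
qed

lemma op_deg:
 assumes "word w" "word v" "x \<in> bdeg (Fo w) k" "y \<in> bdeg (Fo v) l"
 shows "op w v x y \<in> bdeg (Fo (w @ v)) (k + l)"
 using assms(2,4)
proof (induction v arbitrary: y l rule: word_induct)
 case Nil
 then obtain b where "y = Alg b" "b \<in> carrier Z" "b \<in> zz_degree n l" by (auto simp: regular_simps)
 then show ?case using assms graded_bimodule.deg_ract[OF zzb_graded[OF Fo_zzb[OF assms(1)]]]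
   graded_bimodule.deg_closed[OF zzb_graded[OF Fo_zzb[OF assms(1)]]]
  by (simp add: op_Nil_right)
next
 case (single s)
 note G = zzb_graded[OF Fo_zzb[OF assms(1)]] and U = zzb_graded[OF zzb_U[of s]]
 show ?case
 proof (cases "w = []")
  case True
  then obtain b where "x = Alg b" "b \<in> carrier Z" "b \<in> zz_degree n k" using assms(3) by (auto simp: regular_simps)
  then show ?thesis using single True graded_bimodule.deg_lact[OF U, of b k y l] graded_bimodule.deg_closed[OF U, of y l]
   by (simp add: op_Nil_left)
 next
  case False
  then show ?thesis using single assms(1,3) graded_bimodule.deg_closed[OF G] graded_bimodule.deg_closed[OF U]
   by (simp add: op_single Fo_snoc pu_laws(9) Fo_zzb zzb_U)
 qed
next
 case (snoc v s)
 have w: "word v" "s \<in> {1..n}" "word (v @ [s])" "word (w @ v @ [s])" "word (w @ v)" using snoc assms by simp_all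
 note G = zzb_graded[OF Fo_zzb[OF assms(1)]] and U = zzb_graded[OF zzb_U[OF w(2)]] and V = zzb_graded[OF Fo_zzb[OF w(1)]]
  and WVS = zzb_graded[OF Fo_zzb[OF w(4)]]
 note x = graded_bimodule.deg_closed[OF G assms(3)]
 have y: "y \<in> bdeg (ZT (Fo v) (U_bimod n s)) l" using snoc.prems snoc.hyps by (simp add: Fo_snoc)
 show ?case
  using Fo_zzb[OF w(1)] zzb_U[OF w(2)] y
 proof (induction rule: tensor_zz_deg_induct)
  case zero
  then show ?case using op_laws(5)[OF assms(1) w(3) x] graded_bimodule.deg_zero[OF WVS] snoc.hyps by (simp add: Fo_snoc)
 next
  case (pure a b i)
  note ab = graded_bimodule.deg_closed[OF V pure(1)] graded_bimodule.deg_closed[OF U pure(2)]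
  have "pu (Fo (w @ v)) (U_bimod n s) (op w v x a) b \<in> bdeg (ZT (Fo (w @ v)) (U_bimod n s)) ((k + i) + (l - i))"
   by (rule pu_laws(9)[OF Fo_zzb[OF w(5)] zzb_U[OF w(2)] snoc.IH[OF w(1) pure(1)] pure(2)])
  then show ?case
   using op_snoc[OF assms(1) w(1) snoc.hyps(1) w(2) x ab] Fo_snoc[of "w @ v" s] snoc.hyps by simp
 next
  case (add a b)
  then show ?case using op_laws(3)[OF assms(1) w(3) x, of a b] graded_bimodule.deg_add[OF WVS] snoc.hyps
   by (simp add: Fo_snoc[of v])
 qed
qed

text \<open>Invertibility of \<open>mu\<close> says nothing yet about the degrees of its inverse, so
  the homogeneous version is proved directly, by removing the last letter of
  \<open>v\<close>.\<close>

lemma op_deg_span [consumes 3, case_names zero op add]: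
 assumes "word w" "word v" "t \<in> bdeg (Fo (w @ v)) d"
  and "P (bzero (Fo (w @ v)))"
  and "\<And>x y k. x \<in> bdeg (Fo w) k ==> y \<in> bdeg (Fo v) (d - k) ==> P (op w v x y)"
  and "\<And>a b. a \<in> bcar (Fo (w @ v)) ==> b \<in> bcar (Fo (w @ v)) ==> P a ==> P b ==> P (badd (Fo (w @ v)) a b)"
 shows "P t"
 using assms(2-6)
proof (induction v arbitrary: t d P rule: word_induct)
 case Nil
 have G: "graded_bimodule Z (zz_degree n) Z (zz_degree n) (Fo w)" by (rule zzb_graded[OF Fo_zzb[OF assms(1)]])
 have "t \<in> bcar (Fo w)" "t \<in> bdeg (Fo w) d" using graded_bimodule.deg_closed[OF G] Nil by auto
 moreover have "P (op w [] t (Alg \<one>\<^bsub>Z\<^esub>))"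
  using Nil(2) zz_degree_one by (intro Nil(4)[of _ d]) (simp_all add: regular_simps)
 ultimately show ?case using assms(1) by (simp add: op_Nil_right zz_laws(18)[OF Fo_zzb])
next
 case (single s)
 show ?case
 proof (cases "w = []")
  case True
  have U: "graded_bimodule Z (zz_degree n) Z (zz_degree n) (U_bimod n s)" using single by (intro zzb_graded zzb_U) simp
  have "t \<in> bcar (U_bimod n s)" using graded_bimodule.deg_closed[OF U] single True by simp
  moreover have "P (op w [s] (Alg \<one>\<^bsub>Z\<^esub>) t)"
   using single True zz_degree_one by (intro single(4)[of _ 0]) (simp_all add: regular_simps)
  ultimately show ?thesis using True single by (simp add: op_Nil_left zz_laws(17)[OF zzb_U])
 next
  case False
  have t: "t \<in> bdeg (ZT (Fo w) (U_bimod n s)) d" using single False by (simp add: Fo_snoc)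
  have s: "s \<in> {1..n}" using single by simp
  note G = zzb_graded[OF Fo_zzb[OF assms(1)]] and U = zzb_graded[OF zzb_U[OF s]]
  show ?thesis using Fo_zzb[OF assms(1)] zzb_U[OF s] t
  proof (induction rule: tensor_zz_deg_induct)
   case (pure x y k)
   then show ?case using single(4)[of x k y] op_single[OF assms(1) False s, of x y] graded_bimodule.deg_closed[OF G]
     graded_bimodule.deg_closed[OF U] by simp
  qed (use single(3,5) False in \<open>simp_all add: Fo_snoc\<close>)
 qed
next
 case (snoc v s)
 have w: "word v" "s \<in> {1..n}" "word (v @ [s])" "word (w @ v @ [s])" "word (w @ v)" "w @ v \<noteq> []" using snoc assms by simp_all
 note U = zzb_graded[OF zzb_U[OF w(2)]] and V = zzb_graded[OF Fo_zzb[OF w(1)]] and WV = zzb_graded[OF Fo_zzb[OF w(5)]]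
  and G = zzb_graded[OF Fo_zzb[OF assms(1)]]
 have eq: "Fo (w @ v @ [s]) = ZT (Fo (w @ v)) (U_bimod n s)" using Fo_snoc[OF w(6)] by simp
 have t: "t \<in> bdeg (ZT (Fo (w @ v)) (U_bimod n s)) d" using snoc.prems(2) eq by simp
 note pl = pu_laws[OF Fo_zzb[OF w(5)] zzb_U[OF w(2)]]
 show ?case using Fo_zzb[OF w(5)] zzb_U[OF w(2)] t
 proof (induction rule: tensor_zz_deg_induct)
  case (pure a b i)
  have b: "b \<in> bcar (U_bimod n s)" using graded_bimodule.deg_closed[OF U pure(2)] .
  show ?case
   using w(1) pure(1)
  proof (rule snoc.IH)
   show "P (pu (Fo (w @ v)) (U_bimod n s) (bzero (Fo (w @ v))) b)"
    using snoc.prems(3) eq b by (simp add: pl)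
  next
   fix x y k assume xy: "x \<in> bdeg (Fo w) k" "y \<in> bdeg (Fo v) (i - k)"
   note c = graded_bimodule.deg_closed[OF G xy(1)] graded_bimodule.deg_closed[OF V xy(2)]
   have "pu (Fo v) (U_bimod n s) y b \<in> bdeg (Fo (v @ [s])) ((i - k) + (d - i))"
    using pu_laws(9)[OF Fo_zzb[OF w(1)] zzb_U[OF w(2)] xy(2) pure(2)] snoc.hyps by (simp add: Fo_snoc)
   then have "P (op w (v @ [s]) x (pu (Fo v) (U_bimod n s) y b))"
    using xy by (intro snoc.prems(4)[of _ k]) simp_all
   then show "P (pu (Fo (w @ v)) (U_bimod n s) (op w v x y) b)"
    using op_snoc[OF assms(1) w(1) snoc.hyps(1) w(2) c b] by simp
  next
   fix x y assume xy: "x \<in> bcar (Fo (w @ v))" "y \<in> bcar (Fo (w @ v))"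
    "P (pu (Fo (w @ v)) (U_bimod n s) x b)" "P (pu (Fo (w @ v)) (U_bimod n s) y b)"
   then show "P (pu (Fo (w @ v)) (U_bimod n s) (badd (Fo (w @ v)) x y) b)"
    using snoc.prems(5) eq b by (simp add: pl)
  qed
 qed (use snoc.prems(3,5) eq in simp_all)
qed

end

section \<open>A semiring of homogeneous tensors\<close>

text \<open>
 The elements of all the bimodules \<open>Fo w\<close> (for all \<open>n\<close>), together with one absorbing junk element, form a
 semiring without zero and unit: the product of \<open>x \<in> Fo w\<close> and \<open>y \<in> Fo v\<close> is the image of \<open>x \<otimes> y\<close> in
 \<open>Fo (w @ v)\<close>, the sum of elements of different bimodules is junk. Since the elements of the zigzag algebra
 occur as the case of the empty word, this turns computations with bimodule maps into ring arithmetic.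
\<close>

typedef tens = "{None} \<union> {Some (n, w, x) | n w x. 2 \<le> n \<and> set w \<subseteq> {1..n} \<and> x \<in> bcar (type_B.Fo n w)}"
 by blast

definition El :: "nat => nat list => elt => tens" where
 "El n w x = Abs_tens (if 2 \<le> n \<and> set w \<subseteq> {1..n} \<and> x \<in> bcar (type_B.Fo n w) then Some (n, w, x) else None)"

definition Junk :: tens where "Junk = Abs_tens None"

lemma Rep_El: "Rep_tens (El n w x) = (if 2 \<le> n \<and> set w \<subseteq> {1..n} \<and> x \<in> bcar (type_B.Fo n w) then Some (n, w, x) else None)"
 unfolding El_def by (rule Abs_tens_inverse) auto

lemma Rep_Junk: "Rep_tens Junk = None"
 unfolding Junk_def by (rule Abs_tens_inverse) auto

lemma tens_cases [case_names Junk El]: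
 obtains "t = Junk" | n w x where "t = El n w x" "2 \<le> n" "set w \<subseteq> {1..n}" "x \<in> bcar (type_B.Fo n w)"
proof (cases "Rep_tens t")
 case None
 then have "t = Junk" by (metis Rep_Junk Rep_tens_inject)
 then show ?thesis by (rule that)
next
 case (Some p)
 then obtain n w x where p: "p = (n, w, x)" "2 \<le> n" "set w \<subseteq> {1..n}" "x \<in> bcar (type_B.Fo n w)"
  using Rep_tens[of t] by auto
 then have "t = El n w x" using Some by (metis Rep_El Rep_tens_inject)
 then show ?thesis using p that by blast
qed

lemma El_inject: "El n w x = El m v y ==> 2 \<le> n ==> set w \<subseteq> {1..n} ==> x \<in> bcar (type_B.Fo n w) ==> n = m \<and> w = v \<and> x = y"
 by (drule arg_cong[where f = Rep_tens]) (auto simp: Rep_El split: if_splits)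

instantiation tens :: semiring
begin

definition times_tens :: "tens => tens => tens" where
 "s * t = (case Rep_tens s of None => Junk | Some (n, w, x) => (case Rep_tens t of None => Junk
   | Some (m, v, y) => if n = m then El n (w @ v) (type_B.op n w v x y) else Junk))"

definition plus_tens :: "tens => tens => tens" where
 "s + t = (case Rep_tens s of None => Junk | Some (n, w, x) => (case Rep_tens t of None => Junk
   | Some (m, v, y) => if n = m \<and> w = v then El n w (badd (type_B.Fo n w) x y) else Junk))"

lemma times_Junk: "Junk * t = Junk" "t * Junk = Junk"
 by (simp_all add: times_tens_def Rep_Junk split: option.splits)

lemma plus_Junk: "Junk + t = Junk" "t + Junk = Junk"
 by (simp_all add: plus_tens_def Rep_Junk split: option.splits)

lemma times_El:
 assumes "2 \<le> n" "2 \<le> m" "set w \<subseteq> {1..n}" "x \<in> bcar (type_B.Fo n w)" "set v \<subseteq> {1..m}" "y \<in> bcar (type_B.Fo m v)"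
 shows "El n w x * El m v y = (if n = m then El n (w @ v) (type_B.op n w v x y) else Junk)"
 using assms by (simp add: times_tens_def Rep_El)

lemma plus_El:
 assumes "2 \<le> n" "2 \<le> m" "set w \<subseteq> {1..n}" "x \<in> bcar (type_B.Fo n w)" "set v \<subseteq> {1..m}" "y \<in> bcar (type_B.Fo m v)"
 shows "El n w x + El m v y = (if n = m \<and> w = v then El n w (badd (type_B.Fo n w) x y) else Junk)"
 using assms by (simp add: plus_tens_def Rep_El)

lemma op_in: "2 \<le> n ==> set w \<subseteq> {1..n} ==> set v \<subseteq> {1..n} ==> x \<in> bcar (type_B.Fo n w) ==> y \<in> bcar (type_B.Fo n v)
  ==> type_B.op n w v x y \<in> bcar (type_B.Fo n (w @ v))"
 by (rule type_B.op_laws(1)) (simp_all add: type_B.word_def type_B_def)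

lemma badd_in: "2 \<le> n ==> set w \<subseteq> {1..n} ==> x \<in> bcar (type_B.Fo n w) ==> y \<in> bcar (type_B.Fo n w)
  ==> badd (type_B.Fo n w) x y \<in> bcar (type_B.Fo n w)"
 by (rule type_B.zz_laws(1)[OF _ type_B.Fo_zzb]) (simp_all add: type_B.word_def type_B_def)

instance
proof
 fix a b c :: tens
 show "a * b * c = a * (b * c)"
 proof (cases a rule: tens_cases)
  case a: (El n w x)
  show ?thesis
  proof (cases b rule: tens_cases)
   case b: (El m v y)
   show ?thesis
   proof (cases c rule: tens_cases)
    case c: (El k u z)
    show ?thesis
    proof (cases "n = m \<and> m = k")
     case True
     then show ?thesis unfolding a(1) b(1) c(1) using a b c
      by (simp add: times_El op_in type_B.op_assoc type_B.word_def type_B_def)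
    next
     case False
     then show ?thesis unfolding a(1) b(1) c(1) using a b c
      by (auto simp: times_El op_in times_Junk)
    qed
   qed (simp add: times_Junk)
  qed (simp add: times_Junk)
 qed (simp add: times_Junk)
 show "a + b + c = a + (b + c)"
 proof (cases a rule: tens_cases)
  case a: (El n w x)
  show ?thesis
  proof (cases b rule: tens_cases)
   case b: (El m v y)
   show ?thesis
   proof (cases c rule: tens_cases)
    case c: (El k u z)
    show ?thesis unfolding a(1) b(1) c(1) using a b c
     by (auto simp: plus_El badd_in plus_Junk type_B.zz_add_laws(1)[OF _ type_B.Fo_zzb] type_B.word_def type_B_def)
   qed (simp add: plus_Junk)
  qed (simp add: plus_Junk)
 qed (simp add: plus_Junk)
 show "a + b = b + a"
 proof (cases a rule: tens_cases)
  case a: (El n w x)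
  show ?thesis
  proof (cases b rule: tens_cases)
   case b: (El m v y)
   show ?thesis unfolding a(1) b(1) using a b type_B.zz_add_laws(2)[OF _ type_B.Fo_zzb, of n w x y]
    by (auto simp: plus_El type_B.word_def type_B_def)
  qed (simp add: plus_Junk)
 qed (simp add: plus_Junk)
 show "(a + b) * c = a * c + b * c"
 proof (cases a rule: tens_cases)
  case a: (El n w x)
  show ?thesis
  proof (cases b rule: tens_cases)
   case b: (El m v y)
   show ?thesis
   proof (cases c rule: tens_cases)
    case c: (El k u z)
    show ?thesis unfolding a(1) b(1) c(1) using a b c
     by (auto simp: plus_El times_El badd_in op_in plus_Junk times_Junk type_B.op_laws(2) type_B.word_def type_B_def)
   qed (simp add: times_Junk plus_Junk)
  qed (simp add: times_Junk plus_Junk)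
 qed (simp add: times_Junk plus_Junk)
 show "a * (b + c) = a * b + a * c"
 proof (cases a rule: tens_cases)
  case a: (El n w x)
  show ?thesis
  proof (cases b rule: tens_cases)
   case b: (El m v y)
   show ?thesis
   proof (cases c rule: tens_cases)
    case c: (El k u z)
    show ?thesis unfolding a(1) b(1) c(1) using a b c
     by (auto simp: plus_El times_El badd_in op_in plus_Junk times_Junk type_B.op_laws(3) type_B.word_def type_B_def)
   qed (simp add: times_Junk plus_Junk)
  qed (simp add: times_Junk plus_Junk)
 qed (simp add: times_Junk plus_Junk)
qed

end

definition sc :: "real => tens => tens" where
 "sc r t = (case Rep_tens t of None => Junk | Some (n, w, x) => El n w (lact (type_B.Fo n w) (zz_scalar n r) x))"

lemma sc_Junk: "sc r Junk = Junk"
 by (simp add: sc_def Rep_Junk)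

lemma sc_El: "2 \<le> n ==> set w \<subseteq> {1..n} ==> x \<in> bcar (type_B.Fo n w) ==> sc r (El n w x) = El n w (lact (type_B.Fo n w) (zz_scalar n r) x)"
 by (simp add: sc_def Rep_El)

text \<open>The last law stands in for a neutral element: \<open>sc 0 a\<close> is a zero adapted to
  the summand \<open>a\<close>.\<close>

lemma sc_laws: "sc r (a + b) = sc r a + sc r b" "sc (r + s) a = sc r a + sc s a" "sc r (sc s a) = sc (r * s) a" "sc 1 a = a"
 "sc r a * b = sc r (a * b)" "a * sc r b = sc r (a * b)" "a + sc 0 a = a"
proof -
 have in_Fo: "lact (type_B.Fo n w) (zz_scalar n r) x \<in> bcar (type_B.Fo n w)"
  if "2 \<le> n" "set w \<subseteq> {1..n}" "x \<in> bcar (type_B.Fo n w)" for n w x r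
  using type_B.zz_laws(5)[OF _ type_B.Fo_zzb, of n w "zz_scalar n r" x] type_B.zz_scalar_closed[of n r] that
  by (simp add: type_B_def type_B.word_def)
 have L: "zz_scalar n r \<in> carrier (zigzag n)" "graded_bimodule (zigzag n) (zz_degree n) (zigzag n) (zz_degree n) (type_B.Fo n w)"
  "type_B.zzb n (type_B.Fo n w)" "type_B n" "type_B.word n w"
  if "2 \<le> n" "set w \<subseteq> {1..n}" for n w r
  using that type_B.zz_scalar_closed[of n r] type_B.zzb_graded[OF _ type_B.Fo_zzb, of n w] type_B.Fo_zzb[of n w]
  by (simp_all add: type_B_def type_B.word_def)
 show "sc r (a + b) = sc r a + sc r b"
 proof (cases a rule: tens_cases)
  case a: (El n w x)
  show ?thesis
  proof (cases b rule: tens_cases)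
   case b: (El m v y)
   show ?thesis unfolding a(1) b(1) using a b
    by (auto simp: sc_El plus_El sc_Junk badd_in in_Fo type_B.zz_laws(7)[OF L(4,3)] L)
  qed (simp add: sc_Junk plus_Junk)
 qed (simp add: sc_Junk plus_Junk)
 show "sc (r + s) a = sc r a + sc s a"
 proof (cases a rule: tens_cases)
  case a: (El n w x)
  show ?thesis unfolding a(1) using a(2-)
   by (simp add: sc_El plus_El in_Fo type_B.zz_scalar_add[OF L(4)] type_B.zz_laws(11)[OF L(4,3)] L)
 qed (simp add: sc_Junk plus_Junk)
 show "sc r (sc s a) = sc (r * s) a"
 proof (cases a rule: tens_cases)
  case a: (El n w x)
  show ?thesis unfolding a(1) using a(2-)
   by (simp add: sc_El plus_El in_Fo type_B.zz_scalar_mult[OF L(4)] type_B.zz_laws(15)[OF L(4,3)] L)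
 qed (simp add: sc_Junk)
 show "sc 1 a = a"
 proof (cases a rule: tens_cases)
  case a: (El n w x)
  show ?thesis unfolding a(1) using a(2-)
   by (simp add: sc_El type_B.zz_scalar_one[OF L(4)] type_B.zz_laws(17)[OF L(4,3)] L)
 qed (simp add: sc_Junk)
 show "a + sc 0 a = a"
 proof (cases a rule: tens_cases)
  case a: (El n w x)
  show ?thesis unfolding a(1) using a(2-)
   by (simp add: sc_El plus_El in_Fo type_B.zz_scalar_zero[OF L(4)] type_B.zz_laws(2,3,13)[OF L(4,3)] L)
 qed (simp add: sc_Junk plus_Junk)
 show "sc r a * b = sc r (a * b)"
 proof (cases a rule: tens_cases)
  case a: (El n w x)
  show ?thesis
  proof (cases b rule: tens_cases)
   case b: (El m v y)
   show ?thesis unfolding a(1) b(1) using a(2-) b(2-)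
    by (auto simp: sc_El times_El sc_Junk op_in in_Fo type_B.op_laws(7)[OF L(4,5)] L)
  qed (simp add: sc_Junk times_Junk)
 qed (simp add: sc_Junk times_Junk)
 show "a * sc r b = sc r (a * b)"
 proof (cases a rule: tens_cases)
  case a: (El n w x)
  show ?thesis
  proof (cases b rule: tens_cases)
   case b: (El m v y)
   show ?thesis
   proof (cases "n = m")
    case True
    have "type_B.op n w v x (lact (type_B.Fo n v) (zz_scalar n r) y) = type_B.op n w v (ract (type_B.Fo n w) x (zz_scalar n r)) y"
     using a(2-) b(2-) True by (intro type_B.op_laws(6)[symmetric]) (simp_all add: L)
    also have "\<dots> = type_B.op n w v (lact (type_B.Fo n w) (zz_scalar n r) x) y"
     using a(2-) by (subst type_B.zz_laws(20)[OF L(4,3)]) simp_all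
    also have "\<dots> = lact (type_B.Fo n (w @ v)) (zz_scalar n r) (type_B.op n w v x y)"
     using a(2-) b(2-) True by (intro type_B.op_laws(7)[symmetric]) (simp_all add: L)
    finally show ?thesis unfolding a(1) b(1) using a(2-) b(2-) True
     by (simp add: sc_El times_El op_in in_Fo)
   next
    case False
    then show ?thesis unfolding a(1) b(1) using a(2-) b(2-)
     by (simp add: sc_El times_El sc_Junk in_Fo)
   qed
  qed (simp add: sc_Junk times_Junk)
 qed (simp add: sc_Junk times_Junk)
qed

context type_B
begin

text \<open>The type of tensors contains junk and the elements for every rank; \<open>ok\<close>
  selects the genuine elements for the present \<open>n\<close>.\<close>

definition ok :: "tens => bool" where
 "ok t \<longleftrightarrow> (\<exists>w x. word w \<and> x \<in> bcar (Fo w) \<and> t = El n w x)"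

definition wd :: "tens => nat list" where
 "wd t = (case Rep_tens t of Some (m, w, x) => w | None => [])"

definition val :: "tens => elt" where
 "val t = (case Rep_tens t of Some (m, w, x) => x | None => undefined)"

lemma El_simps: assumes "word w" "x \<in> bcar (Fo w)"
 shows "ok (El n w x)" "wd (El n w x) = w" "val (El n w x) = x"
 using assms n_ge_2 by (auto simp: ok_def wd_def val_def Rep_El word_def)

lemma okE: assumes "ok t" obtains "word (wd t)" "val t \<in> bcar (Fo (wd t))" "t = El n (wd t) (val t)"
 using assms El_simps by (auto simp: ok_def)

lemma times_El': "word w ==> x \<in> bcar (Fo w) ==> word v ==> y \<in> bcar (Fo v) ==> El n w x * El n v y = El n (w @ v) (op w v x y)"
 using n_ge_2 by (simp add: times_El word_def)

lemma plus_El': "word w ==> x \<in> bcar (Fo w) ==> y \<in> bcar (Fo w) ==> El n w x + El n w y = El n w (badd (Fo w) x y)"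
 using n_ge_2 by (simp add: plus_El word_def)

lemma sc_El': "word w ==> x \<in> bcar (Fo w) ==> sc r (El n w x) = El n w (lact (Fo w) (zz_scalar n r) x)"
 using n_ge_2 by (simp add: sc_El word_def)

definition B :: "zz => tens" where "B b = El n [] (Alg b)"

text \<open>Every bimodule has its own zero, and a sum with the zero of another word is
  junk.\<close>

definition Zr :: "nat list => tens" where "Zr w = El n w (bzero (Fo w))"

definition One :: tens where "One = B \<one>\<^bsub>Z\<^esub>"

lemma ok_word: "ok t ==> word (wd t)"
 by (elim okE)

lemma ok_simps [simp]:
 "ok a ==> ok b ==> ok (a * b)" "ok a ==> ok b ==> wd a = wd b ==> ok (a + b)" "ok a ==> ok (sc r a)"
 "c \<in> carrier Z ==> ok (B c)" "word w ==> ok (Zr w)" "ok One"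
proof -
 show "ok a ==> ok b ==> ok (a * b)"
  by (elim okE) (metis times_El' El_simps(1) op_laws(1) word_simps(3))
 show "ok a ==> ok b ==> wd a = wd b ==> ok (a + b)"
  by (elim okE) (metis plus_El' El_simps(1) zz_laws(1) Fo_zzb)
 show "ok a ==> ok (sc r a)"
  by (elim okE) (metis sc_El' El_simps(1) zz_laws(5) Fo_zzb zz_scalar_closed)
 show B: "c \<in> carrier Z ==> ok (B c)" for c
  unfolding B_def by (rule El_simps) (simp_all add: regular_closed)
 show "ok One" unfolding One_def by (rule B) simp
 show "word w ==> ok (Zr w)"
  unfolding Zr_def by (rule El_simps) (simp_all add: zz_laws(2) Fo_zzb)
qed

lemma wd_simps [simp]:
 "ok a ==> ok b ==> wd (a * b) = wd a @ wd b" "ok a ==> ok b ==> wd a = wd b ==> wd (a + b) = wd b" "ok a ==> wd (sc r a) = wd a"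
 "c \<in> carrier Z ==> wd (B c) = []" "word w ==> wd (Zr w) = w" "wd One = []"
proof -
 show "ok a ==> ok b ==> wd (a * b) = wd a @ wd b"
  by (elim okE) (metis times_El' El_simps(2) op_laws(1) word_simps(3))
 show "ok a ==> ok b ==> wd a = wd b ==> wd (a + b) = wd b"
  by (elim okE) (metis plus_El' El_simps(2) zz_laws(1) Fo_zzb)
 show "ok a ==> wd (sc r a) = wd a"
  by (elim okE) (metis sc_El' El_simps(2) zz_laws(5) Fo_zzb zz_scalar_closed)
 show B: "c \<in> carrier Z ==> wd (B c) = []" for c
  unfolding B_def by (rule El_simps) (simp_all add: regular_closed)
 show "wd One = []" unfolding One_def by (rule B) simp
 show "word w ==> wd (Zr w) = w"
  unfolding Zr_def by (rule El_simps) (simp_all add: zz_laws(2) Fo_zzb)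
qed

lemma val_Zr: "word w ==> val (Zr w) = bzero (Fo w)"
 unfolding Zr_def by (rule El_simps) (simp_all add: zz_laws(2) Fo_zzb)

lemma Zr_simps [simp]:
 "ok t ==> word w ==> Zr w * t = Zr (w @ wd t)" "ok t ==> word w ==> t * Zr w = Zr (wd t @ w)"
 "ok t ==> wd t = w ==> Zr w + t = t" "ok t ==> wd t = w ==> t + Zr w = t" "word w ==> sc r (Zr w) = Zr w"
proof -
 show "ok t ==> word w ==> Zr w * t = Zr (w @ wd t)"
  unfolding Zr_def by (elim okE) (metis times_El' op_laws(4) zz_laws(2) Fo_zzb)
 show "ok t ==> word w ==> t * Zr w = Zr (wd t @ w)"
  unfolding Zr_def by (elim okE) (metis times_El' op_laws(5) zz_laws(2) Fo_zzb)
 show "ok t ==> wd t = w ==> Zr w + t = t"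
  unfolding Zr_def by (elim okE) (metis plus_El' zz_laws(2,4) Fo_zzb)
 show "ok t ==> wd t = w ==> t + Zr w = t"
  unfolding Zr_def by (elim okE) (metis plus_El' zz_laws(2,3) Fo_zzb)
 show "word w ==> sc r (Zr w) = Zr w"
  unfolding Zr_def by (metis sc_El' zz_laws(2,9) Fo_zzb zz_scalar_closed)
qed

lemma sc_zero [simp]: "ok t ==> sc 0 t = Zr (wd t)"
 unfolding Zr_def by (elim okE) (metis sc_El' zz_laws(13) Fo_zzb zz_scalar_zero)

text \<open>The empty word stands for the algebra itself, where the concatenation product is the
  bimodule action. All actions can thus be written as multiplications.\<close>

lemma B_El: "word w ==> x \<in> bcar (Fo w) ==> b \<in> carrier Z ==> B b * El n w x = El n w (lact (Fo w) b x)"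
 "word w ==> x \<in> bcar (Fo w) ==> b \<in> carrier Z ==> El n w x * B b = El n w (ract (Fo w) x b)"
 unfolding B_def by (simp_all add: times_El' regular_closed op_Nil_left op_Nil_right)

lemma B_laws:
 "b \<in> carrier Z ==> c \<in> carrier Z ==> B b * B c = B (b \<bullet> c)"
 "b \<in> carrier Z ==> c \<in> carrier Z ==> B b + B c = B (b \<oplus>\<^bsub>Z\<^esub> c)"
 "b \<in> carrier Z ==> sc r (B b) = B (zz_scalar n r \<bullet> b)" "B \<zero>\<^bsub>Z\<^esub> = Zr []"
 using B_El(1)[of "[]" "Alg c" b] plus_El'[of "[]" "Alg b" "Alg c"] sc_El'[of "[]" "Alg b" r]
 by (simp_all add: regular_closed regular_simps Zr_def) (simp_all add: B_def regular_closed regular_simps)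

lemma One_laws [simp]: "ok t ==> One * t = t" "ok t ==> t * One = t"
 unfolding One_def by (elim okE; metis B_El zz_laws(17,18) Fo_zzb Z.one_closed)+

lemma wd_NilE: assumes "ok t" "wd t = []" obtains b where "b \<in> carrier Z" "t = B b"
proof -
 have "val t \<in> bcar (zz_regular n)" "t = El n [] (val t)"
  using assms by (elim okE; simp)+
 then show ?thesis using that by (auto simp: bcar_regular B_def)
qed

lemma ok_span [consumes 4, case_names zero times add]:
 assumes "ok t" "wd t = w @ v" "word w" "word v"
  and "P (Zr (w @ v))"
  and "\<And>x y. ok x ==> wd x = w ==> ok y ==> wd y = v ==> P (x * y)"
  and "\<And>a b. ok a ==> wd a = w @ v ==> ok b ==> wd b = w @ v ==> P a ==> P b ==> P (a + b)"
 shows "P t"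
proof -
 have t: "val t \<in> bcar (Fo (w @ v))" "t = El n (w @ v) (val t)" using assms(1,2) by (elim okE; simp)+
 have wv: "word (w @ v)" using assms by simp
 have "P (El n (w @ v) (val t))"
  using assms(3,4) t(1)
 proof (induction rule: op_span)
  case (op x y)
  then show ?case using assms(6)[of "El n w x" "El n v y"] assms(3,4) by (simp add: El_simps times_El')
 next
  case (add a b)
  then show ?case using assms(7)[of "El n (w @ v) a" "El n (w @ v) b"] wv by (simp add: El_simps plus_El' del: word_simps)
 qed (use assms(5) in \<open>simp add: Zr_def\<close>)
 then show ?thesis using t(2) by simp
qed

definition hom :: "int => tens => bool" where
 "hom d t \<longleftrightarrow> (\<exists>w x. word w \<and> x \<in> bdeg (Fo w) d \<and> t = El n w x)"

lemma Fo_graded: "word w ==> graded_bimodule Z (zz_degree n) Z (zz_degree n) (Fo w)"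
 by (rule zzb_graded[OF Fo_zzb])

lemma homD: assumes "hom d t" shows "ok t" "val t \<in> bdeg (Fo (wd t)) d"
proof -
 obtain w x where *: "word w" "x \<in> bdeg (Fo w) d" "t = El n w x" using assms by (auto simp: hom_def)
 then have "x \<in> bcar (Fo w)" using graded_bimodule.deg_closed[OF Fo_graded] by blast
 then show "ok t" "val t \<in> bdeg (Fo (wd t)) d" using * by (simp_all add: El_simps)
qed

lemma homI: assumes "ok t" "val t \<in> bdeg (Fo (wd t)) d" shows "hom d t"
 using assms by (elim okE) (auto simp: hom_def)

lemma hom_times: assumes "hom d s" "hom e t" shows "hom (d + e) (s * t)"
proof -
 note s = homD[OF assms(1)] and t = homD[OF assms(2)]
 have "val (s * t) = op (wd s) (wd t) (val s) (val t)"
  using s t by (elim okE) (metis times_El' El_simps(3) op_laws(1) word_simps(3))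
 then show ?thesis using op_deg[OF ok_word[OF s(1)] ok_word[OF t(1)] s(2) t(2)] s t
  by (intro homI) simp_all
qed

lemma hom_add: assumes "hom d s" "hom d t" "wd s = wd t" shows "hom d (s + t)"
proof -
 note s = homD[OF assms(1)] and t = homD[OF assms(2)]
 have "val (s + t) = badd (Fo (wd t)) (val s) (val t)"
  using s(1) t(1) assms(3) by (elim okE) (metis plus_El' El_simps(3) zz_laws(1) Fo_zzb)
 then show ?thesis using s t assms(3) graded_bimodule.deg_add[OF Fo_graded[OF ok_word[OF t(1)]]]
  by (intro homI) simp_all
qed

lemma hom_Zr: "word w ==> hom d (Zr w)"
 by (rule homI) (simp_all add: val_Zr graded_bimodule.deg_zero[OF Fo_graded])

lemma hom_sc: assumes "hom d t" shows "hom d (sc r t)"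
proof -
 note t = homD[OF assms(1)]
 have "val (sc r t) = lact (Fo (wd t)) (zz_scalar n r) (val t)"
  using t(1) by (elim okE) (metis sc_El' El_simps(3) zz_laws(5) Fo_zzb zz_scalar_closed)
 then show ?thesis using t graded_bimodule.deg_lact[OF Fo_graded[OF ok_word[OF t(1)]] zz_degree_scalar _ t(2), of r]
  by (intro homI) simp_all
qed

lemma hom_B: "b \<in> zz_degree n d ==> hom d (B b)"
 unfolding hom_def B_def using zz_degree_closed[of b d] by (auto simp: regular_simps intro!: exI[of _ "[]"])

lemma hom_span [consumes 4, case_names zero times add]:
 assumes "hom d t" "wd t = w @ v" "word w" "word v"
  and "P (Zr (w @ v))"
  and "\<And>x y k. hom k x ==> wd x = w ==> hom (d - k) y ==> wd y = v ==> P (x * y)"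
  and "\<And>a b. ok a ==> wd a = w @ v ==> ok b ==> wd b = w @ v ==> P a ==> P b ==> P (a + b)"
 shows "P t"
proof -
 have t: "val t \<in> bdeg (Fo (w @ v)) d" "t = El n (w @ v) (val t)" using homD[OF assms(1)] assms(2) by (elim okE; simp)+
 have wv: "word (w @ v)" using assms by simp
 have "P (El n (w @ v) (val t))"
  using assms(3,4) t(1)
 proof (induction rule: op_deg_span)
  case (op x y k)
  then have c: "x \<in> bcar (Fo w)" "y \<in> bcar (Fo v)"
   using graded_bimodule.deg_closed[OF Fo_graded] assms(3,4) by blast+
  then have "hom k (El n w x)" "hom (d - k) (El n v y)"
   using op assms(3,4) by (auto simp: hom_def)
  then show ?case using assms(6)[of k "El n w x" "El n v y"] assms(3,4) c by (simp add: El_simps times_El')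
 next
  case (add a b)
  then show ?case using assms(7)[of "El n (w @ v) a" "El n (w @ v) b"] wv by (simp add: El_simps plus_El' del: word_simps)
 qed (use assms(5) in \<open>simp add: Zr_def\<close>)
 then show ?thesis using t(2) by simp
qed

subsection \<open>Bimodule maps acting on tensors\<close>

text \<open>A bimodule map records its target bimodule but not a word for it, so the target word is
  passed along.\<close>

definition app :: "bimap => nat list => tens => tens" where
 "app f v t = El n v (bfun f (val t))"

lemma app_El: "word w ==> x \<in> bcar (Fo w) ==> app f v (El n w x) = El n v (bfun f x)"
 by (simp add: app_def El_simps)

lemma app_laws:
 assumes f: "f \<in> bimaps n (Fo w) (Fo v)" and w: "word w" "word v" and t: "ok t" "wd t = w"
 shows "ok (app f v t)" "wd (app f v t) = v" "ok s ==> wd s = w ==> app f v (s + t) = app f v s + app f v t"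
  "app f v (sc r t) = sc r (app f v t)" "app f v (Zr w) = Zr v"
  "ok b ==> wd b = [] ==> app f v (b * t) = b * app f v t" "ok b ==> wd b = [] ==> app f v (t * b) = app f v t * b"
proof -
 note F = bimapsD[OF f Fo_zzb[OF w(1)] Fo_zzb[OF w(2)]]
 note Z = zz_laws[OF Fo_zzb[OF w(1)]]
 obtain x where x: "x \<in> bcar (Fo w)" "t = El n w x" using t by (elim okE) auto
 show "ok (app f v t)" "wd (app f v t) = v" using x w F by (simp_all add: app_El El_simps)
 show "ok s ==> wd s = w ==> app f v (s + t) = app f v s + app f v t"
 proof -
  assume "ok s" "wd s = w"
  then obtain y where "y \<in> bcar (Fo w)" "s = El n w y" by (elim okE) auto
  then show ?thesis using x w F by (simp add: app_El plus_El' Z)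
 qed
 show "app f v (sc r t) = sc r (app f v t)" using x w F by (simp add: app_El sc_El' Z)
 show "app f v (Zr w) = Zr v" using w F by (simp add: app_El Zr_def Z)
 show "ok b ==> wd b = [] ==> app f v (b * t) = b * app f v t" "ok b ==> wd b = [] ==> app f v (t * b) = app f v t * b"
  using x w F by (auto elim!: wd_NilE simp: B_El app_El Z)
qed

lemma app_eqI:
 assumes "f \<in> bimaps n (Fo w) (Fo v)" "g \<in> bimaps n (Fo w) (Fo v)" "word w" "word v"
  and "\<And>t. ok t ==> wd t = w ==> app f v t = app g v t"
 shows "f = g"
proof (rule bimap_eqI[OF assms(1,2)])
 fix x assume x: "x \<in> bcar (Fo w)"
 have "El n v (bfun f x) = El n v (bfun g x)"
  using assms(5)[of "El n w x"] assms(3) x by (simp add: El_simps app_El)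
 then show "bfun f x = bfun g x"
  using bimapsD(3)[OF assms(1) Fo_zzb[OF assms(3)] Fo_zzb[OF assms(4)] x] El_inject[of n v _ n v] n_ge_2 assms(4)
  by (simp add: word_def)
qed

subsection \<open>The bimodules of the generators\<close>

definition uel :: "nat => elt" where
 "uel s = tensor_class (KK s) (P_left n s) (P_right n s) [(Alg (pcl s []), Alg (pcl s []))]"

lemma U_simps: "bcar (U_bimod n s) = bcar (tensor (KK s) (P_left n s) (P_right n s))"
 "badd (U_bimod n s) = badd (tensor (KK s) (P_left n s) (P_right n s))"
 "bzero (U_bimod n s) = bzero (tensor (KK s) (P_left n s) (P_right n s))"
 "lact (U_bimod n s) = lact (tensor (KK s) (P_left n s) (P_right n s))"
 "ract (U_bimod n s) = ract (tensor (KK s) (P_left n s) (P_right n s))"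
 by (simp_all add: U_bimod_def)

lemma P_simps: "bcar (P_left n s) = Alg ` PL s" "lact (P_left n s) a (Alg b) = Alg (a \<bullet> b)"
 "ract (P_left n s) (Alg b) c = Alg (b \<bullet> kem s c)" "badd (P_left n s) (Alg a) (Alg b) = Alg (a \<oplus>\<^bsub>Z\<^esub> b)"
 "bzero (P_left n s) = Alg \<zero>\<^bsub>Z\<^esub>" "bdeg (P_left n s) d = Alg ` (PL s \<inter> zz_degree n d)"
 "bcar (P_right n s) = Alg ` PR s" "ract (P_right n s) (Alg b) a = Alg (b \<bullet> a)"
 "lact (P_right n s) c (Alg b) = Alg (kem s c \<bullet> b)" "badd (P_right n s) (Alg a) (Alg b) = Alg (a \<oplus>\<^bsub>Z\<^esub> b)"
 "bzero (P_right n s) = Alg \<zero>\<^bsub>Z\<^esub>" "bdeg (P_right n s) d = Alg ` (PR s \<inter> zz_degree n d)"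
 by (simp_all add: P_left_def P_right_def pe_def zz_bimod_simps)

lemma P_alg:
 assumes s: "s \<in> {1..n}"
 shows "x \<in> bcar (P_left n s) ==> the_alg x \<in> carrier Z" "y \<in> bcar (P_right n s) ==> the_alg y \<in> carrier Z"
  "x \<in> bcar (P_left n s) ==> x' \<in> bcar (P_left n s) ==> the_alg (badd (P_left n s) x x') = the_alg x \<oplus>\<^bsub>Z\<^esub> the_alg x'"
  "y \<in> bcar (P_right n s) ==> y' \<in> bcar (P_right n s) ==> the_alg (badd (P_right n s) y y') = the_alg y \<oplus>\<^bsub>Z\<^esub> the_alg y'"
  "the_alg (bzero (P_left n s)) = \<zero>\<^bsub>Z\<^esub>"
  "x \<in> bcar (P_left n s) ==> the_alg (lact (P_left n s) a x) = a \<bullet> the_alg x"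
  "x \<in> bcar (P_left n s) ==> the_alg (ract (P_left n s) x c) = the_alg x \<bullet> kem s c"
  "y \<in> bcar (P_right n s) ==> the_alg (ract (P_right n s) y a) = the_alg y \<bullet> a"
  "y \<in> bcar (P_right n s) ==> the_alg (lact (P_right n s) c y) = kem s c \<bullet> the_alg y"
proof -
 have a: "\<exists>a\<in>carrier Z. x = Alg a" if "x \<in> bcar (P_left n s)" for x using that s unfolding P_simps by auto
 have b: "\<exists>a\<in>carrier Z. x = Alg a" if "x \<in> bcar (P_right n s)" for x using that s unfolding P_simps by auto
 show "x \<in> bcar (P_left n s) ==> the_alg x \<in> carrier Z"
  "x \<in> bcar (P_left n s) ==> x' \<in> bcar (P_left n s) ==> the_alg (badd (P_left n s) x x') = the_alg x \<oplus>\<^bsub>Z\<^esub> the_alg x'"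
  "x \<in> bcar (P_left n s) ==> the_alg (lact (P_left n s) a x) = a \<bullet> the_alg x"
  "x \<in> bcar (P_left n s) ==> the_alg (ract (P_left n s) x c) = the_alg x \<bullet> kem s c"
  by (auto dest!: a simp: P_simps(2-5))
 show "y \<in> bcar (P_right n s) ==> the_alg y \<in> carrier Z"
  "y \<in> bcar (P_right n s) ==> y' \<in> bcar (P_right n s) ==> the_alg (badd (P_right n s) y y') = the_alg y \<oplus>\<^bsub>Z\<^esub> the_alg y'"
  "y \<in> bcar (P_right n s) ==> the_alg (ract (P_right n s) y a) = the_alg y \<bullet> a"
  "y \<in> bcar (P_right n s) ==> the_alg (lact (P_right n s) c y) = kem s c \<bullet> the_alg y"
  by (auto dest!: b simp: P_simps(8-11))
 show "the_alg (bzero (P_left n s)) = \<zero>\<^bsub>Z\<^esub>" by (simp add: P_simps)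
qed

lemma U_lift:
 assumes s: "s \<in> {1..n}" and N: "zzb N" and bal: "balanced (KK s) (P_left n s) (P_right n s) N f"
 shows "\<And>x y. x \<in> bcar (P_left n s) ==> y \<in> bcar (P_right n s) ==> tlift N f (tensor_class (KK s) (P_left n s) (P_right n s) [(x, y)]) = f x y"
  "\<And>t. t \<in> bcar (U_bimod n s) ==> tlift N f t \<in> bcar N"
  "\<And>t u. t \<in> bcar (U_bimod n s) ==> u \<in> bcar (U_bimod n s) ==> tlift N f (badd (U_bimod n s) t u) = badd N (tlift N f t) (tlift N f u)"
  "tlift N f (bzero (U_bimod n s)) = bzero N"
  "(\<And>x y a. x \<in> bcar (P_left n s) ==> y \<in> bcar (P_right n s) ==> a \<in> carrier Z ==> f (lact (P_left n s) a x) y = lact N a (f x y))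
   ==> (\<And>t a. t \<in> bcar (U_bimod n s) ==> a \<in> carrier Z ==> tlift N f (lact (U_bimod n s) a t) = lact N a (tlift N f t))"
  "(\<And>x y a. x \<in> bcar (P_left n s) ==> y \<in> bcar (P_right n s) ==> a \<in> carrier Z ==> f x (ract (P_right n s) y a) = ract N (f x y) a)
   ==> (\<And>t a. t \<in> bcar (U_bimod n s) ==> a \<in> carrier Z ==> tlift N f (ract (U_bimod n s) t a) = ract N (tlift N f t) a)"
proof -
 interpret L: tensor_lift Z "zz_degree n" "K_ring s" "K_deg s" Z "zz_degree n" "P_left n s" "P_right n s" Z "zz_degree n" Z "zz_degree n" N f
  using tensor_pair_P[OF s] zzb_graded[OF N] bal by (simp add: tensor_lift_def tensor_lift_axioms_def)
 show "\<And>x y. x \<in> bcar (P_left n s) ==> y \<in> bcar (P_right n s) ==> tlift N f (tensor_class (KK s) (P_left n s) (P_right n s) [(x, y)]) = f x y"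
  using L.tlift_pure by simp
 show "\<And>t. t \<in> bcar (U_bimod n s) ==> tlift N f t \<in> bcar N"
  using L.tlift_closed by (simp add: U_simps)
 show "\<And>t u. t \<in> bcar (U_bimod n s) ==> u \<in> bcar (U_bimod n s) ==> tlift N f (badd (U_bimod n s) t u) = badd N (tlift N f t) (tlift N f u)"
  using L.tlift_add by (simp add: U_simps)
 show "tlift N f (bzero (U_bimod n s)) = bzero N"
  using L.tlift_zero by (simp add: U_simps)
 show "(\<And>x y a. x \<in> bcar (P_left n s) ==> y \<in> bcar (P_right n s) ==> a \<in> carrier Z ==> f (lact (P_left n s) a x) y = lact N a (f x y))
   ==> (\<And>t a. t \<in> bcar (U_bimod n s) ==> a \<in> carrier Z ==> tlift N f (lact (U_bimod n s) a t) = lact N a (tlift N f t))"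
  using L.tlift_lact by (simp add: U_simps)
 show "(\<And>x y a. x \<in> bcar (P_left n s) ==> y \<in> bcar (P_right n s) ==> a \<in> carrier Z ==> f x (ract (P_right n s) y a) = ract N (f x y) a)
   ==> (\<And>t a. t \<in> bcar (U_bimod n s) ==> a \<in> carrier Z ==> tlift N f (ract (U_bimod n s) t a) = ract N (tlift N f t) a)"
  using L.tlift_ract by (simp add: U_simps)
qed

lemma U_pure:
 assumes s: "s \<in> {1..n}"
 shows "a \<in> PL s ==> b \<in> PR s ==> tensor_class (KK s) (P_left n s) (P_right n s) [(Alg a, Alg b)] = lact (U_bimod n s) a (ract (U_bimod n s) (uel s) b)"
  "uel s \<in> bcar (U_bimod n s)" "c \<in> KK s ==> lact (U_bimod n s) (kem s c) (uel s) = ract (U_bimod n s) (uel s) (kem s c)"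
  "\<And>P. t \<in> bcar (U_bimod n s) ==> P (bzero (U_bimod n s))
   ==> (\<And>a b. a \<in> carrier Z ==> b \<in> carrier Z ==> P (lact (U_bimod n s) a (ract (U_bimod n s) (uel s) b)))
   ==> (\<And>x y. x \<in> bcar (U_bimod n s) ==> y \<in> bcar (U_bimod n s) ==> P x ==> P y ==> P (badd (U_bimod n s) x y)) ==> P t"
  "\<And>P. t \<in> bdeg (U_bimod n s) d ==> P (bzero (U_bimod n s))
   ==> (\<And>a b k. a \<in> zz_degree n k ==> b \<in> zz_degree n (d + 1 - k) ==> P (lact (U_bimod n s) a (ract (U_bimod n s) (uel s) b)))
   ==> (\<And>x y. x \<in> bcar (U_bimod n s) ==> y \<in> bcar (U_bimod n s) ==> P x ==> P y ==> P (badd (U_bimod n s) x y)) ==> P t"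
  "uel s \<in> bdeg (U_bimod n s) (-1)"
proof -
 interpret T: tensor_pair Z "zz_degree n" "K_ring s" "K_deg s" Z "zz_degree n" "P_left n s" "P_right n s"
  by (rule tensor_pair_P[OF s])
 have e: "pcl s [] \<in> PL s" "pcl s [] \<in> PR s" unfolding PL_iff[OF s] PR_iff[OF s] using s by (auto simp: pcl_nil_idem)
 have ec: "Alg (pcl s []) \<in> bcar (P_left n s)" "Alg (pcl s []) \<in> bcar (P_right n s)" using e by (auto simp: P_simps)
 have PLZ: "a \<in> PL s ==> a \<in> carrier Z \<and> a \<bullet> pcl s [] = a" for a using PL_iff[OF s] by blast
 have PRZ: "a \<in> PR s ==> a \<in> carrier Z \<and> pcl s [] \<bullet> a = a" for a using PR_iff[OF s] by blast
 have ract_e: "ract T.T (uel s) b = T.pure (Alg (pcl s [])) (Alg (pcl s [] \<bullet> b))" if "b \<in> carrier Z" for b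
  using T.ract_pure[OF that ec] by (simp add: uel_def P_simps)
 have br: "Alg (pcl s [] \<bullet> b) \<in> bcar (P_right n s)" if "b \<in> carrier Z" for b
  using that by (auto simp: P_simps)
 show p: "tensor_class (KK s) (P_left n s) (P_right n s) [(Alg a, Alg b)] = lact (U_bimod n s) a (ract (U_bimod n s) (uel s) b)"
  if "a \<in> PL s" "b \<in> PR s" for a b
  using PLZ[OF that(1)] PRZ[OF that(2)] ract_e[of b] T.lact_pure[OF _ ec(1) br[of b], of a]
  by (simp add: U_simps P_simps)
 show u: "uel s \<in> bcar (U_bimod n s)" using T.pure_closed[OF ec] by (simp add: uel_def U_simps)
 show "c \<in> KK s ==> lact (U_bimod n s) (kem s c) (uel s) = ract (U_bimod n s) (uel s) (kem s c)"
 proof -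
  assume c: "c \<in> KK s"
  have "lact T.T (kem s c) (uel s) = T.pure (Alg (kem s c)) (Alg (pcl s []))"
   using T.lact_pure[OF _ ec, of "kem s c"] s c by (simp add: uel_def P_simps kem_pcl)
  also have "\<dots> = T.pure (ract (P_left n s) (Alg (pcl s [])) c) (Alg (pcl s []))"
   using s c by (simp add: P_simps kem_pcl)
  also have "\<dots> = T.pure (Alg (pcl s [])) (lact (P_right n s) c (Alg (pcl s [])))"
   using T.pure_balanced[OF ec(1) _ ec(2), of c] c by simp
  also have "\<dots> = ract T.T (uel s) (kem s c)"
   using ract_e[of "kem s c"] s c by (simp add: P_simps kem_pcl)
  finally show ?thesis by (simp add: U_simps)
 qed
 show "t \<in> bcar (U_bimod n s) ==> P (bzero (U_bimod n s))
   ==> (\<And>a b. a \<in> carrier Z ==> b \<in> carrier Z ==> P (lact (U_bimod n s) a (ract (U_bimod n s) (uel s) b)))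
   ==> (\<And>x y. x \<in> bcar (U_bimod n s) ==> y \<in> bcar (U_bimod n s) ==> P x ==> P y ==> P (badd (U_bimod n s) x y)) ==> P t" for P
 proof -
  assume *: "t \<in> bcar (U_bimod n s)" "P (bzero (U_bimod n s))"
   "\<And>a b. a \<in> carrier Z ==> b \<in> carrier Z ==> P (lact (U_bimod n s) a (ract (U_bimod n s) (uel s) b))"
   "\<And>x y. x \<in> bcar (U_bimod n s) ==> y \<in> bcar (U_bimod n s) ==> P x ==> P y ==> P (badd (U_bimod n s) x y)"
  have pp: "P (T.pure x y)" if xy: "x \<in> bcar (P_left n s)" "y \<in> bcar (P_right n s)" for x y
  proof -
   obtain a b where ab: "x = Alg a" "y = Alg b" "a \<in> PL s" "b \<in> PR s" using xy unfolding P_simps by blast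
   show ?thesis using p[OF ab(3,4)] *(3)[of a b] PLZ[OF ab(3)] PRZ[OF ab(4)] ab(1,2) by simp
  qed
  show ?thesis using *(1,2,4) pp T.tensor_induct[of t P] unfolding U_simps K_ring_simps by blast
 qed
 show "t \<in> bdeg (U_bimod n s) d ==> P (bzero (U_bimod n s))
   ==> (\<And>a b k. a \<in> zz_degree n k ==> b \<in> zz_degree n (d + 1 - k) ==> P (lact (U_bimod n s) a (ract (U_bimod n s) (uel s) b)))
   ==> (\<And>x y. x \<in> bcar (U_bimod n s) ==> y \<in> bcar (U_bimod n s) ==> P x ==> P y ==> P (badd (U_bimod n s) x y)) ==> P t" for P
 proof -
  assume *: "t \<in> bdeg (U_bimod n s) d" "P (bzero (U_bimod n s))"
   "\<And>a b k. a \<in> zz_degree n k ==> b \<in> zz_degree n (d + 1 - k) ==> P (lact (U_bimod n s) a (ract (U_bimod n s) (uel s) b))"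
   "\<And>x y. x \<in> bcar (U_bimod n s) ==> y \<in> bcar (U_bimod n s) ==> P x ==> P y ==> P (badd (U_bimod n s) x y)"
  have pp: "P (T.pure x y)" if xy: "x \<in> bdeg (P_left n s) k" "y \<in> bdeg (P_right n s) (d + 1 - k)" for x y k
  proof -
   obtain a b where ab: "x = Alg a" "y = Alg b" "a \<in> PL s" "b \<in> PR s" "a \<in> zz_degree n k" "b \<in> zz_degree n (d + 1 - k)"
    using xy unfolding P_simps by blast
   show ?thesis using p[OF ab(3,4)] *(3)[OF ab(5,6)] ab(1,2) by simp
  qed
  have t: "t \<in> bdeg T.T (d + 1)" using *(1) by (simp add: U_bimod_def)
  show ?thesis using t *(2,4) pp T.tensor_deg_induct[of t "d + 1" P] unfolding U_simps K_ring_simps by blast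
 qed
 \<comment> \<open>Before the shift \<open>e_s \<otimes> e_s\<close> has degree 0.\<close>
 show "uel s \<in> bdeg (U_bimod n s) (-1)"
  using T.pure_deg[of "Alg (pcl s [])" 0 "Alg (pcl s [])" 0] e zz_degree_pcl[of s "[]" 0] s
  by (simp add: U_bimod_def uel_def P_simps path_degree_def)
qed

definition U :: "nat => tens" where "U s = El n [s] (uel s)"

definition ke :: "nat => complex => tens" where "ke s c = B (kem s c)"

lemma U_ok [simp]: "s \<in> {1..n} ==> ok (U s)" "s \<in> {1..n} ==> wd (U s) = [s]"
 unfolding U_def using U_pure(2)[of s] by (simp_all add: El_simps)

lemma U_act: assumes "s \<in> {1..n}" "a \<in> carrier Z" "b \<in> carrier Z"
 shows "El n [s] (lact (U_bimod n s) a (ract (U_bimod n s) (uel s) b)) = B a * U s * B b"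
 unfolding U_def using assms U_pure(2)[of s] zz_laws(5,6,19)[OF zzb_U[OF assms(1)]] by (simp add: B_El)

lemma ke_U: "s \<in> {1..n} ==> c \<in> KK s ==> ke s c * U s = U s * ke s c"
 unfolding ke_def U_def by (simp add: B_El U_pure)

lemma U_span [consumes 3, case_names zero gen add]:
 assumes "ok t" "wd t = [s]" "s \<in> {1..n}"
  and "P (Zr [s])" "\<And>a b. a \<in> carrier Z ==> b \<in> carrier Z ==> P (B a * U s * B b)"
  and "\<And>x y. ok x ==> wd x = [s] ==> ok y ==> wd y = [s] ==> P x ==> P y ==> P (x + y)"
 shows "P t"
proof -
 have t: "val t \<in> bcar (U_bimod n s)" "t = El n [s] (val t)" using assms(1,2) by (elim okE; simp)+
 have "P (El n [s] (val t))"
 proof (rule U_pure(4)[OF assms(3) t(1)])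
  fix x y assume "x \<in> bcar (U_bimod n s)" "y \<in> bcar (U_bimod n s)" "P (El n [s] x)" "P (El n [s] y)"
  then show "P (El n [s] (badd (U_bimod n s) x y))"
   using assms(6)[of "El n [s] x" "El n [s] y"] assms(3) plus_El'[of "[s]" x y] by (simp add: El_simps)
 qed (use assms(3-5) in \<open>simp_all add: U_act\<close>, simp add: Zr_def)
 then show ?thesis using t by simp
qed

lemma U_hom_span [consumes 3, case_names zero gen add]:
 assumes "hom d t" "wd t = [s]" "s \<in> {1..n}"
  and "P (Zr [s])" "\<And>a b k. a \<in> zz_degree n k ==> b \<in> zz_degree n (d + 1 - k) ==> P (B a * U s * B b)"
  and "\<And>x y. ok x ==> wd x = [s] ==> ok y ==> wd y = [s] ==> P x ==> P y ==> P (x + y)"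
 shows "P t"
proof -
 have t: "val t \<in> bdeg (U_bimod n s) d" "t = El n [s] (val t)" using homD[OF assms(1)] assms(2) by (elim okE; simp)+
 have "P (El n [s] (val t))"
 proof (rule U_pure(5)[OF assms(3) t(1)])
  fix x y assume "x \<in> bcar (U_bimod n s)" "y \<in> bcar (U_bimod n s)" "P (El n [s] x)" "P (El n [s] y)"
  then show "P (El n [s] (badd (U_bimod n s) x y))"
   using assms(6)[of "El n [s] x" "El n [s] y"] assms(3) plus_El'[of "[s]" x y] by (simp add: El_simps)
 next
  fix a b k assume ab: "a \<in> zz_degree n k" "b \<in> zz_degree n (d + 1 - k)"
  show "P (El n [s] (lact (U_bimod n s) a (ract (U_bimod n s) (uel s) b)))"
   using assms(5)[OF ab] U_act[OF assms(3) zz_degree_closed[OF ab(1)] zz_degree_closed[OF ab(2)]] by simp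
 qed (use assms(4) in \<open>simp add: Zr_def\<close>)
 then show ?thesis using t by simp
qed

lemma hom_U: "s \<in> {1..n} ==> hom (-1) (U s)"
 unfolding hom_def U_def using U_pure(6)[of s] by (auto intro!: exI[of _ "[s]"])

text \<open>\<open>U_s\<close> represents the elements \<open>m\<close> with
  \<open>e_s m = m\<close> that commute with the field of \<open>s\<close>: such an \<open>m\<close>
  determines the bimodule map \<open>a \<otimes> b \<mapsto> a m b\<close>.\<close>

definition Uext :: "nat => nat list => tens => bimap" where
 "Uext s v m = mk_bimap (U_bimod n s) (Fo v) (tlift (Fo v) (\<lambda>x y. lact (Fo v) (the_alg x) (ract (Fo v) (val m) (the_alg y))))"

lemma Uext:
 assumes s: "s \<in> {1..n}" and m: "ok m" "wd m = v" "\<And>c. c \<in> KK s ==> ke s c * m = m * ke s c"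
  and em: "B (pcl s []) * m = m"
 shows "Uext s v m \<in> bimaps n (Fo [s]) (Fo v)" "app (Uext s v m) v (U s) = m"
proof -
 have v: "word v" using ok_word m by auto
 note N = Fo_zzb[OF v] and Nl = zz_laws[OF Fo_zzb[OF v]]
 have vm: "val m \<in> bcar (Fo v)" "m = El n v (val m)" using m(1,2) by (elim okE; simp)+
 have com: "lact (Fo v) (kem s c) (val m) = ract (Fo v) (val m) (kem s c)" if "c \<in> KK s" for c
 proof -
  have "El n v (lact (Fo v) (kem s c) (val m)) = El n v (ract (Fo v) (val m) (kem s c))"
   using m(3)[OF that] vm v s that by (metis B_El kem_closed ke_def)
  then show ?thesis using El_inject[of n v _ n v] n_ge_2 v vm Nl(5)[of "kem s c" "val m"] s that by (simp add: word_def)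
 qed
 have PLZ: "a \<in> PL s ==> a \<in> carrier Z" "a \<in> PR s ==> a \<in> carrier Z" for a using s by auto
 let ?f = "\<lambda>x y. lact (Fo v) (the_alg x) (ract (Fo v) (val m) (the_alg y))"
 have bal: "balanced (KK s) (P_left n s) (P_right n s) (Fo v) ?f"
 proof (rule balancedI)
  fix x c y assume xy: "x \<in> bcar (P_left n s)" "c \<in> KK s" "y \<in> bcar (P_right n s)"
  then obtain a b where ab: "x = Alg a" "y = Alg b" "a \<in> carrier Z" "b \<in> carrier Z" unfolding P_simps using PLZ by blast
  have k: "kem s c \<in> carrier Z" using s xy by simp
  have "lact (Fo v) (a \<bullet> kem s c) (ract (Fo v) (val m) b) = lact (Fo v) a (ract (Fo v) (lact (Fo v) (kem s c) (val m)) b)"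
   using ab k vm by (simp add: Nl)
  also have "\<dots> = lact (Fo v) a (ract (Fo v) (val m) (kem s c \<bullet> b))"
   using ab k vm com[OF xy(2)] by (simp add: Nl)
  finally show "?f (ract (P_left n s) x c) y = ?f x (lact (P_right n s) c y)" using ab by (simp add: P_simps)
 qed (use vm(1) in \<open>simp_all add: P_alg[OF s] Nl\<close>)
 note L = U_lift[OF s N bal]
 have b: "Uext s v m \<in> bimaps n (U_bimod n s) (Fo v)"
  unfolding Uext_def
 proof (rule bimapsI)
  show "tlift (Fo v) ?f (lact (U_bimod n s) a t) = lact (Fo v) a (tlift (Fo v) ?f t)"
   if "t \<in> bcar (U_bimod n s)" "a \<in> carrier Z" for t a
   by (rule L(5)) (use that vm(1) in \<open>simp_all add: P_alg[OF s] Nl\<close>)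
  show "tlift (Fo v) ?f (ract (U_bimod n s) t a) = ract (Fo v) (tlift (Fo v) ?f t) a"
   if "t \<in> bcar (U_bimod n s)" "a \<in> carrier Z" for t a
   by (rule L(6)) (use that vm(1) in \<open>simp_all add: P_alg[OF s] Nl\<close>)
 qed (simp_all add: L)
 then show "Uext s v m \<in> bimaps n (Fo [s]) (Fo v)" by simp
 have e: "pcl s [] \<in> PL s" "pcl s [] \<in> PR s" unfolding PL_iff[OF s] PR_iff[OF s] using s by (auto simp: pcl_nil_idem)
 have me: "m * B (pcl s []) = m"
  using m(3)[of 1] em by (simp add: KK_closed ke_def kem_one)
 have "bfun (Uext s v m) (uel s) = lact (Fo v) (pcl s []) (ract (Fo v) (val m) (pcl s []))"
  unfolding Uext_def using U_pure(2)[OF s] L(1)[of "Alg (pcl s [])" "Alg (pcl s [])"] e by (simp add: P_simps flip: uel_def)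
 then have "app (Uext s v m) v (U s) = El n v (lact (Fo v) (pcl s []) (ract (Fo v) (val m) (pcl s [])))"
  unfolding U_def using s U_pure(2)[OF s] by (simp add: app_El)
 also have "\<dots> = B (pcl s []) * El n v (ract (Fo v) (val m) (pcl s []))"
  using v vm s by (intro B_El(1)[symmetric]) (simp_all add: Nl)
 also have "El n v (ract (Fo v) (val m) (pcl s [])) = El n v (val m) * B (pcl s [])"
  using v vm s by (intro B_El(2)[symmetric]) simp_all
 also have "B (pcl s []) * (El n v (val m) * B (pcl s [])) = m" using vm em me by simp
 finally show "app (Uext s v m) v (U s) = m" .
qed

text \<open>Bimodule maps out of the algebra correspond to central elements \<open>m\<close>, the
  images of 1.\<close>

definition Cext :: "nat list => tens => bimap" where
 "Cext v m = mk_bimap (zz_regular n) (Fo v) (\<lambda>x. lact (Fo v) (the_alg x) (val m))"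

lemma Cext:
 assumes m: "ok m" "wd m = v" "\<And>b. ok b ==> wd b = [] ==> b * m = m * b"
 shows "Cext v m \<in> bimaps n (Fo []) (Fo v)" "app (Cext v m) v One = m"
proof -
 have v: "word v" using ok_word m by auto
 note Nl = zz_laws[OF Fo_zzb[OF v]]
 have vm: "val m \<in> bcar (Fo v)" "m = El n v (val m)" using m(1,2) by (elim okE; simp)+
 have com: "lact (Fo v) b (val m) = ract (Fo v) (val m) b" if "b \<in> carrier Z" for b
 proof -
  have "El n v (lact (Fo v) b (val m)) = El n v (ract (Fo v) (val m) b)"
   using m(3)[of "B b"] vm v that by (metis B_El ok_simps(4) wd_simps(4))
  then show ?thesis using El_inject[of n v _ n v] n_ge_2 v vm Nl(5)[of b "val m"] that by (simp add: word_def)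
 qed
 have "Cext v m \<in> bimaps n (zz_regular n) (Fo v)"
  unfolding Cext_def
  by (rule bimapsI) (use vm in \<open>auto simp: bcar_regular regular_simps Nl com simp flip: com\<close>)
 then show "Cext v m \<in> bimaps n (Fo []) (Fo v)" by simp
 show "app (Cext v m) v One = m"
  unfolding One_def B_def using vm
  by (subst app_El) (simp_all add: regular_closed Cext_def Nl)
qed

text \<open>Contraction of the two inner factors of
  \<open>(x \<otimes> y) \<otimes> (z \<otimes> w)\<close> with \<open>y\<close> fixed: the trace of
  \<open>y z\<close> becomes a scalar in front of \<open>w\<close>. As the source is a tensor
  product of tensor products, the contraction is lifted in two stages, here over
  \<open>z \<otimes> w\<close> and in \<open>merge_fun\<close> over
  \<open>x \<otimes> y\<close>.\<close>

definition lam :: "nat => zz => elt => elt" where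
 "lam s y = tlift (U_bimod n s) (\<lambda>z w. lact (U_bimod n s) (kem s (trace s (y \<bullet> the_alg z))) (ract (U_bimod n s) (uel s) (the_alg w)))"

lemma lam_laws:
 assumes s: "s \<in> {1..n}" and y: "y \<in> carrier Z"
 defines "N \<equiv> U_bimod n s"
 shows "q \<in> bcar N ==> lam s y q \<in> bcar N"
  "q \<in> bcar N ==> q' \<in> bcar N ==> lam s y (badd N q q') = badd N (lam s y q) (lam s y q')"
  "lam s y (bzero N) = bzero N"
  "q \<in> bcar N ==> b \<in> carrier Z ==> lam s y (ract N q b) = ract N (lam s y q) b"
  "a \<in> carrier Z ==> b \<in> carrier Z ==> lam s y (lact N a (ract N (uel s) b)) = lact N (kem s (trace s (y \<bullet> a))) (ract N (uel s) b)"
proof -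
 let ?f = "\<lambda>z w. lact N (kem s (trace s (y \<bullet> the_alg z))) (ract N (uel s) (the_alg w))"
 have N: "zzb N" unfolding N_def by (rule zzb_U[OF s])
 note Nl = zz_laws[OF N]
 have u: "uel s \<in> bcar N" unfolding N_def by (rule U_pure(2)[OF s])
 have tk: "kem s (trace s b) \<in> carrier Z" if "b \<in> carrier Z" for b
  using s trace_in_KK[OF that] by simp
 have com: "c \<in> KK s ==> lact N (kem s c) (uel s) = ract N (uel s) (kem s c)" for c
  unfolding N_def by (rule U_pure(3)[OF s])
 have bal: "balanced (KK s) (P_left n s) (P_right n s) N ?f"
 proof (rule balancedI)
  fix z c w assume z: "z \<in> bcar (P_left n s)" "c \<in> KK s" "w \<in> bcar (P_right n s)"
  then have a: "the_alg z \<in> carrier Z" "the_alg w \<in> carrier Z" "kem s c \<in> carrier Z"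
   using P_alg[OF s] s by auto
  let ?t = "trace s (y \<bullet> the_alg z)"
  have t: "?t \<in> KK s" using a y by (intro trace_in_KK) simp
  \<comment> \<open>Linearity of the trace extracts \<open>c\<close> on the right, and since the
    generator commutes with the field, \<open>c\<close> reappears in front of
    \<open>w\<close>.\<close>
  have "?f (ract (P_left n s) z c) w = lact N (kem s (trace s ((y \<bullet> the_alg z) \<bullet> kem s c))) (ract N (uel s) (the_alg w))"
   using a y z by (simp add: P_alg[OF s] Z.m_assoc)
  also have "\<dots> = lact N (kem s (?t * c)) (ract N (uel s) (the_alg w))"
   using a y z s by (subst trace_kem) simp_all
  also have "\<dots> = lact N (kem s ?t) (lact N (kem s c) (ract N (uel s) (the_alg w)))"
   using a y z s t u by (subst kem_mult) (simp_all add: Nl)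
  also have "\<dots> = lact N (kem s ?t) (ract N (lact N (kem s c) (uel s)) (the_alg w))"
   using a u by (simp add: Nl)
  also have "\<dots> = ?f z (lact (P_right n s) c w)"
   using a u z by (simp add: com P_alg[OF s] Nl)
  finally show "?f (ract (P_left n s) z c) w = ?f z (lact (P_right n s) c w)" .
 qed (use y s u in \<open>simp_all add: P_alg[OF s] Nl tk Z.r_distr trace_add kem_add trace_in_KK kem_zero\<close>)
 note L = U_lift[OF s N bal, folded N_def lam_def]
 have lam: "lam s y = tlift N ?f" by (simp add: lam_def N_def)
 show "q \<in> bcar N ==> lam s y q \<in> bcar N"
  "q \<in> bcar N ==> q' \<in> bcar N ==> lam s y (badd N q q') = badd N (lam s y q) (lam s y q')"
  "lam s y (bzero N) = bzero N"
  unfolding lam by (simp_all add: L)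
 show "q \<in> bcar N ==> b \<in> carrier Z ==> lam s y (ract N q b) = ract N (lam s y q) b"
  unfolding lam by (rule L(6)) (use y s u in \<open>simp_all add: P_alg[OF s] Nl tk\<close>)
 show "a \<in> carrier Z ==> b \<in> carrier Z ==> lam s y (lact N a (ract N (uel s) b)) = lact N (kem s (trace s (y \<bullet> a))) (ract N (uel s) b)"
 proof -
  assume ab: "a \<in> carrier Z" "b \<in> carrier Z"
  let ?e = "pcl s []"
  have e: "?e \<in> carrier Z" "kem s 1 = ?e" using s by (simp_all add: kem_one)
  have p: "a \<bullet> ?e \<in> PL s" "?e \<bullet> b \<in> PR s" using ab by auto
  then have c: "Alg (a \<bullet> ?e) \<in> bcar (P_left n s)" "Alg (?e \<bullet> b) \<in> bcar (P_right n s)" by (auto simp: P_simps)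
  \<comment> \<open>The generator absorbs \<open>e_s\<close> on both sides, so arbitrary
    \<open>a\<close> and \<open>b\<close> may be replaced by elements of \<open>B e_s\<close> and
    \<open>e_s B\<close>.\<close>
  have "uel s = lact N ?e (ract N (uel s) ?e)"
   using U_pure(1)[OF s, of ?e ?e] PL_iff[OF s] PR_iff[OF s] e pcl_nil_idem[OF s] by (simp add: uel_def N_def)
  then have eu: "lact N ?e (uel s) = uel s" "ract N (uel s) ?e = uel s"
   using e u pcl_nil_idem[OF s] com[of 1] by (metis Nl(6,15) KK_closed(2))+
  have "lact N a (ract N (uel s) b) = lact N (a \<bullet> ?e) (ract N (uel s) (?e \<bullet> b))"
   using ab e u eu by (simp add: Nl flip: Nl(19))
  also have "\<dots> = tensor_class (KK s) (P_left n s) (P_right n s) [(Alg (a \<bullet> ?e), Alg (?e \<bullet> b))]"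
   using U_pure(1)[OF s p] by (simp add: N_def)
  finally have "lam s y (lact N a (ract N (uel s) b)) = ?f (Alg (a \<bullet> ?e)) (Alg (?e \<bullet> b))"
   using L(1)[OF c] lam by simp
  also have "\<dots> = lact N (kem s (trace s ((y \<bullet> a) \<bullet> kem s 1))) (ract N (uel s) b)"
   using ab e u eu y by (simp add: Nl Z.m_assoc)
  also have "\<dots> = lact N (kem s (trace s (y \<bullet> a))) (ract N (uel s) b)"
   using ab y s by (subst trace_kem) (simp_all add: KK_closed)
  finally show ?thesis .
 qed
qed

text \<open>In the outer variable \<open>y\<close> these are the conditions that permit the second
  lift, over \<open>x \<otimes> y\<close>, and make it compatible with the tensor sign between the
  two copies of \<open>U_s\<close>.\<close>

lemma lam_linear:
 assumes s: "s \<in> {1..n}" and y: "y \<in> carrier Z" and q: "q \<in> bcar (U_bimod n s)"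
 shows "y' \<in> carrier Z ==> lam s (y \<oplus>\<^bsub>Z\<^esub> y') q = badd (U_bimod n s) (lam s y q) (lam s y' q)"
  "b \<in> carrier Z ==> lam s (y \<bullet> b) q = lam s y (lact (U_bimod n s) b q)"
  "c \<in> KK s ==> lam s (kem s c \<bullet> y) q = lact (U_bimod n s) (kem s c) (lam s y q)"
proof -
 note N = zzb_U[OF s]
 note Nl = zz_laws[OF N] zz_add_laws(4)[OF N]
 note u = U_pure(2)[OF s]
 have tk: "kem s (trace s b) \<in> carrier Z" if "b \<in> carrier Z" for b
  using s trace_in_KK[OF that] by simp
 have g: "lact (U_bimod n s) a (ract (U_bimod n s) (uel s) b) \<in> bcar (U_bimod n s)" if "a \<in> carrier Z" "b \<in> carrier Z" for a b
  using that u by (simp add: Nl)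
 note L = lam_laws[OF s]
 show "y' \<in> carrier Z ==> lam s (y \<oplus>\<^bsub>Z\<^esub> y') q = badd (U_bimod n s) (lam s y q) (lam s y' q)"
  by (rule U_pure(4)[OF s q]) (use y u s in \<open>simp_all add: L Nl Z.l_distr trace_add kem_add trace_in_KK tk\<close>)
 show "b \<in> carrier Z ==> lam s (y \<bullet> b) q = lam s y (lact (U_bimod n s) b q)"
  by (rule U_pure(4)[OF s q]) (use y u s in \<open>simp_all add: L Nl(1-14,17-21) Z.m_assoc tk flip: Nl(15)\<close>)
 show "c \<in> KK s ==> lam s (kem s c \<bullet> y) q = lact (U_bimod n s) (kem s c) (lam s y q)"
  by (rule U_pure(4)[OF s q]) (use y u s in \<open>simp_all add: L Nl Z.m_assoc trace_kem kem_mult trace_in_KK tk\<close>)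
qed

definition merge_fun :: "nat => elt => elt => elt" where
 "merge_fun s p q = tlift (U_bimod n s) (\<lambda>x y. lact (U_bimod n s) (the_alg x) (lam s (the_alg y) q)) p"

lemma merge_fun_laws:
 assumes s: "s \<in> {1..n}" and q: "q \<in> bcar (U_bimod n s)"
 defines "N \<equiv> U_bimod n s"
 shows "p \<in> bcar N ==> merge_fun s p q \<in> bcar N"
  "p \<in> bcar N ==> p' \<in> bcar N ==> merge_fun s (badd N p p') q = badd N (merge_fun s p q) (merge_fun s p' q)"
  "merge_fun s (bzero N) q = bzero N"
  "p \<in> bcar N ==> a \<in> carrier Z ==> merge_fun s (lact N a p) q = lact N a (merge_fun s p q)"
  "a \<in> carrier Z ==> b \<in> carrier Z ==> merge_fun s (lact N a (ract N (uel s) b)) q = lact N a (lact N (pcl s []) (lam s b q))"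
proof -
 let ?f = "\<lambda>x y. lact N (the_alg x) (lam s (the_alg y) q)"
 have N: "zzb N" unfolding N_def by (rule zzb_U[OF s])
 note Nl = zz_laws[OF N]
 have u: "uel s \<in> bcar N" unfolding N_def by (rule U_pure(2)[OF s])
 have qN: "q \<in> bcar N" using q by (simp add: N_def)
 note L = lam_laws[OF s, folded N_def] lam_linear[OF s _ q, folded N_def]
 have bal: "balanced (KK s) (P_left n s) (P_right n s) N ?f"
  by (rule balancedI) (use s qN in \<open>simp_all add: P_alg[OF s] Nl L(1-6,8)\<close>)
 note T = U_lift[OF s N bal, folded N_def]
 have m: "merge_fun s p q = tlift N ?f p" for p by (simp add: merge_fun_def N_def)
 show "p \<in> bcar N ==> merge_fun s p q \<in> bcar N"
  "p \<in> bcar N ==> p' \<in> bcar N ==> merge_fun s (badd N p p') q = badd N (merge_fun s p q) (merge_fun s p' q)"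
  "merge_fun s (bzero N) q = bzero N"
  unfolding m by (simp_all add: T)
 show "p \<in> bcar N ==> a \<in> carrier Z ==> merge_fun s (lact N a p) q = lact N a (merge_fun s p q)"
  unfolding m by (rule T(5)) (use qN in \<open>simp_all add: P_alg[OF s] Nl L\<close>)
 show "a \<in> carrier Z ==> b \<in> carrier Z ==> merge_fun s (lact N a (ract N (uel s) b)) q = lact N a (lact N (pcl s []) (lam s b q))"
 proof -
  assume ab: "a \<in> carrier Z" "b \<in> carrier Z"
  let ?e = "pcl s []"
  have e: "?e \<in> carrier Z" "kem s 1 = ?e" using s by (simp_all add: kem_one)
  have p: "a \<bullet> ?e \<in> PL s" "?e \<bullet> b \<in> PR s" using ab by auto
  then have c: "Alg (a \<bullet> ?e) \<in> bcar (P_left n s)" "Alg (?e \<bullet> b) \<in> bcar (P_right n s)" by (auto simp: P_simps)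
  have "uel s = lact N ?e (ract N (uel s) ?e)"
   using U_pure(1)[OF s, of ?e ?e] PL_iff[OF s] PR_iff[OF s] e pcl_nil_idem[OF s] by (simp add: uel_def N_def)
  then have eu: "lact N ?e (uel s) = uel s" "ract N (uel s) ?e = uel s"
   using e u pcl_nil_idem[OF s] U_pure(3)[OF s, of 1, folded N_def] by (metis Nl(6,15) KK_closed(2))+
  have "lact N a (ract N (uel s) b) = lact N (a \<bullet> ?e) (ract N (uel s) (?e \<bullet> b))"
   using ab e u eu by (simp add: Nl flip: Nl(19))
  also have "\<dots> = tensor_class (KK s) (P_left n s) (P_right n s) [(Alg (a \<bullet> ?e), Alg (?e \<bullet> b))]"
   using U_pure(1)[OF s p] by (simp add: N_def)
  finally have "merge_fun s (lact N a (ract N (uel s) b)) q = ?f (Alg (a \<bullet> ?e)) (Alg (?e \<bullet> b))"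
   using T(1)[OF c] m by simp
  also have "\<dots> = lact N (a \<bullet> ?e) (lact N ?e (lam s b q))"
   using L(8)[OF ab(2) KK_closed(2)] e by simp
  also have "\<dots> = lact N a (lact N ?e (lam s b q))"
   using ab e L(1)[OF ab(2) qN] pcl_nil_idem[OF s] Nl(5)[of ?e "lam s b q"]
    Nl(15)[of ?e ?e "lam s b q"] Nl(15)[of a ?e "lact N ?e (lam s b q)"] by simp
  finally show ?thesis .
 qed
qed

definition merge :: "nat => bimap" where
 "merge s = mk_bimap (ZT (U_bimod n s) (U_bimod n s)) (U_bimod n s) (tlift (U_bimod n s) (merge_fun s))"

lemma merge:
 assumes s: "s \<in> {1..n}"
 shows "merge s \<in> bimaps n (Fo [s, s]) (Fo [s])" "y \<in> carrier Z ==> app (merge s) [s] (U s * (B y * U s)) = ke s (trace s y) * U s"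
proof -
 let ?N = "U_bimod n s"
 note N = zzb_U[OF s]
 note Nl = zz_laws[OF N] zz_add_laws(4)[OF N]
 note u = U_pure(2)[OF s]
 note L = lam_laws[OF s] lam_linear[OF s]
 note M = merge_fun_laws[OF s]
 have Fo2: "Fo [s, s] = ZT ?N ?N" using Fo_snoc[of "[s]" s] by simp
 have e: "pcl s [] \<in> carrier Z" using s by simp
 have radd: "merge_fun s p (badd ?N q q') = badd ?N (merge_fun s p q) (merge_fun s p q')"
  if p: "p \<in> bcar ?N" and q: "q \<in> bcar ?N" "q' \<in> bcar ?N" for p q q'
  by (rule U_pure(4)[OF s p]) (use q e in \<open>simp_all add: M L Nl\<close>)
 have mid: "merge_fun s (ract ?N p b) q = merge_fun s p (lact ?N b q)"
  if p: "p \<in> bcar ?N" and q: "q \<in> bcar ?N" "b \<in> carrier Z" for p q b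
 proof (rule U_pure(4)[OF s p])
  fix a c assume ac: "a \<in> carrier Z" "c \<in> carrier Z"
  have "ract ?N (lact ?N a (ract ?N (uel s) c)) b = lact ?N a (ract ?N (uel s) (c \<bullet> b))"
   using ac q u by (simp add: Nl)
  then show "merge_fun s (ract ?N (lact ?N a (ract ?N (uel s) c)) b) q = merge_fun s (lact ?N a (ract ?N (uel s) c)) (lact ?N b q)"
   using ac q e by (simp add: M L Nl)
 qed (use q e in \<open>simp_all add: M L Nl\<close>)
 have ract: "merge_fun s p (ract ?N q b) = ract ?N (merge_fun s p q) b"
  if p: "p \<in> bcar ?N" and q: "q \<in> bcar ?N" "b \<in> carrier Z" for p q b
  by (rule U_pure(4)[OF s p]) (use q e in \<open>simp_all add: M L Nl\<close>)
 have "balanced (carrier Z) ?N ?N ?N (merge_fun s)"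
  by (rule balancedI) (simp_all add: M radd mid)
 note T = tlift_bimap[OF N N N this]
 have b: "merge s \<in> bimaps n (ZT ?N ?N) ?N"
  unfolding merge_def by (rule T(1)) (simp_all add: M ract)
 then show "merge s \<in> bimaps n (Fo [s, s]) (Fo [s])" by (simp add: Fo2)
 show "app (merge s) [s] (U s * (B y * U s)) = ke s (trace s y) * U s" if y: "y \<in> carrier Z"
 proof -
  have yu: "lact ?N y (uel s) \<in> bcar ?N" using y u by (simp add: Nl)
  have k: "kem s (trace s y) \<in> carrier Z" using s trace_in_KK[OF y] by simp
  have "U s * (B y * U s) = El n [s, s] (pu ?N ?N (uel s) (lact ?N y (uel s)))"
   unfolding U_def using s y u yu by (simp add: B_El times_El' op_single)
  moreover have "pu ?N ?N (uel s) (lact ?N y (uel s)) \<in> bcar (Fo [s, s])"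
   unfolding Fo2 by (rule pu_laws(1)[OF N N u yu])
  ultimately have "app (merge s) [s] (U s * (B y * U s)) = El n [s] (bfun (merge s) (pu ?N ?N (uel s) (lact ?N y (uel s))))"
   using s by (simp add: app_El)
  also have "bfun (merge s) (pu ?N ?N (uel s) (lact ?N y (uel s))) = merge_fun s (uel s) (lact ?N y (uel s))"
   unfolding merge_def using pu_laws(1)[OF N N u yu] T(2)[OF _ _ u yu] M ract by simp
  also have "\<dots> = lact ?N (pcl s []) (lam s \<one>\<^bsub>Z\<^esub> (lact ?N y (uel s)))"
   using M(5)[OF yu, of "\<one>\<^bsub>Z\<^esub>" "\<one>\<^bsub>Z\<^esub>"] u yu e L(1) by (simp add: Nl)
  also have "lam s \<one>\<^bsub>Z\<^esub> (lact ?N y (uel s)) = lact ?N (kem s (trace s y)) (uel s)"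
   using lam_laws(5)[OF s Z.one_closed y Z.one_closed] u y by (simp add: Nl)
  also have "lact ?N (pcl s []) (lact ?N (kem s (trace s y)) (uel s)) = lact ?N (kem s (trace s y)) (uel s)"
   using u k e s kem_pcl(2)[OF s trace_in_KK[OF y]] by (simp flip: Nl(15))
  also have "El n [s] \<dots> = ke s (trace s y) * U s"
   unfolding ke_def U_def using s u k by (simp add: B_El)
  finally show ?thesis .
 qed
qed

section \<open>Multiplication in the zigzag algebra\<close>

definition E :: "nat => tens" where "E j = B (pcl j [])"
definition Lo :: "nat => tens" where "Lo j = B (pcl j [Loop j])"
definition S :: "nat => nat => tens" where "S i j = B (pcl i [Step i j])"
definition X :: "nat => tens" where "X s = (if s = 1 then S 1 2 * S 2 1 else S s (s - 1) * S (s - 1) s)"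

definition adj :: "nat => nat => bool" where
 "adj i j \<longleftrightarrow> i \<in> {1..n} \<and> j \<in> {1..n} \<and> (j = i + 1 \<or> i = j + 1)"

lemma adj_sym: "adj i j ==> adj j i"
 by (auto simp: adj_def)

lemma adjD: "adj i j ==> i \<in> {1..n}" "adj i j ==> j \<in> {1..n}" "adj i j ==> i \<noteq> j"
 by (auto simp: adj_def)

lemma B_pcl_mult: "(v, as) \<in> paths n ==> (w, bs) \<in> paths n
  ==> B (pcl v as) * B (pcl w bs) = (if path_end (v, as) = w then B (pcl v (as @ bs)) else Zr [])"
 using B_laws(4) by (simp add: B_laws pcl_mult)

lemma gens_paths: "j \<in> {1..n} ==> (j, []) \<in> paths n" "j \<in> {2..n} ==> (j, [Loop j]) \<in> paths n"
 "adj i j ==> (i, [Step i j]) \<in> paths n"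
 by (auto simp: adj_def)

lemma gens_ok [simp]:
 "j \<in> {1..n} ==> ok (E j)" "j \<in> {1..n} ==> wd (E j) = []"
 "j \<in> {2..n} ==> ok (Lo j)" "j \<in> {2..n} ==> wd (Lo j) = []"
 "adj i j ==> ok (S i j)" "adj i j ==> wd (S i j) = []"
 unfolding E_def Lo_def S_def using gens_paths by simp_all

lemma X_ok [simp]: assumes "s \<in> {1..n}" shows "ok (X s)" "wd (X s) = []"
proof -
 have "s \<noteq> 1 ==> adj s (s - 1) \<and> adj (s - 1) s" "adj 1 2 \<and> adj 2 1"
  using assms n_ge_2 by (auto simp: adj_def)
 then show "ok (X s)" "wd (X s) = []" by (simp_all add: X_def)
qed

lemma E_mult:
 "i \<in> {1..n} ==> j \<in> {1..n} ==> E i * E j = (if i = j then E i else Zr [])"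
 "i \<in> {1..n} ==> j \<in> {2..n} ==> E i * Lo j = (if i = j then Lo j else Zr [])"
 "i \<in> {1..n} ==> j \<in> {2..n} ==> Lo j * E i = (if i = j then Lo j else Zr [])"
 "i \<in> {1..n} ==> adj j k ==> E i * S j k = (if i = j then S j k else Zr [])"
 "i \<in> {1..n} ==> adj j k ==> S j k * E i = (if i = k then S j k else Zr [])"
 using gens_paths by (auto simp: E_def Lo_def S_def B_pcl_mult path_end_def simp del: in_paths)

lemma off_diagonal:
 "i \<in> {2..n} ==> j \<in> {2..n} ==> i \<noteq> j ==> Lo i * Lo j = Zr []"
 "i \<in> {2..n} ==> adj j k ==> i \<noteq> j ==> Lo i * S j k = Zr []"
 "i \<in> {2..n} ==> adj j k ==> i \<noteq> k ==> S j k * Lo i = Zr []"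
 "adj i i' ==> adj j k ==> i' \<noteq> j ==> S i i' * S j k = Zr []"
 using gens_paths by (auto simp: Lo_def S_def B_pcl_mult path_end_def simp del: in_paths)

lemma pcl_eqI:
 assumes "(v, as) \<in> paths n" "(w, bs) \<in> paths n"
  and "single (v, as) 1 - single (w, bs) 1 \<in> zigzag_relations n"
 shows "pcl v as = pcl w bs"
 using assms by (intro cls_eqI relation_in_ideal) auto

lemma pcl_zeroI:
 assumes "(v, as) \<in> paths n" and "single (v, as) 1 \<in> zigzag_relations n"
 shows "pcl v as = \<zero>\<^bsub>Z\<^esub>"
 unfolding cls_zero[symmetric] using assms by (intro cls_eqI) (auto simp: relation_in_ideal)

lemma step_squares: assumes "2 \<le> j" "j < n" shows "S j (j - 1) * S (j - 1) j = S j (j + 1) * S (j + 1) j"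
proof -
 have r: "pstep j (j - 1) ** pstep (j - 1) j - pstep j (j + 1) ** pstep (j + 1) j \<in> zigzag_relations n"
  using assms unfolding zigzag_relations_def by blast
 have j: "1 \<le> j - 1" "j - 1 \<le> n" using assms by linarith+
 have "pcl j [Step j (j - 1), Step (j - 1) j] = pcl j [Step j (j + 1), Step (j + 1) j]"
  by (rule pcl_eqI) (use assms j r in \<open>simp_all add: pstep_def path_mult_single path_end_def\<close>)
 then show ?thesis using assms j by (simp add: S_def B_pcl_mult path_end_def)
qed

lemma step_through:
 assumes "2 \<le> j" "j < n" shows "S (j - 1) j * S j (j + 1) = Zr []" "S (j + 1) j * S j (j - 1) = Zr []"
proof -
 have r: "pstep (j - 1) j ** pstep j (j + 1) \<in> zigzag_relations n" "pstep (j + 1) j ** pstep j (j - 1) \<in> zigzag_relations n"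
  using assms unfolding zigzag_relations_def by blast+
 have j: "1 \<le> j - 1" "j - 1 \<le> n" using assms by linarith+
 have "pcl (j - 1) [Step (j - 1) j, Step j (j + 1)] = \<zero>\<^bsub>Z\<^esub>" "pcl (j + 1) [Step (j + 1) j, Step j (j - 1)] = \<zero>\<^bsub>Z\<^esub>"
  by (rule pcl_zeroI; use assms j r in \<open>simp add: pstep_def path_mult_single path_end_def\<close>)+
 then show "S (j - 1) j * S j (j + 1) = Zr []" "S (j + 1) j * S j (j - 1) = Zr []"
  using assms j B_laws(4) by (simp_all add: S_def B_pcl_mult path_end_def)
qed

lemma loop_squared: assumes "j \<in> {2..n}" shows "Lo j * Lo j = sc (-1) (E j)"
proof -
 have "pcl j [Loop j, Loop j] = cls (single (j, []) (- 1))"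
  using loop_square[of j 1] assms by simp
 also have "\<dots> = zz_scalar n (-1) \<bullet> pcl j []"
  using assms by (subst zz_scalar_single) auto
 finally show ?thesis using assms B_laws(3)[of "pcl j []" "-1"] by (simp add: Lo_def E_def B_pcl_mult path_end_def)
qed

lemma loop_step: assumes "adj i j" "2 \<le> i" "2 \<le> j" shows "S i j * Lo j = Lo i * S i j"
proof (cases "j = i + 1")
 case True
 have "3 \<le> j \<and> j \<le> n" using assms True by (auto simp: adj_def)
 then have r: "pie (j - 1) ** pstep (j - 1) j - pstep (j - 1) j ** pie j \<in> zigzag_relations n"
  unfolding zigzag_relations_def by blast
 have "pcl (j - 1) [Loop (j - 1), Step (j - 1) j] = pcl (j - 1) [Step (j - 1) j, Loop j]"
  by (rule pcl_eqI) (use assms True r in \<open>simp_all add: adj_def pie_def pstep_def path_mult_single path_end_def\<close>)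
 then show ?thesis using assms True by (simp add: adj_def S_def Lo_def B_pcl_mult path_end_def)
next
 case False
 then have i: "i = j + 1" "3 \<le> i \<and> i \<le> n" using assms by (auto simp: adj_def)
 then have r: "pie i ** pstep i (i - 1) - pstep i (i - 1) ** pie (i - 1) \<in> zigzag_relations n"
  unfolding zigzag_relations_def by blast
 have "pcl i [Loop i, Step i (i - 1)] = pcl i [Step i (i - 1), Loop (i - 1)]"
  by (rule pcl_eqI) (use assms i r in \<open>simp_all add: adj_def pie_def pstep_def path_mult_single path_end_def\<close>)
 then show ?thesis using assms i by (simp add: adj_def S_def Lo_def B_pcl_mult path_end_def)
qed

lemma loop_1: "S 1 2 * (Lo 2 * S 2 1) = Zr []"
proof -
 have r: "pstep 1 2 ** pie 2 ** pstep 2 1 \<in> zigzag_relations n"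
  unfolding zigzag_relations_def by blast
 have "pcl 1 [Step 1 2, Loop 2, Step 2 1] = \<zero>\<^bsub>Z\<^esub>"
  by (rule pcl_zeroI) (use n_ge_2 r in \<open>simp_all add: pie_def pstep_def path_mult_single path_end_def\<close>)
 then show ?thesis using n_ge_2 B_laws(4) by (simp add: S_def Lo_def B_pcl_mult path_end_def)
qed

lemma loop_X_2: "X 2 * Lo 2 = Lo 2 * X 2"
proof -
 have r: "pie 2 ** pX 2 - pX 2 ** pie 2 \<in> zigzag_relations n"
  unfolding zigzag_relations_def by blast
 have "pcl 2 [Loop 2, Step 2 1, Step 1 2] = pcl 2 [Step 2 1, Step 1 2, Loop 2]"
  by (rule pcl_eqI) (use n_ge_2 r in \<open>simp_all add: pX_def pie_def pstep_def path_mult_single path_end_def One_nat_def\<close>)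
 moreover have "X 2 = S 2 1 * S 1 2" by (simp add: X_def One_nat_def)
 ultimately show ?thesis using n_ge_2 by (simp add: S_def Lo_def B_pcl_mult path_end_def)
qed

text \<open>The relation \<open>(j|j-1)(j-1|j) = (j|j+1)(j+1|j)\<close> makes the choice of
  neighbour immaterial, so \<open>X i\<close> can be rewritten through whichever neighbour suits a
  computation.\<close>

lemma step_square: assumes "adj i j" shows "S i j * S j i = X i"
proof (cases "j = i + 1")
 case True
 then show ?thesis
 proof (cases "i = 1")
  case True
  then show ?thesis using assms \<open>j = i + 1\<close> by (auto simp: X_def numeral_2_eq_2)
 next
  case False
  then show ?thesis using assms \<open>j = i + 1\<close> step_squares[of i] by (auto simp: X_def adj_def)
 qed
next
 case False
 then show ?thesis using assms by (auto simp: X_def adj_def)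
qed

lemma step_step: assumes "adj i j" "adj j k" "i \<noteq> k" shows "S i j * S j k = Zr []"
 using assms step_through[of j] by (auto simp: adj_def)

text \<open>For \<open>j \<ge> 3\<close> the loop is carried past both arrows of \<open>X j\<close>
  by way of vertex \<open>j - 1\<close>. Vertex 1 has no loop, which is why the case
  \<open>j = 2\<close> is a defining relation.\<close>

lemma X_loop: assumes "j \<in> {2..n}" shows "X j * Lo j = Lo j * X j"
proof (cases "j = 2")
 case False
 then have a: "adj j (j - 1)" "adj (j - 1) j" "2 \<le> j - 1" "2 \<le> j" using assms by (auto simp: adj_def)
 have "X j * Lo j = S j (j - 1) * (S (j - 1) j * Lo j)"
  using step_square[OF a(1)] by (simp flip: mult.assoc)
 also have "\<dots> = S j (j - 1) * Lo (j - 1) * S (j - 1) j"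
  by (simp only: loop_step[OF a(2,3,4)] mult.assoc)
 also have "\<dots> = Lo j * X j"
  by (simp only: loop_step[OF a(1,4,3)] step_square[OF a(1), symmetric] mult.assoc)
 finally show ?thesis .
qed (simp add: loop_X_2)

lemma neighbour: assumes "j \<in> {1..n}" obtains k where "adj j k"
proof (cases "j = 1")
 case True
 then have "adj j 2" using n_ge_2 by (auto simp: adj_def)
 then show ?thesis by (rule that)
next
 case False
 then have "adj j (j - 1)" using assms by (auto simp: adj_def)
 then show ?thesis by (rule that)
qed

lemma E_X: "i \<in> {1..n} ==> j \<in> {1..n} ==> E i * X j = (if i = j then X j else Zr [])"
 "i \<in> {1..n} ==> j \<in> {1..n} ==> X j * E i = (if i = j then X j else Zr [])"
proof -
 assume ij: "i \<in> {1..n}" "j \<in> {1..n}"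
 obtain k where k: "adj j k" using neighbour[OF ij(2)] .
 note k' = adj_sym[OF k]
 have "E i * X j = E i * S j k * S k j" by (simp only: step_square[OF k, symmetric] mult.assoc)
 also have "\<dots> = (if i = j then X j else Zr [])" using ij k k' by (simp add: E_mult step_square)
 finally show "E i * X j = (if i = j then X j else Zr [])" .
 have "X j * E i = S j k * (S k j * E i)" by (simp only: step_square[OF k, symmetric] mult.assoc)
 also have "\<dots> = (if i = j then X j else Zr [])" using ij k k' by (simp add: E_mult step_square)
 finally show "X j * E i = (if i = j then X j else Zr [])" .
qed

text \<open>At the first vertex \<open>X\<^sub>2 (2|1) = - (ie\<^sub>2) X\<^sub>2 (ie\<^sub>2) (2|1)\<close> contains the zero path \<open>(1|2)(ie\<^sub>2)(2|1)\<close>.\<close>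

lemma step_X: assumes "adj i j" shows "S i j * X j = Zr []"
proof -
 note a = assms adj_sym[OF assms]
 have two: "2 \<in> {2..n}" "adj 1 2" "adj 2 1" "1 \<in> {1..n}" "2 \<in> {1..n}" using n_ge_2 by (auto simp: adj_def)
 consider "i = 2" "j = 1" | "i = 1" "j = 2" | "2 \<le> i" "j = i + 1" | "2 \<le> j" "i = j + 1"
  using assms by (force simp: adj_def)
 then show ?thesis
 proof cases
  case 1
  have "S 2 1 * X 1 = X 2 * S 2 1"
   by (simp only: step_square[OF two(2), symmetric] step_square[OF two(3), symmetric] mult.assoc)
  moreover have "sc (-1) (X 2 * S 2 1) = Zr []"
  proof -
   have "sc (-1) (X 2 * S 2 1) = Lo 2 * Lo 2 * (X 2 * S 2 1)"
    using two loop_squared[of 2] by (simp add: sc_laws mult.assoc[symmetric] E_X)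
   also have "\<dots> = Lo 2 * (X 2 * Lo 2) * S 2 1"
    using X_loop[of 2] two by (simp add: mult.assoc)
   also have "\<dots> = Lo 2 * (S 2 1 * (S 1 2 * (Lo 2 * S 2 1)))"
    by (simp only: step_square[OF two(3), symmetric] mult.assoc)
   also have "\<dots> = Zr []" using two loop_1 by simp
   finally show ?thesis .
  qed
  then have "sc (-1) (sc (-1) (X 2 * S 2 1)) = Zr []" by simp
  then have "X 2 * S 2 1 = Zr []" using two by (simp add: sc_laws)
  ultimately show ?thesis using 1 by simp
 next
  case 2
  have "sc (-1) (S 1 2 * X 2) = Zr []"
  proof -
   have "sc (-1) (S 1 2 * X 2) = S 1 2 * (X 2 * (Lo 2 * Lo 2))"
    using two loop_squared[of 2] by (simp add: sc_laws E_X)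
   also have "\<dots> = S 1 2 * (Lo 2 * X 2 * Lo 2)" by (simp only: X_loop[OF two(1), symmetric] mult.assoc)
   also have "\<dots> = (S 1 2 * (Lo 2 * S 2 1)) * (S 1 2 * Lo 2)"
    by (simp only: step_square[OF two(3), symmetric] mult.assoc)
   also have "\<dots> = Zr []" using two loop_1 by simp
   finally show ?thesis .
  qed
  then have "sc (-1) (sc (-1) (S 1 2 * X 2)) = Zr []" by simp
  then show ?thesis using two 2 by (simp add: sc_laws)
 next
  case 3
  then have k: "adj i (i - 1)" "adj (i - 1) i" using a by (auto simp: adj_def)
  have "S i j * X j = X i * S i j"
   by (simp only: step_square[OF a(1), symmetric] step_square[OF a(2), symmetric] mult.assoc)
  \<comment> \<open>Rewritten through the other neighbour, \<open>X i\<close> produces two steps in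
    the same direction.\<close>
  also have "\<dots> = S i (i - 1) * (S (i - 1) i * S i j)"
   by (simp only: step_square[OF k(1), symmetric] mult.assoc)
  also have "\<dots> = Zr []" using k a 3 step_step[OF k(2) a(1)] by simp
  finally show ?thesis .
 next
  case 4
  then have k: "adj j (j - 1)" "adj (j - 1) j" using a by (auto simp: adj_def)
  have "S i j * X j = (S i j * S j (j - 1)) * S (j - 1) j"
   by (simp only: step_square[OF k(1), symmetric] mult.assoc)
  also have "\<dots> = Zr []" using k a 4 step_step[OF a(1) k(1)] by simp
  finally show ?thesis .
 qed
qed

lemma X_step: assumes "adj i j" shows "X i * S i j = Zr []"
proof -
 have "X i * S i j = S i j * X j"
  by (simp only: step_square[OF assms, symmetric] step_square[OF adj_sym[OF assms], symmetric] mult.assoc)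
 then show ?thesis using step_X[OF assms] by simp
qed

text \<open>One of the factors is split into two arrows, and \<open>X j\<close> annihilates the
  first of them.\<close>

lemma X_X: assumes "j \<in> {1..n}" shows "X j * X j = Zr []"
proof -
 obtain k where k: "adj j k" using neighbour[OF assms] .
 have "X j * X j = X j * S j k * S k j" by (simp only: step_square[OF k, symmetric] mult.assoc)
 then show ?thesis using X_step[OF k] adj_sym[OF k] by simp
qed

lemma X_off: "i \<in> {1..n} ==> j \<in> {1..n} ==> i \<noteq> j ==> X i * X j = Zr []"
 "i \<in> {1..n} ==> j \<in> {2..n} ==> i \<noteq> j ==> X i * Lo j = Zr []" "i \<in> {1..n} ==> j \<in> {2..n} ==> i \<noteq> j ==> Lo j * X i = Zr []"
 "i \<in> {1..n} ==> adj j k ==> X i * S j k = Zr []" "i \<in> {1..n} ==> adj j k ==> S j k * X i = Zr []"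
proof -
 assume i: "i \<in> {1..n}"
 have X: "X i = X i * E i" "X i = E i * X i" using i by (simp_all add: E_X)
 show "j \<in> {1..n} ==> i \<noteq> j ==> X i * X j = Zr []"
  using i by (subst X(1)) (simp only: mult.assoc, simp add: E_X)
 show "j \<in> {2..n} ==> i \<noteq> j ==> X i * Lo j = Zr []"
  using i by (subst X(1)) (simp only: mult.assoc, simp add: E_mult)
 show "j \<in> {2..n} ==> i \<noteq> j ==> Lo j * X i = Zr []"
  using i by (subst X(2)) (simp only: mult.assoc[symmetric], simp add: E_mult)
 show "adj j k ==> X i * S j k = Zr []"
  using i X_step[of i k] by (cases "i = j", simp, subst X(1)) (simp only: mult.assoc, simp add: E_mult)
 show "adj j k ==> S j k * X i = Zr []"
  using i step_X[of j i] by (cases "i = k", simp, subst X(2)) (simp only: mult.assoc[symmetric], simp add: E_mult)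
qed

subsection \<open>Generation and spanning\<close>

definition nilt :: "tens set" where "nilt = {b. ok b \<and> wd b = []}"

lemma path_span [consumes 1, case_names single add]:
 assumes "ok b \<and> wd b = []"
  and "\<And>x r. x \<in> paths n ==> P (sc r (B (pcl (fst x) (snd x))))"
  and "\<And>a b. ok a ==> wd a = [] ==> ok b ==> wd b = [] ==> P a ==> P b ==> P (a + b)"
 shows "P b"
proof -
 obtain z where z: "z \<in> carrier Z" "b = B z" using assms(1) wd_NilE by blast
 have "P (B z)" using z(1)
 proof (induction rule: zz_induct)
  case (add b c)
  then show ?case using assms(3)[of "B b" "B c"] by (simp add: B_laws)
 next
  case (single x a)
  then have "B (cls (single x a)) = sc a (B (pcl (fst x) (snd x)))"
   using zz_scalar_single(1)[of x a 1] by (simp add: B_laws)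
  then show ?case using assms(2)[OF single] by simp
 qed
 then show ?thesis using z by simp
qed

lemma path_Cons: assumes "(v, a # as) \<in> paths n"
 shows "B (pcl v (a # as)) = B (pcl v [a]) * B (pcl (tgt a) as)"
proof -
 have "(v, [a]) \<in> paths n" "(tgt a, as) \<in> paths n"
  using assms tgt_arrow[of a n] by auto
 then show ?thesis by (subst B_pcl_mult) (simp_all add: path_end_def del: in_paths)
qed

lemma generated [consumes 1, case_names E L S sc times add]:
 assumes "ok b \<and> wd b = []"
  and "\<And>j. j \<in> {1..n} ==> P (E j)" "\<And>j. j \<in> {2..n} ==> P (Lo j)" "\<And>i j. adj i j ==> P (S i j)"
  and "\<And>r a. ok a ==> wd a = [] ==> P a ==> P (sc r a)"
  and "\<And>a b. ok a ==> wd a = [] ==> ok b ==> wd b = [] ==> P a ==> P b ==> P (a * b)"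
  and "\<And>a b. ok a ==> wd a = [] ==> ok b ==> wd b = [] ==> P a ==> P b ==> P (a + b)"
 shows "P b"
proof -
 have p: "P (B (pcl v as))" if "(v, as) \<in> paths n" for v as
  using that
 proof (induction as arbitrary: v)
  case Nil
  then show ?case using assms(2)[of v] by (simp add: E_def)
 next
  case (Cons a as)
  have "P (B (pcl v [a]))"
   using Cons.prems assms(3)[of v] assms(4)[of v "tgt a"] by (cases a) (auto simp: Lo_def S_def adj_def)
  moreover have "(tgt a, as) \<in> paths n" "(v, [a]) \<in> paths n" using Cons.prems tgt_arrow[of a n] by auto
  ultimately show ?case using Cons.IH[of "tgt a"] unfolding path_Cons[OF Cons.prems]
   by (intro assms(6)) (simp_all del: in_paths)
 qed
 show ?thesis using assms(1)
 proof (induction rule: path_span)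
  case (single x r)
  then show ?case using assms(5)[OF _ _ p[of "fst x" "snd x"]] by simp
 qed (use assms(7) in simp_all)
qed

text \<open>Spanning elements over the reals for the corner \<open>e_s B e_t\<close>. The loop
  accompanying an arrow stands on its left wherever possible; vertex 1 has no loop, so on the edge
  between 1 and 2 it stands at the end 2. Only the spanning property is proved, not
  independence.\<close>

definition Gen :: "nat => nat => tens set" where
 "Gen s t = (if s = t then (if s = 1 then {E 1, X 1} else {E s, Lo s, X s, Lo s * X s})
  else if adj s t then (if s = 1 then {S 1 2, S 1 2 * Lo 2} else if t = 1 then {S 2 1, Lo 2 * S 2 1} else {S s t, Lo s * S s t})
  else {})"

text \<open>All relations are monomial or binomial, so a path reduces to zero or to a multiple of
  one generator rather than to a sum.\<close>

definition Nf :: "nat => nat => tens set" where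
 "Nf s t = {Zr []} \<union> {sc r g | r g. g \<in> Gen s t}"

lemma Gen_ok: "s \<in> {1..n} ==> t \<in> {1..n} ==> g \<in> Gen s t ==> ok g \<and> wd g = []"
 using n_ge_2 by (auto simp: Gen_def adj_def split: if_splits)

lemma assoc_rule: "a * b = c ==> a * (b * z) = c * (z :: tens)"
 by (simp add: mult.assoc[symmetric])

lemma E_U: "i \<in> {1..n} ==> s \<in> {1..n} ==> E i * U s = (if i = s then U s else Zr [s])"
 "i \<in> {1..n} ==> s \<in> {1..n} ==> U s * E i = (if i = s then U s else Zr [s])"
proof -
 have one: "E s * U s = U s \<and> U s * E s = U s" if s: "s \<in> {1..n}" for s
 proof -
  note l = zz_laws[OF zzb_U[OF s]]
  have e: "pcl s [] \<in> carrier Z" "kem s 1 = pcl s []" "pcl s [] \<in> PL s" "pcl s [] \<in> PR s"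
   unfolding PL_iff[OF s] PR_iff[OF s] using s by (auto simp: kem_one pcl_nil_idem)
  have "uel s = lact (U_bimod n s) (pcl s []) (ract (U_bimod n s) (uel s) (pcl s []))"
   using U_pure(1)[OF s e(3,4)] by (simp add: uel_def)
  then have "U s = E s * U s * E s"
   using U_act[OF s e(1,1)] by (simp add: U_def E_def)
  moreover have "E s * E s = E s" using s by (simp add: E_mult)
  ultimately show ?thesis by (metis mult.assoc)
 qed
 show "i \<in> {1..n} ==> s \<in> {1..n} ==> E i * U s = (if i = s then U s else Zr [s])"
  using one[of s] assoc_rule[OF E_mult(1)[of i s], of "U s"] by auto
 show "i \<in> {1..n} ==> s \<in> {1..n} ==> U s * E i = (if i = s then U s else Zr [s])"
  using one[of s] E_mult(1)[of s i] by (auto simp: mult.assoc[symmetric]) (metis (no_types) E_mult(1) U_ok Zr_simps(2) append.right_neutral mult.assoc word_simps(1) atLeastAtMost_iff)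
qed

lemma left_of_U:
 assumes "s \<in> {1..n}" "ok a" "wd a = []" "a * E s = Zr []" shows "a * U s = Zr [s]"
proof -
 have "a * U s = a * (E s * U s)" using assms(1) by (simp add: E_U)
 also have "\<dots> = Zr [s]" using assms by (simp add: mult.assoc[symmetric])
 finally show ?thesis .
qed

lemma right_of_U:
 assumes "s \<in> {1..n}" "ok a" "wd a = []" "E s * a = Zr []" shows "U s * a = Zr [s]"
proof -
 have "U s * a = U s * E s * a" using assms(1) by (simp add: E_U)
 also have "\<dots> = Zr [s]" using assms by (simp add: mult.assoc)
 finally show ?thesis .
qed

lemma U_off:
 "s \<in> {1..n} ==> i \<in> {2..n} ==> i \<noteq> s ==> Lo i * U s = Zr [s]" "s \<in> {1..n} ==> i \<in> {2..n} ==> i \<noteq> s ==> U s * Lo i = Zr [s]"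
 "s \<in> {1..n} ==> i \<in> {1..n} ==> i \<noteq> s ==> X i * U s = Zr [s]" "s \<in> {1..n} ==> i \<in> {1..n} ==> i \<noteq> s ==> U s * X i = Zr [s]"
 "s \<in> {1..n} ==> adj i j ==> j \<noteq> s ==> S i j * U s = Zr [s]" "s \<in> {1..n} ==> adj i j ==> i \<noteq> s ==> U s * S i j = Zr [s]"
 by ((rule left_of_U | rule right_of_U); simp add: E_mult E_X)+

lemma U_Lo: assumes "s \<in> {2..n}" shows "U s * Lo s = Lo s * U s"
proof -
 have "ke s \<i> = Lo s" using assms by (simp add: ke_def KK_embed_def Lo_def)
 then show ?thesis using ke_U[of s \<i>] assms by (simp add: KK_def)
qed

lemmas products = E_mult E_X E_U off_diagonal X_off X_X step_square step_step loop_squared loop_step X_loop U_off U_Lo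
text \<open>Products are kept bracketed to the right. Each rule \<open>a * b = c\<close> is
  therefore also added in the form that rewrites \<open>a * (b * z)\<close>, and products in the
  zigzag algebra are computed by rewriting.\<close>

lemmas zsimps = mult.assoc products products[THEN assoc_rule] loop_1 loop_1[unfolded mult.assoc[symmetric], THEN assoc_rule, unfolded mult.assoc]
 sc_laws(3,5,6)

lemma adj_12 [simp]: "adj 1 2" "adj 2 1" "1 \<in> {1..n}" "2 \<in> {1..n}" "2 \<in> {2..n}" "1 \<le> n" "2 \<le> n"
 using n_ge_2 by (auto simp: adj_def)

lemma Nf_Zr [simp]: "Zr [] \<in> Nf s t"
 by (simp add: Nf_def)

lemma Nf_sc: "s \<in> {1..n} ==> t \<in> {1..n} ==> x \<in> Nf s t ==> sc r x \<in> Nf s t"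
 unfolding Nf_def by (auto simp: sc_laws)

lemma Nf_Gen: "g \<in> Gen s t ==> g \<in> Nf s t"
 unfolding Nf_def using sc_laws(4)[of g] by (metis (mono_tags, lifting) UnI2 mem_Collect_eq)

lemma Nf_Gen': "g \<in> Gen s t ==> sc r g \<in> Nf s t"
 unfolding Nf_def by blast

lemma loop_Gen: assumes v: "v \<in> {2..n}" and t: "t \<in> {1..n}" and g: "g \<in> Gen v t" shows "Lo v * g \<in> Nf v t"
proof -
 have v1: "v \<in> {1..n}" "v \<noteq> 1" using v by auto
 consider "t = v" | "adj v t" "t = 1" | "adj v t" "t \<noteq> 1"
  using g by (auto simp: Gen_def split: if_splits)
 then show ?thesis
 proof cases
  case 1
  have G: "Gen v v = {E v, Lo v, X v, Lo v * X v}" using v1 by (simp add: Gen_def)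
  have "Lo v * E v = Lo v" "Lo v * (Lo v * X v) = sc (-1) (X v)" "Lo v * Lo v = sc (-1) (E v)"
   using v v1 by (simp_all add: zsimps)
  then show ?thesis using g 1 by (auto simp: G intro: Nf_Gen[of _ v v, unfolded G] Nf_Gen'[of _ v v, unfolded G])
 next
  case 2
  then have v2: "v = 2" by (auto simp: adj_def)
  have G: "Gen 2 1 = {S 2 1, Lo 2 * S 2 1}" by (simp add: Gen_def)
  have "Lo 2 * (Lo 2 * S 2 1) = sc (-1) (S 2 1)" by (simp add: zsimps)
  moreover have "S 2 1 \<in> Gen 2 1" "Lo 2 * S 2 1 \<in> Gen 2 1" using G by simp_all
  ultimately show ?thesis using g 2 G v2 Nf_Gen Nf_Gen'[of "S 2 1" 2 1 "-1"] by auto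
 next
  case 3
  then have G: "Gen v t = {S v t, Lo v * S v t}" using v1 adjD[OF 3(1)] by (simp add: Gen_def)
  have "Lo v * (Lo v * S v t) = sc (-1) (S v t)" using v v1 3 by (simp add: zsimps)
  moreover have "S v t \<in> Gen v t" using G by simp
  ultimately show ?thesis using g G Nf_Gen Nf_Gen'[of "S v t" v t "-1"] by auto
 qed
qed

text \<open>An arrow followed by its reverse gives \<open>X\<close>, and an arrow in front of
  \<open>X\<close> gives zero. Two steps in the same direction give zero even with a loop between
  them, after the loop has been moved to an end that carries one.\<close>

lemma step_Gen: assumes vw: "adj v w" and t: "t \<in> {1..n}" and g: "g \<in> Gen w t" shows "S v w * g \<in> Nf v t"
proof -
 note a = vw adj_sym[OF vw] adjD[OF vw]
 consider "t = w" | "adj w t" "t = v" | "adj w t" "t \<noteq> v"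
  using g by (auto simp: Gen_def split: if_splits)
 then show ?thesis
 proof cases
  case 1
  show ?thesis
  proof (cases "w = 1")
   case True
   then have "v = 2" using a by (auto simp: adj_def)
   then show ?thesis using g True 1 by (auto simp: Gen_def zsimps intro: Nf_Gen)
  next
   case w: False
   then have w2: "w \<in> {2..n}" using a by auto
   have z: "S v w * X w = Zr []" "S v w * (Lo w * X w) = Zr []"
    using a w2 by (simp_all add: zsimps flip: X_loop)
   show ?thesis
   proof (cases "v = 1")
    case True
    then have "w = 2" using a by (auto simp: adj_def)
    then show ?thesis using g True 1 z by (auto simp: Gen_def zsimps intro: Nf_Gen)
   next
    case False
    then have "S v w * Lo w = Lo v * S v w" using a w by (intro loop_step) auto
    then show ?thesis using g w False 1 a z by (auto simp: Gen_def E_mult intro: Nf_Gen)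
   qed
  qed
 next
  case 2
  have "v \<in> {2..n} \<or> v = 1" using a by auto
  then show ?thesis
  proof
   assume "v = 1"
   then have "w = 2" using a by (auto simp: adj_def)
   then show ?thesis using g 2 \<open>v = 1\<close> by (auto simp: Gen_def zsimps intro: Nf_Gen)
  next
   assume v: "v \<in> {2..n}"
   show ?thesis
   proof (cases "w = 1")
    case True
    then have "v = 2" using a by (auto simp: adj_def)
    then show ?thesis using g 2 True by (auto simp: Gen_def zsimps intro: Nf_Gen)
   next
    case False
    then have w: "w \<in> {2..n}" using a by auto
    have "S v w * (Lo w * S w v) = Lo v * X v" using a v w by (simp add: zsimps)
    then show ?thesis using g 2 v w False a by (auto simp: Gen_def step_square intro: Nf_Gen)
   qed
  qed
 next
  case 3
  have z: "S v w * S w t = Zr []" using a 3 by (simp add: zsimps)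
  have w: "w \<in> {2..n}" "w \<noteq> 1" using a 3 by (auto simp: adj_def)
  have "S v w * (Lo w * S w t) = Zr []"
  proof (cases "v = 1")
   case True
   \<comment> \<open>With no loop at \<open>v = 1\<close>, the loop is moved forward to
     \<open>t\<close> instead.\<close>
   then have t: "2 \<le> t" using 3 t by auto
   have "S v w * (Lo w * S w t) = S v w * S w t * Lo t"
    using loop_step[OF 3(1)] w t by (simp add: mult.assoc)
   then show ?thesis using z t 3 adjD(2)[OF 3(1)] by simp
  next
   case False
   then have "S v w * (Lo w * S w t) = Lo v * (S v w * S w t)"
    using loop_step[OF vw] w a by (simp add: mult.assoc[symmetric])
   then show ?thesis using z False a by simp
  qed
  moreover have "g = S w t \<or> g = Lo w * S w t"
   using g 3 w adjD(3)[OF 3(1)] a by (auto simp: Gen_def adj_def split: if_splits)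
  ultimately show ?thesis using z by auto
 qed
qed

text \<open>The path is built up from its far end: prepending a loop or an arrow to a generator is
  covered by \<open>loop_Gen\<close> and \<open>step_Gen\<close>.\<close>

lemma path_Nf: "(v, as) \<in> paths n ==> B (pcl v as) \<in> Nf v (path_end (v, as))"
proof (induction as arbitrary: v)
 case Nil
 then show ?case using Nf_Gen[of "E v" v v] by (auto simp: E_def[symmetric] path_end_def Gen_def)
next
 case (Cons a as)
 have p: "(tgt a, as) \<in> paths n" "a \<in> arrows n" "src a = v" using Cons.prems by auto
 have e: "path_end (v, a # as) = path_end (tgt a, as)" by (auto simp: path_end_def)
 have t: "path_end (tgt a, as) \<in> {1..n}" using path_ends[OF p(1)] by simp
 have "B (pcl v [a]) * x \<in> Nf v (path_end (tgt a, as))" if "x \<in> Gen (tgt a) (path_end (tgt a, as))" for x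
  using p(2,3) that t loop_Gen[of v "path_end (tgt a, as)" x] step_Gen[of v "tgt a" "path_end (tgt a, as)" x]
  by (cases a) (auto simp: Lo_def S_def adj_def)
 moreover have "B (pcl v [a]) * Zr [] = Zr []"
  using p by (cases a) auto
 moreover have v: "v \<in> {1..n}" using p path_ends[OF Cons.prems] by simp
 ultimately have "B (pcl v [a]) * x \<in> Nf v (path_end (tgt a, as))" if "x \<in> Nf (tgt a) (path_end (tgt a, as))" for x
  using that t Nf_sc by (auto simp: Nf_def[of "tgt a"] sc_laws)
 then show ?case unfolding path_Cons[OF Cons.prems] e using Cons.IH[OF p(1)] by blast
qed

text \<open>Between \<open>U s\<close> and \<open>U t\<close> an algebra element counts only through
  its corner. Each path contributes to the corner either nothing or a multiple of one element of
  \<open>Gen s t\<close>.\<close>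

lemma corner_induct [consumes 3, case_names zero gen add]:
 assumes "ok b \<and> wd b = []" "s \<in> {1..n}" "t \<in> {1..n}"
  and "P (Zr [])" "\<And>r g. g \<in> Gen s t ==> P (sc r g)"
  and "\<And>a b. ok a ==> wd a = [] ==> ok b ==> wd b = [] ==> P a ==> P b ==> P (a + b)"
 shows "P (E s * b * E t)"
 using assms(1)
proof (induction rule: path_span)
 case (single x r)
 have x: "path_end x \<in> {1..n}" "fst x \<in> {1..n}" using path_ends[OF single] by auto
 have "E s * B (pcl v as) * E t = (if v = s \<and> path_end (v, as) = t then B (pcl v as) else Zr [])" if "(v, as) \<in> paths n" for v as
  using that assms(2,3) gens_paths(1)[of s] gens_paths(1)[of t] path_end_append[of "(s, [])" "(v, as)" s]
  by (auto simp: E_def B_pcl_mult path_end_def[of "(_, [])"] simp del: in_paths)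
 from this[of "fst x" "snd x"] have "E s * B (pcl (fst x) (snd x)) * E t = (if fst x = s \<and> path_end x = t then B (pcl (fst x) (snd x)) else Zr [])"
  using single by simp
 moreover have "P (sc r (B (pcl (fst x) (snd x))))" if "fst x = s" "path_end x = t"
 proof -
  have "B (pcl (fst x) (snd x)) \<in> Nf s t" using path_Nf[of "fst x" "snd x"] single that by (cases x) simp
  then show ?thesis using assms(4,5) by (auto simp: Nf_def sc_laws)
 qed
 ultimately show ?case using assms(4) by (auto simp: sc_laws)
next
 case (add a b)
 then show ?case using assms(2,3) assms(6)[of "E s * a * E t" "E s * b * E t"] by (simp add: distrib_left distrib_right)
qed

subsection \<open>The image of the unit under the start dot\<close>

definition kap :: "nat => real" where "kap s = (-1) ^ s"

definition nb :: "nat => nat => tens" where "nb s k = S k s * (U s * S s k)"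

text \<open>The sign makes \<open>-(1|2)(ie_2)\<close> dual to \<open>(ie_2)(2|1)\<close>: their
  product is \<open>X_1\<close>.\<close>

definition tw :: tens where "tw = sc (-1) (Lo 2 * (nb 1 2 * Lo 2))"

definition side :: "nat => tens" where
 "side s = (if s = 1 then nb 1 2 + tw else nb s (s - 1) + (if s < n then nb s (s + 1) else Zr [s]))"

definition D0 :: "nat => tens" where "D0 s = X s * U s + U s * X s + side s"

definition Ds :: "nat => tens" where "Ds s = sc (kap s) (D0 s)"

lemma nb_ok [simp]: "adj s k ==> ok (nb s k)" "adj s k ==> wd (nb s k) = [s]"
 using adj_sym[of s k] adjD[of s k] by (simp_all add: nb_def)

lemma tw_ok [simp]: "ok tw" "wd tw = [1]"
 by (simp_all add: tw_def)

lemma side_ok [simp]: assumes "s \<in> {1..n}" shows "ok (side s)" "wd (side s) = [s]"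
proof -
 have "s \<noteq> 1 ==> adj s (s - 1)" "s < n ==> adj s (s + 1)" using assms by (auto simp: adj_def)
 then show "ok (side s)" "wd (side s) = [s]" using assms by (auto simp: side_def)
qed

lemma D0_ok [simp]: "s \<in> {1..n} ==> ok (D0 s)" "s \<in> {1..n} ==> wd (D0 s) = [s]"
 by (simp_all add: D0_def)

lemma Ds_ok [simp]: "s \<in> {1..n} ==> ok (Ds s)" "s \<in> {1..n} ==> wd (Ds s) = [s]"
 by (simp_all add: Ds_def)

lemma nb_step:
 assumes "adj s k" "adj i j"
 shows "S i j * nb s k = (if i = s \<and> j = k then X s * (U s * S s k) else Zr [s])"
  "nb s k * S i j = (if i = k \<and> j = s then S k s * (U s * X s) else Zr [s])"
 using assms adj_sym[OF assms(1)] adj_sym[OF assms(2)] adjD[OF assms(1)] adjD[OF assms(2)]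
 by (auto simp: nb_def zsimps) (cases "j = k"; cases "i = k"; simp add: zsimps)+

lemma nb_E: "adj s k ==> j \<in> {1..n} ==> E j * nb s k = (if j = k then nb s k else Zr [s])"
 "adj s k ==> j \<in> {1..n} ==> nb s k * E j = (if j = k then nb s k else Zr [s])"
 using adj_sym[of s k] adjD[of s k] by (auto simp: nb_def zsimps)

text \<open>In the last part the loop passes through both arrows and through \<open>U s\<close>,
  which commutes with the field of \<open>s\<close>. Through \<open>U 1\<close> only real scalars
  pass, hence the restriction to \<open>s \<ge> 2\<close> there.\<close>

lemma nb_Lo: "adj s k ==> j \<in> {2..n} ==> j \<noteq> k ==> Lo j * nb s k = Zr [s]"
 "adj s k ==> j \<in> {2..n} ==> j \<noteq> k ==> nb s k * Lo j = Zr [s]"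
 "adj s k ==> k \<in> {2..n} ==> s \<in> {2..n} ==> nb s k * Lo k = Lo k * nb s k"
proof -
 assume a: "adj s k"
 note a' = a adj_sym[OF a] adjD[OF a]
 show "j \<in> {2..n} ==> j \<noteq> k ==> Lo j * nb s k = Zr [s]" "j \<in> {2..n} ==> j \<noteq> k ==> nb s k * Lo j = Zr [s]"
  using a' by (simp_all add: nb_def zsimps)
 assume k: "k \<in> {2..n}" "s \<in> {2..n}"
 have "nb s k * Lo k = S k s * (U s * (Lo s * S s k))" using a' k loop_step[OF a] by (simp add: nb_def mult.assoc)
 also have "\<dots> = S k s * (Lo s * (U s * S s k))" using U_Lo[OF k(2)] by (metis mult.assoc)
 also have "\<dots> = Lo k * nb s k" using a' k loop_step[OF a'(2)] by (simp add: nb_def mult.assoc[symmetric])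
 finally show "nb s k * Lo k = Lo k * nb s k" .
qed

text \<open>An arrow into vertex 2 meets the loop: from 1 it completes the zero path
  \<open>(1|2)(ie_2)(2|1)\<close>, from 3 the loop slides outwards and leaves two steps in one
  direction. So arrows see only the term \<open>nb 1 2\<close>, never its twisted partner.\<close>

lemma tw_step: assumes "adj i j" shows "S i j * tw = Zr [1]" "tw * S i j = Zr [1]"
proof -
 note a = assms adj_sym[OF assms] adjD[OF assms]
 have one: "i = 1 ==> j = 2" "j = 1 ==> i = 2" using assms by (auto simp: adj_def)
 have "S i j * (Lo 2 * S 2 1) = Zr []"
 proof (cases "j = 2 \<and> i \<noteq> 1")
  case True
  then have "S i 2 * (Lo 2 * S 2 1) = Lo i * (S i 2 * S 2 1)"
   using loop_step[of i 2] a by (simp add: mult.assoc[symmetric])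
  then show ?thesis using a True step_step[of i 2 1] by auto
 next
  case False
  then consider "j \<noteq> 2" | "i = 1" "j = 2" by blast
  then show ?thesis
  proof cases
   case 1
   then have "S i j * Lo 2 * S 2 1 = Zr []" using off_diagonal(3)[of 2 i j] a by simp
   then show ?thesis by (simp only: mult.assoc)
  qed (simp add: loop_1)
 qed
 then have "S i j * (Lo 2 * S 2 1) * (U 1 * (S 1 2 * Lo 2)) = Zr [1]" by simp
 then show "S i j * tw = Zr [1]" unfolding tw_def nb_def by (simp add: sc_laws mult.assoc)
 have "S 1 2 * (Lo 2 * S i j) = Zr []"
 proof (cases "i = 2 \<and> j \<noteq> 1")
  case True
  then have "S 1 2 * (Lo 2 * S 2 j) = S 1 2 * S 2 j * Lo j"
   using loop_step[of 2 j] a by (simp add: mult.assoc)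
  then show ?thesis using a True step_step[of 1 2 j] by auto
 next
  case False
  then consider "i \<noteq> 2" | "i = 2" "j = 1" by blast
  then show ?thesis
  proof cases
   case 1
   then have "Lo 2 * S i j = Zr []" using off_diagonal(2)[of 2 i j] a by simp
   then show ?thesis by simp
  qed (simp add: loop_1)
 qed
 then have "Lo 2 * (S 2 1 * U 1) * (S 1 2 * (Lo 2 * S i j)) = Zr [1]" by simp
 then show "tw * S i j = Zr [1]" unfolding tw_def nb_def by (simp add: sc_laws mult.assoc)
qed

lemma tw_E: "j \<in> {1..n} ==> E j * tw = (if j = 2 then tw else Zr [1])" "j \<in> {1..n} ==> tw * E j = (if j = 2 then tw else Zr [1])"
 unfolding tw_def nb_def by (auto simp: zsimps)

text \<open>The loop on one side of \<open>tw\<close> equals the loop on the other side of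
  \<open>nb 1 2\<close>. The two terms are exchanged, so their sum commutes with the loop.\<close>

lemma tw_Lo: "j \<in> {2..n} ==> j \<noteq> 2 ==> Lo j * tw = Zr [1]" "j \<in> {2..n} ==> j \<noteq> 2 ==> tw * Lo j = Zr [1]"
 "Lo 2 * tw = nb 1 2 * Lo 2" "tw * Lo 2 = Lo 2 * nb 1 2"
 unfolding tw_def nb_def by (simp_all add: zsimps sc_laws)

lemma XU_step: assumes "s \<in> {1..n}" "adj i j"
 shows "S i j * (X s * U s) = Zr [s]" "S i j * (U s * X s) = (if j = s then S i s * (U s * X s) else Zr [s])"
  "X s * U s * S i j = (if i = s then X s * (U s * S s j) else Zr [s])" "U s * X s * S i j = Zr [s]"
 using assms adjD[OF assms(2)] by (auto simp: zsimps)

text \<open>At most one neighbour term matches the arrow, and there the arrow followed by its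
  reverse becomes an \<open>X s\<close> next to \<open>U s\<close>.\<close>

lemma side_step: assumes s: "s \<in> {1..n}" and a: "adj i j"
 shows "S i j * side s = (if i = s then X s * (U s * S s j) else Zr [s])" (is "?L1 = ?R1")
  "side s * S i j = (if j = s then S i s * (U s * X s) else Zr [s])" (is "?L2 = ?R2")
proof -
 note a' = adjD[OF a] adj_sym[OF a]
 have "?L1 = ?R1 \<and> ?L2 = ?R2"
 proof (cases "s = 1")
  case True
  have ij: "i = 1 \<and> j = 2 \<longleftrightarrow> i = 1" "i = 2 \<and> j = 1 \<longleftrightarrow> j = 1" using a by (auto simp: adj_def)
  note nb = nb_step[OF adj_12(1) a, unfolded ij]
  have eq: "?L1 = (if i = 1 then X 1 * (U 1 * S 1 2) else Zr [1])" "?L2 = (if j = 1 then S 2 1 * (U 1 * X 1) else Zr [1])"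
   unfolding True side_def by (simp_all add: distrib_left distrib_right nb tw_step[OF a])
  have "i = 1 ==> j = 2" "j = 1 ==> i = 2" using ij by blast+
  then show ?thesis using eq[unfolded True] True by auto
 next
  case False
  have k: "adj s (s - 1)" using s False by (auto simp: adj_def)
  have ij: "j = s ==> i = s - 1 \<or> i = s + 1 \<and> s < n" "i = s ==> j = s - 1 \<or> j = s + 1 \<and> s < n" using a by (auto simp: adj_def)
  have ne: "s - 1 \<noteq> s + 1" using s False by auto
  define p q where "p = s - 1" and "q = s + 1"
  have side: "side s = nb s p + (if s < n then nb s q else Zr [s])" using False by (simp add: side_def p_def q_def)
  note k = k[folded p_def] and ij = ij[folded p_def q_def] and ne = ne[folded p_def q_def]
  have k': "s < n ==> adj s q" using s False by (auto simp: adj_def q_def)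
  note nb = nb_step[OF k a]
  show ?thesis
  proof (cases "s < n")
   case True
   note nb' = nb_step[OF k'[OF True] a]
   have ok: "ok (X s * (U s * S s p))" "ok (X s * (U s * S s q))" "ok (S p s * (U s * X s))" "ok (S q s * (U s * X s))"
    "wd (X s * (U s * S s p)) = [s]" "wd (X s * (U s * S s q)) = [s]" "wd (S p s * (U s * X s)) = [s]" "wd (S q s * (U s * X s)) = [s]"
    using k k'[OF True] adj_sym[OF k] adj_sym[OF k'[OF True]] s by simp_all
   have eq: "?L1 = S i j * nb s p + S i j * nb s q" "?L2 = nb s p * S i j + nb s q * S i j"
    by (simp_all add: side True distrib_left distrib_right)
   have "?L1 = ?R1" unfolding eq nb nb'
    by (cases "i = s"; cases "j = p") (use ij(2) ne ok s in auto)
   moreover have "?L2 = ?R2" unfolding eq nb nb'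
    by (cases "j = s"; cases "i = p") (use ij(1) ne ok s in auto)
   ultimately show ?thesis ..
  next
   case n: False
   have ok: "ok (X s * (U s * S s p))" "ok (S p s * (U s * X s))"
    "wd (X s * (U s * S s p)) = [s]" "wd (S p s * (U s * X s)) = [s]"
    using k adj_sym[OF k] s by simp_all
   have side': "side s = nb s p + Zr [s]" by (simp only: side n if_False)
   have eq: "?L1 = S i j * nb s p + Zr [s]" "?L2 = nb s p * S i j + Zr [s]"
    unfolding side' distrib_left distrib_right using s a a' by simp_all
   have "?L1 = ?R1" unfolding eq nb
    by (cases "i = s") (use ij(2) ok s n in auto)
   moreover have "?L2 = ?R2" unfolding eq nb
    by (cases "j = s") (use ij(1) ok s n in auto)
   ultimately show ?thesis ..
  qed
 qed
 then show "?L1 = ?R1" "?L2 = ?R2" by auto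
qed

text \<open>The summands compensate each other. An arrow from \<open>s\<close> on the left turns the
  side terms into \<open>X s * (U s * S s j)\<close>, and the same arrow on the right produces this
  from the summand \<open>X s * U s\<close>; arrows into \<open>s\<close> are symmetric.\<close>

lemma D0_central_step: assumes s: "s \<in> {1..n}" and a: "adj i j" shows "S i j * D0 s = D0 s * S i j"
proof -
 note a' = adjD[OF a] adj_sym[OF a]
 show ?thesis unfolding D0_def distrib_left distrib_right side_step[OF s a] XU_step[OF s a]
  using s a a' by (cases "i = s"; cases "j = s") simp_all
qed

lemma D0_central_E: assumes s: "s \<in> {1..n}" and j: "j \<in> {1..n}" shows "E j * D0 s = D0 s * E j"
proof -
 have k: "s \<noteq> 1 ==> adj s (s - 1)" "s < n ==> adj s (s + 1)" using s by (auto simp: adj_def)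
 have "E j * (X s * U s) = X s * U s * E j" "E j * (U s * X s) = U s * X s * E j"
  using s j by (auto simp: zsimps)
 then show ?thesis unfolding D0_def side_def
  using s j k by (auto simp: distrib_left distrib_right nb_E tw_E)
qed

lemma D0_central_Lo: assumes s: "s \<in> {1..n}" and j: "j \<in> {2..n}" shows "Lo j * D0 s = D0 s * Lo j"
proof -
 have k: "s \<noteq> 1 ==> adj s (s - 1)" "s < n ==> adj s (s + 1)" using s by (auto simp: adj_def)
 have XU: "Lo j * (X s * U s) = X s * U s * Lo j" "Lo j * (U s * X s) = U s * X s * Lo j"
  using s j by (cases "j = s"; simp add: zsimps; simp add: X_loop[symmetric] mult.assoc)+
 have nbc: "Lo j * nb s k = nb s k * Lo j" if "adj s k" "s \<in> {2..n}" for k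
  using that j nb_Lo[OF that(1)] by (cases "j = k") auto
 show ?thesis
 proof (cases "s = 1")
  case True
  \<comment> \<open>For \<open>j = 2\<close> the two summands change places.\<close>
  have "Lo j * (nb 1 2 + tw) = (nb 1 2 + tw) * Lo j"
   using j by (cases "j = 2") (simp_all add: distrib_left distrib_right nb_Lo tw_Lo add.commute)
  then show ?thesis unfolding D0_def side_def using XU True by (simp add: distrib_left distrib_right)
 next
  case False
  then have "s \<in> {2..n}" using s by auto
  then show ?thesis unfolding D0_def side_def using XU False k nbc[OF k(1)] nbc[OF k(2)] j
   by (auto simp: distrib_left distrib_right)
 qed
qed

text \<open>Idempotents, loops and arrows generate the algebra, and commuting with
  \<open>D0 s\<close> is stable under sums, products and scalars.\<close>

lemma D0_central: assumes "s \<in> {1..n}" "ok b" "wd b = []" shows "b * D0 s = D0 s * b"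
proof -
 have "ok b \<and> wd b = []" using assms by simp
 then show ?thesis
 proof (induction rule: generated)
  case (times a b)
  then show ?case by (metis mult.assoc)
 qed (use assms(1) in \<open>simp_all add: D0_central_E D0_central_Lo D0_central_step sc_laws distrib_left distrib_right\<close>)
qed

lemma Ds_central: "s \<in> {1..n} ==> ok b ==> wd b = [] ==> b * Ds s = Ds s * b"
 by (simp add: Ds_def sc_laws D0_central)

subsection \<open>Central elements of degree two\<close>

text \<open>A recursion instead of a finite sum, since tensors have no common neutral element for
  addition.\<close>

fun xsum :: "(nat => real) => nat => tens" where
 "xsum c 0 = Zr []"
| "xsum c (Suc k) = xsum c k + sc (c (Suc k)) (X (Suc k))"

lemma xsum_ok [simp]: "k \<le> n ==> ok (xsum c k)" "k \<le> n ==> wd (xsum c k) = []"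
proof -
 have "k \<le> n ==> ok (xsum c k) \<and> wd (xsum c k) = []" by (induction k) simp_all
 then show "k \<le> n ==> ok (xsum c k)" "k \<le> n ==> wd (xsum c k) = []" by simp_all
qed

lemma xsum_E: assumes "s \<in> {1..n}" "k \<le> n"
 shows "E s * xsum c k = (if s \<le> k then sc (c s) (X s) else Zr [])" "xsum c k * E s = (if s \<le> k then sc (c s) (X s) else Zr [])"
proof -
 have "E s * xsum c k = (if s \<le> k then sc (c s) (X s) else Zr []) \<and> xsum c k * E s = (if s \<le> k then sc (c s) (X s) else Zr [])"
  using assms(2)
 proof (induction k)
  case (Suc k)
  then have "Suc k \<in> {1..n}" by simp
  then show ?case using Suc assms(1) by (auto simp: distrib_left distrib_right sc_laws E_X le_Suc_eq)
 qed (use assms in simp)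
 then show "E s * xsum c k = (if s \<le> k then sc (c s) (X s) else Zr [])" "xsum c k * E s = (if s \<le> k then sc (c s) (X s) else Zr [])"
  by simp_all
qed

lemma X_central: assumes "s \<in> {1..n}" "ok b" "wd b = []" shows "b * X s = X s * b"
proof -
 have "ok b \<and> wd b = []" using assms by simp
 then show ?thesis
 proof (induction rule: generated)
  case (E j)
  then show ?case using assms(1) by (simp add: E_X)
 next
  case (L j)
  then show ?case using assms(1) by (cases "j = s") (simp_all add: X_off X_loop)
 next
  case (S i j)
  then show ?case using assms(1) by (simp add: X_off)
 next
  case (times a b)
  then show ?case by (metis mult.assoc)
 qed (simp_all add: sc_laws distrib_left distrib_right)
qed

lemma xsum_central: "k \<le> n ==> ok b ==> wd b = [] ==> b * xsum c k = xsum c k * b"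
 by (induction k) (simp_all add: distrib_left distrib_right sc_laws X_central)

lemma xsum_U: assumes "s \<in> {1..n}" shows "xsum c n * U s = sc (c s) (X s * U s)" "U s * xsum c n = sc (c s) (U s * X s)"
proof -
 have "xsum c n * U s = xsum c n * E s * U s" using assms by (simp add: E_U mult.assoc)
 then show "xsum c n * U s = sc (c s) (X s * U s)" using assms by (simp add: xsum_E sc_laws)
 have "U s * xsum c n = U s * (E s * xsum c n)" using assms by (simp add: E_U mult.assoc[symmetric])
 then show "U s * xsum c n = sc (c s) (U s * X s)" using assms by (simp add: xsum_E sc_laws)
qed

fun esum :: "nat => tens" where
 "esum 0 = Zr []"
| "esum (Suc k) = esum k + E (Suc k)"

lemma esum: "k \<le> n ==> esum k = B (cls (\<Sum>j = 1..k. pe j))"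
proof (induction k)
 case 0
 then show ?case by (simp add: cls_zero B_laws(4))
next
 case (Suc k)
 have "keys (\<Sum>j = 1..k. pe j) \<subseteq> paths n"
  using Suc.prems by (intro order.trans[OF keys_sum] UN_least) (auto simp: pe_def)
 then show ?case using Suc by (simp add: E_def B_laws cls_add pe_def[of "Suc k"])
qed

lemma One_esum: "One = esum n"
 unfolding One_def by (simp add: esum cls_one)

text \<open>The unit is the sum of the vertex idempotents, so an identity can be tested one vertex
  at a time.\<close>

lemma nil_eqI:
 assumes "ok a" "ok b" "\<And>s. s \<in> {1..n} ==> E s * a = E s * b" "wd a = wd b"
 shows "a = b"
proof -
 have "esum k * a = esum k * b" if "k \<le> n" for k
  using that
 proof (induction k)
  case (Suc k)
  then have "Suc k \<in> {1..n}" by simp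
  then show ?case using Suc assms(3)[of "Suc k"] by (simp add: distrib_right)
 qed (use assms in simp)
 from this[of n] show ?thesis using assms by (simp flip: One_esum)
qed

end

section \<open>The low-order part of a polynomial\<close>

definition mon :: "(nat => 'a :: comm_ring_1) => (nat \<Rightarrow>\<^sub>0 nat) => 'a" where
 "mon v m = (\<Prod>i\<in>keys m. v i ^ lookup m i)"

text \<open>Coefficients are mapped by \<open>h\<close>, so that one definition serves for real
  values, for restriction to a line (one-variable polynomials) and for substitution inside
  \<open>R\<close>.\<close>

definition evaluate :: "(real => 'a :: comm_ring_1) => (nat => 'a) => rpoly => 'a" where
 "evaluate h v p = (\<Sum>m\<in>keys p. h (lookup p m) * mon v m)"

lemma mon_superset:
 assumes "finite A" "keys m \<subseteq> A" shows "mon v m = (\<Prod>i\<in>A. v i ^ lookup m i)"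
 unfolding mon_def using assms by (intro prod.mono_neutral_left) (auto simp: in_keys_iff)

lemma mon_add: "mon v (m + m') = mon v m * mon v m'"
proof -
 let ?A = "keys m \<union> keys m'"
 have "mon v (m + m') = (\<Prod>i\<in>?A. v i ^ lookup (m + m') i)"
  by (rule mon_superset) (use keys_add[of m m'] in auto)
 moreover have "mon v m = (\<Prod>i\<in>?A. v i ^ lookup m i)" "mon v m' = (\<Prod>i\<in>?A. v i ^ lookup m' i)"
  by (rule mon_superset; simp)+
 ultimately show ?thesis by (simp add: lookup_add power_add prod.distrib)
qed

lemma mon_simps [simp]: "mon v 0 = 1" "mon v (single i (Suc 0)) = v i" "mon v (single i 1) = v i"
 by (simp_all add: mon_def One_nat_def)

lemma poly_mapping_add_induct [case_names single add]:
 assumes "\<And>x a. P (single x a)" "\<And>p q. P p ==> P q ==> P (p + q)"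
 shows "P (p :: _ \<Rightarrow>\<^sub>0 _ :: comm_monoid_add)"
proof -
 have "P (\<Sum>x\<in>A. single x (lookup p x))" if "finite A" for A
  using that assms by (induction A rule: finite_induct) (simp_all, metis single_zero)
 from this[of "keys p"] show ?thesis by (simp flip: poly_mapping_sum_singles)
qed

locale scalar_hom =
 fixes h :: "real => 'a :: comm_ring_1"
 assumes h_add: "h (a + b) = h a + h b" and h_mult: "h (a * b) = h a * h b" and h_one: "h 1 = 1"
begin

lemma h_zero: "h 0 = 0"
 using h_add[of 0 0] by simp

lemma evaluate_superset:
 assumes "finite A" "keys p \<subseteq> A" shows "evaluate h v p = (\<Sum>m\<in>A. h (lookup p m) * mon v m)"
 unfolding evaluate_def using assms by (intro sum.mono_neutral_left) (auto simp: in_keys_iff h_zero)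

lemma evaluate_add: "evaluate h v (p + q) = evaluate h v p + evaluate h v q"
proof -
 let ?A = "keys p \<union> keys q"
 have "evaluate h v (p + q) = (\<Sum>m\<in>?A. h (lookup (p + q) m) * mon v m)"
  by (rule evaluate_superset) (use keys_add[of p q] in auto)
 moreover have "evaluate h v p = (\<Sum>m\<in>?A. h (lookup p m) * mon v m)"
  "evaluate h v q = (\<Sum>m\<in>?A. h (lookup q m) * mon v m)"
  by (rule evaluate_superset; simp)+
 ultimately show ?thesis by (simp add: lookup_add h_add distrib_right sum.distrib)
qed

lemma evaluate_single: "evaluate h v (single m a) = h a * mon v m"
 by (simp add: evaluate_def h_zero)

lemma evaluate_mult: "evaluate h v (p * q) = evaluate h v p * evaluate h v q"
proof (induction p rule: poly_mapping_add_induct)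
 case (single x a)
 show ?case
 proof (induction q rule: poly_mapping_add_induct)
  case (single y b)
  show ?case by (simp add: mult_single evaluate_single h_mult mon_add mult_ac)
 qed (simp add: distrib_left evaluate_add)
qed (simp add: distrib_right evaluate_add)

lemma evaluate_simps [simp]:
 "evaluate h v 0 = 0" "evaluate h v 1 = 1" "evaluate h v (R_const c) = h c" "evaluate h v (omega i) = v i"
 using evaluate_single[of v 0 1]
 by (simp_all add: evaluate_def[of h v 0] evaluate_single R_const_def omega_def h_one)

lemma evaluate_diff: "evaluate h v (p - q) = evaluate h v p - evaluate h v q"
 using evaluate_add[of v "p - q" q] by simp

lemma evaluate_sum: "evaluate h v (\<Sum>i\<in>A. f i) = (\<Sum>i\<in>A. evaluate h v (f i))"
 by (induction A rule: infinite_finite_induct) (simp_all add: evaluate_add)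

lemma evaluate_power: "evaluate h v (p ^ k) = evaluate h v p ^ k"
 by (induction k) (simp_all add: evaluate_mult)

lemma evaluate_prod: "evaluate h v (\<Prod>i\<in>A. f i) = (\<Prod>i\<in>A. evaluate h v (f i))"
 by (induction A rule: infinite_finite_induct) (simp_all add: evaluate_mult)

lemma evaluate_R_subst: "evaluate h v (R_subst f p) = evaluate h (\<lambda>i. evaluate h v (f i)) p"
 by (simp add: R_subst_def evaluate_sum evaluate_mult evaluate_prod evaluate_power) (simp add: evaluate_def mon_def)

lemma evaluate_alpha: "evaluate h v (alpha n s) = (\<Sum>i = 1..n. h (cartan i s) * v i)"
 by (simp add: alpha_def evaluate_sum evaluate_mult)

end

lemma R_subst_evaluate: "R_subst f p = evaluate R_const f p"
 by (simp add: R_subst_def evaluate_def mon_def)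

interpretation real_eval: scalar_hom "\<lambda>c :: real. c"
 by unfold_locales simp_all

interpretation poly_eval: scalar_hom "\<lambda>c :: real. [:c:]"
proof
 show "[:1 :: real:] = 1" by (rule pCons_one)
qed simp_all

interpretation subst: scalar_hom R_const
 by unfold_locales (simp_all only: R_const_def single_add mult_single single_one add_0)

section \<open>Restriction of polynomials to coroot lines\<close>

definition only :: "nat => 'a :: zero => nat => 'a" where
 "only s x i = (if i = s then x else 0)"

definition const_part :: "rpoly => real" where
 "const_part = evaluate (\<lambda>c. c) (\<lambda>_. 0)"

text \<open>Restriction to the line through the coroot of \<open>s\<close>, on which
  \<open>omega s\<close> is the coordinate and every other \<open>omega i\<close> vanishes. There
  the reflection is \<open>x \<mapsto> -x\<close>, which reduces the required first-order
  information on \<open>reflect\<close> and \<open>demazure\<close> to polynomials in one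
  variable.\<close>

definition line :: "nat => rpoly => real poly" where
 "line s = evaluate (\<lambda>c. [:c:]) (only s [:0, 1:])"

definition lin_part :: "rpoly => nat => real" where
 "lin_part f s = coeff (line s f) 1"

lemma poly_line: "poly (line s f) r = evaluate (\<lambda>c. c) (only s r) f"
proof -
 have "poly (only s [:0, 1:] i) r = only s r i" for i by (simp add: only_def)
 then show ?thesis by (simp add: line_def evaluate_def mon_def poly_sum poly_prod)
qed

lemma coeff_line_0: "coeff (line s f) 0 = const_part f"
proof -
 have "only s (0 :: real) = (\<lambda>_. 0)" by (auto simp: only_def)
 then show ?thesis by (simp add: poly_0_coeff_0[symmetric] poly_line const_part_def)
qed

lemma parts_simps:
 "const_part (f + g) = const_part f + const_part g" "lin_part (f + g) s = lin_part f s + lin_part g s"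
 "const_part (f * g) = const_part f * const_part g"
 "lin_part (f * g) s = const_part f * lin_part g s + lin_part f s * const_part g"
 "const_part 1 = 1" "lin_part 1 s = 0" "const_part (R_const r) = r" "lin_part (R_const r) s = 0"
proof -
 show "lin_part (f * g) s = const_part f * lin_part g s + lin_part f s * const_part g"
  by (simp add: lin_part_def line_def poly_eval.evaluate_mult coeff_mult One_nat_def flip: coeff_line_0[of s])
qed (simp_all add: const_part_def lin_part_def line_def real_eval.evaluate_add real_eval.evaluate_mult poly_eval.evaluate_add One_nat_def)

lemma sum_only: "(\<Sum>i = 1..n. c i * only s x i) = (if s \<in> {1..n} then c s * (x :: 'a :: comm_ring_1) else 0)"
proof -
 have "(\<Sum>i = 1..n. c i * only s x i) = (\<Sum>i = 1..n. if i = s then c i * x else 0)"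
  by (rule sum.cong) (auto simp: only_def)
 then show ?thesis by simp
qed

lemma parts_alpha: "const_part (alpha n s) = 0" "i \<in> {1..n} ==> lin_part (alpha n s) i = cartan i s"
 unfolding const_part_def lin_part_def line_def real_eval.evaluate_alpha poly_eval.evaluate_alpha sum_only
 by (simp_all add: One_nat_def)

lemma cartan_self: "cartan s s = 2"
 by (simp add: cartan_def)

lemma line_alpha: "s \<in> {1..n} ==> line s (alpha n s) = [:0, 2:]"
 unfolding line_def poly_eval.evaluate_alpha sum_only by (simp add: cartan_self)

lemma line_reflect: assumes "s \<in> {1..n}" shows "poly (line s (reflect n s f)) r = poly (line s f) (- r)"
proof -
 have "evaluate (\<lambda>c. c) (only s r) (alpha n s) = 2 * r"
  using assms by (simp add: real_eval.evaluate_alpha sum_only cartan_self)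
 then have "(\<lambda>i. evaluate (\<lambda>c. c) (only s r) (if i = s then omega i - alpha n s else omega i)) = only s (- r)"
  by (auto simp: only_def real_eval.evaluate_diff)
 then show ?thesis by (simp add: poly_line reflect_def real_eval.evaluate_R_subst)
qed

lemma coeff_line_reflect: assumes "s \<in> {1..n}" shows "coeff (line s (reflect n s f)) k = (- 1) ^ k * coeff (line s f) k"
proof -
 have "line s (reflect n s f) = pcompose (line s f) [:0, - 1:]"
  by (subst poly_eq_poly_eq_iff[symmetric]) (simp add: fun_eq_iff line_reflect[OF assms] poly_pcompose)
 then show ?thesis by (simp add: coeff_pcompose_linear)
qed

lemma parts_reflect:
 assumes "s \<in> {1..n}" shows "const_part (reflect n s f) = const_part f" "lin_part (reflect n s f) s = - lin_part f s"
 using coeff_line_reflect[OF assms, of f 0] coeff_line_reflect[OF assms, of f 1] by (simp_all add: coeff_line_0 lin_part_def)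

section \<open>Divisibility by simple roots and Demazure operators\<close>

lemma R_ring_simps:
 "f \<in> R_ring n ==> g \<in> R_ring n ==> f + g \<in> R_ring n" "f \<in> R_ring n ==> g \<in> R_ring n ==> f * g \<in> R_ring n"
 "R_const c \<in> R_ring n" "i \<in> {1..n} ==> omega i \<in> R_ring n"
proof -
 show "f \<in> R_ring n ==> g \<in> R_ring n ==> f + g \<in> R_ring n"
  using keys_add[of f g] unfolding R_ring_def by blast
 assume *: "f \<in> R_ring n" "g \<in> R_ring n"
 show "f * g \<in> R_ring n" unfolding R_ring_def
 proof (intro CollectI ballI)
  fix m assume "m \<in> keys (f * g)"
  then obtain a b where "m = a + b" "a \<in> keys f" "b \<in> keys g" using keys_mult[of f g] by blast
  then show "keys m \<subseteq> {1..n}" using * keys_add[of a b] unfolding R_ring_def by blast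
 qed
qed (auto simp: R_ring_def R_const_def omega_def)

lemma reflect_hom:
 "reflect n s (f + g) = reflect n s f + reflect n s g" "reflect n s (f * g) = reflect n s f * reflect n s g"
 "reflect n s (R_const c) = R_const c" "reflect n s (omega i) = (if i = s then omega i - alpha n s else omega i)"
 "reflect n s 1 = 1"
 by (simp_all add: reflect_def R_subst_evaluate subst.evaluate_add subst.evaluate_mult)

lemma R_const_zero: "R_const 0 = 0"
 by (simp add: R_const_def)

lemma alpha_in_R_ring: "alpha n s \<in> R_ring n"
proof -
 have "(\<Sum>i\<in>A. R_const (cartan i s) * omega i) \<in> R_ring n" if "A \<subseteq> {1..n}" for A
  using finite_subset[OF that] that
  by (induction A rule: finite_induct) (use R_ring_simps(3)[of 0 n] in \<open>auto intro!: R_ring_simps simp: R_const_zero\<close>)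
 then show ?thesis by (simp add: alpha_def)
qed

lemma uminus_R_ring: "f \<in> R_ring n ==> - f \<in> R_ring n"
 by (simp add: R_ring_def)

text \<open>Besides the quotient, the property records that \<open>f\<close> and its reflection stay
  in \<open>R_ring n\<close>: the quotient of a product involves both.\<close>

definition divides_diff :: "nat => nat => rpoly => bool" where
 "divides_diff n s f \<longleftrightarrow> f \<in> R_ring n \<and> reflect n s f \<in> R_ring n \<and> (\<exists>g \<in> R_ring n. alpha n s * g = f - reflect n s f)"

text \<open>By the twisted Leibniz rule, quotients \<open>g\<close> and \<open>g'\<close> of the
  factors combine to the quotient \<open>g * f' + s(f) * g'\<close> of the product.\<close>

lemma divides_diff_mult:
 assumes "divides_diff n s f" "divides_diff n s f'" shows "divides_diff n s (f * f')"
proof -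
 obtain g g' where g: "g \<in> R_ring n" "alpha n s * g = f - reflect n s f" "g' \<in> R_ring n" "alpha n s * g' = f' - reflect n s f'"
  using assms by (auto simp: divides_diff_def)
 have "alpha n s * (g * f' + reflect n s f * g') = (f - reflect n s f) * f' + reflect n s f * (f' - reflect n s f')"
  by (simp only: distrib_left mult.assoc[symmetric] g(2) mult.left_commute[of "alpha n s" "reflect n s f"] g(4) mult.commute[of "alpha n s" "reflect n s f"])
   (simp only: mult.assoc g(4))
 also have "\<dots> = f * f' - reflect n s (f * f')"
  by (simp add: reflect_hom left_diff_distrib right_diff_distrib)
 finally have eq: "alpha n s * (g * f' + reflect n s f * g') = f * f' - reflect n s (f * f')" .
 have "f \<in> R_ring n" "f' \<in> R_ring n" "reflect n s f \<in> R_ring n" "reflect n s f' \<in> R_ring n"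
  using assms by (auto simp: divides_diff_def)
 note * = this g(1,3) R_ring_simps(1,2)
 have "f * f' \<in> R_ring n" "reflect n s (f * f') \<in> R_ring n" "g * f' + reflect n s f * g' \<in> R_ring n"
  unfolding reflect_hom(2) by (intro *)+
 then show ?thesis using eq unfolding divides_diff_def by blast
qed

lemma divides_diff_add:
 assumes "divides_diff n s f" "divides_diff n s f'" shows "divides_diff n s (f + f')"
proof -
 obtain g g' where g: "g \<in> R_ring n" "alpha n s * g = f - reflect n s f" "g' \<in> R_ring n" "alpha n s * g' = f' - reflect n s f'"
  using assms by (auto simp: divides_diff_def)
 then have "alpha n s * (g + g') = (f + f') - reflect n s (f + f')" by (simp add: distrib_left reflect_hom)
 then show ?thesis using assms g R_ring_simps(1,2) unfolding divides_diff_def reflect_hom(1) by blast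
qed

lemma divides_diff_const: "divides_diff n s (R_const c)"
 unfolding divides_diff_def using R_ring_simps(3)[of 0 n] by (auto simp: reflect_hom R_ring_simps R_const_zero intro!: bexI[of _ 0])

lemma divides_diff_omega: assumes "i \<in> {1..n}" shows "divides_diff n s (omega i)"
proof (cases "i = s")
 case True
 have "omega s - alpha n s = omega s + - alpha n s" by simp
 then have "omega s - alpha n s \<in> R_ring n" using assms True by (metis R_ring_simps(1,4) uminus_R_ring alpha_in_R_ring)
 moreover have "(1 :: rpoly) \<in> R_ring n" using R_ring_simps(3)[of 1 n] by (simp add: R_const_def)
 ultimately show ?thesis using assms True unfolding divides_diff_def by (auto simp: reflect_hom R_ring_simps intro!: bexI[of _ 1])
next
 case False
 then show ?thesis using assms R_ring_simps(3)[of 0 n] unfolding divides_diff_def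
  by (auto simp: reflect_hom R_ring_simps R_const_zero intro!: bexI[of _ 0])
qed

lemma single_monomial: "single m c = R_const c * (\<Prod>i\<in>keys m. omega i ^ lookup m i)"
proof -
 have pow: "omega i ^ k = single (single i k) 1" for i k
  by (induction k) (simp_all add: omega_def mult_single One_nat_def flip: single_add)
 have "(\<Prod>i\<in>A. omega i ^ lookup m i) = single (\<Sum>i\<in>A. single i (lookup m i)) 1" if "finite A" for A
  using that by (induction A rule: finite_induct) (simp_all add: pow mult_single)
 then show ?thesis by (simp add: R_const_def mult_single flip: poly_mapping_sum_singles)
qed

lemma divides_diff: assumes "f \<in> R_ring n" shows "divides_diff n s f"
proof -
 have one: "divides_diff n s 1" using divides_diff_const[of n s 1] by (simp add: R_const_def)
 have pow: "divides_diff n s (omega i ^ k)" if "i \<in> {1..n}" for i k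
  by (induction k) (simp_all add: one divides_diff_mult divides_diff_omega[OF that])
 have prod: "divides_diff n s (\<Prod>i\<in>A. omega i ^ lookup m i)" if "finite A" "A \<subseteq> {1..n}" for A m
  using that by (induction A rule: finite_induct) (simp_all add: one divides_diff_mult pow)
 have "divides_diff n s (\<Sum>m\<in>A. single m (lookup f m))" if "finite A" "A \<subseteq> keys f" for A
  using that
 proof (induction A rule: finite_induct)
  case empty
  show ?case using divides_diff_const[of n s 0] by (simp add: R_const_def)
 next
  case (insert m A)
  then have "keys m \<subseteq> {1..n}" using assms by (auto simp: R_ring_def)
  then have "divides_diff n s (single m (lookup f m))"
   unfolding single_monomial by (simp add: divides_diff_mult divides_diff_const prod)
  then show ?case using insert by (simp add: divides_diff_add)
 qed
 from this[of "keys f"] show ?thesis by (simp flip: poly_mapping_sum_singles)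
qed

text \<open>The definite description is meaningful: a quotient exists since divisibility passes from
  the \<open>omega i\<close> to all polynomials, and it is unique because polynomials form a domain
  in which \<open>alpha n s\<close> is nonzero.\<close>

lemma demazure:
 assumes "f \<in> R_ring n" "s \<in> {1..n}" shows "demazure n s f \<in> R_ring n" "alpha n s * demazure n s f = f - reflect n s f"
proof -
 have nz: "alpha n s \<noteq> 0" using line_alpha[OF assms(2)] by (auto simp: line_def)
 obtain g where g: "g \<in> R_ring n" "alpha n s * g = f - reflect n s f"
  using divides_diff[OF assms(1)] by (auto simp: divides_diff_def)
 have "demazure n s f = g"
  unfolding demazure_def
 proof (rule the_equality)
  fix g' assume "g' \<in> R_ring n \<and> alpha n s * g' = f - reflect n s f"
  then have "alpha n s * g' = alpha n s * g" using g by simp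
  then show "g' = g" using nz by simp
 qed (use g in simp)
 then show "demazure n s f \<in> R_ring n" "alpha n s * demazure n s f = f - reflect n s f" using g by simp_all
qed

text \<open>On the coroot line \<open>alpha n s\<close> is \<open>2 x\<close>, so the restrictions
  \<open>q\<close> of the quotient and \<open>p\<close> of \<open>f\<close> satisfy
  \<open>2 x q(x) = p(x) - p(-x)\<close>. Comparing coefficients shows that \<open>q(0)\<close> is
  the linear coefficient of \<open>p\<close> and that \<open>q\<close> has no linear term.\<close>

lemma parts_demazure:
 assumes "f \<in> R_ring n" "s \<in> {1..n}" shows "const_part (demazure n s f) = lin_part f s" "lin_part (demazure n s f) s = 0"
proof -
 have "line s (alpha n s * demazure n s f) = line s (f - reflect n s f)" using demazure[OF assms] by simp
 then have eq: "pCons 0 (smult 2 (line s (demazure n s f))) = line s f - line s (reflect n s f)"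
  using line_alpha[OF assms(2)] by (simp add: line_def poly_eval.evaluate_mult poly_eval.evaluate_diff)
 show "const_part (demazure n s f) = lin_part f s"
  using arg_cong[OF eq, of "\<lambda>p. coeff p 1"] coeff_line_reflect[OF assms(2), of f 1] by (simp add: coeff_line_0 lin_part_def One_nat_def)
 show "lin_part (demazure n s f) s = 0"
  using arg_cong[OF eq, of "\<lambda>p. coeff p 2"] coeff_line_reflect[OF assms(2), of f 2] by (simp add: lin_part_def numeral_2_eq_2 One_nat_def)
qed

lemma homogeneous_parts:
 assumes "R_homogeneous d f" shows "d \<noteq> 0 ==> const_part f = 0" "d \<noteq> 2 ==> lin_part f s = 0"
proof -
 assume d: "d \<noteq> 0"
 have "mon (\<lambda>_. 0 :: real) m = 0" if "m \<in> keys f" for m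
 proof -
  have "keys m \<noteq> {}" using assms d that by (auto simp: R_homogeneous_def)
  then obtain i where "i \<in> keys m" by blast
  then show ?thesis unfolding mon_def by (intro prod_zero bexI[of _ i]) (auto simp: in_keys_iff)
 qed
 then show "const_part f = 0" by (simp add: const_part_def evaluate_def)
next
 assume d: "d \<noteq> 2"
 \<comment> \<open>A monomial survives on the line only if it is a power of \<open>omega s\<close>,
   and its exponent is half its degree in \<open>R\<close>.\<close>
 have "coeff ([:lookup f m:] * mon (only s [:0, 1:]) m) 1 = 0" if m: "m \<in> keys f" for m
 proof (cases "keys m \<subseteq> {s}")
  case True
  have "(\<Sum>i\<in>keys m. lookup m i) = (\<Sum>i\<in>{s}. lookup m i)"
   by (rule sum.mono_neutral_left) (use True in \<open>auto simp: in_keys_iff\<close>)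
  moreover have "mon (only s [:0, 1 :: real:]) m = [:0, 1:] ^ lookup m s"
   using True by (simp add: mon_superset[of "{s}"] only_def)
  ultimately have "mon (only s [:0, 1 :: real:]) m = [:0, 1:] ^ lookup m s" "(\<Sum>i\<in>keys m. lookup m i) = lookup m s"
   by simp_all
  moreover have "lookup m s \<noteq> 1" using assms d m calculation(2) unfolding R_homogeneous_def by (auto simp del: of_nat_sum)
  moreover have "[:0, 1:] ^ k = monom (1 :: real) k" for k by (simp add: monom_altdef)
  ultimately show ?thesis by simp
 next
  case False
  then have "\<exists>i\<in>keys m. only s [:0, 1 :: real:] i ^ lookup m i = 0" by (auto simp: only_def in_keys_iff)
  then have "mon (only s [:0, 1 :: real:]) m = 0" unfolding mon_def by (intro prod_zero) auto
  then show ?thesis by simp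
 qed
 then have "(\<Sum>m\<in>keys f. coeff ([:lookup f m:] * mon (only s [:0, 1:]) m) 1) = 0" by (rule sum.neutral[OF ballI])
 then show "lin_part f s = 0" by (simp only: lin_part_def line_def evaluate_def coeff_sum)
qed

section \<open>The functor on morphisms\<close>

context type_B
begin

lemma app_Id: "ok t ==> wd t = w ==> app (Id ZC (Fo w)) w t = t"
 unfolding app_def by (elim okE) (metis Id_bimap(2))

lemma app_Comp:
 assumes "word u" "word v" "word w" "f \<in> bimaps n (Fo u) (Fo v)" "g \<in> bimaps n (Fo v) (Fo w)" "ok t" "wd t = u"
 shows "app (Comp ZC g f) w t = app g w (app f v t)"
proof -
 note z = Fo_zzb[OF assms(1)] Fo_zzb[OF assms(2)] Fo_zzb[OF assms(3)]
 obtain x where x: "x \<in> bcar (Fo u)" "t = El n u x" using assms(6,7) by (elim okE) auto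
 then show ?thesis using assms(1-3) bimapsD(3)[OF assms(4) z(1,2) x(1)]
  by (simp add: app_El Comp_bimap(2)[OF z assms(4,5)] del: zz_category_simps(3-7))
qed

lemma app_Add:
 assumes "word u" "word v" "f \<in> bimaps n (Fo u) (Fo v)" "g \<in> bimaps n (Fo u) (Fo v)" "ok t" "wd t = u"
 shows "app (Add ZC f g) v t = app f v t + app g v t"
proof -
 note z = Fo_zzb[OF assms(1)] Fo_zzb[OF assms(2)]
 obtain x where x: "x \<in> bcar (Fo u)" "t = El n u x" using assms(5,6) by (elim okE) auto
 then show ?thesis using assms(1,2) bimapsD(3)[OF assms(3) z x(1)] bimapsD(3)[OF assms(4) z x(1)]
  by (simp add: app_El plus_El' Add_bimap(2)[OF z assms(3,4)] del: zz_category_simps(3-7))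
qed

lemma app_Scale:
 assumes "word u" "word v" "f \<in> bimaps n (Fo u) (Fo v)" "ok t" "wd t = u"
 shows "app (Scale ZC r f) v t = sc r (app f v t)"
proof -
 note z = Fo_zzb[OF assms(1)] Fo_zzb[OF assms(2)]
 obtain x where x: "x \<in> bcar (Fo u)" "t = El n u x" using assms(4,5) by (elim okE) auto
 then show ?thesis using assms(1,2) bimapsD(3)[OF assms(3) z x(1)]
  by (simp add: app_El sc_El' Scale_bimap(2)[OF z assms(3)] del: zz_category_simps(3-7))
qed

lemma app_Zero: "word u ==> word v ==> ok t ==> wd t = u ==> app (Zero ZC (Fo u) (Fo v)) v t = Zr v"
 unfolding app_def Zr_def by (elim okE) (metis Zero_bimap(2))

text \<open>The tensor product of maps, transported along \<open>mu\<close> to concatenated words;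
  naturality of \<open>mu\<close> then holds by construction.\<close>

definition ten :: "nat list => nat list => nat list => nat list => bimap => bimap => bimap" where
 "ten u u' v v' f g = Comp ZC (mu v v') (Comp ZC (TenM ZC f g) (ZC.iso_inverse (ZT (Fo u) (Fo u')) (Fo (u @ u')) (mu u u')))"

lemma ten:
 assumes w: "word u" "word u'" "word v" "word v'" and f: "f \<in> bimaps n (Fo u) (Fo v)" and g: "g \<in> bimaps n (Fo u') (Fo v')"
 shows "ten u u' v v' f g \<in> bimaps n (Fo (u @ u')) (Fo (v @ v'))"
  "Comp ZC (ten u u' v v' f g) (mu u u') = Comp ZC (mu v v') (TenM ZC f g)"
proof -
 have uu: "word (u @ u')" "word (v @ v')" using w by simp_all
 note o = Fo_obj[OF uu(1)] Fo_obj[OF uu(2)] zz_objects.tensor[OF Fo_obj[OF w(1)] Fo_obj[OF w(2)]]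
  zz_objects.tensor[OF Fo_obj[OF w(3)] Fo_obj[OF w(4)]]
 note inv = ZC.iso_inverse[OF mu_is_iso[OF w(1,2)]]
 let ?i = "ZC.iso_inverse (ZT (Fo u) (Fo u')) (Fo (u @ u')) (mu u u')"
 note m = mu_bimap[OF w(1,2)] mu_bimap[OF w(3,4)]
 have T: "TenM ZC f g \<in> bimaps n (ZT (Fo u) (Fo u')) (ZT (Fo v) (Fo v'))"
  using w f g by (intro TenM_bimap(1) Fo_zzb)
 have H: "Hom ZC = bimaps n" "Obj ZC = zz_objects n" by (simp_all add: zz_category_def)
 note c = ZC.Comp_in[unfolded H] and a = ZC.Comp_assoc[unfolded H]
 have Ti: "Comp ZC (TenM ZC f g) ?i \<in> bimaps n (Fo (u @ u')) (ZT (Fo v) (Fo v'))"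
  using c[OF o(1,3,4) inv(1)[unfolded H] T] .
 show "ten u u' v v' f g \<in> bimaps n (Fo (u @ u')) (Fo (v @ v'))"
  unfolding ten_def using c[OF o(1,4,2) Ti m(2)] .
 have "Comp ZC (ten u u' v v' f g) (mu u u') = Comp ZC (mu v v') (Comp ZC (Comp ZC (TenM ZC f g) ?i) (mu u u'))"
  unfolding ten_def by (rule a[OF o(3,1,4,2) m(1) Ti m(2)])
 also have "Comp ZC (Comp ZC (TenM ZC f g) ?i) (mu u u') = Comp ZC (TenM ZC f g) (Comp ZC ?i (mu u u'))"
  by (rule a[OF o(3,1,3,4) m(1) inv(1)[unfolded H] T])
 also have "\<dots> = TenM ZC f g"
  unfolding inv(2) by (rule ZC.Comp_Id[unfolded H, OF o(3,4) T])
 finally show "Comp ZC (ten u u' v v' f g) (mu u u') = Comp ZC (mu v v') (TenM ZC f g)" .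
qed

lemma app_ten:
 assumes w: "word u" "word u'" "word v" "word v'" and f: "f \<in> bimaps n (Fo u) (Fo v)" and g: "g \<in> bimaps n (Fo u') (Fo v')"
  and x: "ok x" "wd x = u" and y: "ok y" "wd y = u'"
 shows "app (ten u u' v v' f g) (v @ v') (x * y) = app f v x * app g v' y"
proof -
 obtain a where a: "a \<in> bcar (Fo u)" "x = El n u a" using x by (elim okE) auto
 obtain b where b: "b \<in> bcar (Fo u')" "y = El n u' b" using y by (elim okE) auto
 have uu: "word (u @ u')" "word (v @ v')" using w by simp_all
 note z = Fo_zzb[OF w(1)] Fo_zzb[OF w(2)] Fo_zzb[OF w(3)] Fo_zzb[OF w(4)] and zz = Fo_zzb[OF uu(1)] Fo_zzb[OF uu(2)]
 note T = TenM_bimap[OF z f g]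
 note p = pu_laws(1)[OF z(1,2) a(1) b(1)]
 have fg: "bfun f a \<in> bcar (Fo v)" "bfun g b \<in> bcar (Fo v')"
  using bimapsD(3)[OF f z(1,3) a(1)] bimapsD(3)[OF g z(2,4) b(1)] by simp_all
 have "bfun (ten u u' v v' f g) (op u u' a b) = bfun (Comp ZC (ten u u' v v' f g) (mu u u')) (pu (Fo u) (Fo u') a b)"
  unfolding op_def Comp_bimap(2)[OF zzb_tensor[OF z(1,2)] zz mu_bimap[OF w(1,2)] ten(1)[OF w f g] p] ..
 also have "\<dots> = op v v' (bfun f a) (bfun g b)"
  unfolding ten(2)[OF w f g] Comp_bimap(2)[OF zzb_tensor[OF z(1,2)] zzb_tensor[OF z(3,4)] zz(2) T(1) mu_bimap[OF w(3,4)] p] T(2)[OF a(1) b(1)] op_def ..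
 finally show ?thesis using a b w fg op_laws(1)[OF w(1,2) a(1) b(1)] by (simp add: times_El' app_El)
qed

text \<open>All products \<open>X i * X j\<close> vanish, so it is consistent that a polynomial acts
  only through its terms of order at most one.\<close>

definition central :: "rpoly => tens" where
 "central f = sc (const_part f) One + xsum (\<lambda>s. kap s * lin_part f s) n"

text \<open>Cup and cap are the composites that define the self-duality of a Frobenius object: the
  splitting after the start dot, and the end dot after the merging.\<close>

fun Fi :: "dmor => bimap" where
 "Fi (DId w) = Id ZC (Fo w)"
| "Fi (Box p) = Cext [] (central p)"
| "Fi (StartDot s) = Cext [s] (Ds s)"
| "Fi (EndDot s) = Uext s [] (E s)"
| "Fi (Merge s) = Scale ZC (kap s) (merge s)"
| "Fi (Split s) = Uext s [s, s] (U s * U s)"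
| "Fi (Cup s) = Comp ZC (Uext s [s, s] (U s * U s)) (Cext [s] (Ds s))"
| "Fi (Cap s) = Comp ZC (Uext s [] (E s)) (Scale ZC (kap s) (merge s))"
| "Fi (Vert s t) = Zero ZC (Fo (alt (coxm s t) s t)) (Fo (alt (coxm s t) t s))"
| "Fi (DComp g f) = Comp ZC (Fi g) (Fi f)"
| "Fi (DTen f g) = ten (dsrc f) (dsrc g) (dtgt f) (dtgt g) (Fi f) (Fi g)"
| "Fi (DZero u v) = Zero ZC (Fo u) (Fo v)"
| "Fi (DAdd f g) = Add ZC (Fi f) (Fi g)"
| "Fi (DScale r f) = Scale ZC r (Fi f)"

lemma central_ok [simp]: "ok (central f)" "wd (central f) = []"
 by (simp_all add: central_def)

lemma central_central: "ok b ==> wd b = [] ==> b * central f = central f * b"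
 by (simp add: central_def distrib_left distrib_right sc_laws xsum_central)

lemma ke_1: "ke s 1 = E s"
 by (simp add: ke_def E_def kem_one)

lemma ke_ok [simp]: "s \<in> {1..n} ==> c \<in> KK s ==> ok (ke s c)" "s \<in> {1..n} ==> c \<in> KK s ==> wd (ke s c) = []"
 by (simp_all add: ke_def)

lemma ke_E: assumes "s \<in> {1..n}" "c \<in> KK s" shows "ke s c * E s = ke s c" "E s * ke s c = ke s c"
proof -
 have "1 \<in> KK s" by (simp add: KK_def)
 then show "ke s c * E s = ke s c" "E s * ke s c = ke s c"
  using assms kem_mult[of s c 1] kem_mult[of s 1 c] by (simp_all add: ke_1[symmetric] ke_def B_laws)
qed

lemma generator_maps:
 assumes "s \<in> {1..n}"
 shows "Uext s [] (E s) \<in> bimaps n (Fo [s]) (Fo [])" "app (Uext s [] (E s)) [] (U s) = E s"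
  "Uext s [s, s] (U s * U s) \<in> bimaps n (Fo [s]) (Fo [s, s])" "app (Uext s [s, s] (U s * U s)) [s, s] (U s) = U s * U s"
  "Cext [s] (Ds s) \<in> bimaps n (Fo []) (Fo [s])" "app (Cext [s] (Ds s)) [s] One = Ds s"
  "Cext [] (central f) \<in> bimaps n (Fo []) (Fo [])" "app (Cext [] (central f)) [] One = central f"
proof -
 have e: "B (pcl s []) * E s = E s" "B (pcl s []) * (U s * U s) = U s * U s"
  using assms by (simp_all add: E_def[symmetric] E_mult E_U mult.assoc[symmetric])
 have k: "ke s c * (U s * U s) = (U s * U s) * ke s c" if "c \<in> KK s" for c
  using ke_U[OF assms that] by (metis mult.assoc)
 have [simp]: "ok (U s * U s)" "wd (U s * U s) = [s, s]" using assms by simp_all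
 show "Uext s [] (E s) \<in> bimaps n (Fo [s]) (Fo [])" "app (Uext s [] (E s)) [] (U s) = E s"
  by (rule Uext; use assms e in \<open>simp add: ke_E\<close>)+
 show "Uext s [s, s] (U s * U s) \<in> bimaps n (Fo [s]) (Fo [s, s])" "app (Uext s [s, s] (U s * U s)) [s, s] (U s) = U s * U s"
  by (rule Uext; use assms e k in simp)+
 show "Cext [s] (Ds s) \<in> bimaps n (Fo []) (Fo [s])" "app (Cext [s] (Ds s)) [s] One = Ds s"
  by (rule Cext; use assms in \<open>simp add: Ds_central\<close>)+
 show "Cext [] (central f) \<in> bimaps n (Fo []) (Fo [])" "app (Cext [] (central f)) [] One = central f"
  by (rule Cext; simp add: central_central)+
qed

lemma Comp_Fo: "word u ==> word v ==> word w ==> f \<in> bimaps n (Fo u) (Fo v) ==> g \<in> bimaps n (Fo v) (Fo w)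
  ==> Comp ZC g f \<in> bimaps n (Fo u) (Fo w)"
 by (intro Comp_bimap(1)[of _ "Fo v"] Fo_zzb)

lemma merge_Fo: "s \<in> {1..n} ==> Scale ZC r (merge s) \<in> bimaps n (Fo [s, s]) (Fo [s])"
 by (intro Scale_bimap(1) Fo_zzb merge(1)) simp_all

lemma Fi_diagram: "diagram n w v f ==> word w \<and> word v \<and> Fi f \<in> bimaps n (Fo w) (Fo v)"
proof (induction rule: diagram.induct)
 case (1 w)
 then show ?case using Id_bimap(1)[OF Fo_zzb[of w]] by (simp add: word_def del: zz_category_simps)
next
 case (2 f)
 then show ?case using generator_maps(7)[of 1 f] n_ge_2 by simp
next
 case (5 s)
 then show ?case using merge_Fo[of s] by (simp del: zz_category_simps Fo_single)
next
 case (7 s)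
 then show ?case using Comp_Fo[of "[]" "[s]" "[s, s]", OF _ _ _ generator_maps(5,3)[OF 7]] by (simp del: zz_category_simps Fo_single Fo_Nil)
next
 case (8 s)
 then show ?case using Comp_Fo[of "[s, s]" "[s]" "[]", OF _ _ _ merge_Fo[OF 8] generator_maps(1)[OF 8]] by (simp del: zz_category_simps Fo_single Fo_Nil)
next
 case (9 s t)
 then have "word (alt (coxm s t) s t)" "word (alt (coxm s t) t s)"
  using set_alt[of "coxm s t" s t] set_alt[of "coxm s t" t s] by (auto simp: word_def)
 then show ?case by (simp add: Zero_bimap(1) Fo_zzb del: zz_category_simps)
next
 case (11 u v f u' v' g)
 then have "ten u u' v v' (Fi f) (Fi g) \<in> bimaps n (Fo (u @ u')) (Fo (v @ v'))" by (intro ten(1)) auto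
 moreover have "dsrc f = u" "dtgt f = v" "dsrc g = u'" "dtgt g = v'"
  using diagram_boundary[OF 11(1)] diagram_boundary[OF 11(2)] by simp_all
 ultimately show ?case using 11 by simp
next
 case (10 u v f w g)
 then show ?case using Comp_Fo[of u v w] by (simp del: zz_category_simps)
qed (auto simp: generator_maps Zero_bimap(1) Add_bimap(1) Scale_bimap(1) Fo_zzb word_def[symmetric] simp del: zz_category_simps Fo_Nil Fo_single)

definition D :: "dmor => tens => tens" where
 "D f t = app (Fi f) (dtgt f) t"

abbreviation wf :: "dmor => bool" where "wf \<equiv> wfd n"

lemma wfd_word: "wf f ==> word (dsrc f)" "wf f ==> word (dtgt f)"
 using wfd_words by (auto simp: word_def)

lemma Fi_bimap: "wf f ==> Fi f \<in> bimaps n (Fo (dsrc f)) (Fo (dtgt f))"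
 using Fi_diagram by (simp add: wfd_def)

lemma D_laws:
 assumes "wf f" "ok t" "wd t = dsrc f"
 shows "ok (D f t)" "wd (D f t) = dtgt f" "ok s ==> wd s = dsrc f ==> D f (s + t) = D f s + D f t"
  "D f (sc r t) = sc r (D f t)" "ok b ==> wd b = [] ==> D f (b * t) = b * D f t" "ok b ==> wd b = [] ==> D f (t * b) = D f t * b"
 unfolding D_def using app_laws[OF Fi_bimap[OF assms(1)] wfd_word[OF assms(1)] assms(2,3)] by simp_all

lemma D_Zr: assumes "wf f" shows "D f (Zr (dsrc f)) = Zr (dtgt f)"
 unfolding D_def using app_laws(5)[OF Fi_bimap[OF assms] wfd_word[OF assms], of "Zr (dsrc f)"] wfd_word[OF assms] by simp

lemma Fi_eqI:
 assumes "wf f" "wf g" "dsrc f = dsrc g" "dtgt f = dtgt g" "\<And>t. ok t ==> wd t = dsrc g ==> D f t = D g t"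
 shows "Fi f = Fi g"
 using app_eqI[OF Fi_bimap[OF assms(1), unfolded assms(3,4)] Fi_bimap[OF assms(2)] wfd_word[OF assms(2)]] assms(4,5)
 by (simp add: D_def)

lemma wf_simps [simp]:
 "wf (DId w) \<longleftrightarrow> word w" "wf (Box p) \<longleftrightarrow> p \<in> R_ring n" "wf (StartDot s) \<longleftrightarrow> s \<in> {1..n}" "wf (EndDot s) \<longleftrightarrow> s \<in> {1..n}"
 "wf (Merge s) \<longleftrightarrow> s \<in> {1..n}" "wf (Split s) \<longleftrightarrow> s \<in> {1..n}" "wf (Cup s) \<longleftrightarrow> s \<in> {1..n}" "wf (Cap s) \<longleftrightarrow> s \<in> {1..n}"
 "wf (Vert s t) \<longleftrightarrow> s \<in> {1..n} \<and> t \<in> {1..n} \<and> s \<noteq> t" "wf (DComp g f) \<longleftrightarrow> wf f \<and> wf g \<and> dtgt f = dsrc g"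
 "wf (DTen f g) \<longleftrightarrow> wf f \<and> wf g" "wf (DZero u v) \<longleftrightarrow> word u \<and> word v"
 "wf (DAdd f g) \<longleftrightarrow> wf f \<and> wf g \<and> dsrc f = dsrc g \<and> dtgt f = dtgt g" "wf (DScale r f) \<longleftrightarrow> wf f"
proof -
 have *: "wf h ==> diagram n (dsrc h) (dtgt h) h" for h by (simp add: wfd_def)
 show "wf (DId w) \<longleftrightarrow> word w" "wf (Box p) \<longleftrightarrow> p \<in> R_ring n" "wf (StartDot s) \<longleftrightarrow> s \<in> {1..n}" "wf (EndDot s) \<longleftrightarrow> s \<in> {1..n}"
  "wf (Merge s) \<longleftrightarrow> s \<in> {1..n}" "wf (Split s) \<longleftrightarrow> s \<in> {1..n}" "wf (Cup s) \<longleftrightarrow> s \<in> {1..n}" "wf (Cap s) \<longleftrightarrow> s \<in> {1..n}"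
  "wf (Vert s t) \<longleftrightarrow> s \<in> {1..n} \<and> t \<in> {1..n} \<and> s \<noteq> t" "wf (DZero u v) \<longleftrightarrow> word u \<and> word v"
  unfolding wfd_def word_def by (auto intro: diagram.intros elim: diagram.cases)
 show "wf (DComp g f) \<longleftrightarrow> wf f \<and> wf g \<and> dtgt f = dsrc g"
  by (auto intro: wfd_intros dest!: * elim!: diagram.cases[of _ _ _ "DComp _ _"] simp: diagram_iff)
 show "wf (DTen f g) \<longleftrightarrow> wf f \<and> wf g"
  by (auto intro: wfd_intros dest!: *[of "DTen f g"] elim!: diagram.cases[of _ _ _ "DTen _ _"] simp: diagram_iff)
 show "wf (DAdd f g) \<longleftrightarrow> wf f \<and> wf g \<and> dsrc f = dsrc g \<and> dtgt f = dtgt g"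
  by (auto intro: wfd_intros dest!: *[of "DAdd f g"] elim!: diagram.cases[of _ _ _ "DAdd _ _"] simp: diagram_iff)
 show "wf (DScale r f) \<longleftrightarrow> wf f"
  by (auto intro: wfd_intros dest!: *[of "DScale r f"] elim!: diagram.cases[of _ _ _ "DScale _ _"] simp: diagram_iff)
qed

lemma D_simps:
 "ok t ==> wd t = w ==> D (DId w) t = t"
 "wf (DComp g f) ==> ok t ==> wd t = dsrc f ==> D (DComp g f) t = D g (D f t)"
 "wf f ==> wf g ==> ok x ==> wd x = dsrc f ==> ok y ==> wd y = dsrc g ==> D (DTen f g) (x * y) = D f x * D g y"
 "wf (DAdd f g) ==> ok t ==> wd t = dsrc f ==> D (DAdd f g) t = D f t + D g t"
 "wf f ==> ok t ==> wd t = dsrc f ==> D (DScale r f) t = sc r (D f t)"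
 "word u ==> word v ==> ok t ==> wd t = u ==> D (DZero u v) t = Zr v"
 "wf (Vert i j) ==> ok t ==> wd t = dsrc (Vert i j) ==> D (Vert i j) t = Zr (dtgt (Vert i j))"
proof -
 note b = Fi_bimap and w = wfd_word
 show "ok t ==> wd t = w ==> D (DId w) t = t" by (simp add: D_def app_Id del: zz_category_simps)
 show "wf (DComp g f) ==> ok t ==> wd t = dsrc f ==> D (DComp g f) t = D g (D f t)"
  using app_Comp[of "dsrc f" "dtgt f" "dtgt g" "Fi f" "Fi g" t] b[of f] b[of g] w[of f] w[of g]
  by (simp add: D_def del: zz_category_simps)
 show "wf f ==> wf g ==> ok x ==> wd x = dsrc f ==> ok y ==> wd y = dsrc g ==> D (DTen f g) (x * y) = D f x * D g y"
  by (simp add: D_def app_ten b w)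
 show "wf (DAdd f g) ==> ok t ==> wd t = dsrc f ==> D (DAdd f g) t = D f t + D g t"
  using app_Add[of "dsrc f" "dtgt f" "Fi f" "Fi g" t] b[of f] b[of g] w[of f]
  by (simp add: D_def del: zz_category_simps)
 show "wf f ==> ok t ==> wd t = dsrc f ==> D (DScale r f) t = sc r (D f t)"
  using app_Scale[of "dsrc f" "dtgt f" "Fi f" t] b[of f] w[of f]
  by (simp add: D_def del: zz_category_simps)
 show "word u ==> word v ==> ok t ==> wd t = u ==> D (DZero u v) t = Zr v"
  by (simp add: D_def app_Zero del: zz_category_simps)
 show "wf (Vert i j) ==> ok t ==> wd t = dsrc (Vert i j) ==> D (Vert i j) t = Zr (dtgt (Vert i j))"
  using w[of "Vert i j"] by (simp add: D_def app_Zero del: zz_category_simps wf_simps)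
qed

lemma D_Nil: assumes "wf f" "dsrc f = []" "ok b" "wd b = []" shows "D f b = b * D f One"
 using D_laws(5)[OF assms(1), of One b] assms by simp

lemma D_generators:
 assumes s: "s \<in> {1..n}"
 shows "D (EndDot s) (U s) = E s" "D (Split s) (U s) = U s * U s"
  "D (StartDot s) One = Ds s" "f \<in> R_ring n ==> D (Box f) One = central f"
  "y \<in> carrier Z ==> D (Merge s) (U s * (B y * U s)) = sc (kap s) (ke s (trace s y) * U s)"
  "ok t ==> wd t = [s, s] ==> D (Cap s) t = D (EndDot s) (D (Merge s) t)"
  "ok t ==> wd t = [] ==> D (Cup s) t = D (Split s) (D (StartDot s) t)"
proof -
 show "D (EndDot s) (U s) = E s" "D (Split s) (U s) = U s * U s"
  "D (StartDot s) One = Ds s" "D (Box f) One = central f"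
  using generator_maps[OF s] by (simp_all add: D_def)
 show "y \<in> carrier Z ==> D (Merge s) (U s * (B y * U s)) = sc (kap s) (ke s (trace s y) * U s)"
  using app_Scale[of "[s, s]" "[s]" "merge s" "U s * (B y * U s)" "kap s"] merge[OF s] s
  by (simp add: D_def del: zz_category_simps Fo_single)
 show "ok t ==> wd t = [s, s] ==> D (Cap s) t = D (EndDot s) (D (Merge s) t)"
  using app_Comp[of "[s, s]" "[s]" "[]" _ _ t, OF _ _ _ merge_Fo[OF s] generator_maps(1)[OF s]] s
  by (simp add: D_def del: zz_category_simps Fo_single Fo_Nil)
 show "ok t ==> wd t = [] ==> D (Cup s) t = D (Split s) (D (StartDot s) t)"
  using app_Comp[of "[]" "[s]" "[s, s]" _ _ t, OF _ _ _ generator_maps(5,3)[OF s]] s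
  by (simp add: D_def del: zz_category_simps Fo_single Fo_Nil)
qed

subsection \<open>Values on generators\<close>

lemma trace_E: "s \<in> {1..n} ==> trace s (pcl s []) = 0"
 using trace_cls[of "single (s, []) 1" s] by (simp add: trace_weight_def path_degree_def)

lemma X_path: assumes "adj s k" shows "X s = B (pcl s [Step s k, Step k s])" "(s, [Step s k, Step k s]) \<in> paths n"
proof -
 note p = gens_paths(3)[OF assms] gens_paths(3)[OF adj_sym[OF assms]]
 show "X s = B (pcl s [Step s k, Step k s])"
  using B_pcl_mult[OF p] step_square[OF assms] by (simp add: S_def path_end_def)
 show "(s, [Step s k, Step k s]) \<in> paths n" using p by simp
qed

text \<open>The trace vanishes on \<open>e_s\<close>, which has degree 0, and is 1 on
  \<open>X s\<close>.\<close>

lemma D_Merge: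
 assumes s: "s \<in> {1..n}"
 shows "D (Merge s) (U s * U s) = Zr [s]" "D (Merge s) (U s * (X s * U s)) = sc (kap s) (U s)"
  "D (Cap s) (U s * U s) = Zr []" "D (Cap s) (U s * (X s * U s)) = sc (kap s) (E s)"
proof -
 have c: "pcl s [] \<in> carrier Z" using s by simp
 have "ke s 0 = Zr []" by (simp add: ke_def kem_zero B_laws)
 then show M1: "D (Merge s) (U s * U s) = Zr [s]"
  using D_generators(5)[OF s c] s by (simp add: trace_E E_def[symmetric] E_U)
 obtain k where k: "adj s k" using neighbour[OF s] .
 have "trace s (pcl s [Step s k, Step k s]) = 1"
  using trace_cls[of "single (s, [Step s k, Step k s]) 1" s] X_path(2)[OF k]
  by (simp add: trace_weight_def path_degree_def path_end_def loops_def)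
 then show M2: "D (Merge s) (U s * (X s * U s)) = sc (kap s) (U s)"
  using D_generators(5)[OF s, of "pcl s [Step s k, Step k s]"] X_path(2)[OF k] s
  by (simp add: X_path(1)[OF k] ke_1 E_U)
 show "D (Cap s) (U s * U s) = Zr []" using D_generators(6)[OF s, of "U s * U s"] D_Zr[of "EndDot s"] s by (simp add: M1)
 show "D (Cap s) (U s * (X s * U s)) = sc (kap s) (E s)"
  using D_generators(6)[OF s, of "U s * (X s * U s)"] D_laws(4)[of "EndDot s" "U s" "kap s"] s
  by (simp add: M2 D_generators)
qed

lemma D_bilinear:
 assumes "wf f" "ok a" "wd a = []" "ok b" "wd b = []" "ok t" "wd t = dsrc f" shows "D f (a * (t * b)) = a * (D f t * b)"
 using assms by (simp add: D_laws)

lemma kap_square: "kap s * kap s = 1"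
 by (simp add: kap_def flip: power_mult_distrib)

text \<open>The side terms begin and end at neighbours of \<open>s\<close> and are annihilated by
  \<open>E s\<close>.\<close>

lemma Ds_E:
 assumes s: "s \<in> {1..n}"
 shows "Ds s * E s = sc (kap s) (X s * U s + U s * X s)" "E s * Ds s = sc (kap s) (X s * U s + U s * X s)"
proof -
 have k: "s \<noteq> 1 ==> adj s (s - 1)" "s < n ==> adj s (s + 1)" using s by (auto simp: adj_def)
 have "side s * E s = Zr [s]" using s k by (auto simp: side_def distrib_right nb_E tw_E)
 then show 1: "Ds s * E s = sc (kap s) (X s * U s + U s * X s)"
  using s by (simp add: Ds_def D0_def distrib_right sc_laws mult.assoc E_X E_U)
 then show "E s * Ds s = sc (kap s) (X s * U s + U s * X s)" using s by (simp add: Ds_central)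
qed

lemma Ds_neighbour:
 assumes a: "adj s t"
 shows "Ds s * E t = sc (kap s) (if s = 1 then nb 1 2 + tw else nb s t)" "E t * Ds s = sc (kap s) (if s = 1 then nb 1 2 + tw else nb s t)"
proof -
 note s = adjD[OF a]
 have k: "s \<noteq> 1 ==> adj s (s - 1)" "s < n ==> adj s (s + 1)" using s by (auto simp: adj_def)
 have t: "s = 1 ==> t = 2" "s \<noteq> 1 ==> t = s - 1 \<or> t = s + 1" using a by (auto simp: adj_def)
 have "side s * E t = (if s = 1 then nb 1 2 + tw else nb s t)"
 proof (cases "s = 1")
  case True
  then show ?thesis using t by (simp add: side_def distrib_right nb_E tw_E)
 next
  case False
  have n: "s - 1 \<noteq> s + 1" using s by auto
  from t(2)[OF False] show ?thesis
  proof
   assume "t = s - 1"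
   then show ?thesis using False s k n by (auto simp: side_def distrib_right nb_E)
  next
   assume *: "t = s + 1"
   then have "s < n" using s by auto
   then show ?thesis using * False s k n by (auto simp: side_def distrib_right nb_E)
  qed
 qed
 then show 1: "Ds s * E t = sc (kap s) (if s = 1 then nb 1 2 + tw else nb s t)"
  using s a adj_sym[OF a] by (auto simp: Ds_def D0_def distrib_right sc_laws mult.assoc E_X E_U)
 then show "E t * Ds s = sc (kap s) (if s = 1 then nb 1 2 + tw else nb s t)" using s by (simp add: Ds_central)
qed

subsection \<open>Degrees\<close>

lemma hom_gens:
 "j \<in> {1..n} ==> hom 0 (E j)" "j \<in> {2..n} ==> hom 0 (Lo j)" "adj i j ==> hom 1 (S i j)"
 unfolding E_def Lo_def S_def using gens_paths by (auto intro!: hom_B zz_degree_pcl simp: path_degree_def simp del: in_paths)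

lemma hom_X: assumes "s \<in> {1..n}" shows "hom 2 (X s)"
proof -
 obtain k where k: "adj s k" using neighbour[OF assms] .
 show ?thesis using hom_times[OF hom_gens(3)[OF k] hom_gens(3)[OF adj_sym[OF k]]] by (simp add: step_square[OF k])
qed

lemma hom_cong: "hom d t ==> d = e ==> hom e t"
 by simp

lemma hom_nb: assumes "adj s k" shows "hom 1 (nb s k)"
proof -
 have "hom (1 + (-1 + 1)) (nb s k)"
  unfolding nb_def using assms adj_sym[OF assms] adjD[OF assms] by (intro hom_times hom_gens hom_U)
 then show ?thesis by simp
qed

lemma hom_tw: "hom 1 tw"
proof -
 have "hom (0 + (1 + 0)) tw" unfolding tw_def by (intro hom_sc hom_times hom_gens hom_nb) auto
 then show ?thesis by simp
qed

lemma hom_Ds: assumes s: "s \<in> {1..n}" shows "hom 1 (Ds s)"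
proof -
 have k: "s \<noteq> 1 ==> adj s (s - 1)" "s < n ==> adj s (s + 1)" using s by (auto simp: adj_def)
 have "hom 1 (side s)" unfolding side_def using k s by (auto intro!: hom_add hom_nb hom_tw hom_Zr)
 moreover have "hom (2 + -1) (X s * U s)" "hom (-1 + 2) (U s * X s)"
  using s by (intro hom_times hom_X hom_U; simp)+
 ultimately show ?thesis unfolding Ds_def D0_def using s by (intro hom_sc hom_add) auto
qed

lemma hom_xsum: "k \<le> n ==> hom 2 (xsum c k)"
 by (induction k) (auto intro!: hom_Zr hom_add hom_sc hom_X)

lemma xsum_zero: "k \<le> n ==> (\<And>s. c s = 0) ==> xsum c k = Zr []"
 by (induction k) simp_all

lemma hom_One: "hom 0 One"
 unfolding One_def by (rule hom_B[OF zz_degree_one])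

lemma hom_central: assumes "R_homogeneous d p" shows "hom d (central p)"
proof -
 have 1: "hom d (sc (const_part p) One)"
 proof (cases "d = 0")
  case False
  then show ?thesis using homogeneous_parts(1)[OF assms] by (simp add: hom_Zr)
 qed (simp add: hom_sc hom_One)
 have 2: "hom d (xsum (\<lambda>s. kap s * lin_part p s) n)"
 proof (cases "d = 2")
  case False
  then show ?thesis using homogeneous_parts(2)[OF assms] by (simp add: xsum_zero hom_Zr)
 qed (simp add: hom_xsum)
 show ?thesis unfolding central_def by (rule hom_add[OF 1 2]) simp
qed

lemma D_U: assumes "wf f" "dsrc f = [s]" "s \<in> {1..n}" "a \<in> carrier Z" "b \<in> carrier Z"
 shows "D f (B a * U s * B b) = B a * (D f (U s) * B b)"
 using assms D_bilinear[OF assms(1), of "B a" "B b" "U s"] by (simp add: mult.assoc)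

text \<open>The generator \<open>U s\<close> has degree \<open>-1\<close>, so a map of degree
  \<open>d\<close> has to send it to degree \<open>d - 1\<close>; the coefficients on both sides
  carry the rest of the degree.\<close>

lemma hom_D_single:
 assumes f: "wf f" "dsrc f = [s]" "hom (d - 1) (D f (U s))" and t: "hom k t" "wd t = [s]" and s: "s \<in> {1..n}"
 shows "hom (k + d) (D f t)"
 using t s
proof (induction rule: U_hom_span)
 case zero
 then show ?case using D_Zr[OF f(1)] f(2) wfd_word(2)[OF f(1)] by (simp add: hom_Zr)
next
 case (gen a b i)
 have "hom (i + ((d - 1) + (k + 1 - i))) (B a * (D f (U s) * B b))"
  using gen f by (intro hom_times hom_B) auto
 then show ?case using D_U[OF f(1,2) s, of a b] zz_degree_closed gen by (simp add: algebra_simps)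
next
 case (add x y)
 then show ?case using D_laws(1,2)[OF f(1)] f by (auto simp: D_laws(3) intro!: hom_add)
qed

lemma hom_D_empty:
 assumes f: "wf f" "dsrc f = []" "hom d (D f One)" and t: "hom k t" "wd t = []"
 shows "hom (k + d) (D f t)"
 using D_Nil[OF f(1,2), of t] hom_times[OF t(1) f(3)] homD(1)[OF t(1)] t(2) by simp

lemma hom_ke: "s \<in> {1..n} ==> c \<in> KK s ==> hom 0 (ke s c)"
 unfolding ke_def by (intro hom_B kem_degree)

lemma hom_Merge:
 assumes s: "s \<in> {1..n}" and t: "hom k t" "wd t = [s, s]"
 shows "hom (k - 1) (D (Merge s) t)"
proof -
 have t': "wd t = [s] @ [s]" "word [s]" using t s by auto
 note L = D_laws[of "Merge s"]
 have pure: "hom (i + l - 1) (D (Merge s) (B a * U s * B b * y))"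
  if "hom l y" "wd y = [s]" "a \<in> zz_degree n j" "b \<in> zz_degree n (i + 1 - j)" for i j l a b y
  using that(1,2) s
 proof (induction rule: U_hom_span)
  case zero
  then show ?case using D_Zr[of "Merge s"] s that(3,4) zz_degree_closed[of _ _] by (auto simp: hom_Zr)
 next
  case (gen c d m)
  have cl: "a \<in> carrier Z" "b \<in> carrier Z" "c \<in> carrier Z" "d \<in> carrier Z" using that gen zz_degree_closed by auto
  then have bc: "b \<bullet> c \<in> carrier Z" by simp
  have eq: "B a * U s * B b * (B c * U s * B d) = B a * ((U s * (B (b \<bullet> c) * U s)) * B d)"
   using cl by (simp add: B_laws[symmetric] mult.assoc)
  have D: "D (Merge s) (B a * U s * B b * (B c * U s * B d)) = B a * (sc (kap s) (ke s (trace s (b \<bullet> c)) * U s) * B d)"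
   unfolding eq using cl bc s by (subst D_bilinear) (auto simp: D_generators)
  show ?case
  \<comment> \<open>The trace of the inner factor can be nonzero only in degree 2, and then the
    degree drops by exactly 1. Otherwise the value is zero, which is homogeneous of every
    degree.\<close>
  proof (cases "(i + 1 - j) + m = 2")
   case True
   have "hom (j + ((0 + -1) + (l + 1 - m))) (B a * (sc (kap s) (ke s (trace s (b \<bullet> c)) * U s) * B d))"
    using that gen cl bc s by (intro hom_times hom_sc hom_B hom_ke hom_U trace_in_KK) auto
   then show ?thesis unfolding D by (rule hom_cong) (use True in simp)
  next
   case False
   have "trace s (b \<bullet> c) = 0" by (rule trace_degree[OF zz_degree_mult[OF that(4) gen(1)] False])
   then show ?thesis unfolding D using cl s by (simp add: ke_def kem_zero B_laws hom_Zr)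
  qed
 next
  case (add x y)
  have cl: "a \<in> carrier Z" "b \<in> carrier Z" using that zz_degree_closed by auto
  then show ?case using add s L(1,2) by (auto simp: distrib_left L(3) intro!: hom_add)
 qed
 show ?thesis using t(1) t'(1,2,2)
 proof (induction rule: hom_span)
  case zero
  then show ?case using D_Zr[of "Merge s"] s by (simp add: hom_Zr)
 next
  case (times x y i)
  note y = times(3,4)
  have "hom (i + (k - i) - 1) (D (Merge s) (x * y))"
   using times(1,2) s
  proof (induction rule: U_hom_span)
   case zero
   then show ?case using D_Zr[of "Merge s"] s homD(1)[OF y(1)] y(2) by (simp add: hom_Zr)
  next
   case (gen a b j)
   then show ?case using pure[OF y, of a j b i] by simp
  next
   case (add x x')
   then show ?case using s L(1,2) homD(1)[OF y(1)] y(2) by (auto simp: distrib_right L(3) intro!: hom_add)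
  qed
  then show ?case by simp
 next
  case (add x y)
  then show ?case using s L(1,2) by (auto simp: L(3) intro!: hom_add)
 qed
qed

lemma hom_D: "dhomogeneous d f ==> wf f ==> hom k t ==> wd t = dsrc f ==> hom (k + d) (D f t)"
proof (induction arbitrary: k t rule: dhomogeneous.induct)
 case (1 w)
 then show ?case using homD(1) by (simp add: D_simps)
next
 case (2 d p)
 then show ?case by (intro hom_D_empty) (auto simp: D_generators(4)[of 1] hom_central)
next
 case (3 s)
 then show ?case by (intro hom_D_empty) (auto simp: D_generators hom_Ds)
next
 case (4 s)
 then show ?case by (intro hom_D_single[of _ s]) (auto simp: D_generators hom_gens)
next
 case (5 s)
 then show ?case using hom_Merge[of s k t] by simp
next
 case (6 s)
 then show ?case using hom_times[OF hom_U[of s] hom_U[of s]] by (intro hom_D_single[of _ s]) (auto simp: D_generators)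
next
 case (7 s)
 have 1: "hom (k + 1) (D (StartDot s) t)" using 7 by (intro hom_D_empty) (auto simp: D_generators hom_Ds)
 have "hom (k + 1 + -1) (D (Split s) (D (StartDot s) t))"
  using 7 1 hom_times[OF hom_U[of s] hom_U[of s]] homD(1)[OF 7(2)] D_laws(2)[of "StartDot s" t]
  by (intro hom_D_single[of "Split s" s]) (auto simp: D_generators)
 then show ?case using 7 homD(1)[OF 7(2)] by (simp add: D_generators)
next
 case (8 s)
 have 1: "hom (k - 1) (D (Merge s) t)" using 8 hom_Merge[of s k t] by simp
 have "hom (k - 1 + 1) (D (EndDot s) (D (Merge s) t))"
  using 8 1 homD(1)[OF 8(2)] D_laws(2)[of "Merge s" t]
  by (intro hom_D_single[of "EndDot s" s]) (auto simp: D_generators hom_gens)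
 then show ?case using 8 homD(1)[OF 8(2)] by (simp add: D_generators)
next
 case (9 s t')
 then show ?case using homD(1)[OF 9(2)] wfd_word(2)[OF 9(1)] D_simps(7)[OF 9(1)] by (simp add: hom_Zr del: wf_simps)
next
 case (10 d f e g)
 have w: "wf f" "wf g" "dtgt f = dsrc g" using 10 by simp_all
 have "hom (k + d + e) (D g (D f t))"
  using 10 w homD(1)[OF 10(6)] by (intro 10(4) 10(3)) (auto simp: D_laws)
 then show ?case using 10 w homD(1)[OF 10(6)] by (simp add: D_simps add_ac)
next
 case (11 d f e g)
 have w: "wf f" "wf g" "wd t = dsrc f @ dsrc g" using 11 by simp_all
 note wd = wfd_word[OF w(1)] wfd_word[OF w(2)]
 show ?case using 11(6) w(3) wd(1,3)
 proof (induction rule: hom_span)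
  case zero
  then show ?case using D_Zr[OF 11(5)] wd by (simp add: hom_Zr)
 next
  case (times x y i)
  then have "hom ((i + d) + (k - i + e)) (D f x * D g y)" using w by (intro hom_times 11(3,4))
  then show ?case using times w homD(1)[OF times(1)] homD(1)[OF times(3)] by (simp add: D_simps algebra_simps)
 next
  case (add a b)
  then show ?case using D_laws(1,2)[OF 11(5)] by (auto simp: D_laws(3)[OF 11(5)] intro!: hom_add)
 qed
next
 case (12 d u v)
 then show ?case using homD(1)[OF 12(2)] by (simp add: D_simps hom_Zr)
next
 case (13 d f g)
 then show ?case using homD(1)[OF 13(6)] by (auto simp: D_simps D_laws intro!: hom_add)
next
 case (14 d f r)
 then show ?case using homD(1)[OF 14(4)] by (auto simp: D_simps intro!: hom_sc)
qed

section \<open>The relations\<close>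

subsection \<open>Reduction to generators\<close>

definition par :: "dmor => dmor => bool" where
 "par f g \<longleftrightarrow> wf f \<and> wf g \<and> dsrc f = dsrc g \<and> dtgt f = dtgt g"

lemma parD: "par f g ==> wf f" "par f g ==> wf g" "par f g ==> dsrc f = dsrc g" "par f g ==> dtgt f = dtgt g"
 by (simp_all add: par_def)

text \<open>The elements on which two maps agree form a sub-bimodule, which is why agreement on
  generators suffices below.\<close>

lemma agree_laws:
 assumes p: "par f g"
 shows "D f (Zr (dsrc g)) = D g (Zr (dsrc g))"
  "ok a ==> ok b ==> wd a = dsrc g ==> wd b = dsrc g ==> D f a = D g a ==> D f b = D g b ==> D f (a + b) = D g (a + b)"
  "ok t ==> wd t = dsrc g ==> D f t = D g t ==> D f (sc r t) = D g (sc r t)"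
  "ok t ==> wd t = dsrc g ==> ok b ==> wd b = [] ==> D f t = D g t ==> D f (b * t) = D g (b * t)"
  "ok t ==> wd t = dsrc g ==> ok b ==> wd b = [] ==> D f t = D g t ==> D f (t * b) = D g (t * b)"
 using parD[OF p] D_Zr[of f] D_Zr[of g] by (simp_all add: D_laws)

lemma Fi_parI: "par f g ==> (\<And>t. ok t ==> wd t = dsrc g ==> D f t = D g t) ==> Fi f = Fi g"
 using Fi_eqI parD by blast

lemma cons_span [consumes 3, case_names zero gen add]:
 assumes "ok x" "wd x = s # w" "word (s # w)"
  and "P (Zr (s # w))"
  and "\<And>a z. ok a ==> wd a = [] ==> ok z ==> wd z = w ==> P (a * (U s * z))"
  and "\<And>a b. ok a ==> wd a = s # w ==> ok b ==> wd b = s # w ==> P a ==> P b ==> P (a + b)"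
 shows "P x"
proof -
 have w: "wd x = [s] @ w" "word [s]" "word w" and s: "s \<in> {1..n}" using assms(2,3) by auto
 show ?thesis using assms(1) w
 proof (induction rule: ok_span)
  case (times x y)
  show ?case using times(1,2) s
  proof (induction rule: U_span)
   case zero
   then show ?case using times(3,4) assms(4) s by simp
  next
   case (gen a b)
   then show ?case using times(3,4) assms(5)[of "B a" "B b * y"] by (simp add: mult.assoc)
  next
   case (add x x')
   then show ?case using times(3,4) assms(6)[of "x * y" "x' * y"] by (simp add: distrib_right)
  qed
 qed (use assms(4,6) in auto)
qed

lemma Fi_eq_empty:
 assumes p: "par f g" and w: "dsrc g = []" and gen: "D f One = D g One" shows "Fi f = Fi g"
 by (rule Fi_parI[OF p]) (use parD[OF p] w gen D_Nil in metis)

lemma Fi_eq_single: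
 assumes p: "par f g" and w: "dsrc g = [s]" "s \<in> {1..n}" and gen: "D f (U s) = D g (U s)" shows "Fi f = Fi g"
proof (rule Fi_parI[OF p])
 fix t assume t: "ok t" "wd t = dsrc g"
 note L = agree_laws[OF p, unfolded w(1)]
 show "D f t = D g t" using t(1) t(2)[unfolded w(1)] w(2)
  by (induction rule: U_span) (use L w gen in \<open>auto simp: mult.assoc\<close>)
qed

text \<open>As \<open>x\<close> ends and \<open>z\<close> begins with an idempotent, only the corner
  of \<open>y\<close> matters, and it is spanned by \<open>Gen s t\<close>.\<close>

lemma corner_agree:
 assumes p: "par f g" and st: "s \<in> {1..n}" "t \<in> {1..n}"
  and x: "ok x" "x * E s = x" and z: "ok z" "E t * z = z" and w: "wd x @ wd z = dsrc g"
  and gen: "\<And>y. y \<in> Gen s t ==> D f (x * (y * z)) = D g (x * (y * z))"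
  and y: "ok y" "wd y = []"
 shows "D f (x * (y * z)) = D g (x * (y * z))"
proof -
 note L = agree_laws[OF p]
 have "D f (x * (E s * y * E t * z)) = D g (x * (E s * y * E t * z))" if "ok y \<and> wd y = []" for y
  using that st
 proof (induction rule: corner_induct)
  case zero
  then show ?case using L(1) x z w ok_word[OF x(1)] ok_word[OF z(1)] by simp
 next
  case (gen r y)
  then show ?case using L(3)[of "x * (y * z)" r] x z w Gen_ok[OF st gen] assms(9)[OF gen] by (simp add: sc_laws)
 next
  case (add a b)
  then show ?case using L(2)[of "x * (a * z)" "x * (b * z)"] x z w by (simp add: distrib_left distrib_right)
 qed
 from this[of y] have "D f (x * E s * (y * (E t * z))) = D g (x * E s * (y * (E t * z)))" using y by (simp add: mult.assoc)
 then show ?thesis unfolding x(2) z(2) .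
qed

text \<open>The elements \<open>U s * (y * U t)\<close> generate the bimodule of the word
  \<open>[s, t]\<close>, and \<open>y\<close> may be restricted to the few elements of
  \<open>Gen s t\<close>. An identity between maps on two strands thus becomes a finite
  check.\<close>

lemma Fi_eq_pair:
 assumes p: "par f g" and w: "dsrc g = [s, t]" and st: "s \<in> {1..n}" "t \<in> {1..n}"
  and gen: "\<And>y. y \<in> Gen s t ==> D f (U s * (y * U t)) = D g (U s * (y * U t))"
 shows "Fi f = Fi g"
proof (rule Fi_parI[OF p])
 note L = agree_laws[OF p, unfolded w]
 have w1: "word [s, t]" using st by simp
 have 1: "D f (U s * (y * U t)) = D g (U s * (y * U t))" if "ok y" "wd y = []" for y
  by (rule corner_agree[OF p st]) (use st w gen that in \<open>simp_all add: E_U\<close>)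
 have 2: "D f (U s * z) = D g (U s * z)" if z: "ok z" "wd z = [t]" for z
  using z st(2)
 proof (induction rule: U_span)
  case (gen a b)
  then show ?case using L(5)[of "U s * (B a * U t)" "B b"] 1[of "B a"] st by (simp add: mult.assoc)
 qed (use L(1,2) st in \<open>simp_all add: distrib_left\<close>)
 fix x assume "ok x" "wd x = dsrc g"
 then show "D f x = D g x" using w1 unfolding w
  by (induction rule: cons_span) (use L 2 st in simp_all)
qed

lemma Fi_eq_triple:
 assumes p: "par f g" and w: "dsrc g = [s, t, r]" and str: "s \<in> {1..n}" "t \<in> {1..n}" "r \<in> {1..n}"
  and gen: "\<And>y y'. y \<in> Gen s t ==> y' \<in> Gen t r ==> D f (U s * (y * (U t * (y' * U r)))) = D g (U s * (y * (U t * (y' * U r))))"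
 shows "Fi f = Fi g"
proof (rule Fi_parI[OF p])
 note L = agree_laws[OF p, unfolded w]
 have w1: "word [s, t, r]" "word [t, r]" using str by simp_all
 \<comment> \<open>The two inner slots are extended from spanning elements to the whole algebra one
   after the other, the right one first.\<close>
 have 1: "D f (U s * (y * (U t * (y' * U r)))) = D g (U s * (y * (U t * (y' * U r))))" if y: "y \<in> Gen s t" and y': "ok y'" "wd y' = []" for y y'
 proof -
  note o = Gen_ok[OF str(1,2) y]
  have "D f (U s * (y * U t) * (y' * U r)) = D g (U s * (y * U t) * (y' * U r))"
   by (rule corner_agree[OF p str(2,3)]) (use o str w gen[OF y] y' in \<open>simp_all add: E_U mult.assoc\<close>)
  then show ?thesis by (simp add: mult.assoc)
 qed
 have 2: "D f (U s * (y * (U t * (y' * U r)))) = D g (U s * (y * (U t * (y' * U r))))" if y: "ok y" "wd y = []" and y': "ok y'" "wd y' = []" for y y'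
  by (rule corner_agree[OF p str(1,2)]) (use str w 1 y y' in \<open>simp_all add: E_U mult.assoc[symmetric]\<close>)
 have 3: "D f (U s * (y * (U t * z))) = D g (U s * (y * (U t * z)))" if y: "ok y" "wd y = []" and z: "ok z" "wd z = [r]" for y z
  using z str(3)
 proof (induction rule: U_span)
  case (gen a b)
  then show ?case using L(5)[of "U s * (y * (U t * (B a * U r)))" "B b"] 2[OF y, of "B a"] str y by (simp add: mult.assoc)
 next
  case (add a b)
  then show ?case using L(2)[of "U s * (y * (U t * a))" "U s * (y * (U t * b))"] str y by (simp add: distrib_left)
 qed (use L(1) str y in simp)
 have 4: "D f (U s * z) = D g (U s * z)" if z: "ok z" "wd z = [t, r]" for z
  using z w1(2) by (induction rule: cons_span) (use L 3 str in \<open>simp_all add: distrib_left\<close>)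
 fix x assume "ok x" "wd x = dsrc g"
 then show "D f x = D g x" using w1(1) unfolding w
  by (induction rule: cons_span) (use L 4 str in simp_all)
qed

lemma Fi_eq_ten:
 assumes p: "par f g" and w: "dsrc g = u @ v" "word u" "word v"
  and gen: "\<And>x y. ok x ==> wd x = u ==> ok y ==> wd y = v ==> D f (x * y) = D g (x * y)"
 shows "Fi f = Fi g"
proof (rule Fi_parI[OF p])
 note L = agree_laws[OF p, unfolded w(1)]
 fix t assume "ok t" "wd t = dsrc g"
 then show "D f t = D g t" using w(2,3) unfolding w(1)
  by (induction rule: ok_span) (use L gen in auto)
qed

subsection \<open>Diagrams containing a braid vertex\<close>

text \<open>A \<open>2m\<close>-valent vertex goes to \<open>0\<close>, so the relations in which both sides contain one hold trivially.\<close>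

definition nul :: "dmor => bool" where
 "nul f \<longleftrightarrow> (wf f \<longrightarrow> (\<forall>t. ok t \<and> wd t = dsrc f \<longrightarrow> D f t = Zr (dtgt f)))"

lemma nulD: "nul f ==> wf f ==> ok t ==> wd t = dsrc f ==> D f t = Zr (dtgt f)"
 by (simp add: nul_def)

lemma nul_Vert: "nul (Vert s t)"
 unfolding nul_def using D_simps(7) by blast

text \<open>Maps preserve zero, on either side of a composition. On ill-formed diagrams
  \<open>nul\<close> holds vacuously, which keeps the closure rules free of boundary
  premises.\<close>

lemma nul_DComp: "nul f ==> nul (DComp g f)" "nul g ==> nul (DComp g f)"
proof -
 show "nul f ==> nul (DComp g f)"
  unfolding nul_def[of "DComp g f"] using D_Zr[of g] by (auto simp: D_simps nulD)
 show "nul g ==> nul (DComp g f)"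
  unfolding nul_def[of "DComp g f"] by (auto simp: D_simps nulD D_laws)
qed

lemma nul_DTen: assumes "nul f \<or> nul g" shows "nul (DTen f g)"
 unfolding nul_def
proof (intro impI allI, elim conjE)
 fix t assume w: "wf (DTen f g)" and t: "ok t" "wd t = dsrc (DTen f g)"
 then have fg: "wf f" "wf g" "wd t = dsrc f @ dsrc g" by simp_all
 note W = wfd_word[OF fg(1)] wfd_word[OF fg(2)]
 show "D (DTen f g) t = Zr (dtgt (DTen f g))"
  using t(1) fg(3) W(1,3)
 proof (induction rule: ok_span)
  case zero
  then show ?case using D_Zr[OF w] by simp
 next
  case (times x y)
  then show ?case using fg assms W D_laws(1,2)[OF fg(1), of x] D_laws(1,2)[OF fg(2), of y]
   by (auto simp: D_simps nulD)
 next
  case (add a b)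
  then show ?case using D_laws(3)[OF w, of b a] W by simp
 qed
qed

lemma Fi_eq_nul: "par f g ==> nul f ==> nul g ==> Fi f = Fi g"
 using parD by (auto intro!: Fi_parI simp: nulD)

text \<open>The first move already contains a braid vertex, whatever the rest of the path
  is.\<close>

lemma nul_braid_path: "nul (braid_path (w # w' # ws))"
 by (simp add: braid_move_def Let_def nul_DComp nul_DTen nul_Vert)

subsection \<open>The linear monoidal relations\<close>

lemma Fi_linear: assumes "linear_relation f g" "par f g" shows "Fi f = Fi g"
 using assms
proof (induction rule: linear_relation.induct)
 case (1 f w)
 show ?case using parD(1,2)[OF 1] by (intro Fi_parI[OF 1]) (auto simp: D_simps)
next
 case (2 w f)
 show ?case using parD(1,2)[OF 2] by (intro Fi_parI[OF 2]) (auto simp: D_simps D_laws)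
next
 case (3 h g f)
 show ?case using parD(1,2)[OF 3] by (intro Fi_parI[OF 3]) (auto simp: D_simps D_laws)
next
 case (4 f)
 show ?case
 proof (rule Fi_parI[OF 4])
  fix t assume t: "ok t" "wd t = dsrc f"
  then show "D (DTen f (DId [])) t = D f t" using parD(2)[OF 4] D_simps(3)[of f "DId []" t One] by (simp add: D_simps D_laws)
 qed
next
 case (5 f)
 show ?case
 proof (rule Fi_parI[OF 5])
  fix t assume t: "ok t" "wd t = dsrc f"
  then show "D (DTen (DId []) f) t = D f t" using parD(2)[OF 5] D_simps(3)[of "DId []" f One t] by (simp add: D_simps D_laws)
 qed
next
 case (6 f g h)
 have w: "wf f" "wf g" "wf h" using parD(1)[OF 6] by simp_all
 note W = wfd_word[OF w(1)] wfd_word[OF w(2)] wfd_word[OF w(3)]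
 note L = agree_laws[OF 6]
 \<comment> \<open>A tensor product of maps is computed on products only, so \<open>t\<close> is
   split once more.\<close>
 have "D (DTen (DTen f g) h) (x * t) = D (DTen f (DTen g h)) (x * t)" if x: "ok x" "wd x = dsrc f" and t: "ok t" "wd t = dsrc g @ dsrc h" for x t
  using t W(3,5)
 proof (induction rule: ok_span)
  case zero
  then show ?case using L(1) x W by simp
 next
  case (times y z)
  have "D (DTen (DTen f g) h) (x * y * z) = D f x * D g y * D h z" "D (DTen f (DTen g h)) (x * (y * z)) = D f x * (D g y * D h z)"
   using w x times by (simp_all add: D_simps(3))
  then show ?case by (simp only: mult.assoc)
 next
  case (add a b)
  then show ?case using L(2)[of "x * a" "x * b"] x by (simp add: distrib_left)
 qed
 then show ?case by (intro Fi_eq_ten[OF 6, of "dsrc f" "dsrc g @ dsrc h"]) (simp_all add: W)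
next
 case (7 v w)
 show ?case using parD(2)[OF 7] by (intro Fi_eq_ten[OF 7, of v w]) (simp_all add: D_simps)
next
 case (8 f' g' f g)
 have w: "wf f" "wf g" "wf f'" "wf g'" "dtgt f = dsrc f'" "dtgt g = dsrc g'" using parD(2)[OF 8] by simp_all
 note W = wfd_word[OF w(1)] wfd_word[OF w(2)]
 show ?case using w W by (intro Fi_eq_ten[OF 8, of "dsrc f" "dsrc g"]) (simp_all add: D_simps D_laws)
next
 case (9 f g h)
 show ?case using parD(1,2)[OF 9] by (intro Fi_parI[OF 9]) (auto simp: D_simps add.assoc)
next
 case (10 f g)
 show ?case using parD(1,2)[OF 10] by (intro Fi_parI[OF 10]) (auto simp: D_simps add.commute)
next
 case (11 f v w)
 show ?case using parD(1,2)[OF 11] by (intro Fi_parI[OF 11]) (auto simp: D_simps D_laws)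
next
 case (12 f v w)
 show ?case using parD(1,2,3,4)[OF 12] by (intro Fi_parI[OF 12]) (auto simp: D_simps D_laws)
next
 case (13 f)
 show ?case using parD(1,2)[OF 13] by (intro Fi_parI[OF 13]) (auto simp: D_simps sc_laws)
next
 case (14 r s f)
 show ?case using parD(1,2)[OF 14] by (intro Fi_parI[OF 14]) (auto simp: D_simps sc_laws)
next
 case (15 r s f)
 show ?case using parD(1,2)[OF 15] by (intro Fi_parI[OF 15]) (auto simp: D_simps sc_laws)
next
 case (16 r f g)
 show ?case using parD(1,2)[OF 16] by (intro Fi_parI[OF 16]) (auto simp: D_simps sc_laws)
next
 case (17 g f f')
 show ?case using parD(1,2)[OF 17] by (intro Fi_parI[OF 17]) (auto simp: D_simps D_laws)
next
 case (18 g g' f)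
 show ?case using parD(1,2)[OF 18] by (intro Fi_parI[OF 18]) (auto simp: D_simps D_laws)
next
 case (19 g r f)
 show ?case using parD(1,2)[OF 19] by (intro Fi_parI[OF 19]) (auto simp: D_simps D_laws)
next
 case (20 r g f)
 show ?case using parD(1,2)[OF 20] by (intro Fi_parI[OF 20]) (auto simp: D_simps D_laws)
next
 case (21 f g g')
 have w: "wf f" "wf g" "wf g'" "dsrc g = dsrc g'" "dtgt g = dtgt g'" using parD(2)[OF 21] by auto
 note W = wfd_word[OF w(1)] wfd_word[OF w(2)]
 show ?case using w W by (intro Fi_eq_ten[OF 21, of "dsrc f" "dsrc g"]) (simp_all add: D_simps D_laws distrib_left)
next
 case (22 f f' g)
 have w: "wf f" "wf f'" "wf g" "dsrc f = dsrc f'" "dtgt f = dtgt f'" using parD(2)[OF 22] by auto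
 note W = wfd_word[OF w(1)] wfd_word[OF w(3)]
 show ?case using w W by (intro Fi_eq_ten[OF 22, of "dsrc f" "dsrc g"]) (simp_all add: D_simps D_laws distrib_right)
next
 case (23 f r g)
 have w: "wf f" "wf g" using parD(2)[OF 23] by simp_all
 note W = wfd_word[OF w(1)] wfd_word[OF w(2)]
 show ?case using w W by (intro Fi_eq_ten[OF 23, of "dsrc f" "dsrc g"]) (simp_all add: D_simps D_laws sc_laws)
next
 case (24 r f g)
 have w: "wf f" "wf g" using parD(2)[OF 24] by simp_all
 note W = wfd_word[OF w(1)] wfd_word[OF w(2)]
 show ?case using w W by (intro Fi_eq_ten[OF 24, of "dsrc f" "dsrc g"]) (simp_all add: D_simps D_laws sc_laws)
qed

subsection \<open>Isotopy\<close>

lemma D_ten_left: "wf f ==> wf g ==> dsrc f = [] ==> ok y ==> wd y = dsrc g ==> D (DTen f g) y = D f One * D g y"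
 using D_simps(3)[of f g One y] by simp

lemma D_ten_right: "wf f ==> wf g ==> dsrc g = [] ==> ok x ==> wd x = dsrc f ==> D (DTen f g) x = D f x * D g One"
 using D_simps(3)[of f g x One] by simp

text \<open>\<open>U s\<close> absorbs \<open>E s\<close>, which then cuts the adjacent factor down
  to the vertex \<open>s\<close>.\<close>

lemma E_sandwich: assumes "s \<in> {1..n}" shows "U s * x = U s * (E s * x)" "x * U s = x * E s * U s"
 using assms by (simp_all add: E_U mult.assoc[symmetric]) (simp add: E_U mult.assoc)

lemma Ds_U:
 assumes s: "s \<in> {1..n}"
 shows "Ds s * U s = sc (kap s) (X s * (U s * U s) + U s * (X s * U s))" "U s * Ds s = sc (kap s) (U s * (X s * U s) + U s * (U s * X s))"
 unfolding E_sandwich(1)[OF s, of "Ds s"] E_sandwich(2)[OF s, of "Ds s"] Ds_E[OF s]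
 by (simp_all add: sc_laws distrib_left distrib_right mult.assoc)

lemma D_Cup:
 assumes s: "s \<in> {1..n}"
 shows "D (Cup s) One * U s = sc (kap s) (X s * (U s * (U s * U s)) + U s * (U s * (X s * U s)))"
  "U s * D (Cup s) One = sc (kap s) (U s * (X s * (U s * U s)) + U s * (U s * (U s * X s)))"
proof -
 have c: "D (Cup s) One = D (Split s) (Ds s)" using s by (simp add: D_generators)
 have D: "D (Split s) (X s * U s) = X s * (U s * U s)" "D (Split s) (U s * X s) = U s * (U s * X s)"
  using s D_laws(5,6)[of "Split s" "U s" "X s"] by (simp_all add: D_generators mult.assoc)
 have 1: "D (Split s) (Ds s) * E s = sc (kap s) (X s * (U s * U s) + U s * (U s * X s))"
  using D_laws(6)[of "Split s" "Ds s" "E s"] s by (simp add: Ds_E D_laws D)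
 have 2: "E s * D (Split s) (Ds s) = sc (kap s) (X s * (U s * U s) + U s * (U s * X s))"
  using D_laws(5)[of "Split s" "Ds s" "E s"] s by (simp add: Ds_E D_laws D)
 show "D (Cup s) One * U s = sc (kap s) (X s * (U s * (U s * U s)) + U s * (U s * (X s * U s)))"
  unfolding c E_sandwich(2)[OF s, of "D (Split s) (Ds s)"] 1 by (simp add: sc_laws distrib_right mult.assoc)
 show "U s * D (Cup s) One = sc (kap s) (U s * (X s * (U s * U s)) + U s * (U s * (U s * X s)))"
  unfolding c E_sandwich(1)[OF s, of "D (Split s) (Ds s)"] 2 by (simp add: sc_laws distrib_left)
qed

text \<open>Next to \<open>U s\<close> the cup has two summands. In one of them \<open>X s\<close>
  lies between the strands to be merged and has trace 1; in the other it lies outside, and the trace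
  of \<open>e_s\<close> gives 0. The signs \<open>kap s\<close> of cup and merging multiply to
  1.\<close>

lemma zigzag:
 assumes s: "s \<in> {1..n}"
 shows "D (DComp (DTen (DId [s]) (Cap s)) (DTen (Cup s) (DId [s]))) (U s) = U s"
  "D (DComp (DTen (Cap s) (DId [s])) (DTen (DId [s]) (Cup s))) (U s) = U s"
  "D (DComp (DTen (DId [s]) (Merge s)) (DTen (Cup s) (DId [s]))) (U s) = U s * U s"
  "D (DComp (DTen (Merge s) (DId [s])) (DTen (DId [s]) (Cup s))) (U s) = U s * U s"
proof -
 have cup: "D (DTen (Cup s) (DId [s])) (U s) = sc (kap s) (X s * (U s * (U s * U s)) + U s * (U s * (X s * U s)))"
  "D (DTen (DId [s]) (Cup s)) (U s) = sc (kap s) (U s * (X s * (U s * U s)) + U s * (U s * (U s * X s)))"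
  using s by (simp_all add: D_ten_left D_ten_right D_simps D_Cup)
 have right: "D (DTen (DId [s]) f) (X s * (U s * (U s * U s))) = X s * (U s * D f (U s * U s))"
  "D (DTen (DId [s]) f) (U s * (U s * (X s * U s))) = U s * D f (U s * (X s * U s))"
  if "wf f" "dsrc f = [s, s]" for f
  using that s D_laws(5)[of "DTen (DId [s]) f" "U s * (U s * U s)" "X s"] D_simps(3)[of "DId [s]" f "U s" "U s * U s"]
   D_simps(3)[of "DId [s]" f "U s" "U s * (X s * U s)"]
  by (simp_all add: D_simps)
 have left: "D (DTen f (DId [s])) (U s * (X s * (U s * U s))) = D f (U s * (X s * U s)) * U s"
  "D (DTen f (DId [s])) (U s * (U s * (U s * X s))) = D f (U s * U s) * (U s * X s)"
  if "wf f" "dsrc f = [s, s]" for f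
  using that s D_simps(3)[of f "DId [s]" "U s * (X s * U s)" "U s"] D_simps(3)[of f "DId [s]" "U s * U s" "U s * X s"]
  by (simp_all add: D_simps(1) mult.assoc)
 show "D (DComp (DTen (DId [s]) (Cap s)) (DTen (Cup s) (DId [s]))) (U s) = U s"
  "D (DComp (DTen (Cap s) (DId [s])) (DTen (DId [s]) (Cup s))) (U s) = U s"
  "D (DComp (DTen (DId [s]) (Merge s)) (DTen (Cup s) (DId [s]))) (U s) = U s * U s"
  "D (DComp (DTen (Merge s) (DId [s])) (DTen (DId [s]) (Cup s))) (U s) = U s * U s"
  using s by (simp_all add: D_simps cup D_laws right left D_Merge sc_laws kap_square E_U)
qed

lemma dots:
 assumes s: "s \<in> {1..n}"
 shows "D (Cap s) (Ds s * U s) = E s" "D (Cap s) (U s * Ds s) = E s" "D (Merge s) (Ds s * U s) = U s"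
proof -
 have 1: "D f (X s * (U s * U s)) = X s * D f (U s * U s)" "D f (U s * (U s * X s)) = D f (U s * U s) * X s"
  if "wf f" "dsrc f = [s, s]" for f
  using that s D_laws(5,6)[of f "U s * U s" "X s"] by (simp_all add: mult.assoc)
 show "D (Cap s) (Ds s * U s) = E s" "D (Cap s) (U s * Ds s) = E s" "D (Merge s) (Ds s * U s) = U s"
  using s by (simp_all add: Ds_U D_laws 1 D_Merge sc_laws kap_square)
qed

lemma Fi_isotopy: assumes "isotopy_relation f g" "par f g" shows "Fi f = Fi g"
 using assms
proof (induction rule: isotopy_relation.induct)
 case (1 s)
 then show ?case using parD(2)[OF 1] zigzag(1)[of s] by (intro Fi_eq_single[OF 1, of s]) (simp_all add: D_simps(1))
next
 case (2 s)
 then show ?case using parD(2)[OF 2] zigzag(2)[of s] by (intro Fi_eq_single[OF 2, of s]) (simp_all add: D_simps(1))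
next
 case (3 s)
 then show ?case using parD(1)[OF 3] by (intro Fi_eq_single[OF 3, of s]) (simp_all add: D_simps D_ten_left D_generators(1,3) dots)
next
 case (4 s)
 then show ?case using parD(1)[OF 4] by (intro Fi_eq_single[OF 4, of s]) (simp_all add: D_simps D_ten_right D_generators(1,3) dots)
next
 case (5 s)
 then show ?case using parD(1)[OF 5] zigzag(3)[of s] by (intro Fi_eq_single[OF 5, of s]) (simp_all add: D_generators)
next
 case (6 s)
 then show ?case using parD(1)[OF 6] zigzag(4)[of s] by (intro Fi_eq_single[OF 6, of s]) (simp_all add: D_generators)
next
 case (7 ts s t)
 show ?case by (rule Fi_eq_nul[OF 7(2) nul_Vert]) (simp add: nul_DComp nul_DTen nul_Vert)
qed

subsection \<open>Polynomials\<close>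

lemma xsum_linear:
 "k \<le> n ==> xsum (\<lambda>s. c s + d s) k = xsum c k + xsum d k" "k \<le> n ==> xsum (\<lambda>s. r * c s) k = sc r (xsum c k)"
 by (induction k) (simp_all add: sc_laws add_ac)

lemma X_mult_X: "i \<in> {1..n} ==> j \<in> {1..n} ==> X i * X j = Zr []"
 by (cases "i = j") (simp_all add: X_X X_off)

lemma xsum_mult: "k \<le> n ==> l \<le> n ==> xsum c k * xsum d l = Zr []"
proof (induction k)
 case (Suc k)
 have "j \<in> {1..n} ==> l \<le> n ==> X j * xsum d l = Zr []" for j
  by (induction l) (simp_all add: distrib_left sc_laws X_mult_X)
 then show ?case using Suc by (simp add: distrib_right sc_laws)
qed simp

text \<open>Polynomials act through their expansion to first order: linear parts obey the product
  rule, and the remaining products of two linear parts vanish on both sides.\<close>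

lemma central_laws:
 "central 1 = One" "central (f + g) = central f + central g" "central (f * g) = central f * central g"
 "central (R_const r * f) = sc r (central f)"
proof -
 show "central 1 = One" by (simp add: central_def parts_simps xsum_zero sc_laws)
 show "central (f + g) = central f + central g"
  by (simp add: central_def parts_simps sc_laws xsum_linear(1) distrib_left add_ac)
 have *: "(\<lambda>s. kap s * (const_part f * lin_part g s + lin_part f s * const_part g))
   = (\<lambda>s. const_part f * (kap s * lin_part g s) + const_part g * (kap s * lin_part f s))" for f g
  by (auto simp: algebra_simps)
 show mult: "central (f * g) = central f * central g" for f g
  unfolding central_def parts_simps(3,4) * xsum_linear[OF order.refl]
  by (simp add: distrib_left distrib_right sc_laws xsum_mult add_ac mult.commute)
 have "central (R_const r) = sc r One" by (simp add: central_def parts_simps xsum_zero)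
 then show "central (R_const r * f) = sc r (central f)" by (simp add: mult sc_laws)
qed

lemma E_central: assumes "s \<in> {1..n}" shows "E s * central f = sc (const_part f) (E s) + sc (kap s * lin_part f s) (X s)"
 using assms by (simp add: central_def distrib_left sc_laws xsum_E)

lemma barbell_side:
 assumes s: "s \<in> {1..n}" and j: "j \<in> {1..n}"
 shows "E j * D (EndDot s) (side s) = (if adj s j then sc (if s = 1 then 2 else 1) (X j) else Zr [])"
proof -
 note L = D_laws[of "EndDot s"]
 have nb: "D (EndDot s) (nb s k) = X k" if k: "adj s k" for k
  using D_bilinear[of "EndDot s" "S k s" "S s k" "U s"] s k adj_sym[OF k] by (simp add: nb_def D_generators E_mult step_square)
 have k: "s \<noteq> 1 ==> adj s (s - 1)" "s < n ==> adj s (s + 1)" using s by (auto simp: adj_def)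
 show ?thesis
 proof (cases "s = 1")
  case True
  \<comment> \<open>The minus sign in \<open>tw\<close> cancels the square of the loop, so the
    twisted term contributes a second copy of \<open>X 2\<close>.\<close>
  have "D (EndDot 1) tw = X 2"
   using D_bilinear[of "EndDot 1" "Lo 2" "Lo 2" "nb 1 2"] nb[unfolded True] D_laws(4)[of "EndDot 1" "Lo 2 * (nb 1 2 * Lo 2)" "-1"]
   by (simp add: tw_def X_loop zsimps sc_laws(4))
  moreover have "adj 1 j \<longleftrightarrow> j = 2" using n_ge_2 by (auto simp: adj_def)
  moreover have "X 2 + X 2 = sc 2 (X 2)" using sc_laws(2)[of 1 1 "X 2"] by (simp add: sc_laws(4))
  ultimately show ?thesis using L(3)[of tw "nb 1 2"] nb[unfolded True] j True
   by (auto simp: side_def E_X sc_laws)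
 next
  case False
  have a: "adj s j \<longleftrightarrow> j = s - 1 \<or> j = s + 1 \<and> s < n" using s j False by (auto simp: adj_def)
  have ne: "s - 1 \<noteq> s + 1" using s by auto
  have "D (EndDot s) (side s) = X (s - 1) + (if s < n then X (s + 1) else Zr [])"
   using L(3) D_Zr[of "EndDot s"] nb k s False by (auto simp: side_def)
  moreover have "E j * X (s - 1) = (if j = s - 1 then X (s - 1) else Zr [])" "s < n ==> E j * X (s + 1) = (if j = s + 1 then X (s + 1) else Zr [])"
   using E_X(1)[OF j adjD(2)[OF k(1)[OF False]]] E_X(1)[OF j adjD(2)[OF k(2)]] by simp_all
  moreover have "ok (X (s - 1))" "wd (X (s - 1)) = []" "s < n ==> ok (X (s + 1)) \<and> wd (X (s + 1)) = []"
   using adjD(2)[OF k(1)[OF False]] adjD(2)[OF k(2)] by (auto simp del: atLeastAtMost_iff)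
  ultimately have "E j * D (EndDot s) (side s) = (if j = s - 1 then X (s - 1) else Zr []) + (if s < n then (if j = s + 1 then X (s + 1) else Zr []) else Zr [])"
   by (simp only: distrib_left if_distrib[of "\<lambda>x. E j * x"] Zr_simps gens_ok(1,2)[OF j] word_simps append_Nil cong: if_cong)
  moreover have "ok (X (s - 1))" "wd (X (s - 1)) = []" "s < n ==> ok (X (s + 1))" "s < n ==> wd (X (s + 1)) = []"
   using X_ok[OF adjD(2)[OF k(1)[OF False]]] X_ok[OF adjD(2)[OF k(2)]] by simp_all
  ultimately show ?thesis unfolding a using False sc_laws(4) ne Zr_simps(3,4)[of _ "[]"]
   by (cases "s < n") (auto simp only: if_True if_False simp_thms split: if_split, auto)
 qed
qed

lemma barbell: assumes s: "s \<in> {1..n}" shows "D (EndDot s) (Ds s) = central (alpha n s)"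
proof (rule nil_eqI)
 fix j assume j: "j \<in> {1..n}"
 note L = D_laws[of "EndDot s"]
 have "D (EndDot s) (X s * U s) = X s" "D (EndDot s) (U s * X s) = X s"
  using s L(5,6)[of "U s" "X s"] by (simp_all add: D_generators E_X)
 then have "E j * D (EndDot s) (Ds s) = sc (kap s) (E j * X s + E j * X s + E j * D (EndDot s) (side s))"
  using s j by (simp add: Ds_def D0_def L sc_laws distrib_left)
 also have "\<dots> = sc (kap j * cartan j s) (X j)"
 proof (cases "j = s")
  case True
  have "X s + X s = sc 2 (X s)" using sc_laws(2)[of 1 1 "X s"] by (simp add: sc_laws(4))
  then show ?thesis using True s j adjD(3)[of s s] by (auto simp: barbell_side E_X sc_laws cartan_self)
 next
  case False
  show ?thesis
  proof (cases "adj s j")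
   case True
   then have "kap j = - kap s" by (auto simp: adj_def kap_def power_add)
   moreover have "cartan j s = - (if s = 1 then 2 else 1)" using True by (auto simp: adj_def cartan_def)
   ultimately show ?thesis using True False s j by (simp add: barbell_side E_X sc_laws)
  next
   case no: False
   then have "cartan j s = 0" using s j False by (auto simp: adj_def cartan_def)
   then show ?thesis using no False s j by (simp add: barbell_side E_X)
  qed
 qed
 also have "\<dots> = E j * central (alpha n s)"
  using j by (simp add: E_central parts_alpha)
 finally show "E j * D (EndDot s) (Ds s) = E j * central (alpha n s)" .
qed (use s in \<open>simp_all add: D_laws\<close>)

text \<open>On \<open>U s\<close> a polynomial acts by its constant part and its coefficient at
  \<open>X s\<close>. The constant parts agree, and since the reflection negates the linear
  coefficient, the two sides differ by a multiple of \<open>X s * U s + U s * X s\<close>. This is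
  precisely the part of the start dot that survives next to \<open>E s\<close>.\<close>

lemma forcing:
 assumes s: "s \<in> {1..n}" and f: "f \<in> R_ring n"
 shows "central f * U s = U s * central (reflect n s f) + E s * (central (demazure n s f) * Ds s)"
proof -
 let ?u = "U s" and ?x = "X s * U s" and ?y = "U s * X s" and ?k = "kap s"
 have 1: "central f * ?u = sc (const_part f) ?u + sc (?k * lin_part f s) ?x"
  using s by (simp add: central_def distrib_right sc_laws xsum_U)
 have 2: "?u * central (reflect n s f) = sc (const_part f) ?u + sc (?k * (- lin_part f s)) ?y"
  using s by (simp add: central_def distrib_left sc_laws xsum_U parts_reflect)
 have "E s * central (demazure n s f) = sc (lin_part f s) (E s)"
  using s f by (simp add: E_central parts_demazure)
 then have 3: "E s * (central (demazure n s f) * Ds s) = sc (lin_part f s * ?k) (?x + ?y)"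
  using s by (simp add: mult.assoc[symmetric] sc_laws Ds_E)
 have "sc (?k * (- lin_part f s)) ?y + sc (lin_part f s * ?k) ?y = Zr [s]"
  using s by (simp add: sc_laws(2)[symmetric])
 then show ?thesis unfolding 1 2 3 sc_laws(1) using s
  by (simp add: add_ac) (simp add: add.left_commute[of "sc _ ?y"] mult.commute)
qed

subsection \<open>The local relations\<close>

lemma Fi_H_eq_I:
 assumes p: "par (DComp (DTen (DId [s]) (Merge s)) (DTen (Split s) (DId [s]))) (DComp (Split s) (Merge s))" (is "par ?f ?g")
 shows "Fi ?f = Fi ?g"
proof -
 have s: "s \<in> {1..n}" using parD(2)[OF p] by simp
 have split: "D (DTen (Split s) (DId [s])) (U s * z) = U s * (U s * z)" if "ok z" "wd z = [s]" for z
  using that s D_simps(3)[of "Split s" "DId [s]" "U s" z] by (simp add: D_simps(1) D_generators mult.assoc)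
 have merge: "D (DTen (DId [s]) (Merge s)) (U s * z) = U s * D (Merge s) z" if "ok z" "wd z = [s, s]" for z
  using that s D_simps(3)[of "DId [s]" "Merge s" "U s" z] by (simp add: D_simps(1))
 have 1: "D ?f (U s * U s) = D ?g (U s * U s)"
  using s D_Zr[of "Split s"] by (simp add: D_simps(2) split merge D_Merge)
 have 2: "D ?f (U s * (X s * U s)) = D ?g (U s * (X s * U s))"
  using s by (simp add: D_simps(2) split merge D_Merge sc_laws D_laws D_generators)
 note L = agree_laws(4)[OF p]
 have w: "ok (U s * U s)" "wd (U s * U s) = dsrc ?g" "ok (U s * (X s * U s))" "wd (U s * (X s * U s)) = dsrc ?g"
  using s by simp_all
 show ?thesis
 proof (rule Fi_eq_pair[OF p _ s s])
  fix y assume y: "y \<in> Gen s s"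
  show "D ?f (U s * (y * U s)) = D ?g (U s * (y * U s))"
  proof (cases "s = 1")
   case True
   then have "y = E s \<or> y = X s" using y by (simp add: Gen_def)
   then show ?thesis using 1 2 s by (auto simp: E_U)
  next
   case False
   then have s2: "s \<in> {2..n}" using s by auto
   \<comment> \<open>A loop between the two generators passes to the outside, where both maps are
     linear; only \<open>E s\<close> and \<open>X s\<close> remain to be tested.\<close>
   have l: "U s * (Lo s * z) = Lo s * (U s * z)" for z using U_Lo[OF s2] by (simp add: mult.assoc[symmetric])
   have "y = E s \<or> y = Lo s \<or> y = X s \<or> y = Lo s * X s" using y False by (simp add: Gen_def)
   then show ?thesis
    using 1 2 s L[OF w(1,2) gens_ok(3,4)[OF s2] 1] L[OF w(3,4) gens_ok(3,4)[OF s2] 2]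
    by (elim disjE) (simp_all only: mult.assoc l E_U(1)[OF s s] if_True HOL.refl)
  qed
 qed simp
qed

text \<open>The side with the vertex is zero, so the two graphs on the other side have to cancel. On
  the test element both yield the same tensor \<open>?w\<close>, once with coefficient 1 and once
  with \<open>kap t * kap s\<close>.\<close>

lemma Fi_dot_crossing_3:
 assumes st: "coxm s t = 3"
  and p: "par (DComp (DTen (DId [s, t]) (EndDot s)) (Vert t s))
   (DAdd (DTen (EndDot t) (DId [s, t])) (DTen (StartDot s) (DComp (Merge t) (DTen (DId [t]) (DTen (EndDot s) (DId [t]))))))"
   (is "par ?f (DAdd ?a ?b)")
 shows "Fi ?f = Fi (DAdd ?a ?b)"
proof -
 have w: "s \<in> {1..n}" "t \<in> {1..n}" using parD(1)[OF p] by simp_all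
 \<comment> \<open>The value 3 excludes the edge between 1 and 2, so both vertices carry a
   loop.\<close>
 have a: "adj s t" "adj t s" and s2: "s \<in> {2..n}" and t2: "t \<in> {2..n}"
  using st w by (auto simp: coxm_def adj_def split: if_splits)
 have ne: "s \<noteq> 1" "t \<noteq> 1" "s \<noteq> t" using s2 t2 a by (auto simp: adj_def)
 have src: "dsrc (DAdd ?a ?b) = [t, s, t]" by simp
 have tgt: "dtgt (DAdd ?a ?b) = [s, t]" by simp
 let ?w = "S t s * (U s * (S s t * U t))"
 have ok: "ok ?w" "wd ?w = [s, t]" using a w by simp_all
 have A: "D ?a (U t * z) = E t * z" if "ok z" "wd z = [s, t]" for z
  using that w D_simps(3)[of "EndDot t" "DId [s, t]" "U t" z] by (simp add: D_simps(1) D_generators)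
 have end_dot: "D (EndDot s) (S t s * (U s * S s t)) = X t"
  using D_bilinear[of "EndDot s" "S t s" "S s t" "U s"] a w by (simp add: D_generators E_mult step_square)
 have "D (DTen (DId [t]) (DTen (EndDot s) (DId [t]))) (U t * (S t s * (U s * S s t) * U t)) = U t * (X t * U t)"
  using a w D_simps(3)[of "DId [t]" "DTen (EndDot s) (DId [t])" "U t" "S t s * (U s * S s t) * U t"]
   D_simps(3)[of "EndDot s" "DId [t]" "S t s * (U s * S s t)" "U t"]
  by (simp add: D_simps(1) end_dot)
 then have "D (DComp (Merge t) (DTen (DId [t]) (DTen (EndDot s) (DId [t])))) (U t * ?w) = sc (kap t) (U t)"
  using a w by (simp add: D_simps(2) D_Merge mult.assoc)
 then have "D ?b (U t * ?w) = Ds s * sc (kap t) (U t)"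
  using a w ok by (subst D_ten_left) (simp_all add: D_generators)
 also have "\<dots> = sc (kap t) (Ds s * E t * U t)" using w by (simp add: mult.assoc E_U sc_laws)
 also have "\<dots> = sc (- 1) ?w"
 proof -
  have "kap t * kap s = - 1" using a kap_square[of s] by (auto simp: adj_def kap_def power_add)
  then show ?thesis using a ne by (simp add: Ds_neighbour sc_laws nb_def mult.assoc)
 qed
 finally have B: "D ?b (U t * ?w) = sc (- 1) ?w" .
 have "D (DAdd ?a ?b) (U t * ?w) = Zr [s, t]"
  using parD(2)[OF p] A[OF ok] B a w ok sc_laws(2)[of 1 "-1" ?w] by (simp add: D_simps(4) sc_laws(4) E_mult mult.assoc[symmetric])
 moreover have "D ?f (U t * ?w) = Zr [s, t]"
  using nulD[OF nul_DComp(1)[OF nul_Vert] parD(1)[OF p], of "U t * ?w"] parD(3)[OF p] ok w by simp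
 ultimately have eq: "D ?f (U t * ?w) = D (DAdd ?a ?b) (U t * ?w)" by simp
 \<comment> \<open>All loops can be moved to the far left, which reduces the four choices of
   \<open>y\<close> and \<open>y'\<close> to one test element.\<close>
 have lU: "U s * (Lo s * z) = Lo s * (U s * z)" "U t * (Lo t * z) = Lo t * (U t * z)" for z
  using U_Lo[OF s2] U_Lo[OF t2] by (simp_all add: mult.assoc[symmetric])
 have lS: "S t s * (Lo s * z) = Lo t * (S t s * z)" for z
  using loop_step[OF a(2)] s2 t2 by (simp add: mult.assoc[symmetric])
 note L = agree_laws(4)[OF p]
 have gen: "ok (U t * ?w)" "wd (U t * ?w) = dsrc (DAdd ?a ?b)" using ok w by simp_all
 note l1 = L[OF gen gens_ok(3,4)[OF t2] eq]
 have gen': "ok (Lo t * (U t * ?w))" "wd (Lo t * (U t * ?w)) = dsrc (DAdd ?a ?b)" using gen t2 by simp_all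
 note l2 = L[OF gen' gens_ok(3,4)[OF t2] l1]
 show ?thesis
 proof (rule Fi_eq_triple[OF p src w(2,1,2)])
  fix y y' assume y: "y \<in> Gen t s" "y' \<in> Gen s t"
  have "y = S t s \<or> y = Lo t * S t s" "y' = S s t \<or> y' = Lo s * S s t"
   using y a ne by (auto simp: Gen_def)
  then show "D ?f (U t * (y * (U s * (y' * U t)))) = D (DAdd ?a ?b) (U t * (y * (U s * (y' * U t))))"
   by (elim disjE) (simp_all only: mult.assoc lU lS eq l1 l2)
 qed
qed

lemma Fi_dot_crossing_2:
 assumes st: "coxm s t = 2"
  and p: "par (DComp (DTen (DId [t]) (EndDot s)) (Vert s t)) (DTen (EndDot s) (DId [t]))" (is "par ?f ?g")
 shows "Fi ?f = Fi ?g"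
proof -
 have w: "s \<in> {1..n}" "t \<in> {1..n}" using parD(2)[OF p] by simp_all
 have "Gen s t = {}" using st by (auto simp: Gen_def adj_def coxm_def split: if_splits)
 then show ?thesis using w by (intro Fi_eq_pair[OF p, of s t]) simp_all
qed

subsection \<open>The Jones--Wenzl projector\<close>

lemma wf_JW: "s \<in> {1..n} ==> t \<in> {1..n} ==> wf (JW s t) \<and> dsrc (JW s t) = [s, t, s] \<and> dtgt (JW s t) = [t, s, t]"
 by (simp add: JW_def Let_def)

lemma D_Split: "t \<in> {1..n} ==> ok a ==> wd a = [] ==> ok b ==> wd b = [] ==> D (Split t) (a * (U t * b)) = a * (U t * (U t * b))"
 using D_bilinear[of "Split t" a b "U t"] by (simp add: D_generators mult.assoc)

lemma D_insert:
 assumes "s \<in> {1..n}" "t \<in> {1..n}" "ok a" "wd a = []" "ok b" "wd b = []"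
 shows "D (DTen (DId [t]) (DTen (StartDot s) (DId [t]))) (a * (U t * (U t * b))) = a * (U t * (Ds s * (U t * b)))"
 using assms D_simps(3)[of "DId [t]" "DTen (StartDot s) (DId [t])" "a * U t" "U t * b"]
  D_ten_left[of "StartDot s" "DId [t]" "U t * b"]
 by (simp add: D_simps(1) D_generators mult.assoc)

text \<open>One evaluation of the five summands for arbitrary inner elements; \<open>d\<close> makes
  the denominators 1. The premise \<open>m\<close> records what remains when the middle strand is
  dotted and the outer ones are merged, a multiple \<open>c\<close> of \<open>U s\<close>.\<close>

lemma D_JW:
 assumes st: "s \<in> {1..n}" "t \<in> {1..n}" and d: "cartan s t * cartan t s = 2"
  and y: "ok y" "wd y = []" "ok y'" "wd y' = []"
  and m: "D (Merge s) (U s * (y * (E t * (y' * U s)))) = sc c (U s)"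
 shows "D (JW s t) (U s * (y * (U t * (y' * U s)))) =
  E s * (y * (U t * (y' * (U s * Ds t))))
  + (sc (- cartan s t) (E s * (y * (U t * (Ds s * (U t * (y' * E s))))))
  + (sc (- cartan t s * c) (Ds t * (U s * Ds t))
  + (sc c (D (DTen (DId [t]) (DTen (StartDot s) (DId [t]))) (D (Split t) (E s * Ds t)))
  + Ds t * (U s * (y * (U t * (y' * E s))))))) "
proof -
 let ?x = "U s * (y * (U t * (y' * U s)))"
 let ?mid = "DTen (DId [t]) (DTen (StartDot s) (DId [t]))"
 note o = st y
 have 1: "D (DTen (EndDot s) (DTen (DId [t, s]) (StartDot t))) ?x = E s * (y * (U t * (y' * (U s * Ds t))))"
  using o D_simps(3)[of "EndDot s" "DTen (DId [t, s]) (StartDot t)" "U s" "y * (U t * (y' * U s))"]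
   D_ten_right[of "DId [t, s]" "StartDot t" "y * (U t * (y' * U s))"]
  by (simp add: D_simps(1) D_generators mult.assoc)
 have ends: "D (DTen (EndDot s) (DTen (DId [t]) (EndDot s))) ?x = E s * (y * (U t * (y' * E s)))"
  using o D_simps(3)[of "EndDot s" "DTen (DId [t]) (EndDot s)" "U s" "y * (U t * y' * U s)"]
   D_simps(3)[of "DId [t]" "EndDot s" "y * (U t * y')" "U s"]
  by (simp add: D_simps(1) D_generators mult.assoc)
 have 2: "D (DComp ?mid (DComp (Split t) (DTen (EndDot s) (DTen (DId [t]) (EndDot s))))) ?x
   = E s * (y * (U t * (Ds s * (U t * (y' * E s)))))"
  using o D_Split[of t "E s * y" "y' * E s"] D_insert[of s t "E s * y" "y' * E s"] by (simp add: D_simps(2) ends mult.assoc)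
 have middle: "D (DTen (DId [s]) (DTen (EndDot t) (DId [s]))) ?x = U s * (y * (E t * (y' * U s)))"
  using o D_simps(3)[of "DId [s]" "DTen (EndDot t) (DId [s])" "U s" "y * (U t * y') * U s"]
   D_simps(3)[of "EndDot t" "DId [s]" "y * (U t * y')" "U s"] D_bilinear[of "EndDot t" y y' "U t"]
  by (simp add: D_simps(1) D_generators mult.assoc)
 have merge: "D (DComp (Merge s) (DTen (DId [s]) (DTen (EndDot t) (DId [s])))) ?x = sc c (U s)"
  using o by (simp add: D_simps(2) middle m)
 have 3: "D (DTen (StartDot t) (DTen (DComp (Merge s) (DTen (DId [s]) (DTen (EndDot t) (DId [s])))) (StartDot t))) ?x
   = Ds t * (sc c (U s) * Ds t)"
  using o by (simp add: D_ten_left D_ten_right D_generators merge)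
 have cap: "D (DComp (Cap s) (DTen (DId [s]) (DTen (EndDot t) (DId [s])))) ?x = sc c (E s)"
  using o D_laws(4)[of "EndDot s" "U s" c] by (simp add: D_simps(2) middle D_generators(6) m D_generators(1))
 have cup: "D (Cup t) (E s) = D (Split t) (E s * Ds t)"
  using st D_Nil[of "StartDot t" "E s"] by (simp add: D_generators)
 have 4: "D (DComp (DComp ?mid (Cup t)) (DComp (Cap s) (DTen (DId [s]) (DTen (EndDot t) (DId [s]))))) ?x
   = sc c (D ?mid (D (Split t) (E s * Ds t)))"
  using o by (simp add: D_simps(2) cap D_laws cup)
 have 5: "D (DTen (StartDot t) (DTen (DId [s, t]) (EndDot s))) ?x = Ds t * (U s * (y * (U t * (y' * E s))))"
  using o D_simps(3)[of "DId [s, t]" "EndDot s" "U s * (y * (U t * y'))" "U s"]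
  by (simp add: D_ten_left D_simps(1) D_generators mult.assoc)
 have sum: "D (DAdd f1 (DAdd (DScale r2 f2) (DAdd (DScale r3 f3) (DAdd (DScale r4 f4) (DScale r5 f5))))) ?x
   = D f1 ?x + (sc r2 (D f2 ?x) + (sc r3 (D f3 ?x) + (sc r4 (D f4 ?x) + sc r5 (D f5 ?x))))"
  if "\<forall>f \<in> {f1, f2, f3, f4, f5}. wf f \<and> dsrc f = [s, t, s] \<and> dtgt f = [t, s, t]" for f1 f2 f3 f4 f5 r2 r3 r4 r5
  using that o by (simp add: D_simps(4,5))
 have eq: "cartan s t * cartan t s - 1 = 1" using d by simp
 show ?thesis
  unfolding JW_def Let_def eq div_by_1
  by (subst sum) (use st in simp, simp only: 1 2 3 4 5 sc_laws mult.commute[of c] mult_1_left)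
qed

text \<open>Tensors cannot be subtracted in the semiring, so cancellation is carried out in the real
  coefficients of four fixed tensors.\<close>

definition lc :: "tens => tens => tens => tens => real => real => real => real => tens" where
 "lc p q r t a b c d = sc a p + (sc b q + (sc c r + sc d t))"

lemma lc_add: "lc p q r t a b c d + lc p q r t a' b' c' d' = lc p q r t (a + a') (b + b') (c + c') (d + d')"
 by (simp add: lc_def sc_laws(2) add_ac)

lemma lc_sc: "sc x (lc p q r t a b c d) = lc p q r t (x * a) (x * b) (x * c) (x * d)"
 by (simp add: lc_def sc_laws)

lemma lc_unit:
 assumes "ok p" "ok q" "ok r" "ok t" "wd q = wd p" "wd r = wd p" "wd t = wd p"
 shows "p = lc p q r t 1 0 0 0" "q = lc p q r t 0 1 0 0" "r = lc p q r t 0 0 1 0" "t = lc p q r t 0 0 0 1" "Zr (wd p) = lc p q r t 0 0 0 0"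
 using assms ok_word[OF assms(1)] by (simp_all add: lc_def sc_laws(4))

text \<open>The outer coefficients come from \<open>D_JW\<close>: for the colours
  \<open>1, 2\<close> they are \<open>1\<close>, \<open>2 c\<close> and \<open>c\<close> with
  \<open>c = -1\<close> or \<open>c = 0\<close>, for the colours \<open>2, 1\<close> they are
  \<open>2\<close>, \<open>c\<close> and \<open>c\<close> with \<open>c = 1\<close>. The inner signs
  come from \<open>Ds 1\<close>.\<close>

lemma jw_cancel:
 assumes "ok p" "ok q" "ok r" "ok t" "wd q = wd p" "wd r = wd p" "wd t = wd p"
 shows "p + (sc 1 (sc (- 1) p + q) + (sc (- 2) p + (sc (- 1) (sc (- 1) p + q) + p))) = Zr (wd p)"
  "r + (sc 1 (sc (- 1) r + sc (- 1) t) + (sc 0 p + (sc 0 (sc (- 1) p + q) + t))) = Zr (wd p)"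
  "(sc (- 1) p + q) + (sc 2 p + (sc 1 (sc (- 1) (sc (- 1) p + r) + (sc (- 1) t + sc (- 1) q))
   + (sc 1 (sc (- 1) p + t) + (sc (- 1) p + r)))) = Zr (wd p)"
proof -
 let ?p = "lc p q r t 1 0 0 0" and ?q = "lc p q r t 0 1 0 0" and ?r = "lc p q r t 0 0 1 0" and ?t = "lc p q r t 0 0 0 1"
 have "?p + (sc 1 (sc (- 1) ?p + ?q) + (sc (- 2) ?p + (sc (- 1) (sc (- 1) ?p + ?q) + ?p))) = lc p q r t 0 0 0 0"
  "?r + (sc 1 (sc (- 1) ?r + sc (- 1) ?t) + (sc 0 ?p + (sc 0 (sc (- 1) ?p + ?q) + ?t))) = lc p q r t 0 0 0 0"
  "(sc (- 1) ?p + ?q) + (sc 2 ?p + (sc 1 (sc (- 1) (sc (- 1) ?p + ?r) + (sc (- 1) ?t + sc (- 1) ?q))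
   + (sc 1 (sc (- 1) ?p + ?t) + (sc (- 1) ?p + ?r)))) = lc p q r t 0 0 0 0"
  by (simp_all add: lc_add lc_sc)
 note this[unfolded lc_unit[OF assms, symmetric]]
 then show "p + (sc 1 (sc (- 1) p + q) + (sc (- 2) p + (sc (- 1) (sc (- 1) p + q) + p))) = Zr (wd p)"
  "r + (sc 1 (sc (- 1) r + sc (- 1) t) + (sc 0 p + (sc 0 (sc (- 1) p + q) + t))) = Zr (wd p)"
  "(sc (- 1) p + q) + (sc 2 p + (sc 1 (sc (- 1) (sc (- 1) p + r) + (sc (- 1) t + sc (- 1) q))
   + (sc 1 (sc (- 1) p + t) + (sc (- 1) p + r)))) = Zr (wd p)"
  by blast+
qed

lemma kap_12: "kap 1 = - 1" "kap 2 = 1"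
 by (simp_all add: kap_def)

lemma Ds_12:
 "U 1 * Ds 2 = U 1 * (S 1 2 * (U 2 * S 2 1))" "Ds 2 * (U 1 * z) = S 1 2 * (U 2 * (S 2 1 * (U 1 * z)))"
 "E 1 * Ds 2 = S 1 2 * (U 2 * S 2 1)"
 "U 2 * Ds 1 = sc (- 1) (U 2 * (S 2 1 * (U 1 * S 1 2))) + U 2 * (Lo 2 * (S 2 1 * (U 1 * (S 1 2 * Lo 2))))"
 "Ds 1 * (U 2 * z) = sc (- 1) (S 2 1 * (U 1 * (S 1 2 * (U 2 * z)))) + Lo 2 * (S 2 1 * (U 1 * (S 1 2 * (Lo 2 * (U 2 * z)))))"
 "E 2 * Ds 1 = sc (- 1) (S 2 1 * (U 1 * S 1 2)) + Lo 2 * (S 2 1 * (U 1 * (S 1 2 * Lo 2)))"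
proof -
 have 1: "E 1 * Ds 2 = S 1 2 * (U 2 * S 2 1)" "Ds 2 * E 1 = S 1 2 * (U 2 * S 2 1)"
  by (simp_all add: Ds_neighbour kap_12 nb_def sc_laws(4))
 have 2: "E 2 * Ds 1 = sc (- 1) (S 2 1 * (U 1 * S 1 2)) + Lo 2 * (S 2 1 * (U 1 * (S 1 2 * Lo 2)))"
  "Ds 1 * E 2 = sc (- 1) (S 2 1 * (U 1 * S 1 2)) + Lo 2 * (S 2 1 * (U 1 * (S 1 2 * Lo 2)))"
  by (simp_all add: Ds_neighbour kap_12 nb_def tw_def sc_laws mult.assoc)
 show "E 1 * Ds 2 = S 1 2 * (U 2 * S 2 1)" "E 2 * Ds 1 = sc (- 1) (S 2 1 * (U 1 * S 1 2)) + Lo 2 * (S 2 1 * (U 1 * (S 1 2 * Lo 2)))"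
  by (fact 1 2)+
 show "U 1 * Ds 2 = U 1 * (S 1 2 * (U 2 * S 2 1))"
  "U 2 * Ds 1 = sc (- 1) (U 2 * (S 2 1 * (U 1 * S 1 2))) + U 2 * (Lo 2 * (S 2 1 * (U 1 * (S 1 2 * Lo 2))))"
  unfolding E_sandwich(1)[OF adj_12(3), of "Ds 2"] E_sandwich(1)[OF adj_12(4), of "Ds 1"] 1 2 by (simp_all add: distrib_left sc_laws)
 have "Ds 2 * U 1 = S 1 2 * (U 2 * S 2 1) * U 1"
  "Ds 1 * U 2 = (sc (- 1) (S 2 1 * (U 1 * S 1 2)) + Lo 2 * (S 2 1 * (U 1 * (S 1 2 * Lo 2)))) * U 2"
  unfolding E_sandwich(2)[OF adj_12(3), of "Ds 2"] E_sandwich(2)[OF adj_12(4), of "Ds 1"] 1 2 by simp_all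
 from this[THEN arg_cong, of "\<lambda>x. x * z"]
 show "Ds 2 * (U 1 * z) = S 1 2 * (U 2 * (S 2 1 * (U 1 * z)))"
  "Ds 1 * (U 2 * z) = sc (- 1) (S 2 1 * (U 1 * (S 1 2 * (U 2 * z)))) + Lo 2 * (S 2 1 * (U 1 * (S 1 2 * (Lo 2 * (U 2 * z)))))"
  by (simp_all add: mult.assoc distrib_right sc_laws)
qed

lemma U_Lo_2: "U 2 * Lo 2 = Lo 2 * U 2" "U 2 * (Lo 2 * z) = Lo 2 * (U 2 * z)"
 using U_Lo[of 2] by (simp_all add: mult.assoc[symmetric])

lemma cartan_12: "cartan 1 2 = - 1" "cartan 2 1 = - 2"
 by (simp_all add: cartan_def)

lemma Ds_Lo: "Ds 1 * (Lo 2 * z) = Lo 2 * (Ds 1 * z)"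
 using Ds_central[of 1 "Lo 2"] by (simp add: mult.assoc[symmetric])

lemmas jw_simps = zsimps Ds_12 Ds_Lo U_Lo_2 distrib_left distrib_right

text \<open>Two test elements occur: a loop at the middle generator \<open>U 2\<close> commutes with
  it but is shut in between the arrows to vertex 1.\<close>

lemma JW_12:
 "D (JW 1 2) (U 1 * (S 1 2 * (U 2 * (S 2 1 * U 1)))) = Zr [2, 1, 2]"
 "D (JW 1 2) (U 1 * (S 1 2 * (U 2 * (Lo 2 * (S 2 1 * U 1))))) = Zr [2, 1, 2]"
proof -
 have d: "cartan 1 2 * cartan 2 1 = 2" by (simp add: cartan_12)
 let ?P = "S 1 2 * (U 2 * (S 2 1 * (U 1 * (S 1 2 * (U 2 * S 2 1)))))"
 let ?V = "S 1 2 * (Lo 2 * (U 2 * (S 2 1 * (U 1 * (S 1 2 * (Lo 2 * (U 2 * S 2 1)))))))"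
 let ?W = "S 1 2 * (Lo 2 * (U 2 * (S 2 1 * (U 1 * (S 1 2 * (U 2 * S 2 1))))))"
 let ?W' = "S 1 2 * (U 2 * (S 2 1 * (U 1 * (S 1 2 * (Lo 2 * (U 2 * S 2 1))))))"
 \<comment> \<open>Here \<open>(1|2)(2|1) = X_1\<close> has trace 1, and the sign is
   \<open>kap 1\<close>.\<close>
 have m1: "D (Merge 1) (U 1 * (S 1 2 * (E 2 * (S 2 1 * U 1)))) = sc (- 1) (U 1)"
  using D_Merge(2)[of 1] by (simp add: zsimps kap_12)
 \<comment> \<open>The loop makes the inner path \<open>(1|2)(ie_2)(2|1)\<close> zero, hence
   \<open>c = 0\<close>.\<close>
 have m2: "D (Merge 1) (U 1 * (S 1 2 * (E 2 * (Lo 2 * S 2 1 * U 1)))) = sc 0 (U 1)"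
  using D_Zr[of "Merge 1"] by (simp add: zsimps)
 have ok: "ok ?P" "ok ?V" "ok ?W" "ok ?W'" "wd ?V = wd ?P" "wd ?W = wd ?P" "wd ?W' = wd ?P" and w: "Zr [2, 1, 2] = Zr (wd ?P)"
  by simp_all
 have t4: "D (DTen (DId [2]) (DTen (StartDot 1) (DId [2]))) (D (Split 2) (E 1 * Ds 2)) = sc (- 1) ?P + ?V"
  unfolding Ds_12(3) using D_Split[of 2 "S 1 2" "S 2 1"] D_insert[of 1 2 "S 1 2" "S 2 1"] by (simp add: jw_simps)
 have "D (JW 1 2) (U 1 * (S 1 2 * (U 2 * (S 2 1 * U 1))))
   = ?P + (sc 1 (sc (- 1) ?P + ?V) + (sc (- 2) ?P + (sc (- 1) (sc (- 1) ?P + ?V) + ?P)))"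
  by (subst D_JW[OF adj_12(3,4) d _ _ _ _ m1], simp_all only: t4 cartan_12 minus_minus) (simp_all add: jw_simps)
 also have "\<dots> = Zr [2, 1, 2]"
  unfolding w by (rule jw_cancel(1)[OF ok])
 finally show "D (JW 1 2) (U 1 * (S 1 2 * (U 2 * (S 2 1 * U 1)))) = Zr [2, 1, 2]" .
 have "D (JW 1 2) (U 1 * (S 1 2 * (U 2 * (Lo 2 * S 2 1 * U 1))))
   = ?W + (sc 1 (sc (- 1) ?W + sc (- 1) ?W') + (sc 0 ?P + (sc 0 (sc (- 1) ?P + ?V) + ?W')))"
  by (subst D_JW[OF adj_12(3,4) d _ _ _ _ m2], simp_all only: t4 cartan_12 minus_minus) (simp_all add: jw_simps)
 also have "\<dots> = Zr [2, 1, 2]"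
  unfolding w by (rule jw_cancel(2)[OF ok])
 finally show "D (JW 1 2) (U 1 * (S 1 2 * (U 2 * (Lo 2 * (S 2 1 * U 1))))) = Zr [2, 1, 2]" by (simp add: mult.assoc)
qed

text \<open>For these colours one test element is enough, because loops at vertex 2 pass through the
  outer generators \<open>U 2\<close> and leave the product.\<close>

lemma JW_21: "D (JW 2 1) (U 2 * (S 2 1 * (U 1 * (S 1 2 * U 2)))) = Zr [1, 2, 1]"
proof -
 have d: "cartan 2 1 * cartan 1 2 = 2" by (simp add: cartan_12)
 let ?P = "S 2 1 * (U 1 * (S 1 2 * (U 2 * (S 2 1 * (U 1 * S 1 2)))))"
 let ?Q = "S 2 1 * (U 1 * (S 1 2 * (Lo 2 * (U 2 * (S 2 1 * (U 1 * (S 1 2 * Lo 2)))))))"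
 let ?Q' = "Lo 2 * (S 2 1 * (U 1 * (S 1 2 * (Lo 2 * (U 2 * (S 2 1 * (U 1 * S 1 2)))))))"
 let ?R = "Lo 2 * (S 2 1 * (U 1 * (S 1 2 * (U 2 * (S 2 1 * (U 1 * (S 1 2 * Lo 2)))))))"
 have m: "D (Merge 2) (U 2 * (S 2 1 * (E 1 * (S 1 2 * U 2)))) = sc 1 (U 2)"
  using D_Merge(2)[of 2] by (simp add: zsimps kap_12)
 have ok: "ok ?P" "ok ?Q" "ok ?Q'" "ok ?R" "wd ?Q = wd ?P" "wd ?Q' = wd ?P" "wd ?R = wd ?P" and w: "Zr [1, 2, 1] = Zr (wd ?P)"
  by simp_all
 let ?mid = "DTen (DId [1]) (DTen (StartDot 2) (DId [1]))"
 have i: "D ?mid (D (Split 1) (a * (U 1 * b))) = a * (U 1 * (Ds 2 * (U 1 * b)))" if "ok a" "wd a = []" "ok b" "wd b = []" for a b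
  using that by (simp add: D_Split D_insert)
 have "D ?mid (D (Split 1) (sc (- 1) (S 2 1 * (U 1 * S 1 2)) + Lo 2 * (S 2 1 * (U 1 * (S 1 2 * Lo 2)))))
  = sc (- 1) (D ?mid (D (Split 1) (S 2 1 * (U 1 * S 1 2)))) + D ?mid (D (Split 1) (Lo 2 * S 2 1 * (U 1 * (S 1 2 * Lo 2))))"
  by (simp add: D_laws mult.assoc)
 then have t4: "D ?mid (D (Split 1) (E 2 * Ds 1)) = sc (- 1) ?P + ?R"
  unfolding Ds_12(6) by (simp add: i) (simp add: jw_simps)
 have "D (JW 2 1) (U 2 * (S 2 1 * (U 1 * (S 1 2 * U 2))))
   = (sc (- 1) ?P + ?Q) + (sc 2 ?P + (sc 1 (sc (- 1) (sc (- 1) ?P + ?Q') + (sc (- 1) ?R + sc (- 1) ?Q)) + (sc 1 (sc (- 1) ?P + ?R) + (sc (- 1) ?P + ?Q'))))"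
  by (subst D_JW[OF adj_12(4,3) d _ _ _ _ m], simp_all only: t4 cartan_12 minus_minus) (simp_all add: jw_simps)
 also have "\<dots> = Zr [1, 2, 1]"
  unfolding w by (rule jw_cancel(3)[OF ok])
 finally show ?thesis .
qed

text \<open>The box is compared with the zero diagram of the same boundary on the test elements of
  each ordering of the two colours; all others arise from these by moving loops.\<close>

lemma nul_JW: assumes "coxm s t = 4" shows "nul (JW s t)"
proof -
 have par: "par (JW s t) (DZero [s, t, s] [t, s, t])" if "s \<in> {1..n}" "t \<in> {1..n}"
  using wf_JW[OF that] that by (simp add: par_def)
 consider "s = 1" "t = 2" | "s = 2" "t = 1" using assms by (auto simp: coxm_def split: if_splits)
 then have "Fi (JW s t) = Fi (DZero [s, t, s] [t, s, t])"
 proof cases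
  case 1
  note p = par[unfolded 1, OF adj_12(3,4)]
  note L = agree_laws[OF p]
  let ?g = "U 1 * (S 1 2 * (U 2 * (S 2 1 * U 1)))" and ?h = "U 1 * (S 1 2 * (U 2 * (Lo 2 * (S 2 1 * U 1))))"
  have g: "D (JW 1 2) ?g = D (DZero [1, 2, 1] [2, 1, 2]) ?g" "D (JW 1 2) ?h = D (DZero [1, 2, 1] [2, 1, 2]) ?h"
   by (simp_all add: JW_12 D_simps(6))
  have g': "D (JW 1 2) (sc (- 1) ?g) = D (DZero [1, 2, 1] [2, 1, 2]) (sc (- 1) ?g)"
   by (rule L(3)[OF _ _ g(1)]) simp_all
  show ?thesis unfolding 1
  proof (rule Fi_eq_triple[OF p])
   fix y y' assume "y \<in> Gen 1 2" "y' \<in> Gen 2 1"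
   then have "y = S 1 2 \<or> y = S 1 2 * Lo 2" "y' = S 2 1 \<or> y' = Lo 2 * S 2 1" by (simp_all add: Gen_def)
   moreover have "U 1 * (S 1 2 * (Lo 2 * (U 2 * (S 2 1 * U 1)))) = ?h" by (simp add: U_Lo_2)
   \<comment> \<open>Two loops meet at \<open>U 2\<close> and give the factor
     \<open>-1\<close>.\<close>
   moreover have "U 1 * (S 1 2 * (Lo 2 * (U 2 * (Lo 2 * (S 2 1 * U 1))))) = sc (- 1) ?g"
    by (simp add: U_Lo_2 zsimps)
   ultimately show "D (JW 1 2) (U 1 * (y * (U 2 * (y' * U 1)))) = D (DZero [1, 2, 1] [2, 1, 2]) (U 1 * (y * (U 2 * (y' * U 1))))"
    using g g' by (elim disjE) (simp_all only: mult.assoc)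
  qed simp_all
 next
  case 2
  note p = par[unfolded 2, OF adj_12(4,3)]
  note L = agree_laws[OF p]
  let ?g = "U 2 * (S 2 1 * (U 1 * (S 1 2 * U 2)))"
  have g: "D (JW 2 1) ?g = D (DZero [2, 1, 2] [1, 2, 1]) ?g" by (simp add: JW_21 D_simps(6))
  have l: "D (JW 2 1) (Lo 2 * ?g) = D (DZero [2, 1, 2] [1, 2, 1]) (Lo 2 * ?g)"
   by (rule L(4)[OF _ _ _ _ g]) simp_all
  have r: "D (JW 2 1) (?g * Lo 2) = D (DZero [2, 1, 2] [1, 2, 1]) (?g * Lo 2)"
   by (rule L(5)[OF _ _ _ _ g]) simp_all
  have lr: "D (JW 2 1) (Lo 2 * (?g * Lo 2)) = D (DZero [2, 1, 2] [1, 2, 1]) (Lo 2 * (?g * Lo 2))"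
   by (rule L(4)[OF _ _ _ _ r]) simp_all
  show ?thesis unfolding 2
  proof (rule Fi_eq_triple[OF p])
   fix y y' assume "y \<in> Gen 2 1" "y' \<in> Gen 1 2"
   then have "y = S 2 1 \<or> y = Lo 2 * S 2 1" "y' = S 1 2 \<or> y' = S 1 2 * Lo 2" by (simp_all add: Gen_def)
   then show "D (JW 2 1) (U 2 * (y * (U 1 * (y' * U 2)))) = D (DZero [2, 1, 2] [1, 2, 1]) (U 2 * (y * (U 1 * (y' * U 2))))"
    using g l r lr by (elim disjE) (simp_all only: mult.assoc U_Lo_2)
  qed simp_all
 qed
 then have F: "D (JW s t) x = D (DZero [s, t, s] [t, s, t]) x" if "s \<in> {1..n}" "t \<in> {1..n}" for x
  using wf_JW[OF that] by (simp only: D_def) simp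
 have st: "s \<in> {1..n}" "t \<in> {1..n}" using assms n_ge_2 by (auto simp: coxm_def split: if_splits)
 show ?thesis unfolding nul_def using F[OF st] wf_JW[OF st] st by (auto simp: D_simps(6))
qed

lemma Fi_local: assumes "local_relation n f g" "par f g" shows "Fi f = Fi g"
 using assms
proof (induction rule: local_relation.induct)
 case box_one
 then show ?case using parD(1)[OF box_one] by (intro Fi_eq_empty[OF box_one]) (simp_all add: D_simps(1) D_generators(4)[of 1] central_laws)
next
 case (box_mult f g)
 then show ?case using parD(1,2)[OF box_mult]
  by (intro Fi_eq_empty[OF box_mult]) (simp_all add: D_ten_left D_generators(4)[of 1] central_laws)
next
 case (box_add f g)
 then show ?case using parD(1,2)[OF box_add]
  by (intro Fi_eq_empty[OF box_add]) (simp_all add: D_simps(4) D_generators(4)[of 1] central_laws)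
next
 case (box_scale r f)
 then show ?case using parD(1,2)[OF box_scale]
  by (intro Fi_eq_empty[OF box_scale]) (simp_all add: D_simps(5) D_generators(4)[of 1] central_laws(4))
next
 case (barbell s)
 then show ?case using parD(1,2)[OF barbell]
  by (intro Fi_eq_empty[OF barbell]) (simp_all add: D_simps(2) D_generators(3,4)[of s] type_B.barbell[OF type_B_axioms])
next
 case (forcing f s)
 have w: "s \<in> {1..n}" "f \<in> R_ring n" "reflect n s f \<in> R_ring n" "demazure n s f \<in> R_ring n"
  using parD(1,2)[OF forcing] by simp_all
 have "D (StartDot s) (D (Box (demazure n s f)) (E s)) = E s * (central (demazure n s f) * Ds s)"
  using w D_Nil[of "Box (demazure n s f)" "E s"] D_Nil[of "StartDot s" "E s * central (demazure n s f)"]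
  by (simp add: D_generators(3,4)[OF w(1)] mult.assoc)
 then show ?case using w type_B.forcing[OF type_B_axioms w(1,2)]
  by (intro Fi_eq_single[OF forcing, of s])
   (simp_all add: D_simps(1,2,4) D_ten_left D_ten_right D_generators(1,3,4)[OF w(1)] D_laws)
next
 case (needle s)
 have s: "s \<in> {1..n}" using parD(1)[OF needle] by simp
 then show ?case by (intro Fi_eq_single[OF needle, of s]) (simp_all add: D_simps(2,6) D_generators(2) D_Merge)
next
 case (H_eq_I s)
 then show ?case by (rule Fi_H_eq_I)
next
 case (unit s)
 have s: "s \<in> {1..n}" using parD(2)[OF unit] by simp
 then show ?case by (intro Fi_eq_single[OF unit, of s]) (simp_all add: D_simps(1,2) D_ten_left D_generators(3) dots)
next
 case (two_colour_assoc s t m x)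
 show ?case by (rule Fi_eq_nul[OF two_colour_assoc(4)]) (simp_all add: nul_DComp nul_DTen nul_Vert)
next
 case (dot_crossing_2 s t)
 then show ?case by (rule Fi_dot_crossing_2)
next
 case (dot_crossing_3 s t)
 then show ?case by (rule Fi_dot_crossing_3)
next
 case (dot_crossing_4 s t)
 show ?case by (rule Fi_eq_nul[OF dot_crossing_4(2)]) (simp_all add: nul_DComp nul_DTen nul_Vert nul_JW dot_crossing_4(1))
next
 case (three_colour_slide s t m u)
 show ?case by (rule Fi_eq_nul[OF three_colour_slide(5)]) (simp_all add: nul_DComp nul_DTen nul_Vert)
next
 case (three_colour_A3 a b c)
 \<comment> \<open>Unfolding exposes the first two words of each path, and hence its first braid
   vertex.\<close>
 show ?case by (rule Fi_eq_nul[OF three_colour_A3(4)]; unfold recolour_def A3_path_def A3_path'_def list.map; rule nul_braid_path)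
next
 case (three_colour_B3 a b c)
 show ?case by (rule Fi_eq_nul[OF three_colour_B3(4)]; unfold recolour_def B3_path_def B3_path'_def list.map; rule nul_braid_path)
qed

section \<open>The monoidal functor\<close>

lemma Fi_dequiv: "dequiv n w v f g ==> Fi f = Fi g"
proof (induction rule: dequiv.induct)
 case (base w v f g)
 then have "par f g" by (simp add: par_def diagram_iff)
 then show ?case using base(3) Fi_linear Fi_isotopy Fi_local by blast
next
 case (ten u v f f' u' v' g g')
 have "dsrc f = u" "dsrc f' = u" "dtgt f = v" "dtgt f' = v" "dsrc g = u'" "dsrc g' = u'" "dtgt g = v'" "dtgt g' = v'"
  using dequiv_diagram[OF ten(1)] dequiv_diagram[OF ten(2)] by (auto simp: diagram_iff)
 then show ?case using ten(3,4) by simp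
qed simp_all

text \<open>A morphism is a class of diagrams; any member may be evaluated, since \<open>Fi\<close>
  is constant on classes.\<close>

definition Fm :: "dmor set => bimap" where
 "Fm F = Fi (SOME f. f \<in> F)"

lemma Fm_dclass: assumes "wf f" shows "Fm (dclass n f) = Fi f"
proof -
 have d: "diagram n (dsrc f) (dtgt f) f" using assms by (simp add: wfd_def)
 have "(SOME g. g \<in> dclass n f) \<in> dclass n f" by (rule someI[of _ f]) (rule dclass_self[OF d])
 then show ?thesis unfolding Fm_def using Fi_dequiv[OF in_dclass[OF d]] by simp
qed

lemma Fm_hom: "F \<in> Hom (SC n) w v ==> \<exists>f. F = dclass n f \<and> wf f \<and> dsrc f = w \<and> dtgt f = v"
 by (auto simp: diagram_iff)

lemma HomDeg_iff: "f \<in> HomDeg ZC d M N \<longleftrightarrow> f \<in> bimaps n M N \<and> (\<forall>k x. x \<in> bdeg M k \<longrightarrow> bfun f x \<in> bdeg N (k + d))"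
 by (auto simp: image_subset_iff)

lemma Fi_degree:
 assumes "wf f" "dhomogeneous d f" shows "Fi f \<in> HomDeg ZC d (Fo (dsrc f)) (Fo (dtgt f))"
 unfolding HomDeg_iff
proof (intro conjI allI impI)
 show F: "Fi f \<in> bimaps n (Fo (dsrc f)) (Fo (dtgt f))" by (rule Fi_bimap[OF assms(1)])
 fix k x assume x: "x \<in> bdeg (Fo (dsrc f)) k"
 note w = wfd_word[OF assms(1)]
 have c: "x \<in> bcar (Fo (dsrc f))" using graded_bimodule.deg_closed[OF Fo_graded[OF w(1)]] x by blast
 have y: "bfun (Fi f) x \<in> bcar (Fo (dtgt f))" using bimapsD(3)[OF F Fo_zzb[OF w(1)] Fo_zzb[OF w(2)] c] .
 have "hom k (El n (dsrc f) x)" unfolding hom_def using w x by blast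
 then have "hom (k + d) (D f (El n (dsrc f) x))" using hom_D[OF assms(2,1)] w c by (simp add: El_simps)
 moreover have "D f (El n (dsrc f) x) = El n (dtgt f) (bfun (Fi f) x)" by (simp add: D_def app_El w c)
 ultimately show "bfun (Fi f) x \<in> bdeg (Fo (dtgt f)) (k + d)" using homD(2)[of "k + d"] El_simps[OF w(2) y] by fastforce
qed

lemma mu_degree: assumes "word w" "word v" shows "mu w v \<in> HomDeg ZC 0 (ZT (Fo w) (Fo v)) (Fo (w @ v))"
 unfolding HomDeg_iff
proof (intro conjI allI impI)
 show "mu w v \<in> bimaps n (ZT (Fo w) (Fo v)) (Fo (w @ v))" by (rule mu_bimap[OF assms])
 fix k x assume x: "x \<in> bdeg (ZT (Fo w) (Fo v)) k"
 have wv: "word (w @ v)" using assms by simp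
 note z = Fo_zzb[OF assms(1)] Fo_zzb[OF assms(2)]
 note M = bimapsD[OF mu_bimap[OF assms] zzb_tensor[OF z] Fo_zzb[OF wv]]
 note G = Fo_graded[OF wv]
 have "bfun (mu w v) x \<in> bdeg (Fo (w @ v)) k" using z x
 proof (induction rule: tensor_zz_deg_induct)
  case (pure x y i)
  then show ?case using op_deg[OF assms, of x i y "k - i"] by (simp add: op_def)
 qed (simp_all add: M graded_bimodule.deg_zero[OF G] graded_bimodule.deg_add[OF G])
 then show "bfun (mu w v) x \<in> bdeg (Fo (w @ v)) (k + 0)" by simp
qed

lemma Id_degree: "zzb M ==> Id ZC M \<in> HomDeg ZC 0 M M"
 unfolding HomDeg_iff using Id_bimap(1)[of M] Id_bimap(2)[of _ M] graded_bimodule.deg_closed[OF zzb_graded, of M] by fastforce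

text \<open>Evaluated on \<open>(x \<otimes> y) \<otimes> v\<close>, the two sides are the two
  bracketings of the concatenation product, so \<open>op_assoc\<close> applies.\<close>

lemma mu_associative:
 assumes w: "word a" "word b" "word c"
 shows "Comp ZC (mu (a @ b) c) (TenM ZC (mu a b) (Id ZC (Fo c)))
  = Comp ZC (mu a (b @ c)) (Comp ZC (TenM ZC (Id ZC (Fo a)) (mu b c)) (Assoc ZC (Fo a) (Fo b) (Fo c)))"
proof -
 have ww: "word (a @ b)" "word (b @ c)" "word (a @ b @ c)" using w by simp_all
 note z = Fo_zzb[OF w(1)] Fo_zzb[OF w(2)] Fo_zzb[OF w(3)] and zz = Fo_zzb[OF ww(1)] Fo_zzb[OF ww(2)] Fo_zzb[OF ww(3)]
 note t = zzb_tensor[OF z(1,2)] zzb_tensor[OF z(2,3)]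
 note m = mu_bimap[OF w(1,2)] mu_bimap[OF w(2,3)] mu_bimap[OF ww(1) w(3), unfolded append_assoc] mu_bimap[OF w(1) ww(2)]
 note T1 = TenM_bimap[OF t(1) z(3) zz(1) z(3) m(1) Id_bimap(1)[OF z(3)]]
 note T2 = TenM_bimap[OF z(1) t(2) z(1) zz(2) Id_bimap(1)[OF z(1)] m(2)]
 note A = Assoc_bimap[OF z]
 note C1 = Comp_bimap[OF zzb_tensor[OF t(1) z(3)] zzb_tensor[OF zz(1) z(3)] zz(3) T1(1) m(3)]
 note C2 = Comp_bimap[OF zzb_tensor[OF t(1) z(3)] zzb_tensor[OF z(1) t(2)] zzb_tensor[OF z(1) zz(2)] A(1) T2(1)]
 note C3 = Comp_bimap[OF zzb_tensor[OF t(1) z(3)] zzb_tensor[OF z(1) zz(2)] zz(3) C2(1) m(4)]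
 show ?thesis
 proof (rule bimap_tensor3_eqI[OF z zz(3) C1(1) C3(1)])
  fix x y v assume e: "x \<in> bcar (Fo a)" "y \<in> bcar (Fo b)" "v \<in> bcar (Fo c)"
  note p = pu_laws(1)[OF z(1,2) e(1,2)] pu_laws(1)[OF z(2,3) e(2,3)]
  note q = pu_laws(1)[OF t(1) z(3) p(1) e(3)]
  have "bfun (Comp ZC (mu (a @ b) c) (TenM ZC (mu a b) (Id ZC (Fo c)))) (pu (ZT (Fo a) (Fo b)) (Fo c) (pu (Fo a) (Fo b) x y) v)
   = op (a @ b) c (op a b x y) v"
   unfolding C1(2)[OF q] T1(2)[OF p(1) e(3)] op_def using Id_bimap(2)[OF e(3)] by (simp only:)
  moreover have "bfun (Comp ZC (mu a (b @ c)) (Comp ZC (TenM ZC (Id ZC (Fo a)) (mu b c)) (Assoc ZC (Fo a) (Fo b) (Fo c))))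
    (pu (ZT (Fo a) (Fo b)) (Fo c) (pu (Fo a) (Fo b) x y) v) = op a (b @ c) x (op b c y v)"
   unfolding C3(2)[OF q] C2(2)[OF q] A(2)[OF e] T2(2)[OF e(1) p(2)] op_def using Id_bimap(2)[OF e(1)] by (simp only:)
  ultimately show "bfun (Comp ZC (mu (a @ b) c) (TenM ZC (mu a b) (Id ZC (Fo c)))) (pu (ZT (Fo a) (Fo b)) (Fo c) (pu (Fo a) (Fo b) x y) v)
   = bfun (Comp ZC (mu a (b @ c)) (Comp ZC (TenM ZC (Id ZC (Fo a)) (mu b c)) (Assoc ZC (Fo a) (Fo b) (Fo c))))
    (pu (ZT (Fo a) (Fo b)) (Fo c) (pu (Fo a) (Fo b) x y) v)"
   using op_assoc[OF w e] by simp
 qed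
qed

lemma mu_Nil_left: assumes "word a" shows "mu [] a = Lunit ZC (Fo a)"
proof -
 note z = zzb_regular Fo_zzb[OF assms]
 have m: "mu [] a \<in> bimaps n (ZT (zz_regular n) (Fo a)) (Fo a)" using mu_bimap[of "[]" a] assms by simp
 show ?thesis
 proof (rule bimap_tensor_eqI[OF z z(2) m Lunit_bimap(1)[OF z(2)]])
  fix b x assume b: "b \<in> bcar (zz_regular n)" and x: "x \<in> bcar (Fo a)"
  then obtain c where c: "b = Alg c" "c \<in> carrier Z" by (auto simp: bcar_regular)
  show "bfun (mu [] a) (pu (zz_regular n) (Fo a) b x) = bfun (Lunit ZC (Fo a)) (pu (zz_regular n) (Fo a) b x)"
   using op_Nil_left[OF assms x c(2)] Lunit_bimap(2)[OF z(2) c(2) x] c by (simp add: op_def)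
 qed
qed

text \<open>Objects of the target are arbitrary bracketings, possibly with unit factors, while the
  functor reaches the left-bracketed ones. The isomorphisms \<open>mu\<close> connect the
  two.\<close>

lemma essentially_surjective_Fo: "b \<in> zz_objects n ==> \<exists>w f. word w \<and> is_iso ZC (Fo w) b f"
proof (induction rule: zz_objects.induct)
 case unit
 then show ?case using ZC.is_iso_Id[of "Fo []"] Fo_obj[of "[]"] by (intro exI[of _ "[]"]) auto
next
 case (gen j)
 then show ?case using ZC.is_iso_Id[of "Fo [j]"] Fo_obj[of "[j]"] by (intro exI[of _ "[j]"]) auto
next
 case (tensor M N)
 then obtain w v f g where *: "word w" "is_iso ZC (Fo w) M f" "word v" "is_iso ZC (Fo v) N g" by blast
 have wv: "word (w @ v)" using * by simp
 have H: "Obj ZC = zz_objects n" "TenO ZC = ZT" by (simp_all add: zz_category_def)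
 note o = Fo_obj[OF *(1)] Fo_obj[OF *(3)] Fo_obj[OF wv]
 have "is_iso ZC (ZT (Fo w) (Fo v)) (ZT M N) (TenM ZC f g)"
  using ZC.is_iso_TenM[of "Fo w" M "Fo v" N f g] o tensor * unfolding H by blast
 then have "is_iso ZC (Fo (w @ v)) (ZT M N)
   (Comp ZC (TenM ZC f g) (ZC.iso_inverse (ZT (Fo w) (Fo v)) (Fo (w @ v)) (mu w v)))"
  using ZC.is_iso_Comp[of "Fo (w @ v)" "ZT (Fo w) (Fo v)" "ZT M N"] o tensor
   ZC.iso_inverse(4)[OF mu_is_iso[OF *(1,3)]] zz_objects.tensor[OF o(1,2)] zz_objects.tensor[OF tensor(1,2)]
  unfolding H by blast
 then show ?case using wv by blast
qed

lemma monoidal_functor: "linear_monoidal_functor (SC n) ZC Fo Fm mu (Id ZC (Fo []))"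
proof -
 interpret SC: linear_monoidal_category "SC n" by (rule linear_monoidal_category_soergel)
 have H: "Obj ZC = zz_objects n" "Hom ZC = bimaps n" "Unit ZC = zz_regular n" "TenO ZC = ZT"
  by (simp_all add: zz_category_def)
 have S: "Obj (SC n) = Collect word" by (simp add: word_def[abs_def])
 note [simp del] = zz_category_simps
 have Id_Comp: "Comp ZC (Id ZC (Fo w)) f = f" if "f \<in> bimaps n M (Fo w)" "word w" "M \<in> zz_objects n" for f M w
  using ZC.Id_Comp[unfolded H, of M "Fo w" f] that Fo_obj by blast
 have Comp_Id: "Comp ZC f (Id ZC M) = f" if "f \<in> bimaps n M (Fo w)" "word w" "M \<in> zz_objects n" for f M w
  using ZC.Comp_Id[unfolded H, of M "Fo w" f] that Fo_obj by blast
 \<comment> \<open>The constraints of the diagrammatic category are identities, so their images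
   cancel in the coherence conditions.\<close>
 have id: "Fm (dclass n (DId w)) = Id ZC (Fo w)" if "word w" for w
  using Fm_dclass[of "DId w"] that by simp
 show ?thesis
 proof (intro linear_monoidal_functor.intro linear_monoidal_functor_axioms.intro linear_monoidal_category_soergel
   linear_monoidal_category_zz)
  fix a b c a' b' F G r d
  show "a \<in> Obj (SC n) ==> Fo a \<in> Obj ZC" unfolding S H by (simp add: Fo_obj)
  show "a \<in> Obj (SC n) ==> b \<in> Obj (SC n) ==> F \<in> Hom (SC n) a b ==> Fm F \<in> Hom ZC (Fo a) (Fo b)"
   unfolding H using Fm_hom Fm_dclass Fi_bimap by metis
  show "a \<in> Obj (SC n) ==> Fm (Id (SC n) a) = Id ZC (Fo a)" unfolding S by (simp add: id)
  show "a \<in> Obj (SC n) ==> b \<in> Obj (SC n) ==> c \<in> Obj (SC n) ==> F \<in> Hom (SC n) a b ==> G \<in> Hom (SC n) b c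
   ==> Fm (Comp (SC n) G F) = Comp ZC (Fm G) (Fm F)"
   by (drule Fm_hom, drule Fm_hom) (clarsimp simp: ops_wfd Fm_dclass)
  show "a \<in> Obj (SC n) ==> b \<in> Obj (SC n) ==> F \<in> Hom (SC n) a b ==> G \<in> Hom (SC n) a b
   ==> Fm (Add (SC n) F G) = Add ZC (Fm F) (Fm G)"
   by (drule Fm_hom, drule Fm_hom) (clarsimp simp: ops_wfd Fm_dclass)
  show "a \<in> Obj (SC n) ==> b \<in> Obj (SC n) ==> F \<in> Hom (SC n) a b ==> Fm (Scale (SC n) r F) = Scale ZC r (Fm F)"
   by (drule Fm_hom) (clarsimp simp: ops_wfd Fm_dclass)
  show "a \<in> Obj (SC n) ==> b \<in> Obj (SC n) ==> F \<in> HomDeg (SC n) d a b ==> Fm F \<in> HomDeg ZC d (Fo a) (Fo b)"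
   by (clarsimp simp: diagram_iff Fm_dclass Fi_degree)
  show "a \<in> Obj (SC n) ==> b \<in> Obj (SC n) ==> is_iso ZC (TenO ZC (Fo a) (Fo b)) (Fo (TenO (SC n) a b)) (mu a b)"
   unfolding S H by (simp add: mu_is_iso)
  show "a \<in> Obj (SC n) ==> b \<in> Obj (SC n) ==> mu a b \<in> HomDeg ZC 0 (TenO ZC (Fo a) (Fo b)) (Fo (TenO (SC n) a b))"
   unfolding S H by (simp add: mu_degree)
  show "a \<in> Obj (SC n) ==> a' \<in> Obj (SC n) ==> b \<in> Obj (SC n) ==> b' \<in> Obj (SC n) ==> F \<in> Hom (SC n) a a' ==> G \<in> Hom (SC n) b b'
   ==> Comp ZC (mu a' b') (TenM ZC (Fm F) (Fm G)) = Comp ZC (Fm (TenM (SC n) F G)) (mu a b)"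
   by (drule Fm_hom, drule Fm_hom) (clarsimp simp: ops_wfd Fm_dclass ten(2) wfd_word Fi_bimap)
  show "is_iso ZC (Unit ZC) (Fo (Unit (SC n))) (Id ZC (Fo []))"
   unfolding H using ZC.is_iso_Id[unfolded H, OF Fo_obj[of "[]"]] by simp
  show "Id ZC (Fo []) \<in> HomDeg ZC 0 (Unit ZC) (Fo (Unit (SC n)))"
   unfolding H using Id_degree[OF Fo_zzb[of "[]"]] by simp
  show "Comp ZC (Fm (Assoc (SC n) a b c)) (Comp ZC (mu (TenO (SC n) a b) c) (TenM ZC (mu a b) (Id ZC (Fo c))))
   = Comp ZC (mu a (TenO (SC n) b c)) (Comp ZC (TenM ZC (Id ZC (Fo a)) (mu b c)) (Assoc ZC (Fo a) (Fo b) (Fo c)))"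
   if "a \<in> Obj (SC n)" "b \<in> Obj (SC n)" "c \<in> Obj (SC n)"
  proof -
   have w: "word a" "word b" "word c" using that unfolding S by simp_all
   have ww: "word (a @ b)" "word (a @ b @ c)" using w by simp_all
   note z = Fo_zzb[OF w(1)] Fo_zzb[OF w(2)] Fo_zzb[OF w(3)] and o = Fo_obj[OF w(1)] Fo_obj[OF w(2)] Fo_obj[OF w(3)]
   have "Comp ZC (mu (a @ b) c) (TenM ZC (mu a b) (Id ZC (Fo c))) \<in> bimaps n (ZT (ZT (Fo a) (Fo b)) (Fo c)) (Fo (a @ b @ c))"
    by (rule Comp_bimap(1)[OF zzb_tensor[OF zzb_tensor[OF z(1,2)] z(3)] zzb_tensor[OF Fo_zzb[OF ww(1)] z(3)] Fo_zzb[OF ww(2)]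
      TenM_bimap(1)[OF zzb_tensor[OF z(1,2)] z(3) Fo_zzb[OF ww(1)] z(3) mu_bimap[OF w(1,2)] Id_bimap(1)[OF z(3)]]
      mu_bimap[OF ww(1) w(3), unfolded append_assoc]])
   then have "Comp ZC (Id ZC (Fo (a @ b @ c))) (Comp ZC (mu (a @ b) c) (TenM ZC (mu a b) (Id ZC (Fo c))))
    = Comp ZC (mu (a @ b) c) (TenM ZC (mu a b) (Id ZC (Fo c)))"
    by (rule Id_Comp[OF _ ww(2) zz_objects.tensor[OF zz_objects.tensor[OF o(1,2)] o(3)]])
   then show ?thesis using mu_associative[OF w] id[OF ww(2)] by simp
  qed
  show "Comp ZC (Fm (Lunit (SC n) a)) (Comp ZC (mu (Unit (SC n)) a) (TenM ZC (Id ZC (Fo [])) (Id ZC (Fo a)))) = Lunit ZC (Fo a)"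
   "Comp ZC (Fm (Runit (SC n) a)) (Comp ZC (mu a (Unit (SC n))) (TenM ZC (Id ZC (Fo a)) (Id ZC (Fo [])))) = Runit ZC (Fo a)"
   if "a \<in> Obj (SC n)"
  proof -
   have w: "word a" using that unfolding S by simp
   note o = Fo_obj[OF w] zz_objects.unit[of n]
   have T: "TenM ZC (Id ZC (zz_regular n)) (Id ZC (Fo a)) = Id ZC (ZT (zz_regular n) (Fo a))"
    "TenM ZC (Id ZC (Fo a)) (Id ZC (zz_regular n)) = Id ZC (ZT (Fo a) (zz_regular n))"
    using ZC.TenM_Id[unfolded H] o by blast+
   note L = Lunit_bimap(1)[OF Fo_zzb[OF w]] Runit_bimap(1)[OF Fo_zzb[OF w]]
   note t = zz_objects.tensor[OF o(2,1)] zz_objects.tensor[OF o(1,2)]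
   show "Comp ZC (Fm (Lunit (SC n) a)) (Comp ZC (mu (Unit (SC n)) a) (TenM ZC (Id ZC (Fo [])) (Id ZC (Fo a)))) = Lunit ZC (Fo a)"
    by (simp add: T mu_Nil_left w id Comp_Id[OF L(1) w t(1)] Id_Comp[OF L(1) w t(1)])
   show "Comp ZC (Fm (Runit (SC n) a)) (Comp ZC (mu a (Unit (SC n))) (TenM ZC (Id ZC (Fo a)) (Id ZC (Fo [])))) = Runit ZC (Fo a)"
    by (simp add: T mu_simps w id Comp_Id[OF L(2) w t(2)] Id_Comp[OF L(2) w t(2)])
  qed
 qed
qed

end

theorem theorem4p3:
  fixes n :: nat
  assumes "2 \<le> n"
  shows "\<exists>(Fo :: nat list \<Rightarrow> zbimod) (Fm :: dmor set \<Rightarrow> bimap) mu eps.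
    linear_monoidal_functor (soergel_category n) (zz_category n) Fo Fm mu eps
    \<and> essentially_surjective (soergel_category n) (zz_category n) Fo
    \<and> Fo [] = zz_regular n
    \<and> (\<forall>j \<in> {1..n}. Fo [j] = U_bimod n j)
    \<and> (\<forall>w s. w \<noteq> [] \<longrightarrow> set (w @ [s]) \<subseteq> {1..n} \<longrightarrow> Fo (w @ [s]) = zz_tensor n (Fo w) (Fo [s]))"
proof -
  interpret type_B n using assms by unfold_locales
  have "essentially_surjective (soergel_category n) (zz_category n) Fo"
    unfolding essentially_surjective_def
  proof
    fix b assume "b \<in> Obj (zz_category n)"
    then have "b \<in> zz_objects n" by simp
    then obtain w f where "word w" "is_iso (zz_category n) (Fo w) b f" using essentially_surjective_Fo by blast
    then show "\<exists>a \<in> Obj (soergel_category n). \<exists>f. is_iso (zz_category n) (Fo a) b f"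
      by (intro bexI[of _ w]) (auto simp: word_def)
  qed
  then show ?thesis
    using monoidal_functor by (intro exI[of _ Fo] exI[of _ Fm] exI[of _ mu] exI[of _ "Id (zz_category n) (Fo [])"]) (simp add: Fo_snoc del: zz_category_simps)
qed

end
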